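(* Let $\omega\subset\omega^*$ be concentric open cubes in $\mathbb{R}^d$ with side lengths $\sigma$ and $(1+\rho)\sigma$, $\rho>0$, contained in a domain on which the coefficient matrix $A$ is defined. Let $\lambda_1\ge\lambda_2\ge\cdots$ (listed with multiplicity) and $\varphi_1,\varphi_2,\ldots\in H_A(\omega^* )/\mathbb{R}$ be the eigenvalues and eigenfunctions of the problem $$(\varphi_i,\delta)_{\mathcal{E}(\omega)}=\lambda_i(\varphi_i,\delta)_{\mathcal{E}(\omega^* )}\qquad\text{for all }\delta\in H_A(\omega^* )/\mathbb{R}.$$ Then the optimal $n$-dimensional local approximation space is $\Psi_n(\omega)=\mathrm{span}\{\psi_1,\ldots,\psi_n\}$ with $\psi_i=P\varphi_i$, i.e. $$d_n(\omega,\omega^* )=\sup_{u\in H_A(\omega^* )/\mathbb{R},\,u\neq 0}\ \inf_{\chi\in\Psi_n(\omega)}\frac{\|Pu-\chi\|_{\mathcal{E}(\omega)}}{\|u\|_{\mathcal{E}(\omega^* )}}.$$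
   Context: $A$ is a measurable symmetric $d\times d$ matrix field with $L^\infty$ entries satisfying $\alpha|v|^2\le v^TA(x)v\le\beta|v|^2$ for all $v\in\mathbb{R}^d$ and a.e. $x$, with $0<\alpha\le\beta<\infty$. For an open set $S$, $(u,v)_{\mathcal{E}(S)}=\int_S A\nabla u\cdot\nabla v\,dx$ and $\|u\|_{\mathcal{E}(S)}=(u,u)_{\mathcal{E}(S)}^{1/2}$; $H_A(S)$ is the space of $v\in H^1(S)$ with $\int_S A\nabla v\cdot\nabla\varphi\,dx=0$ for all $\varphi\in C_0^\infty(S)$ ($A$-harmonic functions), and $H_A(S)/\mathbb{R}$ is its quotient by constants, equipped with the energy inner product. $P:H_A(\omega^* )/\mathbb{R}\to H_A(\omega)/\mathbb{R}$ is the restriction operator $Pu=u|_\omega$. The Kolmogorov $n$-width is $$d_n(\omega,\omega^* )=\inf_{S(n)}\ \sup_{u\in H_A(\omega^* )/\mathbb{R},\,u\ne0}\ \inf_{\chi\in S(n)}\frac{\|Pu-\chi\|_{\mathcal{E}(\omega)}}{\|u\|_{\mathcal{E}(\omega^* )}},$$ the infimum being over all $n$-dimensional subspaces $S(n)\subset H_A(\omega)/\mathbb{R}$. *)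

theory Defs
  imports "HOL-Analysis.Analysis"
begin

definition partial :: "'n::finite \<Rightarrow> (real^'n \<Rightarrow> real) \<Rightarrow> real^'n \<Rightarrow> real" where
  "partial i f x = frechet_derivative f (at x) (axis i 1)"

definition grad_fun :: "(real^'n::finite \<Rightarrow> real) \<Rightarrow> real^'n \<Rightarrow> real^'n" where
  "grad_fun f x = (\<chi> i. partial i f x)"

coinductive smooth_fun :: "(real^'n::finite \<Rightarrow> real) \<Rightarrow> bool" where
  "(\<forall>x. f differentiable (at x)) \<Longrightarrow> (\<forall>i. smooth_fun (partial i f)) \<Longrightarrow> smooth_fun f"

definition test_fun :: "(real^'n::finite) set \<Rightarrow> (real^'n \<Rightarrow> real) \<Rightarrow> bool" where
  "test_fun S f \<longleftrightarrow> smooth_fun f \<and> compact (closure {x. f x \<noteq> 0}) \<and> closure {x. f x \<noteq> 0} \<subseteq> S"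

definition is_weak_grad :: "(real^'n::finite) set \<Rightarrow> (real^'n \<Rightarrow> real) \<Rightarrow> (real^'n \<Rightarrow> real^'n) \<Rightarrow> bool" where
  "is_weak_grad S u g \<longleftrightarrow>
     (\<forall>i. set_borel_measurable lebesgue S (\<lambda>x. g x $ i) \<and> set_integrable lebesgue S (\<lambda>x. (g x $ i)^2)) \<and>
     (\<forall>\<phi> i. test_fun S \<phi> \<longrightarrow>
        (LINT x:S|lebesgue. u x * partial i \<phi> x) = - (LINT x:S|lebesgue. g x $ i * \<phi> x))"

definition H1 :: "(real^'n::finite) set \<Rightarrow> (real^'n \<Rightarrow> real) \<Rightarrow> bool" where
  "H1 S u \<longleftrightarrow> set_borel_measurable lebesgue S u \<and> set_integrable lebesgue S (\<lambda>x. (u x)^2) \<and>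
     (\<exists>g. is_weak_grad S u g)"

definition wgrad :: "(real^'n::finite) set \<Rightarrow> (real^'n \<Rightarrow> real) \<Rightarrow> real^'n \<Rightarrow> real^'n" where
  "wgrad S u = (SOME g. is_weak_grad S u g)"

definition energy_ip :: "(real^'n \<Rightarrow> real^'n^'n) \<Rightarrow> (real^'n::finite) set \<Rightarrow> (real^'n \<Rightarrow> real) \<Rightarrow> (real^'n \<Rightarrow> real) \<Rightarrow> real" where
  "energy_ip A S u v = (LINT x:S|lebesgue. (A x *v wgrad S u x) \<bullet> wgrad S v x)"

definition energy_norm :: "(real^'n \<Rightarrow> real^'n^'n) \<Rightarrow> (real^'n::finite) set \<Rightarrow> (real^'n \<Rightarrow> real) \<Rightarrow> real" where
  "energy_norm A S u = sqrt (energy_ip A S u u)"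

definition A_harmonic :: "(real^'n \<Rightarrow> real^'n^'n) \<Rightarrow> (real^'n::finite) set \<Rightarrow> (real^'n \<Rightarrow> real) \<Rightarrow> bool" where
  "A_harmonic A S u \<longleftrightarrow> H1 S u \<and>
     (\<forall>\<phi>. test_fun S \<phi> \<longrightarrow> (LINT x:S|lebesgue. (A x *v wgrad S u x) \<bullet> grad_fun \<phi> x) = 0)"

text \<open>u is zero in the quotient by constants: u is a.e. constant on S.\<close>
definition const_on :: "(real^'n::finite) set \<Rightarrow> (real^'n \<Rightarrow> real) \<Rightarrow> bool" where
  "const_on S u \<longleftrightarrow> (\<exists>c. AE x in lebesgue. x \<in> S \<longrightarrow> u x = c)"

definition indep_mod_const :: "(real^'n::finite) set \<Rightarrow> (nat \<Rightarrow> real^'n \<Rightarrow> real) \<Rightarrow> nat \<Rightarrow> bool" where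
  "indep_mod_const S \<chi>s n \<longleftrightarrow>
     (\<forall>c. const_on S (\<lambda>x. \<Sum>j<n. c j * \<chi>s j x) \<longrightarrow> (\<forall>j<n. c j = 0))"

definition approx_error :: "(real^'n \<Rightarrow> real^'n^'n) \<Rightarrow> (real^'n::finite) set \<Rightarrow> (real^'n) set \<Rightarrow>
    (nat \<Rightarrow> real^'n \<Rightarrow> real) \<Rightarrow> nat \<Rightarrow> real" where
  "approx_error A \<omega> \<omega>s \<chi>s n =
     Sup {(INF c::nat \<Rightarrow> real. energy_norm A \<omega> (\<lambda>x. u x - (\<Sum>j<n. c j * \<chi>s j x)))
            / energy_norm A \<omega>s u | u. A_harmonic A \<omega>s u \<and> \<not> const_on \<omega>s u}"

text \<open>Kolmogorov n-width: infimum over n-dimensional subspaces of H_A(omega)/R, given by bases.\<close>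
definition n_width :: "(real^'n \<Rightarrow> real^'n^'n) \<Rightarrow> (real^'n::finite) set \<Rightarrow> (real^'n) set \<Rightarrow> nat \<Rightarrow> real" where
  "n_width A \<omega> \<omega>s n =
     Inf {approx_error A \<omega> \<omega>s \<chi>s n | \<chi>s. (\<forall>j<n. A_harmonic A \<omega> (\<chi>s j)) \<and> indep_mod_const \<omega> \<chi>s n}"

end

(* The paper's operator P restricts an A-harmonic function from the large cube to the small one. Two facts about
   the energies a and b on the two cubes suffice. First, b is compact relative to a: Caccioppoli's inequality bounds b by
   an L2 norm, and Poincare's inequality on the cells of a fine subdivision makes that norm small compared to a, up to
   finitely many averages. Secondly, H_A modulo constants is complete in the energy norm. Hence the supremum of b/a on
   the a-orthogonal complement of the first n eigenfunctions is attained at an eigenfunction, so it is at most the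
   eigenvalue lam n (counting from 0), which bounds the error of their span by sqrt (lam n). Conversely, for every
   n-dimensional competitor the span of the first n+1 eigenfunctions contains a nonzero u that is b-orthogonal to the
   competitor, and b u u >= lam n * a u u on that span. *)

theory Submission
  imports Defs "HOL-Library.Function_Algebras" "HOL-Computational_Algebra.Polynomial" "HOL-Real_Asymp.Real_Asymp"
begin

section \<open>Square-integrable functions\<close>

text \<open>The quotient by constants is never formed: the energy stays a semidefinite form on
  functions, whose null vectors are the functions that are a.e. constant on the cube. The listed
  eigenfunctions are not assumed orthogonal, so projections go through Gram-Schmidt, and the lower
  bound on their spans is an induction that keeps the cross terms. The obstacle lies in the
  competitors. The width ranges over n-dimensional subspaces, but independent eigenfunctions may
  become dependent when restricted to the small cube: unique continuation can fail for rough
  coefficients, so \<open>lam j = 0\<close> is not excluded, and the optimal span then has to be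
  enlarged to dimension n. This requires that the A-harmonic functions on the small cube modulo
  constants have dimension at least n; otherwise the infimum would run over the empty set. In
  dimension at least two this is shown by solving Dirichlet problems with polynomial data; in
  dimension one even the large cube carries at most a line of such functions, which contradicts the
  infinite independent sequence of eigenfunctions.\<close>

definition L2 :: "'a measure \<Rightarrow> ('a \<Rightarrow> real) \<Rightarrow> bool" where
  "L2 M f \<longleftrightarrow> f \<in> borel_measurable M \<and> integrable M (\<lambda>x. (f x)\<^sup>2)"

text \<open>The squared distance keeps all estimates free of square roots, at the price of a factor
  2 in the triangle inequality; the small constants chosen later (such as 1/4 and 1/16) absorb this
  factor.\<close>

definition L2dist2 :: "'a measure \<Rightarrow> ('a \<Rightarrow> real) \<Rightarrow> ('a \<Rightarrow> real) \<Rightarrow> real" where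
  "L2dist2 M f g = (\<integral>x. (f x - g x)\<^sup>2 \<partial>M)"

lemma L2_measurable [measurable_dest]: "L2 M f \<Longrightarrow> f \<in> borel_measurable M"
  by (simp add: L2_def)

lemma L2_integrable_square: "L2 M f \<Longrightarrow> integrable M (\<lambda>x. (f x)\<^sup>2)"
  by (simp add: L2_def)

lemma L2_integrable_mult:
  assumes "L2 M f" "L2 M g" shows "integrable M (\<lambda>x. f x * g x)"
proof (rule Bochner_Integration.integrable_bound)
  show "integrable M (\<lambda>x. (f x)\<^sup>2 + (g x)\<^sup>2)"
    using assms by (auto simp: L2_def)
  show "(\<lambda>x. f x * g x) \<in> borel_measurable M"
    using assms by (auto simp: L2_def)
  have "\<bar>s * t\<bar> \<le> s\<^sup>2 + t\<^sup>2" for s t :: real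
    using sum_squares_ge_zero[of s t] zero_le_power2[of "s - t"] zero_le_power2[of "s + t"]
    by (auto simp: power2_eq_square algebra_simps abs_if)
  then show "AE x in M. norm (f x * g x) \<le> norm ((f x)\<^sup>2 + (g x)\<^sup>2)"
    by simp
qed

lemma L2_cmult: "L2 M f \<Longrightarrow> L2 M (\<lambda>x. r * f x)"
  by (auto simp: L2_def power_mult_distrib)

lemma L2_add:
  assumes "L2 M f" "L2 M g" shows "L2 M (\<lambda>x. f x + g x)"
  using assms L2_integrable_mult[OF assms]
  by (auto simp: L2_def power2_sum mult.assoc intro!: Bochner_Integration.integrable_add)

lemma L2_diff:
  assumes "L2 M f" "L2 M g" shows "L2 M (\<lambda>x. f x - g x)"
  using L2_add[OF assms(1) L2_cmult[OF assms(2), of "-1"]] by simp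

lemma L2_zero: "L2 M (\<lambda>x. 0)"
  by (simp add: L2_def)

lemma L2_AE_bounded_mult:
  assumes f: "L2 M f" and h: "h \<in> borel_measurable M" "AE x in M. \<bar>h x\<bar> \<le> B"
  shows "L2 M (\<lambda>x. h x * f x)"
  unfolding L2_def
proof
  show "(\<lambda>x. h x * f x) \<in> borel_measurable M" using f h by (auto simp: L2_def)
  show "integrable M (\<lambda>x. (h x * f x)\<^sup>2)"
  proof (rule Bochner_Integration.integrable_bound)
    show "integrable M (\<lambda>x. B\<^sup>2 * (f x)\<^sup>2)" using f by (auto simp: L2_def)
    show "(\<lambda>x. (h x * f x)\<^sup>2) \<in> borel_measurable M" using f h by (auto simp: L2_def)
    show "AE x in M. norm ((h x * f x)\<^sup>2) \<le> norm (B\<^sup>2 * (f x)\<^sup>2)"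
      using h(2)
    proof eventually_elim
      case (elim x)
      then have "(h x)\<^sup>2 \<le> B\<^sup>2" by (metis abs_ge_zero abs_le_square_iff abs_of_nonneg order_trans)
      then show ?case by (simp add: power_mult_distrib mult_right_mono)
    qed
  qed
qed

lemma L2_AE_cong:
  assumes "L2 M f" "g \<in> borel_measurable M" "AE x in M. f x = g x" shows "L2 M g"
proof -
  have "integrable M (\<lambda>x. (g x)\<^sup>2) = integrable M (\<lambda>x. (f x)\<^sup>2)"
    by (rule integrable_cong_AE) (use assms in \<open>auto simp: L2_def\<close>)
  then show ?thesis using assms by (auto simp: L2_def)
qed

text \<open>For \<open>r > 0\<close> evaluate at the minimiser \<open>- q / r\<close>; for
  \<open>r = 0\<close> or \<open>r < 0\<close> a suitable \<open>t\<close> makes the quadratic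
  negative unless \<open>q = 0\<close>. It yields every Cauchy-Schwarz inequality below, and with
  \<open>p = 0\<close> it forces a first variation \<open>q\<close> to vanish.\<close>

lemma nonneg_discriminant:
  fixes p q r :: real
  assumes "\<And>t. 0 \<le> p + 2 * t * q + t\<^sup>2 * r" shows "q\<^sup>2 \<le> p * r"
proof (cases "r = 0")
  case True
  have "q = 0"
  proof (rule ccontr)
    assume "q \<noteq> 0"
    then show False using assms[of "- (p + 1) / (2 * q)"] True by (simp add: field_simps)
  qed
  then show ?thesis using True by simp
next
  case False
  have "r \<ge> 0"
  proof (rule ccontr)
    assume r: "\<not> r \<ge> 0"
    \<comment> \<open>At least 1, and so large that \<open>t * (- r)\<close> dominates the
      coefficients of the lower-order terms.\<close>
    define t where "t = (\<bar>p\<bar> + 2 * \<bar>q\<bar> + 1) / (- r) + 1"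
    have "0 \<le> (\<bar>p\<bar> + 2 * \<bar>q\<bar> + 1) / (- r)" using r by (intro divide_nonneg_nonneg) auto
    then have t1: "t \<ge> 1" by (simp add: t_def)
    have "t * (- r) = \<bar>p\<bar> + 2 * \<bar>q\<bar> + 1 - r" using r by (simp add: t_def field_simps)
    then have "t * (- r) \<ge> \<bar>p\<bar> + 2 * \<bar>q\<bar> + 1" using r by linarith
    then have 1: "t * (\<bar>p\<bar> + 2 * \<bar>q\<bar> + 1) \<le> t * (t * (- r))" using t1 by (intro mult_left_mono) auto
    have 2: "p \<le> t * \<bar>p\<bar>" using mult_right_mono[OF t1, of "\<bar>p\<bar>"] by auto
    have 3: "t * q \<le> t * \<bar>q\<bar>" using t1 by (intro mult_left_mono) auto
    have 4: "t * (\<bar>p\<bar> + 2 * \<bar>q\<bar> + 1) = t * \<bar>p\<bar> + 2 * (t * \<bar>q\<bar>) + t"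
      "2 * t * q = 2 * (t * q)" "t * (t * (- r)) = - (t\<^sup>2 * r)"
      by (simp_all add: algebra_simps power2_eq_square)
    show False using assms[of t] t1 1 2 3 4 by linarith
  qed
  with False have "r > 0" by simp
  then show ?thesis using assms[of "- q / r"] by (simp add: power2_eq_square field_simps)
qed

lemma L2_Cauchy_Schwarz:
  assumes f: "L2 M f" and g: "L2 M g"
  shows "(\<integral>x. f x * g x \<partial>M)\<^sup>2 \<le> (\<integral>x. (f x)\<^sup>2 \<partial>M) * (\<integral>x. (g x)\<^sup>2 \<partial>M)"
proof (rule nonneg_discriminant)
  fix t :: real
  have "0 \<le> (\<integral>x. (f x + t * g x)\<^sup>2 \<partial>M)" by (rule integral_nonneg_AE) simp
  also have "\<dots> = (\<integral>x. (f x)\<^sup>2 + 2 * t * (f x * g x) + t\<^sup>2 * (g x)\<^sup>2 \<partial>M)"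
    by (simp add: power2_sum power_mult_distrib algebra_simps)
  also have "\<dots> = (\<integral>x. (f x)\<^sup>2 \<partial>M) + 2 * t * (\<integral>x. f x * g x \<partial>M) + t\<^sup>2 * (\<integral>x. (g x)\<^sup>2 \<partial>M)"
    using L2_integrable_mult[OF f g] f g by (simp add: L2_def)
  finally show "0 \<le> (\<integral>x. (f x)\<^sup>2 \<partial>M) + 2 * t * (\<integral>x. f x * g x \<partial>M) + t\<^sup>2 * (\<integral>x. (g x)\<^sup>2 \<partial>M)" .
qed

lemma L2dist2_nonneg: "0 \<le> L2dist2 M f g"
  unfolding L2dist2_def by (rule integral_nonneg_AE) simp

lemma L2dist2_commute: "L2dist2 M f g = L2dist2 M g f"
  unfolding L2dist2_def by (simp add: power2_commute)

lemma L2dist2_triangle: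
  assumes "L2 M f" "L2 M g" "L2 M h"
  shows "L2dist2 M f h \<le> 2 * L2dist2 M f g + 2 * L2dist2 M g h"
proof -
  have i: "integrable M (\<lambda>x. (f x - g x)\<^sup>2)" "integrable M (\<lambda>x. (g x - h x)\<^sup>2)"
    "integrable M (\<lambda>x. (f x - h x)\<^sup>2)"
    using assms L2_diff L2_integrable_square by blast+
  have "L2dist2 M f h \<le> (\<integral>x. 2 * (f x - g x)\<^sup>2 + 2 * (g x - h x)\<^sup>2 \<partial>M)"
    unfolding L2dist2_def
  proof (rule integral_mono)
    fix x
    show "(f x - h x)\<^sup>2 \<le> 2 * (f x - g x)\<^sup>2 + 2 * (g x - h x)\<^sup>2"
      using zero_le_power2[of "(f x - g x) - (g x - h x)"] by (simp add: power2_eq_square algebra_simps)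
  qed (use i in auto)
  also have "\<dots> = 2 * L2dist2 M f g + 2 * L2dist2 M g h" using i by (simp add: L2dist2_def)
  finally show ?thesis .
qed

lemma L2_tendsto_mult:
  assumes F: "\<And>k. L2 M (F k)" and f: "L2 M f" and g: "L2 M g"
    and lim: "(\<lambda>k. L2dist2 M (F k) f) \<longlonglongrightarrow> 0"
  shows "(\<lambda>k. \<integral>x. F k x * g x \<partial>M) \<longlonglongrightarrow> (\<integral>x. f x * g x \<partial>M)"
proof -
  have "((\<lambda>k. ((\<integral>x. F k x * g x \<partial>M) - (\<integral>x. f x * g x \<partial>M))\<^sup>2) \<longlongrightarrow> 0) sequentially"
  proof (rule tendsto_sandwich[of "\<lambda>_. 0"])
    show "(\<lambda>k. L2dist2 M (F k) f * (\<integral>x. (g x)\<^sup>2 \<partial>M)) \<longlonglongrightarrow> 0"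
      using tendsto_mult_right[OF lim] by simp
    show "\<forall>\<^sub>F k in sequentially. ((\<integral>x. F k x * g x \<partial>M) - (\<integral>x. f x * g x \<partial>M))\<^sup>2
       \<le> L2dist2 M (F k) f * (\<integral>x. (g x)\<^sup>2 \<partial>M)"
    proof (intro always_eventually allI)
      fix k
      have "(\<integral>x. F k x * g x \<partial>M) - (\<integral>x. f x * g x \<partial>M) = (\<integral>x. (F k x - f x) * g x \<partial>M)"
        using L2_integrable_mult[OF F g] L2_integrable_mult[OF f g] by (simp add: algebra_simps)
      then show "((\<integral>x. F k x * g x \<partial>M) - (\<integral>x. f x * g x \<partial>M))\<^sup>2
       \<le> L2dist2 M (F k) f * (\<integral>x. (g x)\<^sup>2 \<partial>M)"
        using L2_Cauchy_Schwarz[OF L2_diff[OF F f] g] by (simp add: L2dist2_def)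
    qed
  qed auto
  then have "(\<lambda>k. (\<integral>x. F k x * g x \<partial>M) - (\<integral>x. f x * g x \<partial>M)) \<longlonglongrightarrow> 0"
    by (simp add: power_tendsto_0_iff)
  then show ?thesis by (rule LIM_zero_cancel)
qed

lemma L2_tendsto_square:
  assumes F: "\<And>k. L2 M (F k)" and f: "L2 M f"
    and lim: "(\<lambda>k. L2dist2 M (F k) f) \<longlonglongrightarrow> 0"
  shows "(\<lambda>k. \<integral>x. (F k x)\<^sup>2 \<partial>M) \<longlonglongrightarrow> (\<integral>x. (f x)\<^sup>2 \<partial>M)"
proof -
  have "(\<lambda>k. L2dist2 M (F k) f + 2 * (\<integral>x. F k x * f x \<partial>M) - (\<integral>x. (f x)\<^sup>2 \<partial>M))
      \<longlonglongrightarrow> 0 + 2 * (\<integral>x. f x * f x \<partial>M) - (\<integral>x. (f x)\<^sup>2 \<partial>M)"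
    by (intro tendsto_intros lim L2_tendsto_mult F f)
  moreover have "L2dist2 M (F k) f + 2 * (\<integral>x. F k x * f x \<partial>M) - (\<integral>x. (f x)\<^sup>2 \<partial>M) = (\<integral>x. (F k x)\<^sup>2 \<partial>M)" for k
  proof -
    have "L2dist2 M (F k) f = (\<integral>x. (F k x)\<^sup>2 + (f x)\<^sup>2 - 2 * (F k x * f x) \<partial>M)"
      by (simp add: L2dist2_def power2_diff algebra_simps)
    also have "\<dots> = (\<integral>x. (F k x)\<^sup>2 \<partial>M) + (\<integral>x. (f x)\<^sup>2 \<partial>M) - 2 * (\<integral>x. F k x * f x \<partial>M)"
      using L2_integrable_mult[OF F[of k] f] L2_integrable_square[OF F[of k]] L2_integrable_square[OF f] by simp
    finally show ?thesis by simp
  qed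
  moreover have "0 + 2 * (\<integral>x. f x * f x \<partial>M) - (\<integral>x. (f x)\<^sup>2 \<partial>M) = (\<integral>x. (f x)\<^sup>2 \<partial>M)"
    by (simp add: power2_eq_square)
  ultimately show ?thesis by (simp only:)
qed

text \<open>Along a subsequence with \<open>L2dist2 (F (r k)) (F (r (k+1))) \<le> 4^-k\<close> the function
  \<open>\<Sum>k. 2^k |F (r k) - F (r (k+1))|^2\<close> is integrable, so the increments are almost everywhere
  dominated by a geometric sequence; Fatou's lemma then identifies the pointwise limit.\<close>

lemma L2_complete:
  assumes F: "\<And>k. L2 M (F k)"
    and Cauchy: "\<And>e. e > 0 \<Longrightarrow> \<exists>N. \<forall>m\<ge>N. \<forall>n\<ge>N. L2dist2 M (F m) (F n) < e"
  shows "\<exists>f. L2 M f \<and> (\<lambda>k. L2dist2 M (F k) f) \<longlonglongrightarrow> 0"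
proof -
  note [measurable] = L2_measurable[OF F]
  have "\<exists>r. \<forall>k. (\<forall>m\<ge>r k. \<forall>n\<ge>r k. L2dist2 M (F m) (F n) < (1/4)^k) \<and> r k \<le> r (Suc k)"
  proof (rule dependent_nat_choice[where P="\<lambda>k N. \<forall>m\<ge>N. \<forall>n\<ge>N. L2dist2 M (F m) (F n) < (1/4)^k"
        and Q="\<lambda>k N N'. N \<le> N'"])
    show "\<exists>x. \<forall>m\<ge>x. \<forall>n\<ge>x. L2dist2 M (F m) (F n) < (1/4)^0" using Cauchy[of 1] by simp
  next
    fix x k
    have "(0::real) < (1/4)^(Suc k)" by (simp only: zero_less_power zero_less_divide_1_iff zero_less_numeral)
    then obtain N where "\<forall>m\<ge>N. \<forall>n\<ge>N. L2dist2 M (F m) (F n) < (1/4)^(Suc k)"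
      using Cauchy by blast
    then have "(\<forall>m\<ge>max N x. \<forall>n\<ge>max N x. L2dist2 M (F m) (F n) < (1/4)^(Suc k)) \<and> x \<le> max N x"
      by (auto simp only: max.bounded_iff max.cobounded2 simp_thms)
    then show "\<exists>y. (\<forall>m\<ge>y. \<forall>n\<ge>y. L2dist2 M (F m) (F n) < (1/4)^(Suc k)) \<and> x \<le> y" ..
  qed
  then obtain r where R: "\<forall>k. (\<forall>m\<ge>r k. \<forall>n\<ge>r k. L2dist2 M (F m) (F n) < (1/4)^k) \<and> r k \<le> r (Suc k)" ..
  have r: "L2dist2 M (F m) (F n) < (1/4)^k" if "m \<ge> r k" "n \<ge> r k" for k m n
    using R[THEN spec, of k] that by simp
  have rmono: "r k \<le> r (Suc k)" for k
    using R[THEN spec, of k] by simp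
  define d where "d k x = F (r (Suc k)) x - F (r k) x" for k x
  have [measurable]: "d k \<in> borel_measurable M" for k unfolding d_def by measurable
  have nn_d: "(\<integral>\<^sup>+x. ennreal ((d k x)\<^sup>2) \<partial>M) \<le> ennreal ((1/4)^k)" for k
  proof -
    have "(\<integral>\<^sup>+x. ennreal ((d k x)\<^sup>2) \<partial>M) = ennreal (L2dist2 M (F (r (Suc k))) (F (r k)))"
      unfolding L2dist2_def d_def
      by (rule nn_integral_eq_integral) (use L2_integrable_square[OF L2_diff[OF F F]] in auto)
    also have "\<dots> \<le> ennreal ((1/4)^k)"
      using r[of k "r (Suc k)" "r k"] rmono[of k] by (intro ennreal_leI) auto
    finally show ?thesis .
  qed
  have "(\<integral>\<^sup>+x. (\<Sum>k. ennreal (2^k * (d k x)\<^sup>2)) \<partial>M) = (\<Sum>k. \<integral>\<^sup>+x. ennreal (2^k * (d k x)\<^sup>2) \<partial>M)"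
    by (rule nn_integral_suminf) measurable
  also have "\<dots> \<le> (\<Sum>k. ennreal ((1/2)^k))"
  proof (rule suminf_le)
    fix k
    have "(\<integral>\<^sup>+x. ennreal (2^k * (d k x)\<^sup>2) \<partial>M) = ennreal (2^k) * (\<integral>\<^sup>+x. ennreal ((d k x)\<^sup>2) \<partial>M)"
      by (simp add: ennreal_mult nn_integral_cmult)
    also have "\<dots> \<le> ennreal (2^k) * ennreal ((1/4)^k)" by (intro mult_left_mono nn_d) auto
    also have "\<dots> = ennreal ((1/2)^k)"
    proof -
      have "(2::real)^k * (1/4)^k = (1/2)^k" by (induction k) auto
      then show ?thesis by (simp only: ennreal_mult[symmetric] zero_le_power zero_le_numeral zero_le_divide_1_iff)
    qed
    finally show "(\<integral>\<^sup>+x. ennreal (2^k * (d k x)\<^sup>2) \<partial>M) \<le> ennreal ((1/2)^k)" .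
  qed auto
  also have "\<dots> < \<infinity>"
    by (subst suminf_ennreal2) (auto intro: summable_geometric)
  finally have "AE x in M. (\<Sum>k. ennreal (2^k * (d k x)\<^sup>2)) \<noteq> \<infinity>"
    by (intro nn_integral_PInf_AE) auto
  then have conv: "AE x in M. convergent (\<lambda>k. F (r k) x)"
  proof eventually_elim
    case (elim x)
    then have "(\<Sum>k. ennreal (2^k * (d k x)\<^sup>2)) \<noteq> top" by (simp only: infinity_ennreal_def not_False_eq_True)
    then have "summable (\<lambda>k. 2^k * (d k x)\<^sup>2)"
      by (rule summable_suminf_not_top[rotated]) simp
    from convergent_imp_Bseq[OF convergentI[OF summable_LIMSEQ_zero[OF this]]]
    have "Bseq (\<lambda>k. 2^k * (d k x)\<^sup>2)" .
    then obtain C where C: "C > 0" "\<And>k. norm (2^k * (d k x)\<^sup>2) \<le> C"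
      unfolding Bseq_def by blast
    have "norm (d k x) \<le> sqrt C * (sqrt (1/2))^k" for k
    proof -
      have "(1/2)^k * (2^k * (d k x)\<^sup>2) \<le> (1/2)^k * C"
        using C(2)[of k] by (intro mult_left_mono) auto
      moreover have "(1/2)^k * 2^k = (1::real)" by (induction k) auto
      ultimately have "(d k x)\<^sup>2 \<le> C * (1/2)^k"
        by (simp only: mult.assoc[symmetric] mult_1 mult.commute[of C])
      then have "sqrt ((d k x)\<^sup>2) \<le> sqrt (C * (1/2)^k)" by (rule real_sqrt_le_mono)
      moreover have "sqrt (C * (1/2)^k) = sqrt C * (sqrt (1/2))^k" by (simp only: real_sqrt_mult real_sqrt_power)
      moreover have "sqrt ((d k x)\<^sup>2) = norm (d k x)" by simp
      ultimately show ?thesis by linarith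
    qed
    moreover have "summable (\<lambda>k. sqrt C * (sqrt (1/2))^k)"
      by (intro summable_mult summable_geometric) simp
    ultimately have "summable (\<lambda>k. d k x)" by (rule summable_comparison_test'[where N=0, rotated])
    then have "convergent (\<lambda>n. \<Sum>k<n. d k x)" by (simp add: summable_iff_convergent)
    moreover have "(\<Sum>k<n. d k x) = F (r n) x - F (r 0) x" for n
      by (induction n) (auto simp: d_def)
    ultimately have "convergent (\<lambda>n. (F (r n) x - F (r 0) x) + F (r 0) x)"
      by (intro convergent_add convergent_const) simp
    then show ?case by simp
  qed
  define f where "f x = lim (\<lambda>k. F (r k) x)" for x
  have fm [measurable]: "f \<in> borel_measurable M" unfolding f_def by measurable
  have lim: "AE x in M. (\<lambda>k. F (r k) x) \<longlonglongrightarrow> f x"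
    using conv by eventually_elim (simp add: f_def convergent_LIMSEQ_iff)
  have fatou: "(\<integral>\<^sup>+x. ennreal ((F m x - f x)\<^sup>2) \<partial>M) \<le> ennreal ((1/4)^k)" if "m \<ge> r k" for m k
  proof -
    have "(\<integral>\<^sup>+x. ennreal ((F m x - f x)\<^sup>2) \<partial>M) = (\<integral>\<^sup>+x. liminf (\<lambda>j. ennreal ((F m x - F (r j) x)\<^sup>2)) \<partial>M)"
    proof (rule nn_integral_cong_AE)
      show "AE x in M. ennreal ((F m x - f x)\<^sup>2) = liminf (\<lambda>j. ennreal ((F m x - F (r j) x)\<^sup>2))"
        using lim
      proof eventually_elim
        case (elim x)
        then have "(\<lambda>j. ennreal ((F m x - F (r j) x)\<^sup>2)) \<longlonglongrightarrow> ennreal ((F m x - f x)\<^sup>2)"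
          by (intro tendsto_ennrealI tendsto_power tendsto_diff tendsto_const)
        then show ?case by (intro lim_imp_Liminf[symmetric]) auto
      qed
    qed
    also have "\<dots> \<le> liminf (\<lambda>j. \<integral>\<^sup>+x. ennreal ((F m x - F (r j) x)\<^sup>2) \<partial>M)"
      by (rule nn_integral_liminf) measurable
    also have "\<dots> \<le> ennreal ((1/4)^k)"
    proof (rule Liminf_le)
      show "\<forall>\<^sub>F j in sequentially. (\<integral>\<^sup>+x. ennreal ((F m x - F (r j) x)\<^sup>2) \<partial>M) \<le> ennreal ((1/4)^k)"
        using eventually_ge_at_top[of k]
      proof eventually_elim
        case (elim j)
        have "r k \<le> r j" using elim rmono by (rule lift_Suc_mono_le[rotated])
        have "(\<integral>\<^sup>+x. ennreal ((F m x - F (r j) x)\<^sup>2) \<partial>M) = ennreal (L2dist2 M (F m) (F (r j)))"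
          unfolding L2dist2_def
          by (rule nn_integral_eq_integral) (use L2_integrable_square[OF L2_diff[OF F F]] in auto)
        also have "\<dots> \<le> ennreal ((1/4)^k)"
          using r[of k m "r j"] that \<open>r k \<le> r j\<close> by (intro ennreal_leI) auto
        finally show ?case .
      qed
    qed simp
    finally show ?thesis .
  qed
  have intdiff: "integrable M (\<lambda>x. (F m x - f x)\<^sup>2)" if "m \<ge> r 0" for m
  proof (rule integrableI_nonneg)
    show "(\<integral>\<^sup>+x. ennreal ((F m x - f x)\<^sup>2) \<partial>M) < \<infinity>"
      using fatou[OF that] by (simp add: order_le_less_trans)
  qed auto
  have "L2 M (\<lambda>x. F (r 0) x - f x)" using intdiff[of "r 0"] by (auto simp: L2_def)
  from L2_diff[OF F this, of "r 0"] have Lf: "L2 M f" by simp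
  have small: "L2dist2 M (F m) f \<le> (1/4)^k" if "m \<ge> r k" for m k
  proof -
    have "ennreal (L2dist2 M (F m) f) = (\<integral>\<^sup>+x. ennreal ((F m x - f x)\<^sup>2) \<partial>M)"
      unfolding L2dist2_def
      by (rule nn_integral_eq_integral[symmetric]) (use L2_integrable_square[OF L2_diff[OF F Lf]] in auto)
    also have "\<dots> \<le> ennreal ((1/4)^k)" by (rule fatou[OF that])
    finally show ?thesis by (simp add: ennreal_le_iff)
  qed
  have "(\<lambda>k. L2dist2 M (F k) f) \<longlonglongrightarrow> 0"
  proof (rule LIMSEQ_I)
    fix e :: real assume "e > 0"
    obtain k where "(1/4::real)^k < e" using real_arch_pow_inv[OF \<open>e > 0\<close>, of "1/4"] by auto
    then show "\<exists>no. \<forall>n\<ge>no. norm (L2dist2 M (F n) f - 0) < e"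
      using order_le_less_trans[OF small[of k]] L2dist2_nonneg[of M _ f] by (intro exI[of _ "r k"]) auto
  qed
  then show ?thesis using Lf by blast
qed

section \<open>Smooth functions and test functions\<close>

text \<open>Smoothness cut into finite levels: closure under products becomes an induction on
  \<open>k\<close>, whereas in a coinduction the derivative of a product, being a sum of products,
  would leave the shape of the invariant.\<close>

primrec Ck :: "nat \<Rightarrow> (real^'n::finite \<Rightarrow> real) \<Rightarrow> bool" where
  "Ck 0 f \<longleftrightarrow> True"
| "Ck (Suc k) f \<longleftrightarrow> (\<forall>x. f differentiable (at x)) \<and> (\<forall>i. Ck k (partial i f))"

lemma smooth_fun_partial: "smooth_fun f \<Longrightarrow> smooth_fun (partial i f)"
  by (erule smooth_fun.cases) auto

lemma smooth_fun_differentiable: "smooth_fun f \<Longrightarrow> f differentiable (at x)"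
  by (erule smooth_fun.cases) auto

lemma smooth_fun_iff_Ck: "smooth_fun f \<longleftrightarrow> (\<forall>k. Ck k f)"
proof
  assume "smooth_fun f"
  moreover have "smooth_fun f \<Longrightarrow> Ck k f" for k
    by (induction k arbitrary: f) (auto intro: smooth_fun_partial smooth_fun_differentiable)
  ultimately show "\<forall>k. Ck k f" by blast
next
  assume "\<forall>k. Ck k f"
  then show "smooth_fun f"
  proof (coinduction arbitrary: f)
    case smooth_fun
    have "Ck (Suc k) f" for k using smooth_fun by blast
    then show ?case by auto
  qed
qed

lemma Ck_Suc_imp: "Ck (Suc k) f \<Longrightarrow> Ck k f"
  by (induction k arbitrary: f) auto

lemma has_derivative_imp_partial:
  "(f has_derivative f') (at x) \<Longrightarrow> partial i f x = f' (axis i 1)"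
  by (simp add: partial_def frechet_derivative_at[symmetric])

lemma differentiable_has_derivative_partial:
  fixes f :: "real^'n::finite \<Rightarrow> real"
  assumes "f differentiable (at x)"
  shows "(f has_derivative (\<lambda>h. \<Sum>i\<in>UNIV. h $ i * partial i f x)) (at x)"
proof -
  let ?D = "frechet_derivative f (at x)"
  have D: "(f has_derivative ?D) (at x)" using assms by (simp add: frechet_derivative_works)
  then have lin: "linear ?D" by (rule has_derivative_linear)
  have "?D h = (\<Sum>i\<in>UNIV. h $ i * partial i f x)" for h
  proof -
    have "?D h = ?D (\<Sum>i\<in>UNIV. h $ i *\<^sub>R axis i 1)"
      using basis_expansion[of h] by (simp add: scalar_mult_eq_scaleR)
    also have "\<dots> = (\<Sum>i\<in>UNIV. h $ i * partial i f x)"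
      using lin by (simp add: linear_sum linear_scale partial_def)
    finally show ?thesis .
  qed
  then have "?D = (\<lambda>h. \<Sum>i\<in>UNIV. h $ i * partial i f x)" by auto
  with D show ?thesis by simp
qed

lemma partial_const [simp]: "partial i (\<lambda>x. c) = (\<lambda>x. 0)"
  by (rule ext, rule has_derivative_imp_partial[THEN trans]) auto

lemma partial_add:
  assumes "f differentiable (at x)" "g differentiable (at x)"
  shows "partial i (\<lambda>x. f x + g x) x = partial i f x + partial i g x"
proof -
  obtain f' g' where D: "(f has_derivative f') (at x)" "(g has_derivative g') (at x)"
    using assms by (auto simp: differentiable_def)
  show ?thesis
    using has_derivative_imp_partial[OF has_derivative_add[OF D]] D[THEN has_derivative_imp_partial]
    by simp
qed

lemma partial_mult:
  assumes "f differentiable (at x)" "g differentiable (at x)"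
  shows "partial i (\<lambda>x. f x * g x) x = partial i f x * g x + f x * partial i g x"
proof -
  obtain f' g' where D: "(f has_derivative f') (at x)" "(g has_derivative g') (at x)"
    using assms by (auto simp: differentiable_def)
  show ?thesis
    using has_derivative_imp_partial[OF has_derivative_mult[OF D]] D[THEN has_derivative_imp_partial]
    by simp
qed

lemma differentiable_affine:
  fixes f :: "real^'n::finite \<Rightarrow> real"
  assumes "f differentiable (at (c + r *\<^sub>R x))"
  shows "(\<lambda>x. f (c + r *\<^sub>R x)) differentiable (at x)"
    and "partial i (\<lambda>x. f (c + r *\<^sub>R x)) x = r * partial i f (c + r *\<^sub>R x)"
proof -
  obtain f' where D: "(f has_derivative f') (at (c + r *\<^sub>R x))"
    using assms by (auto simp: differentiable_def)
  have A: "((\<lambda>x. c + r *\<^sub>R x) has_derivative (\<lambda>h. r *\<^sub>R h)) (at x)"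
    by (auto intro!: derivative_eq_intros)
  have C: "((\<lambda>x. f (c + r *\<^sub>R x)) has_derivative (\<lambda>h. f' (r *\<^sub>R h))) (at x)"
    using diff_chain_at[OF A D] by (simp add: o_def)
  then show "(\<lambda>x. f (c + r *\<^sub>R x)) differentiable (at x)" by (auto simp: differentiable_def)
  show "partial i (\<lambda>x. f (c + r *\<^sub>R x)) x = r * partial i f (c + r *\<^sub>R x)"
    using has_derivative_imp_partial[OF C] has_derivative_imp_partial[OF D]
      linear_scale[OF has_derivative_linear[OF D]] by simp
qed

lemma Ck_const: "Ck k (\<lambda>x. c)"
  by (induction k arbitrary: c) auto

lemma Ck_add: "Ck k f \<Longrightarrow> Ck k g \<Longrightarrow> Ck k (\<lambda>x. f x + g x)"
proof (induction k arbitrary: f g)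
  case (Suc k)
  have "partial i (\<lambda>x. f x + g x) = (\<lambda>x. partial i f x + partial i g x)" for i
    using Suc.prems by (auto intro!: partial_add)
  then show ?case using Suc by auto
qed auto

lemma Ck_mult: "Ck k f \<Longrightarrow> Ck k g \<Longrightarrow> Ck k (\<lambda>x. f x * g x)"
proof (induction k arbitrary: f g)
  case (Suc k)
  have "partial i (\<lambda>x. f x * g x) = (\<lambda>x. partial i f x * g x + f x * partial i g x)" for i
    using Suc.prems by (auto intro!: partial_mult)
  then show ?case using Suc Ck_Suc_imp[of k f] Ck_Suc_imp[of k g] by (auto intro: Ck_add)
qed auto

lemma smooth_const: "smooth_fun (\<lambda>x. c)"
  by (simp add: smooth_fun_iff_Ck Ck_const)

lemma smooth_add: "smooth_fun f \<Longrightarrow> smooth_fun g \<Longrightarrow> smooth_fun (\<lambda>x. f x + g x)"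
  by (simp add: smooth_fun_iff_Ck Ck_add)

lemma smooth_mult: "smooth_fun f \<Longrightarrow> smooth_fun g \<Longrightarrow> smooth_fun (\<lambda>x. f x * g x)"
  by (simp add: smooth_fun_iff_Ck Ck_mult)

lemma smooth_cmult: "smooth_fun f \<Longrightarrow> smooth_fun (\<lambda>x. c * f x)"
  by (simp add: smooth_mult smooth_const)

lemma smooth_sum: "(\<And>i. i \<in> I \<Longrightarrow> smooth_fun (f i)) \<Longrightarrow> smooth_fun (\<lambda>x. \<Sum>i\<in>I. f i x)"
  by (induction I rule: infinite_finite_induct) (auto intro: smooth_const smooth_add)

lemma smooth_prod: "(\<And>i. i \<in> I \<Longrightarrow> smooth_fun (f i)) \<Longrightarrow> smooth_fun (\<lambda>x. \<Prod>i\<in>I. f i x)"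
  by (induction I rule: infinite_finite_induct) (auto intro: smooth_const smooth_mult)

lemma smooth_affine:
  assumes "smooth_fun f" shows "smooth_fun (\<lambda>x. f (c + r *\<^sub>R x))"
proof -
  have "Ck k f \<Longrightarrow> Ck k (\<lambda>x. f (c + r *\<^sub>R x))" for k
  proof (induction k arbitrary: f)
    case (Suc k)
    have "partial i (\<lambda>x. f (c + r *\<^sub>R x)) = (\<lambda>x. r * partial i f (c + r *\<^sub>R x))" for i
      using Suc.prems by (auto intro!: differentiable_affine(2))
    moreover have "Ck k (\<lambda>x. r * partial i f (c + r *\<^sub>R x))" for i
      using Suc by (auto intro!: Ck_mult Ck_const)
    ultimately show ?case using Suc.prems by (auto intro: differentiable_affine(1))
  qed auto
  then show ?thesis using assms by (simp add: smooth_fun_iff_Ck)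
qed

text \<open>The sequence \<open>F\<close> carries all derivatives of \<open>F 0\<close> at once, so
  differentiating just moves the index; hence the induction is over all \<open>m\<close>
  simultaneously.\<close>

lemma smooth_coordinate_function:
  fixes F :: "nat \<Rightarrow> real \<Rightarrow> real"
  assumes "\<And>k t. (F k has_real_derivative F (Suc k) t) (at t)"
  shows "smooth_fun (\<lambda>x::real^'n::finite. F m (x $ j))"
proof -
  have D: "((\<lambda>x::real^'n. F m (x $ j)) has_derivative (\<lambda>h. F (Suc m) (x $ j) * h $ j)) (at x)" for m x
  proof -
    have 1: "((\<lambda>x::real^'n. x $ j) has_derivative (\<lambda>h. h $ j)) (at x)"
      by (rule bounded_linear_imp_has_derivative) (rule bounded_linear_vec_nth)
    have 2: "(F m has_derivative (\<lambda>h. F (Suc m) (x $ j) * h)) (at (x $ j))"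
      using assms by (simp add: has_field_derivative_def)
    show ?thesis using diff_chain_at[OF 1 2] by (simp add: o_def)
  qed
  have P: "partial i (\<lambda>x::real^'n. F m (x $ j)) = (\<lambda>x. (if i = j then 1 else 0) * F (Suc m) (x $ j))" for i m
    by (rule ext, rule has_derivative_imp_partial[OF D, THEN trans]) (simp add: axis_def)
  have "Ck k (\<lambda>x::real^'n. F m (x $ j))" for k
  proof (induction k arbitrary: m)
    case (Suc k)
    show ?case using D Suc by (auto simp: P differentiable_def intro!: Ck_mult Ck_const)
  qed simp
  then show "smooth_fun (\<lambda>x::real^'n. F m (x $ j))" by (simp add: smooth_fun_iff_Ck)
qed

lemma smooth_coordinate: "smooth_fun (\<lambda>x::real^'n::finite. x $ j)"
proof -
  define F where "F k t = (if k = 0 then t else if k = 1 then 1 else 0)" for k :: nat and t :: real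
  have "(F k has_real_derivative F (Suc k) t) (at t)" for k t
    unfolding F_def by (cases "k = 0"; cases "k = 1") (auto intro!: derivative_eq_intros)
  from smooth_coordinate_function[of F 0 j, OF this] show ?thesis by (simp add: F_def)
qed

lemma smooth_power: "smooth_fun f \<Longrightarrow> smooth_fun (\<lambda>x. f x ^ k)"
  by (induction k) (auto intro: smooth_const smooth_mult)

lemma smooth_continuous: "smooth_fun f \<Longrightarrow> continuous_on S f"
  by (meson continuous_at_imp_continuous_on differentiable_imp_continuous_within smooth_fun_differentiable)

lemma smooth_borel_measurable: "smooth_fun f \<Longrightarrow> f \<in> borel_measurable borel"
  by (simp add: borel_measurable_continuous_onI smooth_continuous)

lemma smooth_lebesgue_measurable: "smooth_fun f \<Longrightarrow> f \<in> borel_measurable lebesgue"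
  by (simp add: smooth_borel_measurable measurable_completion)

lemma partial_cmult: "f differentiable (at x) \<Longrightarrow> partial i (\<lambda>x. c * f x) x = c * partial i f x"
  by (subst partial_mult) auto

lemma partial_sum:
  assumes "\<And>j. j \<in> J \<Longrightarrow> f j differentiable (at x)"
  shows "partial i (\<lambda>x. \<Sum>j\<in>J. f j x) x = (\<Sum>j\<in>J. partial i (f j) x)"
  using assms
  by (induction J rule: infinite_finite_induct) (auto simp: partial_add)

lemma test_fun_smooth: "test_fun S f \<Longrightarrow> smooth_fun f"
  by (simp add: test_fun_def)

lemma test_funI:
  assumes "smooth_fun f" "compact K" "K \<subseteq> S" "\<And>x. x \<notin> K \<Longrightarrow> f x = 0"
  shows "test_fun S f"
proof -
  have sub: "{x. f x \<noteq> 0} \<subseteq> K" using assms(4) by blast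
  then have "closure {x. f x \<noteq> 0} \<subseteq> K"
    using assms(2) by (simp add: closure_minimal compact_imp_closed)
  moreover have "bounded {x. f x \<noteq> 0}"
    using assms(2) sub bounded_subset compact_imp_bounded by blast
  ultimately show ?thesis using assms(1,3) by (simp add: test_fun_def compact_closure)
qed

lemma test_fun_support:
  assumes "test_fun S f"
  shows "\<exists>K. compact K \<and> K \<subseteq> S \<and> (\<forall>x. x \<notin> K \<longrightarrow> f x = 0)"
proof (intro exI conjI allI impI)
  show "f x = 0" if "x \<notin> closure {x. f x \<noteq> 0}" for x
    using that closure_subset[of "{x. f x \<noteq> 0}"] by blast
qed (use assms in \<open>auto simp: test_fun_def\<close>)

lemma partial_eq_0_outside:
  assumes "closed K" "\<And>x. x \<notin> K \<Longrightarrow> f x = 0" "x \<notin> K"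
  shows "partial i f x = 0"
proof -
  have "(f has_derivative (\<lambda>h. 0)) (at x)"
    by (rule has_derivative_transform_within_open[of "\<lambda>x. 0" _ x UNIV "- K"]) (use assms in auto)
  then show ?thesis by (rule has_derivative_imp_partial)
qed

lemma test_fun_partial:
  assumes "test_fun S f" shows "test_fun S (partial i f)"
proof -
  obtain K where K: "compact K" "K \<subseteq> S" "\<And>x. x \<notin> K \<Longrightarrow> f x = 0"
    using test_fun_support[OF assms] by blast
  show ?thesis
  proof (rule test_funI[of _ K])
    show "partial i f x = 0" if "x \<notin> K" for x
      by (rule partial_eq_0_outside[of K]) (use K that in \<open>auto intro: compact_imp_closed\<close>)
  qed (use K assms in \<open>auto intro: smooth_fun_partial test_fun_smooth\<close>)
qed

lemma test_fun_mult:
  assumes "test_fun S f" "smooth_fun g" shows "test_fun S (\<lambda>x. f x * g x)"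
proof -
  obtain K where K: "compact K" "K \<subseteq> S" "\<And>x. x \<notin> K \<Longrightarrow> f x = 0"
    using test_fun_support[OF assms(1)] by blast
  show ?thesis
    by (rule test_funI[of _ K]) (use K assms in \<open>auto intro: smooth_mult test_fun_smooth\<close>)
qed

lemma test_fun_cmult: "test_fun S f \<Longrightarrow> test_fun S (\<lambda>x. c * f x)"
  using test_fun_mult[OF _ smooth_const, of S f c] by (simp add: mult.commute)

lemma test_fun_add:
  assumes "test_fun S f" "test_fun S g" shows "test_fun S (\<lambda>x. f x + g x)"
proof -
  obtain K where K: "compact K" "K \<subseteq> S" "\<And>x. x \<notin> K \<Longrightarrow> f x = 0"
    using test_fun_support[OF assms(1)] by blast
  obtain L where L: "compact L" "L \<subseteq> S" "\<And>x. x \<notin> L \<Longrightarrow> g x = 0"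
    using test_fun_support[OF assms(2)] by blast
  show ?thesis
    by (rule test_funI[of _ "K \<union> L"])
      (use assms K L in \<open>auto intro: smooth_add test_fun_smooth compact_Un\<close>)
qed

lemma test_fun_zero: "test_fun S (\<lambda>x. 0)"
  by (rule test_funI[of _ "{}"]) (auto intro: smooth_const)

lemma test_fun_subset: "test_fun S f \<Longrightarrow> S \<subseteq> T \<Longrightarrow> test_fun T f"
  by (auto simp: test_fun_def)

lemma test_fun_bounded:
  assumes "test_fun S f" obtains B where "B \<ge> 0" "\<And>x. \<bar>f x\<bar> \<le> B"
proof -
  obtain K where K: "compact K" "K \<subseteq> S" "\<And>x. x \<notin> K \<Longrightarrow> f x = 0"
    using test_fun_support[OF assms] by blast
  have "compact (f ` K)"
    using K assms by (intro compact_continuous_image smooth_continuous) (auto simp: test_fun_def)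
  then obtain B where B: "\<And>x. x \<in> K \<Longrightarrow> norm (f x) \<le> B"
    by (meson bounded_iff compact_imp_bounded image_eqI)
  show ?thesis
  proof (rule that[of "max 0 B"])
    fix x show "\<bar>f x\<bar> \<le> max 0 B" using B[of x] K(3)[of x] by (cases "x \<in> K") auto
  qed simp
qed

lemma test_fun_Lipschitz:
  fixes f :: "real^'n::finite \<Rightarrow> real"
  assumes f: "test_fun S f"
  obtains B where "B \<ge> 0" "\<And>x y. \<bar>f y - f x\<bar> \<le> B * norm (y - x)"
proof -
  have "\<exists>b. b \<ge> 0 \<and> (\<forall>x. \<bar>partial i f x\<bar> \<le> b)" for i
    using test_fun_bounded[OF test_fun_partial[OF f, of i]] by metis
  then obtain b where b: "\<And>i. b i \<ge> 0" "\<And>i x. \<bar>partial i f x\<bar> \<le> b i" by metis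
  have D: "(f has_derivative (\<lambda>h. \<Sum>i\<in>UNIV. h $ i * partial i f x)) (at x)" for x
    using f by (intro differentiable_has_derivative_partial) (auto simp: test_fun_def intro: smooth_fun_differentiable)
  have O: "onorm (\<lambda>h. \<Sum>i\<in>UNIV. h $ i * partial i f x) \<le> (\<Sum>i\<in>UNIV. b i)" for x
  proof (rule onorm_bound)
    fix h :: "real^'n"
    have "norm (\<Sum>i\<in>UNIV. h $ i * partial i f x) \<le> (\<Sum>i\<in>UNIV. \<bar>h $ i\<bar> * \<bar>partial i f x\<bar>)"
      using norm_sum[of "\<lambda>i. h $ i * partial i f x" UNIV] by (simp add: abs_mult)
    also have "\<dots> \<le> (\<Sum>i\<in>UNIV. norm h * b i)"
      using b by (intro sum_mono mult_mono) (auto simp: component_le_norm_cart)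
    finally show "norm (\<Sum>i\<in>UNIV. h $ i * partial i f x) \<le> (\<Sum>i\<in>UNIV. b i) * norm h"
      by (simp add: sum_distrib_left mult.commute)
  qed (use b in \<open>auto intro: sum_nonneg\<close>)
  show ?thesis
  proof (rule that[of "\<Sum>i\<in>UNIV. b i"])
    fix x y
    show "\<bar>f y - f x\<bar> \<le> (\<Sum>i\<in>UNIV. b i) * norm (y - x)"
      using differentiable_bound[OF convex_UNIV D O UNIV_I UNIV_I, of y x] by simp
  qed (use b in \<open>auto intro: sum_nonneg\<close>)
qed

text \<open>Subtract the linear part at \<open>x\<close> and apply the mean value inequality on the
  ball of radius \<open>norm h\<close>, where the gradient differs from that at \<open>x\<close> by
  at most a constant times \<open>norm h\<close>. The constant does not depend on \<open>x\<close>;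
  this uniformity is what allows differentiation under a convolution integral.\<close>

lemma test_fun_Taylor:
  fixes f :: "real^'n::finite \<Rightarrow> real"
  assumes f: "test_fun S f"
  obtains B where "B \<ge> 0"
    "\<And>x h. \<bar>f (x + h) - f x - (\<Sum>i\<in>UNIV. h $ i * partial i f x)\<bar> \<le> B * (norm h)\<^sup>2"
proof -
  have "\<exists>b. b \<ge> 0 \<and> (\<forall>x y. \<bar>partial i f y - partial i f x\<bar> \<le> b * norm (y - x))" for i
    using test_fun_Lipschitz[OF test_fun_partial[OF f, of i]] by metis
  then obtain b where b: "\<And>i. b i \<ge> 0"
    "\<And>i x y. \<bar>partial i f y - partial i f x\<bar> \<le> b i * norm (y - x)" by metis
  show ?thesis
  proof (rule that[of "\<Sum>i\<in>UNIV. b i"])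
    fix x h :: "real^'n"
    define g where "g z = f z - (\<Sum>i\<in>UNIV. (z - x) $ i * partial i f x)" for z
    have Df: "(f has_derivative (\<lambda>h. \<Sum>i\<in>UNIV. h $ i * partial i f z)) (at z)" for z
      using f by (intro differentiable_has_derivative_partial) (auto simp: test_fun_def intro: smooth_fun_differentiable)
    have D: "(g has_derivative (\<lambda>h. \<Sum>i\<in>UNIV. h $ i * (partial i f z - partial i f x))) (at z)" for z
      unfolding g_def
      by (rule has_derivative_eq_rhs, rule has_derivative_diff[OF Df], rule has_derivative_sum,
          rule has_derivative_mult_left, rule bounded_linear.has_derivative[OF bounded_linear_vec_nth],
          rule has_derivative_diff, rule has_derivative_ident, rule has_derivative_const)
        (auto simp: fun_eq_iff algebra_simps sum_subtractf)
    have "norm (g (x + h) - g x) \<le> ((\<Sum>i\<in>UNIV. b i) * norm h) * norm (x + h - x)"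
    proof (rule differentiable_bound[of "cball x (norm h)"])
      fix z assume z: "z \<in> cball x (norm h)"
      show "(g has_derivative (\<lambda>h. \<Sum>i\<in>UNIV. h $ i * (partial i f z - partial i f x))) (at z within cball x (norm h))"
        using D by (rule has_derivative_at_withinI)
      show "onorm (\<lambda>h. \<Sum>i\<in>UNIV. h $ i * (partial i f z - partial i f x)) \<le> (\<Sum>i\<in>UNIV. b i) * norm h"
      proof (rule onorm_bound)
        fix k :: "real^'n"
        have "norm (\<Sum>i\<in>UNIV. k $ i * (partial i f z - partial i f x))
          \<le> (\<Sum>i\<in>UNIV. \<bar>k $ i\<bar> * \<bar>partial i f z - partial i f x\<bar>)"
          using norm_sum[of "\<lambda>i. k $ i * (partial i f z - partial i f x)" UNIV] by (simp add: abs_mult)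
        also have "\<dots> \<le> (\<Sum>i\<in>UNIV. norm k * (b i * norm h))"
        proof (intro sum_mono mult_mono)
          fix i
          have "\<bar>partial i f z - partial i f x\<bar> \<le> b i * norm (z - x)" by (rule b(2))
          also have "\<dots> \<le> b i * norm h"
            using z b(1) by (intro mult_left_mono) (auto simp: dist_norm norm_minus_commute)
          finally show "\<bar>partial i f z - partial i f x\<bar> \<le> b i * norm h" .
        qed (auto simp: component_le_norm_cart)
        finally show "norm (\<Sum>i\<in>UNIV. k $ i * (partial i f z - partial i f x)) \<le> (\<Sum>i\<in>UNIV. b i) * norm h * norm k"
          by (simp add: sum_distrib_right sum_distrib_left algebra_simps)
      qed (use b in \<open>auto intro!: sum_nonneg mult_nonneg_nonneg\<close>)
    qed (auto simp: dist_norm)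
    then show "\<bar>f (x + h) - f x - (\<Sum>i\<in>UNIV. h $ i * partial i f x)\<bar> \<le> (\<Sum>i\<in>UNIV. b i) * (norm h)\<^sup>2"
      by (simp add: g_def power2_eq_square algebra_simps)
  qed (use b in \<open>auto intro: sum_nonneg\<close>)
qed

section \<open>A smooth bump with compact support\<close>

text \<open>With \<open>s = 1 / t\<close>, the derivative in \<open>t\<close> of
  \<open>P(s) exp (- s)\<close> is \<open>s^2 (P - P')(s) exp (- s)\<close>, which is the
  recursion.\<close>

primrec flat_poly :: "nat \<Rightarrow> real poly" where
  "flat_poly 0 = 1"
| "flat_poly (Suc k) = [:0, 0, 1:] * (flat_poly k - pderiv (flat_poly k))"

text \<open>\<open>flat k\<close> is the \<open>k\<close>-th derivative of the function \<open>exp (-1/t)\<close>, extended by zero to \<open>t \<le> 0\<close>.\<close>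

definition flat :: "nat \<Rightarrow> real \<Rightarrow> real" where
  "flat k t = (if t \<le> 0 then 0 else poly (flat_poly k) (1 / t) * exp (- (1 / t)))"

lemma poly_mult_exp_tendsto_0: "((\<lambda>s. poly q s * exp (- s)) \<longlongrightarrow> 0) (at_top :: real filter)"
proof -
  have "((\<lambda>s. \<Sum>i\<le>degree q. coeff q i * (s ^ i / exp s)) \<longlongrightarrow> (\<Sum>i\<le>degree q. coeff q i * 0)) at_top"
    by (intro tendsto_sum tendsto_mult tendsto_const tendsto_power_div_exp_0)
  moreover have "(\<lambda>s. poly q s * exp (- s)) = (\<lambda>s. \<Sum>i\<le>degree q. coeff q i * (s ^ i / exp s))"
    by (auto simp: poly_altdef sum_distrib_right exp_minus divide_inverse mult.assoc)
  ultimately show ?thesis by simp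
qed

lemma flat_has_derivative: "(flat k has_real_derivative flat (Suc k) t) (at t)"
proof -
  consider "t < 0" | "t = 0" | "t > 0" by linarith
  then show ?thesis
  proof cases
    case 1
    have "((\<lambda>t::real. 0::real) has_real_derivative 0) (at t)" by simp
    then have "(flat k has_real_derivative 0) (at t)"
      by (rule has_field_derivative_transform_within_open[of _ _ _ "{..<0}"]) (use 1 in \<open>auto simp: flat_def\<close>)
    then show ?thesis using 1 by (simp add: flat_def)
  next
    case 3
    have "((\<lambda>t. poly (flat_poly k) (1 / t) * exp (- (1 / t))) has_real_derivative
        poly (pderiv (flat_poly k)) (1 / t) * (- 1 / t^2) * exp (- (1 / t)) +
        exp (- (1 / t)) * (1 / t^2) * poly (flat_poly k) (1 / t)) (at t)"
      using 3 by (auto intro!: derivative_eq_intros DERIV_chain2[OF poly_DERIV] simp: power2_eq_square)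
    then have "(flat k has_real_derivative
        poly (pderiv (flat_poly k)) (1 / t) * (- 1 / t^2) * exp (- (1 / t)) +
        exp (- (1 / t)) * (1 / t^2) * poly (flat_poly k) (1 / t)) (at t)"
      by (rule has_field_derivative_transform_within_open[of _ _ _ "{0<..}"]) (use 3 in \<open>auto simp: flat_def\<close>)
    moreover have "poly (pderiv (flat_poly k)) (1 / t) * (- 1 / t^2) * exp (- (1 / t)) +
        exp (- (1 / t)) * (1 / t^2) * poly (flat_poly k) (1 / t) = flat (Suc k) t"
      using 3 by (simp add: flat_def power2_eq_square field_simps)
    ultimately show ?thesis by simp
  next
    case 2
    \<comment> \<open>The difference quotient at 0 from the right is \<open>s P(s) exp (- s)\<close>
      with \<open>s = 1 / t\<close> tending to infinity.\<close>
    have "((\<lambda>t. flat k t / t) \<longlongrightarrow> 0) (at_right 0)"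
    proof (rule Lim_transform_eventually)
      show "((\<lambda>t. poly ([:0, 1:] * flat_poly k) (inverse t) * exp (- (inverse t))) \<longlongrightarrow> 0) (at_right 0)"
        by (rule filterlim_compose[OF poly_mult_exp_tendsto_0 filterlim_inverse_at_top_right])
      show "\<forall>\<^sub>F t in at_right 0. poly ([:0, 1:] * flat_poly k) (inverse t) * exp (- (inverse t)) = flat k t / t"
        by (auto simp: eventually_at_right_less flat_def field_simps eventually_at_filter)
    qed
    moreover have "((\<lambda>t. flat k t / t) \<longlongrightarrow> 0) (at_left 0)"
    proof (rule Lim_transform_eventually[OF tendsto_const])
      show "\<forall>\<^sub>F t in at_left 0. 0 = flat k t / t"
        by (auto simp: flat_def eventually_at_filter)
    qed
    ultimately have "((\<lambda>t. flat k t / t) \<longlongrightarrow> 0) (at 0)" by (rule filterlim_split_at[rotated])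
    then show ?thesis using 2 by (simp add: has_field_derivative_iff flat_def)
  qed
qed

lemma flat_0: "flat 0 t = (if t \<le> 0 then 0 else exp (- (1 / t)))"
  by (simp add: flat_def)

text \<open>The product form reduces smoothness to functions of one coordinate. The support is the
  cube of side 2 instead of a ball, which is where the factors \<open>CARD('n)\<close> in later
  support estimates come from.\<close>

definition bump :: "real^'n::finite \<Rightarrow> real" where
  "bump x = (\<Prod>i\<in>UNIV. flat 0 (1 + x $ i) * flat 0 (1 - x $ i))"

lemma bump_nonneg: "0 \<le> bump x"
  unfolding bump_def by (intro prod_nonneg) (auto simp: flat_0)

lemma bump_pos_0: "0 < bump 0"
  unfolding bump_def by (intro prod_pos) (auto simp: flat_0)

lemma bump_eq_0:
  assumes "\<not> \<bar>x $ i\<bar> < 1" shows "bump x = 0"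
proof -
  have "flat 0 (1 + x $ i) * flat 0 (1 - x $ i) = 0"
    using assms by (auto simp: flat_0)
  then show ?thesis unfolding bump_def by (intro prod_zero) auto
qed

lemma smooth_bump: "smooth_fun (bump :: real^'n::finite \<Rightarrow> real)"
proof -
  have F: "smooth_fun (\<lambda>x::real^'n. flat 0 (x $ i))" for i
    by (rule smooth_coordinate_function) (rule flat_has_derivative)
  have "smooth_fun (\<lambda>x::real^'n. flat 0 (1 + x $ i))" for i
    using smooth_affine[OF F, where c=1 and r=1] by simp
  moreover have "smooth_fun (\<lambda>x::real^'n. flat 0 (1 - x $ i))" for i
    using smooth_affine[OF F, where c=1 and r="-1"] by simp
  ultimately show ?thesis unfolding bump_def[abs_def] by (intro smooth_prod smooth_mult)
qed

section \<open>Mollification\<close>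

definition conv :: "(real^'n::finite \<Rightarrow> real) \<Rightarrow> (real^'n \<Rightarrow> real) \<Rightarrow> real^'n \<Rightarrow> real" where
  "conv w \<rho> x = (\<integral>y. w y * \<rho> (x - y) \<partial>lebesgue)"

lemma integrable_mult_bounded:
  fixes w f :: "'a \<Rightarrow> real"
  assumes "integrable M w" "f \<in> borel_measurable M" "\<And>x. \<bar>f x\<bar> \<le> B"
  shows "integrable M (\<lambda>x. w x * f x)"
proof (rule Bochner_Integration.integrable_bound)
  show "integrable M (\<lambda>x. B * w x)" using assms by auto
  show "(\<lambda>x. w x * f x) \<in> borel_measurable M" using assms by measurable
  have "\<bar>f x\<bar> \<le> \<bar>B\<bar>" for x using assms(3)[of x] by linarith
  then show "AE x in M. norm (w x * f x) \<le> norm (B * w x)"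
    by (auto simp: abs_mult mult.commute intro!: mult_right_mono AE_I2)
qed

lemma test_fun_reflect:
  assumes "test_fun UNIV \<rho>" shows "test_fun UNIV (\<lambda>y. \<rho> (x - y))"
proof -
  obtain K where K: "compact K" "\<And>x. x \<notin> K \<Longrightarrow> \<rho> x = 0"
    using test_fun_support[OF assms] by blast
  have "smooth_fun (\<lambda>y. \<rho> (x + (-1) *\<^sub>R y))"
    by (rule smooth_affine[OF test_fun_smooth[OF assms]])
  then have "smooth_fun (\<lambda>y. \<rho> (x - y))" by simp
  then show ?thesis
  proof (rule test_funI)
    show "compact ((\<lambda>y. x - y) ` K)"
      by (intro compact_continuous_image continuous_intros K)
    show "\<rho> (x - y) = 0" if "y \<notin> (\<lambda>y. x - y) ` K" for y
    proof (rule K(2))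
      show "x - y \<notin> K" using that by (metis diff_diff_eq2 add_diff_cancel_left' image_eqI)
    qed
  qed simp
qed

lemma test_fun_borel: "test_fun S f \<Longrightarrow> f \<in> borel_measurable borel"
  by (simp add: test_fun_smooth smooth_borel_measurable)

lemma test_fun_lebesgue: "test_fun S f \<Longrightarrow> f \<in> borel_measurable lebesgue"
  by (simp add: test_fun_smooth smooth_lebesgue_measurable)

lemma integrable_conv:
  assumes w: "integrable lebesgue w" and \<rho>: "test_fun UNIV \<rho>"
  shows "integrable lebesgue (\<lambda>y. w y * \<rho> (x - y))"
proof -
  obtain B where "\<And>x. \<bar>\<rho> x\<bar> \<le> B" using test_fun_bounded[OF \<rho>] by blast
  then show ?thesis
    by (intro integrable_mult_bounded[OF w, where B=B] test_fun_lebesgue[OF test_fun_reflect[OF \<rho>]])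
qed

text \<open>The Taylor remainder of the kernel is at most \<open>B * (norm h)\<^sup>2\<close>
  uniformly in the base point, so after integration against \<open>w\<close> it is at most the L1
  norm of \<open>w\<close> times the same quantity.\<close>

lemma conv_has_derivative:
  assumes w: "integrable lebesgue w" and \<rho>: "test_fun UNIV \<rho>"
  shows "(conv w \<rho> has_derivative (\<lambda>h. \<Sum>i\<in>UNIV. h $ i * conv w (partial i \<rho>) x)) (at x)"
    (is "(_ has_derivative ?D) _")
proof -
  obtain B where B: "B \<ge> 0"
    "\<And>x h. \<bar>\<rho> (x + h) - \<rho> x - (\<Sum>i\<in>UNIV. h $ i * partial i \<rho> x)\<bar> \<le> B * (norm h)\<^sup>2"
    using test_fun_Taylor[OF \<rho>] by blast
  note I = integrable_conv[OF w \<rho>] integrable_conv[OF w test_fun_partial[OF \<rho>]]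
  define C where "C = (\<integral>y. \<bar>w y\<bar> \<partial>lebesgue) * B"
  have key: "\<bar>conv w \<rho> (x + h) - conv w \<rho> x - ?D h\<bar> \<le> C * (norm h)\<^sup>2" for h
  proof -
    let ?R = "\<lambda>y. \<rho> (x + h - y) - \<rho> (x - y) - (\<Sum>i\<in>UNIV. h $ i * partial i \<rho> (x - y))"
    have split: "w y * ?R y = w y * \<rho> (x + h - y) - w y * \<rho> (x - y) - (\<Sum>i\<in>UNIV. h $ i * (w y * partial i \<rho> (x - y)))" for y
      by (simp add: right_diff_distrib sum_distrib_left mult.left_commute)
    have int: "integrable lebesgue (\<lambda>y. w y * ?R y)"
      unfolding split by (intro Bochner_Integration.integrable_diff Bochner_Integration.integrable_sum integrable_mult_right I)
    have eq: "conv w \<rho> (x + h) - conv w \<rho> x - ?D h = (\<integral>y. w y * ?R y \<partial>lebesgue)"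
      unfolding split using I by (simp add: conv_def Bochner_Integration.integral_sum)
    have "\<bar>conv w \<rho> (x + h) - conv w \<rho> x - ?D h\<bar> \<le> (\<integral>y. \<bar>w y * ?R y\<bar> \<partial>lebesgue)"
      unfolding eq by (rule integral_abs_bound)
    also have "\<dots> \<le> (\<integral>y. \<bar>w y\<bar> * (B * (norm h)\<^sup>2) \<partial>lebesgue)"
    proof (rule integral_mono)
      show "integrable lebesgue (\<lambda>y. \<bar>w y * ?R y\<bar>)" using int by (rule integrable_abs)
      show "integrable lebesgue (\<lambda>y. \<bar>w y\<bar> * (B * (norm h)\<^sup>2))" using w by auto
      fix y
      have shift: "x + h - y = x - y + h" by simp
      have "\<bar>?R y\<bar> \<le> B * (norm h)\<^sup>2" unfolding shift by (rule B(2))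
      then show "\<bar>w y * ?R y\<bar> \<le> \<bar>w y\<bar> * (B * (norm h)\<^sup>2)"
        unfolding abs_mult by (rule mult_left_mono) simp
    qed
    also have "\<dots> = C * (norm h)\<^sup>2" by (simp add: C_def)
    finally show ?thesis .
  qed
  show ?thesis
    unfolding has_derivative_at
  proof
    show "bounded_linear ?D"
      by (intro bounded_linear_sum bounded_linear_mult_const bounded_linear_vec_nth)
    show "(\<lambda>h. norm (conv w \<rho> (x + h) - conv w \<rho> x - ?D h) / norm h) \<midarrow>0\<rightarrow> 0"
    proof (rule tendsto_sandwich[of "\<lambda>_. 0" _ _ "\<lambda>h. C * norm h"])
      show "\<forall>\<^sub>F h in at 0. norm (conv w \<rho> (x + h) - conv w \<rho> x - ?D h) / norm h \<le> C * norm h"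
        using key by (auto simp: eventually_at_filter divide_le_eq power2_eq_square mult.assoc)
      have "((\<lambda>h::real^'a. C * norm h) \<longlongrightarrow> C * norm (0::real^'a)) (at 0)" by (intro tendsto_intros)
      then show "((\<lambda>h::real^'a. C * norm h) \<longlongrightarrow> 0) (at 0)" by simp
    qed auto
  qed
qed

lemma partial_conv:
  assumes w: "integrable lebesgue w" and \<rho>: "test_fun UNIV \<rho>"
  shows "partial i (conv w \<rho>) = conv w (partial i \<rho>)"
proof
  fix x
  show "partial i (conv w \<rho>) x = conv w (partial i \<rho>) x"
    using has_derivative_imp_partial[OF conv_has_derivative[OF w \<rho>], of i x]
    by (simp add: axis_def if_distrib[of "\<lambda>c. c * _"] cong: if_cong)
qed

lemma smooth_conv:
  assumes w: "integrable lebesgue w" and \<rho>: "test_fun UNIV \<rho>"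
  shows "smooth_fun (conv w \<rho>)"
proof -
  have "test_fun UNIV \<rho> \<Longrightarrow> Ck k (conv w \<rho>)" for k
  proof (induction k arbitrary: \<rho>)
    case (Suc k)
    then show ?case
      using conv_has_derivative[OF w Suc.prems]
      by (auto simp: differentiable_def partial_conv[OF w] intro: test_fun_partial)
  qed simp
  then show ?thesis using \<rho> by (simp add: smooth_fun_iff_Ck)
qed

lemma lborel_distr_reflect:
  fixes x :: "'a::euclidean_space" shows "distr lborel borel (\<lambda>y. x - y) = lborel"
  using lborel_affine[of "-1" x] by (simp add: density_1)

lemma nn_integral_lborel_reflect:
  fixes f :: "'a::euclidean_space \<Rightarrow> ennreal"
  assumes [measurable]: "f \<in> borel_measurable borel"
  shows "(\<integral>\<^sup>+y. f (x - y) \<partial>lborel) = (\<integral>\<^sup>+y. f y \<partial>lborel)"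
proof -
  have "(\<integral>\<^sup>+y. f y \<partial>lborel) = (\<integral>\<^sup>+y. f y \<partial>distr lborel borel (\<lambda>y. x - y))"
    by (simp add: lborel_distr_reflect)
  also have "\<dots> = (\<integral>\<^sup>+y. f (x - y) \<partial>lborel)" by (rule nn_integral_distr) measurable
  finally show ?thesis by simp
qed

lemma test_fun_integrable:
  assumes "test_fun S f" shows "integrable lebesgue f"
proof -
  obtain K where K: "compact K" "\<And>x. x \<notin> K \<Longrightarrow> f x = 0"
    using test_fun_support[OF assms] by blast
  obtain B where B: "\<And>x. \<bar>f x\<bar> \<le> B" using test_fun_bounded[OF assms] by blast
  have "integrable lebesgue (indicator K :: _ \<Rightarrow> real)"
    using K(1) by (simp add: lmeasurable_iff_integrable[symmetric] lmeasurable_compact)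
  then have "integrable lebesgue (\<lambda>x. indicator K x * f x)"
    by (rule integrable_mult_bounded[OF _ test_fun_lebesgue[OF assms] B])
  moreover have "(\<lambda>x. indicator K x * f x) = f" using K(2) by (auto simp: indicator_def fun_eq_iff)
  ultimately show ?thesis by simp
qed

lemma test_fun_L2: assumes "test_fun S f" shows "L2 lebesgue f"
  using test_fun_integrable[OF test_fun_mult[OF assms test_fun_smooth[OF assms]]] test_fun_lebesgue[OF assms]
  by (simp add: L2_def power2_eq_square)

definition mol :: "real \<Rightarrow> real^'n::finite \<Rightarrow> real" where
  "mol e x = inverse (\<integral>y. bump ((1/e) *\<^sub>R (y::real^'n)) \<partial>lebesgue) * bump ((1/e) *\<^sub>R x)"

lemma test_fun_bump_scaled:
  assumes "e > 0" shows "test_fun UNIV (\<lambda>x::real^'n::finite. bump ((1/e) *\<^sub>R x))"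
proof (rule test_funI)
  show "smooth_fun (\<lambda>x::real^'n. bump ((1/e) *\<^sub>R x))"
    using smooth_affine[OF smooth_bump, of 0 "1/e"] by simp
  show "compact (cbox (\<chi> i. - e) (\<chi> i. e) :: (real^'n) set)" by simp
  show "bump ((1/e) *\<^sub>R x) = 0" if x: "x \<notin> cbox (\<chi> i. - e) (\<chi> i. e)" for x :: "real^'n"
  proof -
    obtain i where "\<not> (- e \<le> x $ i \<and> x $ i \<le> e)" using x by (auto simp: mem_box_cart)
    then show ?thesis using assms by (intro bump_eq_0[of _ i]) (auto simp: field_simps abs_less_iff)
  qed
qed simp

lemma bump_integral_pos:
  assumes "e > 0" shows "0 < (\<integral>y. bump ((1/e) *\<^sub>R (y::real^'n::finite)) \<partial>lebesgue)"
proof (rule ccontr)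
  let ?f = "\<lambda>y::real^'n. bump ((1/e) *\<^sub>R y)"
  note T = test_fun_bump_scaled[OF assms]
  assume "\<not> 0 < (\<integral>y. ?f y \<partial>lebesgue)"
  moreover have "0 \<le> (\<integral>y. ?f y \<partial>lebesgue)" by (simp add: bump_nonneg)
  ultimately have "(\<integral>y. ?f y \<partial>lebesgue) = 0" by simp
  moreover have "(\<integral>y. ?f y \<partial>lebesgue) = 0 \<longleftrightarrow> (AE y in lebesgue. ?f y = 0)"
    by (rule integral_nonneg_eq_0_iff_AE[OF test_fun_integrable[OF T]]) (simp add: bump_nonneg)
  ultimately have AE: "AE y in lebesgue. ?f y = 0" by blast
  have "continuous_on UNIV ?f" using smooth_continuous[OF test_fun_smooth[OF T]] .
  then have op: "open {y. ?f y \<noteq> 0}" using open_Collect_neq[of ?f "\<lambda>_. 0"] by simp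
  then have "{y. ?f y \<noteq> 0} \<in> sets lebesgue" by simp
  then have "{y. ?f y \<noteq> 0} \<in> null_sets lebesgue" using AE AE_iff_null[of lebesgue "\<lambda>y. ?f y = 0"] by simp
  then have "negligible {y. ?f y \<noteq> 0}" by (simp add: negligible_iff_null_sets)
  moreover have "0 < bump (0 :: real^'n)" by (rule bump_pos_0)
  then have "0 \<in> {y. ?f y \<noteq> 0}" by simp
  ultimately show False using op open_not_negligible by blast
qed

lemma test_fun_mol: "e > 0 \<Longrightarrow> test_fun UNIV (mol e)"
  unfolding mol_def[abs_def] by (intro test_fun_cmult test_fun_bump_scaled)

lemma mol_nonneg: "e > 0 \<Longrightarrow> 0 \<le> mol e x"
  unfolding mol_def by (simp add: bump_nonneg bump_integral_pos less_imp_le)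

lemma mol_integral:
  assumes "e > 0" shows "(\<integral>y. mol e (y::real^'n::finite) \<partial>lebesgue) = 1"
proof -
  have "0 < (\<integral>y. bump ((1/e) *\<^sub>R (y::real^'n)) \<partial>lebesgue)" by (rule bump_integral_pos[OF assms])
  then show ?thesis by (simp add: mol_def)
qed

text \<open>The kernel lives on the cube of half side \<open>e\<close>, and the Euclidean norm is at
  most the l1 norm. The crude radius \<open>e * CARD('n)\<close> is the one by which mollification
  spreads supports below.\<close>

lemma mol_eq_0:
  fixes x :: "real^'n::finite" and e :: real
  assumes "e > 0" "norm x > e * CARD('n)" shows "mol e x = 0"
proof -
  have "\<exists>i. e < \<bar>x $ i\<bar>"
  proof (rule ccontr)
    assume "\<not> ?thesis"
    then have "(\<Sum>i\<in>UNIV. \<bar>x $ i\<bar>) \<le> (\<Sum>i\<in>(UNIV::'n set). e)" by (intro sum_mono) (auto simp: not_less)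
    then show False using norm_le_l1_cart[of x] assms(2) by (simp add: mult.commute)
  qed
  then obtain i where "e < \<bar>x $ i\<bar>" by blast
  then show ?thesis using assms(1) by (auto simp: mol_def field_simps intro!: bump_eq_0[of _ i])
qed

lemma mol_integral_reflect:
  fixes x :: "real^'n::finite"
  assumes "e > 0" shows "(\<integral>y. mol e (x - y) \<partial>lebesgue) = 1" "(\<integral>\<^sup>+y. ennreal (mol e (x - y)) \<partial>lborel) = 1"
proof -
  have [measurable]: "(mol e :: real^'n \<Rightarrow> real) \<in> borel_measurable borel" by (rule test_fun_borel[OF test_fun_mol[OF assms]])
  have "(\<integral>\<^sup>+y. ennreal (mol e (x - y)) \<partial>lborel) = (\<integral>\<^sup>+y. ennreal (mol e (y::real^'n)) \<partial>lborel)"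
    by (rule nn_integral_lborel_reflect) measurable
  also have "\<dots> = (\<integral>\<^sup>+y. ennreal (mol e (y::real^'n)) \<partial>lebesgue)" by (simp add: nn_integral_completion)
  also have "\<dots> = ennreal (\<integral>y. mol e (y::real^'n) \<partial>lebesgue)"
    by (rule nn_integral_eq_integral[OF test_fun_integrable[OF test_fun_mol[OF assms]]]) (simp add: mol_nonneg assms)
  finally show 1: "(\<integral>\<^sup>+y. ennreal (mol e (x - y)) \<partial>lborel) = 1" by (simp add: mol_integral assms)
  have "ennreal (\<integral>y. mol e (x - y) \<partial>lebesgue) = (\<integral>\<^sup>+y. ennreal (mol e (x - y)) \<partial>lebesgue)"
    by (rule nn_integral_eq_integral[symmetric, OF test_fun_integrable[OF test_fun_reflect[OF test_fun_mol[OF assms]]]])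
      (simp add: mol_nonneg assms)
  also have "\<dots> = ennreal 1" using 1 by (simp add: nn_integral_completion)
  finally show "(\<integral>y. mol e (x - y) \<partial>lebesgue) = 1"
    by (subst (asm) ennreal_inj) (auto intro!: integral_nonneg_AE simp: mol_nonneg assms)
qed

text \<open>Jensen's inequality for the probability density \<open>mol e\<close>, followed by Tonelli.\<close>

lemma conv_mol_contraction:
  fixes w :: "real^'n::finite \<Rightarrow> real"
  assumes w: "L2 lebesgue w" "integrable lebesgue w" and e: "e > 0"
  shows "L2 lebesgue (conv w (mol e))"
    and "(\<integral>x. (conv w (mol e) x)\<^sup>2 \<partial>lebesgue) \<le> (\<integral>x. (w x)\<^sup>2 \<partial>lebesgue)"
proof -
  let ?m = "mol e :: real^'n \<Rightarrow> real"
  have tm: "test_fun UNIV ?m" by (rule test_fun_mol[OF e])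
  have [measurable]: "?m \<in> borel_measurable borel" by (rule test_fun_borel[OF tm])
  \<comment> \<open>A Borel representative of \<open>w\<close>, so that the integrand of the double
    integral is jointly measurable and Tonelli applies on \<open>lborel\<close>.\<close>
  obtain w' where w' [measurable]: "w' \<in> borel_measurable borel" and ae: "AE x in lborel. w x = w' x"
    using completion_ex_borel_measurable_real[of w lborel] w by (auto simp: L2_def)
  have ae': "AE x in lebesgue. w x = w' x" using ae by (rule AE_completion)
  have w'leb: "w' \<in> borel_measurable lebesgue" using w' by (simp add: measurable_completion)
  have L2w': "L2 lebesgue w'" using L2_AE_cong[OF w(1) w'leb ae'] .
  obtain B where B: "\<And>x. \<bar>?m x\<bar> \<le> B" using test_fun_bounded[OF tm] by blast
  have refl_meas: "(\<lambda>y. ?m (x - y)) \<in> borel_measurable lebesgue" for x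
    by (rule test_fun_lebesgue[OF test_fun_reflect[OF tm]])
  have conv_w': "conv w ?m x = (\<integral>y. w' y * ?m (x - y) \<partial>lebesgue)" for x
    unfolding conv_def
    by (rule integral_cong_AE) (use w(1) w'leb refl_meas ae' in \<open>auto simp: L2_def\<close>)
  have int2: "integrable lebesgue (\<lambda>y. (w' y)\<^sup>2 * ?m (x - y))" for x
    by (rule integrable_mult_bounded[OF L2_integrable_square[OF L2w'] refl_meas B])
  have jensen: "(conv w ?m x)\<^sup>2 \<le> (\<integral>y. (w' y)\<^sup>2 * ?m (x - y) \<partial>lebesgue)" for x
  proof -
    \<comment> \<open>Splitting the density as \<open>?s * ?s\<close> and applying Cauchy-Schwarz to
      \<open>w' * ?s\<close> and \<open>?s\<close> gives Jensen, because the second factor has total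
      mass 1.\<close>
    let ?s = "\<lambda>y. sqrt (?m (x - y))"
    have s2: "(?s y)\<^sup>2 = ?m (x - y)" for y using mol_nonneg[OF e] by simp
    have sm: "?s \<in> borel_measurable lebesgue"
      using refl_meas[of x] by measurable
    have "L2 lebesgue ?s"
      unfolding L2_def s2 using sm test_fun_integrable[OF test_fun_reflect[OF tm]] by auto
    moreover have "L2 lebesgue (\<lambda>y. w' y * ?s y)"
      unfolding L2_def power_mult_distrib s2 using int2 sm w'leb by auto
    ultimately have "(\<integral>y. (w' y * ?s y) * ?s y \<partial>lebesgue)\<^sup>2
        \<le> (\<integral>y. (w' y * ?s y)\<^sup>2 \<partial>lebesgue) * (\<integral>y. (?s y)\<^sup>2 \<partial>lebesgue)"
      by (intro L2_Cauchy_Schwarz)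
    then show ?thesis
      unfolding conv_w' power_mult_distrib s2 mult.assoc power2_eq_square[symmetric]
      by (simp add: mol_integral_reflect[OF e])
  qed
  have smooth: "smooth_fun (conv w ?m)" by (rule smooth_conv[OF w(2) tm])
  have nn: "(\<integral>\<^sup>+x. ennreal ((conv w ?m x)\<^sup>2) \<partial>lborel) \<le> ennreal (\<integral>x. (w x)\<^sup>2 \<partial>lebesgue)"
  proof -
    have "(\<integral>\<^sup>+x. ennreal ((conv w ?m x)\<^sup>2) \<partial>lborel)
        \<le> (\<integral>\<^sup>+x. (\<integral>\<^sup>+y. ennreal ((w' y)\<^sup>2 * ?m (x - y)) \<partial>lborel) \<partial>lborel)"
    proof (rule nn_integral_mono)
      fix x
      have "ennreal ((conv w ?m x)\<^sup>2) \<le> ennreal (\<integral>y. (w' y)\<^sup>2 * ?m (x - y) \<partial>lebesgue)"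
        using jensen by (rule ennreal_leI)
      also have "\<dots> = (\<integral>\<^sup>+y. ennreal ((w' y)\<^sup>2 * ?m (x - y)) \<partial>lebesgue)"
        by (rule nn_integral_eq_integral[symmetric, OF int2]) (simp add: mol_nonneg e)
      finally show "ennreal ((conv w ?m x)\<^sup>2) \<le> (\<integral>\<^sup>+y. ennreal ((w' y)\<^sup>2 * ?m (x - y)) \<partial>lborel)"
        by (simp add: nn_integral_completion)
    qed
    also have "\<dots> = (\<integral>\<^sup>+y. (\<integral>\<^sup>+x. ennreal ((w' y)\<^sup>2 * ?m (x - y)) \<partial>lborel) \<partial>lborel)"
      by (rule lborel_pair.Fubini'[symmetric]) measurable
    also have "\<dots> = (\<integral>\<^sup>+y. ennreal ((w' y)\<^sup>2) \<partial>lborel)"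
    proof (rule nn_integral_cong)
      fix y
      have "(\<integral>\<^sup>+x. ennreal ((w' y)\<^sup>2 * ?m (x - y)) \<partial>lborel)
          = ennreal ((w' y)\<^sup>2) * (\<integral>\<^sup>+x. ennreal (?m (x - y)) \<partial>lborel)"
        by (simp add: ennreal_mult mol_nonneg e nn_integral_cmult)
      also have "(\<integral>\<^sup>+x. ennreal (?m (x - y)) \<partial>lborel) = (\<integral>\<^sup>+x. ennreal (?m (x - 0)) \<partial>lborel)"
      proof -
        have "(\<integral>\<^sup>+x. ennreal (?m ((- y) - (- x))) \<partial>lborel) = (\<integral>\<^sup>+x. ennreal (?m (- y - x)) \<partial>lborel)"
          using nn_integral_lborel_reflect[of "\<lambda>x. ennreal (?m (- y - x))" 0] by simp
        also have "\<dots> = (\<integral>\<^sup>+x. ennreal (?m x) \<partial>lborel)"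
          by (rule nn_integral_lborel_reflect) measurable
        finally show ?thesis by simp
      qed
      also have "\<dots> = 1"
        using nn_integral_lborel_reflect[of "\<lambda>x. ennreal (?m x)" 0, symmetric] mol_integral_reflect(2)[OF e, of 0] by simp
      finally show "(\<integral>\<^sup>+x. ennreal ((w' y)\<^sup>2 * ?m (x - y)) \<partial>lborel) = ennreal ((w' y)\<^sup>2)" by simp
    qed
    also have "\<dots> = (\<integral>\<^sup>+y. ennreal ((w' y)\<^sup>2) \<partial>lebesgue)" by (simp add: nn_integral_completion)
    also have "\<dots> = ennreal (\<integral>y. (w' y)\<^sup>2 \<partial>lebesgue)"
      by (rule nn_integral_eq_integral[OF L2_integrable_square[OF L2w']]) simp
    also have "(\<integral>y. (w' y)\<^sup>2 \<partial>lebesgue) = (\<integral>y. (w y)\<^sup>2 \<partial>lebesgue)"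
      by (rule integral_cong_AE) (use w(1) w'leb ae' in \<open>auto simp: L2_def\<close>)
    finally show ?thesis .
  qed
  have int: "integrable lebesgue (\<lambda>x. (conv w ?m x)\<^sup>2)"
  proof (rule integrableI_nonneg)
    show "(\<lambda>x. (conv w ?m x)\<^sup>2) \<in> borel_measurable lebesgue"
      using smooth_lebesgue_measurable[OF smooth] by auto
    show "(\<integral>\<^sup>+x. ennreal ((conv w ?m x)\<^sup>2) \<partial>lebesgue) < \<infinity>"
      using nn by (simp add: nn_integral_completion order_le_less_trans)
  qed auto
  then show "L2 lebesgue (conv w ?m)" using smooth_lebesgue_measurable[OF smooth] by (simp add: L2_def)
  have "ennreal (\<integral>x. (conv w ?m x)\<^sup>2 \<partial>lebesgue) \<le> ennreal (\<integral>x. (w x)\<^sup>2 \<partial>lebesgue)"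
    using nn nn_integral_eq_integral[OF int] by (simp add: nn_integral_completion)
  then show "(\<integral>x. (conv w ?m x)\<^sup>2 \<partial>lebesgue) \<le> (\<integral>x. (w x)\<^sup>2 \<partial>lebesgue)"
    by (subst (asm) ennreal_le_iff) (auto intro!: integral_nonneg_AE)
qed

section \<open>Approximation of L2 functions of bounded support by continuous ones\<close>

lemma lmeasurable_integrable_indicator:
  "S \<in> lmeasurable \<Longrightarrow> integrable lebesgue (indicator S :: _ \<Rightarrow> real)"
  by (simp add: lmeasurable_iff_integrable[symmetric])

lemma L2_indicator: "S \<in> lmeasurable \<Longrightarrow> L2 lebesgue (indicator S)"
proof -
  assume S: "S \<in> lmeasurable"
  have "(\<lambda>x. (indicator S x :: real)\<^sup>2) = indicator S" by (auto simp: indicator_def)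
  then show ?thesis
    using lmeasurable_integrable_indicator[OF S] S by (simp add: L2_def fmeasurableD)
qed

lemma L2_bounded_support_integrable:
  fixes w :: "'a::euclidean_space \<Rightarrow> real"
  assumes "L2 lebesgue w" "bounded {x. w x \<noteq> 0}"
  shows "integrable lebesgue w"
proof -
  obtain R where R: "\<And>x. w x \<noteq> 0 \<Longrightarrow> norm x \<le> R"
    using assms(2) by (auto simp: bounded_iff)
  have "integrable lebesgue (\<lambda>x. w x * indicator (cball 0 R) x)"
    by (rule L2_integrable_mult[OF assms(1) L2_indicator[OF lmeasurable_cball]])
  moreover have "(\<lambda>x. w x * indicator (cball 0 R) x) = w"
    using R by (auto simp: indicator_def fun_eq_iff)
  ultimately show ?thesis by simp
qed

definition clamp_real :: "real \<Rightarrow> real \<Rightarrow> real" where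
  "clamp_real m t = max (- m) (min m t)"

lemma clamp_real_continuous: "continuous_on UNIV (clamp_real m)"
  unfolding clamp_real_def[abs_def] by (intro continuous_intros)

lemma clamp_real_bound: "m \<ge> 0 \<Longrightarrow> \<bar>clamp_real m t\<bar> \<le> m"
  by (auto simp: clamp_real_def)

lemma clamp_real_id: "\<bar>t\<bar> \<le> m \<Longrightarrow> clamp_real m t = t"
  by (auto simp: clamp_real_def)

lemma clamp_real_diff: "m \<ge> 0 \<Longrightarrow> \<bar>t - clamp_real m t\<bar> \<le> \<bar>t\<bar>"
  by (auto simp: clamp_real_def)

lemma clamp_real_measurable [measurable]: "clamp_real m \<in> borel_measurable borel"
  by (rule borel_measurable_continuous_onI[OF clamp_real_continuous])

lemma L2_clamp_tendsto:
  assumes w: "L2 M w"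
  shows "(\<lambda>m. L2dist2 M w (\<lambda>x. clamp_real (real m) (w x))) \<longlonglongrightarrow> 0"
proof -
  note [measurable] = L2_measurable[OF w]
  have "(\<lambda>m. \<integral>x. (w x - clamp_real (real m) (w x))\<^sup>2 \<partial>M) \<longlonglongrightarrow> (\<integral>x. 0 \<partial>M)"
  proof (rule integral_dominated_convergence[where w="\<lambda>x. (w x)\<^sup>2"])
    show "integrable M (\<lambda>x. (w x)\<^sup>2)" by (rule L2_integrable_square[OF w])
    show "AE x in M. (\<lambda>m. (w x - clamp_real (real m) (w x))\<^sup>2) \<longlonglongrightarrow> 0"
    proof (rule AE_I2)
      fix x
      obtain N :: nat where N: "\<bar>w x\<bar> \<le> real N" using real_arch_simple by blast
      have "\<forall>\<^sub>F m in sequentially. (w x - clamp_real (real m) (w x))\<^sup>2 = 0"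
        using eventually_ge_at_top[of N]
      proof eventually_elim
        case (elim m)
        then have "\<bar>w x\<bar> \<le> real m" using N by linarith
        then show ?case by (simp add: clamp_real_id)
      qed
      then show "(\<lambda>m. (w x - clamp_real (real m) (w x))\<^sup>2) \<longlonglongrightarrow> 0"
        by (rule tendsto_eventually)
    qed
    show "AE x in M. norm ((w x - clamp_real (real m) (w x))\<^sup>2) \<le> (w x)\<^sup>2" for m
      using clamp_real_diff[of "real m"] by (intro AE_I2) (simp add: abs_le_square_iff[symmetric])
  qed auto
  then show ?thesis by (simp add: L2dist2_def)
qed

lemma L2_clamp: "L2 M w \<Longrightarrow> m \<ge> 0 \<Longrightarrow> L2 M (\<lambda>x. clamp_real m (w x))"
proof -
  assume w: "L2 M w" and m: "m \<ge> 0"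
  have [measurable]: "w \<in> borel_measurable M" by (rule L2_measurable[OF w])
  have sq: "(clamp_real m t)\<^sup>2 \<le> t\<^sup>2" for t
    using m by (auto simp: clamp_real_def abs_le_square_iff[symmetric])
  have "integrable M (\<lambda>x. (clamp_real m (w x))\<^sup>2)"
    by (rule Bochner_Integration.integrable_bound[OF L2_integrable_square[OF w]]) (auto simp: sq)
  then show ?thesis by (simp add: L2_def)
qed

lemma L2_continuous_bounded_support:
  fixes g :: "'a::euclidean_space \<Rightarrow> real"
  assumes g: "continuous_on UNIV g" and supp: "\<And>x. norm x > R \<Longrightarrow> g x = 0"
  shows "L2 lebesgue g"
proof -
  have gm: "g \<in> borel_measurable lebesgue"
    using borel_measurable_continuous_onI[OF g] by (simp add: measurable_completion)
  have "compact (g ` cball 0 R)"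
    using continuous_on_subset[OF g subset_UNIV] by (intro compact_continuous_image) auto
  then obtain B where B: "\<And>x. norm x \<le> R \<Longrightarrow> \<bar>g x\<bar> \<le> B"
    by (force simp: bounded_iff dest!: compact_imp_bounded)
  have "L2 lebesgue (\<lambda>x. g x * indicator (cball 0 R) x)"
  proof (rule L2_AE_bounded_mult[OF L2_indicator[OF lmeasurable_cball], where B="max 0 B", OF gm])
    show "AE x in lebesgue. \<bar>g x\<bar> \<le> max 0 B"
    proof (rule AE_I2)
      fix x show "\<bar>g x\<bar> \<le> max 0 B"
        using B[of x] supp[of x] by (cases "norm x \<le> R") auto
    qed
  qed
  moreover have "(\<lambda>x. g x * indicator (cball 0 R) x) = g"
    using supp by (auto simp: indicator_def fun_eq_iff)
  ultimately show ?thesis by simp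
qed

text \<open>A Lebesgue measurable function is an a.e. limit of continuous functions. Clamping these
  to \<open>[-m, m]\<close> and multiplying by \<open>cut\<close>, which is 1 up to radius
  \<open>R\<close> and 0 beyond \<open>R + 1\<close>, keeps the limit and bounds the squared error
  by \<open>(2 * m)\<^sup>2\<close> on a fixed ball, so dominated convergence turns the a.e. limit
  into an L2 limit.\<close>

lemma L2_approx_continuous_bounded:
  fixes w :: "'a::euclidean_space \<Rightarrow> real"
  assumes w: "L2 lebesgue w" and supp: "\<And>x. norm x > R \<Longrightarrow> w x = 0"
    and bd: "\<And>x. \<bar>w x\<bar> \<le> m" and e: "e > 0"
  shows "\<exists>g. continuous_on UNIV g \<and> (\<forall>x. norm x > R + 1 \<longrightarrow> g x = 0) \<and> L2dist2 lebesgue w g < e"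
proof -
  have m: "m \<ge> 0" using bd[of 0] by linarith
  have "w measurable_on UNIV"
    using w by (intro lebesgue_measurable_imp_measurable_on_real) (auto simp: L2_def)
  then obtain N G where N: "negligible N" and G: "\<And>n. continuous_on UNIV (G n)"
    and lim: "\<And>x. x \<notin> N \<Longrightarrow> (\<lambda>n. G n x) \<longlonglongrightarrow> w x"
    unfolding measurable_on_def by auto
  define cut where "cut x = max 0 (min 1 (R + 1 - norm x))" for x :: 'a
  have cutc: "continuous_on UNIV cut" unfolding cut_def by (intro continuous_intros)
  have cutb: "\<bar>cut x\<bar> \<le> 1" for x by (auto simp: cut_def)
  define g where "g n x = cut x * clamp_real m (G n x)" for n x
  have gc: "continuous_on UNIV (g n)" for n
    unfolding g_def
    by (intro continuous_intros cutc continuous_on_compose2[OF clamp_real_continuous G]) auto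
  have gs: "g n x = 0" if "norm x > R + 1" for n x using that by (simp add: g_def cut_def)
  have gb: "\<bar>g n x\<bar> \<le> m" for n x
    using mult_mono[OF cutb[of x] clamp_real_bound[OF m, of "G n x"]] by (simp add: g_def abs_mult)
  have gL: "L2 lebesgue (g n)" for n by (rule L2_continuous_bounded_support[OF gc gs])
  have glim: "(\<lambda>n. g n x) \<longlonglongrightarrow> w x" if "x \<notin> N" for x
  proof -
    have "(\<lambda>n. g n x) \<longlonglongrightarrow> cut x * clamp_real m (w x)"
      unfolding g_def
      by (rule tendsto_mult[OF tendsto_const continuous_on_tendsto_compose[OF clamp_real_continuous lim[OF that]]])
        auto
    moreover have "cut x * clamp_real m (w x) = w x"
      using supp[of x] bd[of x] by (cases "norm x \<le> R") (auto simp: cut_def clamp_real_id m)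
    ultimately show ?thesis by simp
  qed
  have "(\<lambda>n. \<integral>x. (w x - g n x)\<^sup>2 \<partial>lebesgue) \<longlonglongrightarrow> (\<integral>x. 0 \<partial>(lebesgue :: 'a measure))"
  proof (rule integral_dominated_convergence[where w="\<lambda>x. (2 * m)\<^sup>2 * indicator (cball 0 (R + 1)) x"])
    show "integrable lebesgue (\<lambda>x::'a. (2 * m)\<^sup>2 * indicator (cball 0 (R + 1)) x)"
      by (intro integrable_mult_right lmeasurable_integrable_indicator lmeasurable_cball)
    show "AE x in lebesgue. (\<lambda>n. (w x - g n x)\<^sup>2) \<longlonglongrightarrow> 0"
    proof -
      have "AE x in lebesgue. x \<notin> N"
        using N by (simp add: AE_not_in negligible_iff_null_sets)
      then show ?thesis
      proof eventually_elim
        case (elim x)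
        have "(\<lambda>n. (w x - g n x)\<^sup>2) \<longlonglongrightarrow> (w x - w x)\<^sup>2"
          by (intro tendsto_intros glim elim)
        then show ?case by simp
      qed
    qed
    show "AE x in lebesgue. norm ((w x - g n x)\<^sup>2) \<le> (2 * m)\<^sup>2 * indicator (cball 0 (R + 1)) x" for n
    proof (rule AE_I2)
      fix x :: 'a
      show "norm ((w x - g n x)\<^sup>2) \<le> (2 * m)\<^sup>2 * indicator (cball 0 (R + 1)) x"
      proof (cases "norm x \<le> R + 1")
        case True
        have "\<bar>w x - g n x\<bar> \<le> \<bar>2 * m\<bar>" using bd[of x] gb[of n x] by linarith
        then have "(w x - g n x)\<^sup>2 \<le> (2 * m)\<^sup>2" by (simp only: abs_le_square_iff)
        then show ?thesis using True by simp
      next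
        case False
        then show ?thesis using supp[of x] gs[of x n] by simp
      qed
    qed
  qed (use L2_measurable[OF w] L2_measurable[OF gL] in auto)
  then have "(\<lambda>n. L2dist2 lebesgue w (g n)) \<longlonglongrightarrow> 0" by (simp add: L2dist2_def)
  then have "\<forall>\<^sub>F n in sequentially. L2dist2 lebesgue w (g n) < e" using e by (rule order_tendstoD)
  then obtain n where "L2dist2 lebesgue w (g n) < e" by (auto simp: eventually_sequentially)
  then show ?thesis using gc gs by blast
qed

lemma L2_approx_continuous:
  fixes w :: "'a::euclidean_space \<Rightarrow> real"
  assumes w: "L2 lebesgue w" and supp: "\<And>x. norm x > R \<Longrightarrow> w x = 0" and e: "e > 0"
  shows "\<exists>g. continuous_on UNIV g \<and> (\<forall>x. norm x > R + 1 \<longrightarrow> g x = 0) \<and> L2dist2 lebesgue w g < e"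
proof -
  have "\<forall>\<^sub>F m in sequentially. L2dist2 lebesgue w (\<lambda>x. clamp_real (real m) (w x)) < e / 4"
    using L2_clamp_tendsto[OF w] e by (intro order_tendstoD) auto
  then obtain m where m: "L2dist2 lebesgue w (\<lambda>x. clamp_real (real m) (w x)) < e / 4"
    by (auto simp: eventually_sequentially)
  let ?w = "\<lambda>x. clamp_real (real m) (w x)"
  have Lw: "L2 lebesgue ?w" by (rule L2_clamp[OF w]) simp
  have sw: "?w x = 0" if "norm x > R" for x using supp[OF that] by (simp add: clamp_real_def)
  obtain g where g: "continuous_on UNIV g" "\<And>x. norm x > R + 1 \<Longrightarrow> g x = 0" "L2dist2 lebesgue ?w g < e / 4"
    using L2_approx_continuous_bounded[OF Lw sw clamp_real_bound, where e="e/4"] e by auto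
  have "L2dist2 lebesgue w g \<le> 2 * L2dist2 lebesgue w ?w + 2 * L2dist2 lebesgue ?w g"
    by (rule L2dist2_triangle[OF w Lw L2_continuous_bounded_support[OF g(1) g(2)]])
  then have "L2dist2 lebesgue w g < e" using m g(3) by linarith
  then show ?thesis using g by blast
qed

section \<open>Convergence of mollifications, and smooth cutoffs\<close>

lemma conv_mol_eq_0:
  fixes w :: "real^'n::finite \<Rightarrow> real" and e :: real
  assumes "e > 0" "\<And>y. w y \<noteq> 0 \<Longrightarrow> norm (x - y) > e * CARD('n)"
  shows "conv w (mol e) x = 0"
proof -
  have "w y * mol e (x - y) = 0" for y
    using assms(2)[of y] mol_eq_0[OF assms(1), of "x - y"] by auto
  then show ?thesis by (simp only: conv_def Bochner_Integration.integral_zero)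
qed

text \<open>Since \<open>mol e\<close> has integral 1, the difference is an average of
  \<open>g y - g x\<close> over those \<open>y\<close> at which the kernel is nonzero.\<close>

lemma conv_mol_uniform:
  fixes g :: "real^'n::finite \<Rightarrow> real" and e :: real
  assumes int: "integrable lebesgue g" and e: "e > 0"
    and osc: "\<And>y. norm (x - y) \<le> e * CARD('n) \<Longrightarrow> \<bar>g y - g x\<bar> \<le> \<eta>"
  shows "\<bar>conv g (mol e) x - g x\<bar> \<le> \<eta>"
proof -
  have tm: "test_fun UNIV (\<lambda>y. mol e (x - y))" by (rule test_fun_reflect[OF test_fun_mol[OF e]])
  have i1: "integrable lebesgue (\<lambda>y. g y * mol e (x - y))" by (rule integrable_conv[OF int test_fun_mol[OF e]])
  have i2: "integrable lebesgue (\<lambda>y. mol e (x - y))" by (rule test_fun_integrable[OF tm])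
  have i3: "integrable lebesgue (\<lambda>y. (g y - g x) * mol e (x - y))"
    using i1 i2 by (simp add: left_diff_distrib)
  have eq: "conv g (mol e) x - g x = (\<integral>y. (g y - g x) * mol e (x - y) \<partial>lebesgue)"
    using i1 i2 mol_integral_reflect(1)[OF e, of x] by (simp add: conv_def left_diff_distrib)
  have "\<bar>conv g (mol e) x - g x\<bar> \<le> (\<integral>y. \<bar>(g y - g x) * mol e (x - y)\<bar> \<partial>lebesgue)"
    unfolding eq by (rule integral_abs_bound)
  also have "\<dots> \<le> (\<integral>y. \<eta> * mol e (x - y) \<partial>lebesgue)"
  proof (rule integral_mono)
    fix y
    show "\<bar>(g y - g x) * mol e (x - y)\<bar> \<le> \<eta> * mol e (x - y)"
    proof (cases "norm (x - y) \<le> e * CARD('n)")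
      case True
      then show ?thesis using osc[OF True] mol_nonneg[OF e, of "x - y"] by (simp add: abs_mult mult_right_mono)
    next
      case False
      then show ?thesis using mol_eq_0[OF e, of "x - y"] by simp
    qed
  qed (use i3 i2 in \<open>auto intro: integrable_abs\<close>)
  also have "\<dots> = \<eta>" using mol_integral_reflect(1)[OF e, of x] by simp
  finally show ?thesis .
qed

lemma conv_mol_continuous_tendsto:
  fixes g :: "real^'n::finite \<Rightarrow> real"
  assumes g: "continuous_on UNIV g" and supp: "\<And>x. norm x > R \<Longrightarrow> g x = 0" and \<eta>: "\<eta> > 0"
  shows "\<exists>e0>0. \<forall>e. 0 < e \<and> e < e0 \<longrightarrow> L2dist2 lebesgue (conv g (mol e)) g < \<eta>"
proof -
  have gL: "L2 lebesgue g" by (rule L2_continuous_bounded_support[OF g supp])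
  have "bounded {x. g x \<noteq> 0}" using supp by (auto simp: bounded_iff not_less[symmetric] intro!: exI[of _ R])
  then have gi: "integrable lebesgue g" by (rule L2_bounded_support_integrable[OF gL])
  define V where "V = measure lebesgue (cball (0::real^'n) (R + 1))"
  \<comment> \<open>The uniform error is to be \<open>s\<close> on a ball of volume
    \<open>V\<close>, so \<open>s\<^sup>2 * V\<close> must fall below \<open>\<eta>\<close>; the
    summand 1 keeps the denominator positive.\<close>
  define s where "s = sqrt (\<eta> / (2 * (V + 1)))"
  have V: "V \<ge> 0" by (simp add: V_def)
  have s: "s > 0" "s\<^sup>2 * V < \<eta>"
  proof -
    have "0 < \<eta> / (2 * (V + 1))" using \<eta> V by simp
    then show "s > 0" by (simp add: s_def)
    have "s\<^sup>2 * V = \<eta> / (2 * (V + 1)) * V" using \<eta> V by (simp add: s_def)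
    also have "\<dots> = \<eta> * (V / (2 * (V + 1)))" by simp
    also have "V / (2 * (V + 1)) < 1" using V by (simp add: divide_less_eq)
    finally show "s\<^sup>2 * V < \<eta>" using \<eta> by simp
  qed
  have "uniformly_continuous_on (cball 0 (R + 2)) g"
    using continuous_on_subset[OF g subset_UNIV] by (intro compact_uniformly_continuous) auto
  then obtain d where d: "d > 0"
    "\<And>x y. x \<in> cball 0 (R + 2) \<Longrightarrow> y \<in> cball 0 (R + 2) \<Longrightarrow> dist y x < d \<Longrightarrow> dist (g y) (g x) < s"
    using s(1) unfolding uniformly_continuous_on_def by blast
  define e0 where "e0 = min 1 (d / 2) / CARD('n)"
  have "e0 > 0" using d by (simp add: e0_def)
  moreover have "L2dist2 lebesgue (conv g (mol e)) g < \<eta>" if e: "0 < e" "e < e0" for e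
  proof -
    \<comment> \<open>The first bound confines the mollification to radius \<open>R + 1\<close>; the
      second keeps averaging within the modulus of continuity of \<open>g\<close>, taken on radius
      \<open>R + 2\<close> so that both points are covered.\<close>
    have small: "e * CARD('n) < 1" "e * CARD('n) < d"
      using e d(1) by (auto simp: e0_def field_simps min_less_iff_conj)
    have "\<bar>conv g (mol e) x - g x\<bar> \<le> s" for x
    proof (rule conv_mol_uniform[OF gi e(1)])
      fix y assume y: "norm (x - y) \<le> e * CARD('n)"
      show "\<bar>g y - g x\<bar> \<le> s"
      proof (cases "norm x \<le> R + 1")
        case True
        have "norm y \<le> norm x + norm (x - y)" using norm_triangle_ineq4[of x "x - y"] by simp
        then show ?thesis
          using d(2)[of x y] True y small by (auto simp: dist_norm norm_minus_commute)
      next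
        case False
        have "norm x \<le> norm y + norm (x - y)" using norm_triangle_ineq[of y "x - y"] by simp
        then have "norm y > R" using False y small by linarith
        then show ?thesis using False supp[of x] supp[of y] s(1) by simp
      qed
    qed
    moreover have "conv g (mol e) x - g x = 0" if "norm x > R + 1" for x
    proof -
      have "conv g (mol e) x = 0"
      proof (rule conv_mol_eq_0[OF e(1)])
        fix y assume "g y \<noteq> 0"
        then have "norm y \<le> R" using supp[of y] by linarith
        moreover have "norm x \<le> norm y + norm (x - y)" using norm_triangle_ineq[of y "x - y"] by simp
        ultimately show "norm (x - y) > e * CARD('n)" using that small by linarith
      qed
      then show ?thesis using supp[of x] that by simp
    qed
    ultimately have bound: "(conv g (mol e) x - g x)\<^sup>2 \<le> s\<^sup>2 * indicator (cball 0 (R + 1)) x" for x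
      using s(1) by (cases "norm x \<le> R + 1") (auto simp: abs_le_square_iff[symmetric])
    have cL: "L2 lebesgue (conv g (mol e))" by (rule conv_mol_contraction(1)[OF gL gi e(1)])
    have "L2dist2 lebesgue (conv g (mol e)) g \<le> (\<integral>x. s\<^sup>2 * indicator (cball (0::real^'n) (R + 1)) x \<partial>lebesgue)"
      unfolding L2dist2_def
    proof (rule integral_mono)
      show "integrable lebesgue (\<lambda>x. (conv g (mol e) x - g x)\<^sup>2)"
        by (rule L2_integrable_square[OF L2_diff[OF cL gL]])
      show "integrable lebesgue (\<lambda>x::real^'n. s\<^sup>2 * indicator (cball 0 (R + 1)) x)"
        by (intro integrable_mult_right lmeasurable_integrable_indicator lmeasurable_cball)
    qed (rule bound)
    also have "\<dots> = s\<^sup>2 * V" by (simp add: V_def)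
    finally show ?thesis using s(2) by linarith
  qed
  ultimately show ?thesis by blast
qed

text \<open>Mollification is a contraction of L2 for every \<open>e\<close>, so convergence carries
  over from a continuous \<open>g\<close> close to \<open>w\<close>.\<close>

lemma conv_mol_tendsto:
  fixes w :: "real^'n::finite \<Rightarrow> real"
  assumes w: "L2 lebesgue w" and bs: "bounded {x. w x \<noteq> 0}" and \<eta>: "\<eta> > 0"
  shows "\<exists>e0>0. \<forall>e. 0 < e \<and> e < e0 \<longrightarrow> L2dist2 lebesgue (conv w (mol e)) w < \<eta>"
proof -
  obtain R where "\<And>x. w x \<noteq> 0 \<Longrightarrow> norm x \<le> R"
    using bs by (auto simp: bounded_iff)
  then have R: "\<And>x. norm x > R \<Longrightarrow> w x = 0" by force
  \<comment> \<open>Two triangle inequalities with factor 2 produce 2/16 + 4/16 + 4/16 = 10/16 of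
    \<open>\<eta>\<close>.\<close>
  obtain g where g: "continuous_on UNIV g" "\<And>x. norm x > R + 1 \<Longrightarrow> g x = 0" "L2dist2 lebesgue w g < \<eta> / 16"
    using L2_approx_continuous[OF w R, where e="\<eta> / 16"] \<eta> by auto
  obtain e0 where e0: "e0 > 0" "\<And>e. 0 < e \<Longrightarrow> e < e0 \<Longrightarrow> L2dist2 lebesgue (conv g (mol e)) g < \<eta> / 16"
    using conv_mol_continuous_tendsto[of g "R + 1" "\<eta> / 16"] g(1,2) \<eta> by auto
  have gL: "L2 lebesgue g" by (rule L2_continuous_bounded_support[OF g(1,2)])
  have "bounded {x. g x \<noteq> 0}" using g(2) by (auto simp: bounded_iff not_less[symmetric] intro!: exI[of _ "R + 1"])
  then have gi: "integrable lebesgue g" by (rule L2_bounded_support_integrable[OF gL])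
  have wi: "integrable lebesgue w" by (rule L2_bounded_support_integrable[OF w bs])
  have "L2dist2 lebesgue (conv w (mol e)) w < \<eta>" if e: "0 < e" "e < e0" for e
  proof -
    have cw: "L2 lebesgue (conv w (mol e))" by (rule conv_mol_contraction(1)[OF w wi e(1)])
    have cg: "L2 lebesgue (conv g (mol e))" by (rule conv_mol_contraction(1)[OF gL gi e(1)])
    have "conv w (mol e) x - conv g (mol e) x = conv (\<lambda>x. w x - g x) (mol e) x" for x
      using integrable_conv[OF wi test_fun_mol[OF e(1)]] integrable_conv[OF gi test_fun_mol[OF e(1)]]
      by (simp add: conv_def left_diff_distrib)
    then have "L2dist2 lebesgue (conv w (mol e)) (conv g (mol e)) \<le> L2dist2 lebesgue w g"
      using conv_mol_contraction(2)[OF L2_diff[OF w gL] _ e(1)] wi gi by (simp add: L2dist2_def)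
    moreover have "L2dist2 lebesgue (conv w (mol e)) w
        \<le> 2 * L2dist2 lebesgue (conv w (mol e)) (conv g (mol e)) + 2 * L2dist2 lebesgue (conv g (mol e)) w"
      by (rule L2dist2_triangle[OF cw cg w])
    moreover have "L2dist2 lebesgue (conv g (mol e)) w
        \<le> 2 * L2dist2 lebesgue (conv g (mol e)) g + 2 * L2dist2 lebesgue g w"
      by (rule L2dist2_triangle[OF cg gL w])
    ultimately show ?thesis
      using g(3) e0(2)[OF e] L2dist2_nonneg[of lebesgue] L2dist2_commute[of lebesgue g w] \<eta> by linarith
  qed
  then show ?thesis using e0(1) by blast
qed

lemma conv_mol_seq:
  fixes w :: "real^'n::finite \<Rightarrow> real"
  assumes w: "L2 lebesgue w" and bs: "bounded {x. w x \<noteq> 0}" and e: "e > 0"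
  shows "(\<lambda>k. L2dist2 lebesgue (conv w (mol (e / Suc k))) w) \<longlonglongrightarrow> 0"
proof (rule LIMSEQ_I)
  fix \<eta> :: real assume "\<eta> > 0"
  then obtain e0 where e0: "e0 > 0" "\<And>e. 0 < e \<Longrightarrow> e < e0 \<Longrightarrow> L2dist2 lebesgue (conv w (mol e)) w < \<eta>"
    using conv_mol_tendsto[OF w bs] by meson
  obtain N :: nat where N: "e / e0 < real N" using reals_Archimedean2 by blast
  have "norm (L2dist2 lebesgue (conv w (mol (e / Suc k))) w - 0) < \<eta>" if "k \<ge> N" for k
  proof -
    have "e / e0 < real (Suc k)" using N that by linarith
    then have "e / Suc k < e0" using e0(1) by (simp add: field_simps)
    then show ?thesis using e0(2)[of "e / Suc k"] e by (simp add: abs_of_nonneg L2dist2_nonneg)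
  qed
  then show "\<exists>no. \<forall>k\<ge>no. norm (L2dist2 lebesgue (conv w (mol (e / Suc k))) w - 0) < \<eta>" by blast
qed

lemma conv_mol_support:
  fixes w :: "real^'n::finite \<Rightarrow> real" and e :: real
  assumes "0 < e" "e * CARD('n) \<le> d" "\<And>x. x \<notin> K \<Longrightarrow> w x = 0" "x \<notin> (\<Union>y\<in>K. cball y d)"
  shows "conv w (mol e) x = 0"
proof (rule conv_mol_eq_0[OF assms(1)])
  fix y assume "w y \<noteq> 0"
  then have "y \<in> K" using assms(3) by blast
  then have "x \<notin> cball y d" using assms(4) by blast
  then show "norm (x - y) > e * CARD('n)" using assms(2) by (simp add: dist_norm norm_minus_commute)
qed

text \<open>Mollify the indicator of the \<open>d/2\<close>-neighbourhood \<open>L\<close> of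
  \<open>K\<close> with a kernel that spreads by \<open>d/2\<close>: around a point of
  \<open>K\<close> the kernel sees the value 1 everywhere, and the support stays within distance
  \<open>d\<close> of \<open>K\<close>.\<close>

lemma ex_cutoff:
  fixes K S :: "(real^'n::finite) set"
  assumes K: "compact K" and S: "open S" "K \<subseteq> S"
  shows "\<exists>\<eta>. test_fun S \<eta> \<and> (\<forall>x\<in>K. \<eta> x = 1)"
proof -
  obtain d where d: "d > 0" "(\<Union>x\<in>K. cball x d) \<subseteq> S"
    using compact_subset_open_imp_cball_epsilon_subset[OF K S] by blast
  define L where "L = (\<Union>x\<in>K. cball x (d/2))"
  define w :: "real^'n \<Rightarrow> real" where "w = indicator L"
  have L: "compact L" unfolding L_def by (rule compact_minkowski_sum_cball[OF K])
  have wL: "L2 lebesgue w" unfolding w_def by (rule L2_indicator[OF lmeasurable_compact[OF L]])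
  have wi: "integrable lebesgue w" unfolding w_def
    by (rule lmeasurable_integrable_indicator[OF lmeasurable_compact[OF L]])
  define e where "e = d / 2 / CARD('n)"
  have e: "e > 0" "e * CARD('n) = d / 2" using d by (simp_all add: e_def)
  have sub: "(\<Union>y\<in>L. cball y (d/2)) \<subseteq> (\<Union>x\<in>K. cball x d)"
  proof
    fix z assume "z \<in> (\<Union>y\<in>L. cball y (d/2))"
    then obtain x y where "x \<in> K" "dist x y \<le> d/2" "dist y z \<le> d/2" by (auto simp: L_def)
    then have "dist x z \<le> d" using dist_triangle[of x z y] by linarith
    then show "z \<in> (\<Union>x\<in>K. cball x d)" using \<open>x \<in> K\<close> by auto
  qed
  have "test_fun S (conv w (mol e))"
  proof (rule test_funI)
    show "smooth_fun (conv w (mol e))" by (rule smooth_conv[OF wi test_fun_mol[OF e(1)]])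
    show "compact (\<Union>y\<in>L. cball y (d/2))" by (rule compact_minkowski_sum_cball[OF L])
    show "(\<Union>y\<in>L. cball y (d/2)) \<subseteq> S" using sub d(2) by blast
    show "conv w (mol e) x = 0" if "x \<notin> (\<Union>y\<in>L. cball y (d/2))" for x
      by (rule conv_mol_support[OF e(1) _ _ that]) (use e(2) in \<open>auto simp: w_def\<close>)
  qed
  moreover have "conv w (mol e) x = 1" if "x \<in> K" for x
  proof -
    have xL: "x \<in> L" using that d(1) by (force simp: L_def)
    have "\<bar>conv w (mol e) x - w x\<bar> \<le> 0"
    proof (rule conv_mol_uniform[OF wi e(1)])
      fix y assume "norm (x - y) \<le> e * CARD('n)"
      then have "y \<in> L" using that e(2) by (auto simp: L_def dist_norm)
      then show "\<bar>w y - w x\<bar> \<le> 0" using xL by (simp add: w_def)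
    qed
    then show ?thesis using xL by (simp add: w_def)
  qed
  ultimately show ?thesis by blast
qed

section \<open>Weak gradients\<close>

text \<open>Extension by zero, so that the results for \<open>L2 lebesgue\<close> on the whole space
  apply to functions whose values outside \<open>S\<close> are arbitrary.\<close>

definition L2on :: "'a::euclidean_space set \<Rightarrow> ('a \<Rightarrow> real) \<Rightarrow> bool" where
  "L2on S f \<longleftrightarrow> L2 lebesgue (\<lambda>x. indicator S x * f x)"

lemma indicator_mult_square: "(indicator S x * (f x :: real))\<^sup>2 = indicator S x * (f x)\<^sup>2"
  by (simp add: indicator_def)

lemma L2on_iff:
  "L2on S f \<longleftrightarrow> set_borel_measurable lebesgue S f \<and> set_integrable lebesgue S (\<lambda>x. (f x)\<^sup>2)"
  by (simp add: L2on_def L2_def set_borel_measurable_def set_integrable_def indicator_mult_square)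

lemma is_weak_grad_L2on: "is_weak_grad S u g \<Longrightarrow> L2on S (\<lambda>x. g x $ i)"
  by (simp add: is_weak_grad_def L2on_iff)

lemma L2on_add: "L2on S f \<Longrightarrow> L2on S g \<Longrightarrow> L2on S (\<lambda>x. f x + g x)"
  unfolding L2on_def distrib_left by (rule L2_add)

lemma L2on_diff: "L2on S f \<Longrightarrow> L2on S g \<Longrightarrow> L2on S (\<lambda>x. f x - g x)"
  unfolding L2on_def right_diff_distrib by (rule L2_diff)

lemma L2on_cmult: "L2on S f \<Longrightarrow> L2on S (\<lambda>x. r * f x)"
  unfolding L2on_def mult.left_commute[of "indicator S _"] by (rule L2_cmult)

lemma L2on_subset:
  assumes "L2on S f" "T \<subseteq> S" "T \<in> sets lebesgue" shows "L2on T f"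
proof -
  have "L2 lebesgue (\<lambda>x. indicator T x * (indicator S x * f x))"
    by (rule L2_AE_bounded_mult[where B=1])
      (use assms in \<open>auto simp: L2on_def indicator_def intro!: borel_measurable_indicator\<close>)
  moreover have "(\<lambda>x. indicator T x * (indicator S x * f x)) = (\<lambda>x. indicator T x * f x)"
    using assms(2) by (auto simp: indicator_def fun_eq_iff)
  ultimately show ?thesis by (simp add: L2on_def)
qed

lemma L2on_bounded:
  assumes "S \<in> lmeasurable" "f \<in> borel_measurable lebesgue" "\<And>x. x \<in> S \<Longrightarrow> \<bar>f x\<bar> \<le> B"
  shows "L2on S f"
proof -
  have "L2 lebesgue (\<lambda>x. (indicator S x * f x) * indicator S x)"
  proof (rule L2_AE_bounded_mult[OF L2_indicator[OF assms(1)]])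
    show "(\<lambda>x. indicator S x * f x) \<in> borel_measurable lebesgue"
      using assms(1,2) by (intro borel_measurable_times borel_measurable_indicator) (auto simp: fmeasurableD)
    show "AE x in lebesgue. \<bar>indicator S x * f x\<bar> \<le> max 0 B"
      using assms(3) by (intro AE_I2) (auto simp: indicator_def le_max_iff_disj)
  qed
  moreover have "(\<lambda>x. (indicator S x * f x) * indicator S x) = (\<lambda>x. indicator S x * f x)"
    by (auto simp: indicator_def fun_eq_iff)
  ultimately show ?thesis by (simp add: L2on_def)
qed

lemma test_fun_outside: "test_fun S \<phi> \<Longrightarrow> x \<notin> S \<Longrightarrow> \<phi> x = 0"
  using test_fun_support[of S \<phi>] by blast

lemma test_fun_indicator: "test_fun S \<phi> \<Longrightarrow> indicator S x * \<phi> x = \<phi> x"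
  using test_fun_outside[of S \<phi> x] by (cases "x \<in> S") auto

lemma L2on_mult_test:
  assumes u: "L2on S u" and \<phi>: "test_fun S \<phi>"
  shows "L2 lebesgue (\<lambda>x. u x * \<phi> x)" "bounded {x. u x * \<phi> x \<noteq> 0}" "integrable lebesgue (\<lambda>x. u x * \<phi> x)"
proof -
  obtain B where B: "\<And>x. \<bar>\<phi> x\<bar> \<le> B" using test_fun_bounded[OF \<phi>] by blast
  have "L2 lebesgue (\<lambda>x. \<phi> x * (indicator S x * u x))"
    by (rule L2_AE_bounded_mult[OF u[unfolded L2on_def] test_fun_lebesgue[OF \<phi>] AE_I2[OF B]])
  moreover have eq: "(\<lambda>x. \<phi> x * (indicator S x * u x)) = (\<lambda>x. u x * \<phi> x)"
    using test_fun_indicator[OF \<phi>] by (auto simp: fun_eq_iff mult_ac)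
  ultimately show 1: "L2 lebesgue (\<lambda>x. u x * \<phi> x)" by simp
  obtain K where "compact K" "\<And>x. x \<notin> K \<Longrightarrow> \<phi> x = 0" using test_fun_support[OF \<phi>] by blast
  then show 2: "bounded {x. u x * \<phi> x \<noteq> 0}"
    by (auto intro: bounded_subset[OF compact_imp_bounded])
  show "integrable lebesgue (\<lambda>x. u x * \<phi> x)" by (rule L2_bounded_support_integrable[OF 1 2])
qed

lemma set_integral_test:
  assumes "test_fun S \<phi>"
  shows "(LINT x:S|lebesgue. u x * \<phi> x) = (\<integral>x. u x * \<phi> x \<partial>lebesgue)"
proof -
  have "indicator S x *\<^sub>R (u x * \<phi> x) = u x * \<phi> x" for x
    using test_fun_indicator[OF assms, of x] by (simp add: mult.left_commute)
  then show ?thesis by (simp only: set_lebesgue_integral_def)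
qed

lemma is_weak_grad_integral:
  assumes "is_weak_grad S u g" "test_fun S \<phi>"
  shows "(\<integral>x. u x * partial i \<phi> x \<partial>lebesgue) = - (\<integral>x. g x $ i * \<phi> x \<partial>lebesgue)"
  using assms by (simp add: is_weak_grad_def set_integral_test[OF test_fun_partial] set_integral_test)

lemma is_weak_gradI:
  assumes "\<And>i. L2on S (\<lambda>x. g x $ i)"
    "\<And>\<phi> i. test_fun S \<phi> \<Longrightarrow> (\<integral>x. u x * partial i \<phi> x \<partial>lebesgue) = - (\<integral>x. g x $ i * \<phi> x \<partial>lebesgue)"
  shows "is_weak_grad S u g"
  using assms by (simp add: is_weak_grad_def set_integral_test[OF test_fun_partial] set_integral_test L2on_iff)

text \<open>Cover \<open>S\<close> by countably many closed boxes and cut \<open>h\<close> off by an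
  \<open>\<eta>\<close> equal to 1 on one of them. The mollification of \<open>h * \<eta>\<close> at
  \<open>x\<close> is the integral of \<open>h\<close> against the test function
  \<open>\<eta> y * mol e (x - y)\<close>, hence 0, while it converges in L2 to
  \<open>h * \<eta>\<close>.\<close>

lemma fundamental_lemma:
  fixes S :: "(real^'n::finite) set"
  assumes S: "open S" and h: "L2on S h"
    and zero: "\<And>\<phi>. test_fun S \<phi> \<Longrightarrow> (\<integral>x. h x * \<phi> x \<partial>lebesgue) = 0"
  shows "AE x in lebesgue. x \<in> S \<longrightarrow> h x = 0"
proof -
  obtain D where D: "countable D" "D \<subseteq> Pow S" "\<And>X. X \<in> D \<Longrightarrow> \<exists>a b. X = cbox a b" "\<Union>D = S"
    using open_countable_Union_open_cbox[OF S] by metis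
  have "AE x in lebesgue. x \<in> X \<longrightarrow> h x = 0" if "X \<in> D" for X
  proof -
    have cX: "compact X" using D(3)[OF that] compact_cbox by blast
    have XS: "X \<subseteq> S" using D(2) that by blast
    obtain \<eta> where \<eta>: "test_fun S \<eta>" "\<forall>x\<in>X. \<eta> x = 1"
      using ex_cutoff[OF cX S XS] by blast
    note w = L2on_mult_test[OF h \<eta>(1)]
    let ?w = "\<lambda>x. h x * \<eta> x"
    have "conv ?w (mol (1 / Suc k)) x = 0" for k x
    proof -
      have "test_fun S (\<lambda>y. \<eta> y * mol (1 / Suc k) (x - y))"
        by (intro test_fun_mult \<eta> test_fun_smooth[OF test_fun_reflect] test_fun_mol) simp
      then show ?thesis using zero by (simp add: conv_def mult.assoc)
    qed
    then have "(\<lambda>k::nat. \<integral>x. (?w x)\<^sup>2 \<partial>lebesgue) \<longlonglongrightarrow> 0"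
      using conv_mol_seq[OF w(1,2), of 1] by (simp add: L2dist2_def)
    then have "(\<integral>x. (?w x)\<^sup>2 \<partial>lebesgue) = 0" by (simp add: LIMSEQ_const_iff)
    moreover have "(\<integral>x. (?w x)\<^sup>2 \<partial>lebesgue) = 0 \<longleftrightarrow> (AE x in lebesgue. (?w x)\<^sup>2 = 0)"
      by (rule integral_nonneg_eq_0_iff_AE[OF L2_integrable_square[OF w(1)]]) simp
    ultimately have "AE x in lebesgue. (?w x)\<^sup>2 = 0" by blast
    then show ?thesis by eventually_elim (use \<eta>(2) in auto)
  qed
  then have "AE x in lebesgue. \<forall>X\<in>D. x \<in> X \<longrightarrow> h x = 0"
    by (intro AE_ball_countable[OF D(1), THEN iffD2] ballI)
  then show ?thesis by eventually_elim (use D(4) in blast)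
qed

text \<open>The difference of the two fields is orthogonal to all test functions. This makes the
  energy independent of the choice operator in \<open>wgrad\<close>.\<close>

lemma weak_grad_unique:
  fixes S :: "(real^'n::finite) set"
  assumes S: "open S" and g: "is_weak_grad S u g" "is_weak_grad S u' g'"
    and u: "AE x in lebesgue. x \<in> S \<longrightarrow> u x = u' x" "L2on S u" "L2on S u'"
  shows "AE x in lebesgue. x \<in> S \<longrightarrow> g x = g' x"
proof -
  have "AE x in lebesgue. x \<in> S \<longrightarrow> g x $ i - g' x $ i = 0" for i
  proof (rule fundamental_lemma[OF S])
    note L = is_weak_grad_L2on[OF g(1), of i] is_weak_grad_L2on[OF g(2), of i]
    show "L2on S (\<lambda>x. g x $ i - g' x $ i)" by (intro L2on_diff L)
    fix \<phi> assume \<phi>: "test_fun S \<phi>"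
    have "(\<integral>x. u x * partial i \<phi> x \<partial>lebesgue) = (\<integral>x. u' x * partial i \<phi> x \<partial>lebesgue)"
    proof (rule integral_cong_AE)
      show "AE x in lebesgue. u x * partial i \<phi> x = u' x * partial i \<phi> x"
        using u(1) by eventually_elim (use test_fun_outside[OF test_fun_partial[OF \<phi>]] in auto)
    qed (use L2on_mult_test(1)[OF _ test_fun_partial[OF \<phi>]] u in \<open>auto simp: L2_def\<close>)
    then have "(\<integral>x. g x $ i * \<phi> x \<partial>lebesgue) = (\<integral>x. g' x $ i * \<phi> x \<partial>lebesgue)"
      using is_weak_grad_integral[OF g(1) \<phi>, of i] is_weak_grad_integral[OF g(2) \<phi>, of i] by simp
    then show "(\<integral>x. (g x $ i - g' x $ i) * \<phi> x \<partial>lebesgue) = 0"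
      using L2on_mult_test(3)[OF L(1) \<phi>] L2on_mult_test(3)[OF L(2) \<phi>] by (simp add: left_diff_distrib)
  qed
  then have "AE x in lebesgue. \<forall>i. x \<in> S \<longrightarrow> g x $ i - g' x $ i = 0"
    by (intro AE_all_countable[THEN iffD2] allI)
  then show ?thesis by eventually_elim (simp add: vec_eq_iff)
qed

text \<open>Differentiate the convolution of a test function with the indicator of a large ball, which is constant
  near the origin.\<close>

lemma integral_partial_test_fun:
  fixes \<phi> :: "real^'n::finite \<Rightarrow> real"
  assumes \<phi>: "test_fun UNIV \<phi>"
  shows "(\<integral>x. partial i \<phi> x \<partial>lebesgue) = 0"
proof -
  obtain K where K: "compact K" "\<And>x. x \<notin> K \<Longrightarrow> \<phi> x = 0" using test_fun_support[OF \<phi>] by blast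
  obtain R where "\<And>x. x \<in> K \<Longrightarrow> norm x \<le> R" using compact_imp_bounded[OF K(1)] by (auto simp: bounded_iff)
  then have R: "\<phi> x = 0" if "norm x > R" for x using K(2)[of x] that by force
  define w :: "real^'n \<Rightarrow> real" where "w = indicator (cball 0 (R + 1))"
  have wi: "integrable lebesgue w" unfolding w_def by (rule lmeasurable_integrable_indicator[OF lmeasurable_cball])
  have refl: "(\<integral>y. f (x - y) \<partial>lebesgue) = (\<integral>y. f y \<partial>lebesgue)" if "test_fun UNIV f" for f :: "real^'n \<Rightarrow> real" and x
  proof -
    have [measurable]: "f \<in> borel_measurable borel" by (rule test_fun_borel[OF that])
    have "(\<integral>y. f (x - y) \<partial>lebesgue) = (\<integral>y. f (x - y) \<partial>lborel)" by (rule integral_completion) measurable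
    also have "\<dots> = (\<integral>y. f y \<partial>distr lborel borel (\<lambda>y. x - y))" by (rule integral_distr[symmetric]) measurable
    also have "\<dots> = (\<integral>y. f y \<partial>lebesgue)" by (simp add: lborel_distr_reflect integral_completion)
    finally show ?thesis .
  qed
  have wmul: "w y * f (x - y) = f (x - y)" if "\<And>z. norm z > R \<Longrightarrow> f z = 0" "norm x < 1" for f :: "real^'n \<Rightarrow> real" and x y
  proof (cases "norm y \<le> R + 1")
    case False
    have "norm y \<le> norm x + norm (x - y)" using norm_triangle_ineq4[of x "x - y"] by simp
    then show ?thesis using False that(1)[of "x - y"] that(2) by simp
  qed (simp add: w_def)
  have const: "conv w \<phi> x = (\<integral>y. \<phi> y \<partial>lebesgue)" if "norm x < 1" for x
  proof -
    have "w y * \<phi> (x - y) = \<phi> (x - y)" for y by (rule wmul[OF R that])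
    then show ?thesis by (simp only: conv_def refl[OF \<phi>])
  qed
  have "(conv w \<phi> has_derivative (\<lambda>h. 0)) (at 0)"
    by (rule has_derivative_transform_within_open[of "\<lambda>x. \<integral>y. \<phi> y \<partial>lebesgue" _ 0 UNIV "ball 0 1"]) (use const in auto)
  then have "partial i (conv w \<phi>) 0 = 0" by (rule has_derivative_imp_partial)
  then have "conv w (partial i \<phi>) 0 = 0" by (simp add: partial_conv[OF wi \<phi>])
  moreover have "partial i \<phi> z = 0" if "norm z > R" for z
    by (rule partial_eq_0_outside[of "cball 0 R"]) (use R that in auto)
  then have "w y * partial i \<phi> (0 - y) = partial i \<phi> (0 - y)" for y by (intro wmul) auto
  then have "conv w (partial i \<phi>) 0 = (\<integral>y. partial i \<phi> y \<partial>lebesgue)"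
    by (simp only: conv_def refl[OF test_fun_partial[OF \<phi>]])
  ultimately show ?thesis by simp
qed

lemma integration_by_parts_smooth:
  fixes \<phi> :: "real^'n::finite \<Rightarrow> real"
  assumes f: "smooth_fun f" and \<phi>: "test_fun S \<phi>"
  shows "(\<integral>x. f x * partial i \<phi> x \<partial>lebesgue) = - (\<integral>x. partial i f x * \<phi> x \<partial>lebesgue)"
proof -
  have T: "test_fun UNIV (\<lambda>x. \<phi> x * f x)"
    using test_fun_mult[OF \<phi> f] test_fun_subset by blast
  have eq: "partial i (\<lambda>x. \<phi> x * f x) x = f x * partial i \<phi> x + partial i f x * \<phi> x" for x
    using partial_mult[OF smooth_fun_differentiable[OF test_fun_smooth[OF \<phi>]] smooth_fun_differentiable[OF f]]
    by (simp add: mult.commute add.commute)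
  have "(\<integral>x. partial i (\<lambda>x. \<phi> x * f x) x \<partial>lebesgue) = 0" by (rule integral_partial_test_fun[OF T])
  moreover have "integrable lebesgue (\<lambda>x. f x * partial i \<phi> x)"
    using test_fun_integrable[OF test_fun_mult[OF test_fun_partial[OF \<phi>] f]] by (simp add: mult.commute)
  moreover have "integrable lebesgue (\<lambda>x. partial i f x * \<phi> x)"
    using test_fun_integrable[OF test_fun_mult[OF \<phi> smooth_fun_partial[OF f]]] by (simp add: mult.commute)
  ultimately show ?thesis unfolding eq by simp
qed

lemma partial_reflect:
  assumes "smooth_fun f" shows "partial i (\<lambda>y. f (x - y)) y = - partial i f (x - y)"
  using differentiable_affine(2)[of f x "-1" y i] smooth_fun_differentiable[OF assms] by simp

text \<open>Mollify \<open>u * \<eta>\<close>. The derivative falls on the kernel; testing the weak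
  gradient with \<open>\<eta> y * mol e (x - y)\<close> moves it back and shows that the gradient of
  the mollification is the mollification of the product-rule gradient. The scales \<open>e k\<close>
  are small enough for all supports to stay in one compact subset of \<open>S\<close>.\<close>

lemma smooth_approximation_cutoff:
  fixes S :: "(real^'n::finite) set"
  assumes S: "open S" and u: "L2on S u" and g: "is_weak_grad S u g" and \<eta>: "test_fun S \<eta>"
  shows "\<exists>W. (\<forall>k::nat. test_fun S (W k)) \<and>
    (\<lambda>k. L2dist2 lebesgue (W k) (\<lambda>x. u x * \<eta> x)) \<longlonglongrightarrow> 0 \<and>
    (\<forall>i. (\<lambda>k. L2dist2 lebesgue (partial i (W k)) (\<lambda>x. g x $ i * \<eta> x + u x * partial i \<eta> x)) \<longlonglongrightarrow> 0)"
proof -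
  obtain K where K: "compact K" "K \<subseteq> S" "\<And>x. x \<notin> K \<Longrightarrow> \<eta> x = 0"
    using test_fun_support[OF \<eta>] by blast
  obtain d where d: "d > 0" "(\<Union>x\<in>K. cball x d) \<subseteq> S"
    using compact_subset_open_imp_cball_epsilon_subset[OF K(1) S K(2)] by blast
  define e where "e k = d / CARD('n) / Suc k" for k
  have e: "e k > 0" "e k * CARD('n) \<le> d" for k
  proof -
    show "e k > 0" using d(1) unfolding e_def by (intro divide_pos_pos) auto
    have "e k * CARD('n) = d / Suc k" by (simp add: e_def)
    also have "\<dots> \<le> d" using d(1) by (simp add: divide_le_eq)
    finally show "e k * CARD('n) \<le> d" .
  qed
  let ?w = "\<lambda>x. u x * \<eta> x"
  let ?G = "\<lambda>i x. g x $ i * \<eta> x + u x * partial i \<eta> x"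
  note w = L2on_mult_test[OF u \<eta>]
  note gL = is_weak_grad_L2on[OF g]
  note t1 = L2on_mult_test[OF gL \<eta>] and t2 = L2on_mult_test[OF u test_fun_partial[OF \<eta>]]
  have GL: "L2 lebesgue (?G i)" for i by (intro L2_add t1 t2)
  have Gb: "bounded {x. ?G i x \<noteq> 0}" for i
    by (rule bounded_subset[OF bounded_Un[THEN iffD2, OF conjI[OF t1(2)[of i] t2(2)[of i]]]]) auto
  define W where "W k = conv ?w (mol (e k))" for k
  have "test_fun S (W k)" for k
  proof (rule test_funI)
    show "smooth_fun (W k)" unfolding W_def by (rule smooth_conv[OF w(3) test_fun_mol[OF e(1)]])
    show "compact (\<Union>y\<in>K. cball y d)" by (rule compact_minkowski_sum_cball[OF K(1)])
    show "W k x = 0" if "x \<notin> (\<Union>y\<in>K. cball y d)" for x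
      unfolding W_def by (rule conv_mol_support[OF e _ that]) (use K(3) in auto)
  qed (rule d(2))
  moreover have "(\<lambda>k. L2dist2 lebesgue (W k) ?w) \<longlonglongrightarrow> 0"
    unfolding W_def e_def by (rule conv_mol_seq[OF w(1,2)]) (use d in simp)
  moreover have "(\<lambda>k. L2dist2 lebesgue (partial i (W k)) (?G i)) \<longlonglongrightarrow> 0" for i
  proof -
    have "partial i (W k) = conv (?G i) (mol (e k))" for k
    proof
      fix x :: "real^'n"
      let ?\<rho> = "\<lambda>y. mol (e k) (x - y)"
      note tm = test_fun_mol[OF e(1)[of k]]
      have sm: "smooth_fun ?\<rho>" by (rule test_fun_smooth[OF test_fun_reflect[OF tm]])
      have T: "test_fun S (\<lambda>y. \<eta> y * ?\<rho> y)" by (rule test_fun_mult[OF \<eta> sm])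
      have P: "partial i (\<lambda>y. \<eta> y * ?\<rho> y) y = partial i \<eta> y * ?\<rho> y - \<eta> y * partial i (mol (e k)) (x - y)" for y
      proof -
        have "partial i ?\<rho> y = - partial i (mol (e k)) (x - y)"
          by (rule partial_reflect[OF test_fun_smooth[OF tm]])
        moreover have "partial i (\<lambda>y. \<eta> y * ?\<rho> y) y = partial i \<eta> y * ?\<rho> y + \<eta> y * partial i ?\<rho> y"
          by (rule partial_mult[OF smooth_fun_differentiable[OF test_fun_smooth[OF \<eta>]] smooth_fun_differentiable[OF sm]])
        ultimately show ?thesis by (simp only: mult_minus_right diff_conv_add_uminus)
      qed
      have i1: "integrable lebesgue (\<lambda>y. u y * (partial i \<eta> y * ?\<rho> y))"
        using integrable_conv[OF t2(3) tm] by (simp add: mult.assoc)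
      have i2: "integrable lebesgue (\<lambda>y. u y * (\<eta> y * partial i (mol (e k)) (x - y)))"
        using integrable_conv[OF w(3) test_fun_partial[OF tm]] by (simp add: mult.assoc)
      have i3: "integrable lebesgue (\<lambda>y. g y $ i * (\<eta> y * ?\<rho> y))"
        using integrable_conv[OF t1(3) tm] by (simp add: mult.assoc)
      have "(\<integral>y. u y * (partial i \<eta> y * ?\<rho> y) \<partial>lebesgue) - (\<integral>y. u y * (\<eta> y * partial i (mol (e k)) (x - y)) \<partial>lebesgue)
          = - (\<integral>y. g y $ i * (\<eta> y * ?\<rho> y) \<partial>lebesgue)"
        using is_weak_grad_integral[OF g T, of i] i1 i2 unfolding P by (simp add: right_diff_distrib)
      then have "conv ?w (partial i (mol (e k))) x = conv (?G i) (mol (e k)) x"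
        using i1 i3 by (simp add: conv_def distrib_right mult.assoc)
      then show "partial i (W k) x = conv (?G i) (mol (e k)) x"
        by (simp add: W_def partial_conv[OF w(3) tm])
    qed
    then show ?thesis unfolding e_def using conv_mol_seq[OF GL Gb, of "d / CARD('n)"] d(1) by simp
  qed
  ultimately show ?thesis by blast
qed

section \<open>Poincare inequality\<close>

lemma nn_integral_lborel_affine:
  fixes f :: "'a::euclidean_space \<Rightarrow> ennreal"
  assumes [measurable]: "f \<in> borel_measurable borel" and c: "c \<noteq> 0"
  shows "(\<integral>\<^sup>+x. f x \<partial>lborel) = ennreal (\<bar>c\<bar> ^ DIM('a)) * (\<integral>\<^sup>+x. f (t + c *\<^sub>R x) \<partial>lborel)"
  by (subst lborel_affine[OF c, of t])
     (simp add: nn_integral_density nn_integral_distr nn_integral_cmult)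

text \<open>Fundamental theorem of calculus along the segment, Cauchy-Schwarz on
  \<open>[0,1]\<close>, and Cauchy-Schwarz for the directional derivative. The nonnegative integral
  is chosen with a view to exchanging it with those over \<open>x\<close> and
  \<open>y\<close>.\<close>

lemma segment_square_bound:
  fixes \<phi> :: "real^'n::finite \<Rightarrow> real"
  assumes \<phi>: "smooth_fun \<phi>" and D: "norm (y - x) \<le> D"
  shows "ennreal ((\<phi> y - \<phi> x)\<^sup>2)
    \<le> (\<integral>\<^sup>+t. indicator {0..1} t * ennreal (D\<^sup>2 * (\<Sum>i\<in>UNIV. (partial i \<phi> (x + t *\<^sub>R (y - x)))\<^sup>2)) \<partial>lborel)"
proof -
  define f' where "f' t = (\<Sum>i\<in>UNIV. (y - x) $ i * partial i \<phi> (x + t *\<^sub>R (y - x)))" for t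
  define G where "G t = (\<Sum>i\<in>UNIV. (partial i \<phi> (x + t *\<^sub>R (y - x)))\<^sup>2)" for t
  have pc: "continuous_on T (\<lambda>t. partial i \<phi> (x + t *\<^sub>R (y - x)))" for T i
    by (rule continuous_on_compose2[OF smooth_continuous[OF smooth_fun_partial[OF \<phi>]]])
      (auto intro!: continuous_intros)
  have f'c: "continuous_on {0..1} f'" unfolding f'_def by (intro continuous_intros pc)
  have Gc: "continuous_on {0..1} G" unfolding G_def by (intro continuous_intros pc)
  have der: "((\<lambda>t. \<phi> (x + t *\<^sub>R (y - x))) has_vector_derivative f' t) (at t within {0..1})" for t
  proof -
    have 1: "((\<lambda>t. x + t *\<^sub>R (y - x)) has_derivative (\<lambda>h. h *\<^sub>R (y - x))) (at t)"
      by (auto intro!: derivative_eq_intros)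
    have 2: "(\<phi> has_derivative (\<lambda>h. \<Sum>i\<in>UNIV. h $ i * partial i \<phi> (x + t *\<^sub>R (y - x)))) (at (x + t *\<^sub>R (y - x)))"
      by (rule differentiable_has_derivative_partial[OF smooth_fun_differentiable[OF \<phi>]])
    have "((\<lambda>t. \<phi> (x + t *\<^sub>R (y - x))) has_derivative (\<lambda>h. h *\<^sub>R f' t)) (at t)"
      using diff_chain_at[OF 1 2] by (simp add: o_def f'_def sum_distrib_left mult.assoc)
    then show ?thesis by (simp add: has_vector_derivative_def has_derivative_at_withinI)
  qed
  have FTC: "(\<integral>t. indicator {0..1} t * f' t \<partial>lborel) = \<phi> y - \<phi> x"
    using integral_FTC_Icc[of 0 1 "\<lambda>t. \<phi> (x + t *\<^sub>R (y - x))" f', OF _ der f'c] by simp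
  have i_sq: "integrable lborel (\<lambda>t. indicator {0..1} t * (f' t)\<^sup>2)"
    using borel_integrable_compact[of "{0..1}" "\<lambda>t. (f' t)\<^sup>2"] f'c
    by (auto simp: set_integrable_def indicator_def if_distrib cong: if_cong intro!: continuous_intros)
  have i_G: "integrable lborel (\<lambda>t. indicator {0..1} t * G t)"
    using borel_integrable_compact[of "{0..1}" G] Gc
    by (auto simp: set_integrable_def indicator_def if_distrib cong: if_cong intro!: continuous_intros)
  have "f' \<in> borel_measurable borel"
    unfolding f'_def by (intro borel_measurable_continuous_onI continuous_intros pc)
  then have L1: "L2 lborel (\<lambda>t. indicator {0..1} t * f' t)"
    using i_sq by (simp add: L2_def indicator_mult_square)
  have L2: "L2 lborel (indicator {0..1::real} :: real \<Rightarrow> real)"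
  proof -
    have "(\<lambda>x. (indicator {0..1::real} x :: real)\<^sup>2) = indicator {0..1}" by (auto simp: indicator_def)
    then show ?thesis by (simp add: L2_def)
  qed
  have "(\<phi> y - \<phi> x)\<^sup>2 \<le> (\<integral>t. indicator {0..1} t * (f' t)\<^sup>2 \<partial>lborel)"
  proof -
    have "(\<integral>t. (indicator {0..1} t * f' t) * indicator {0..1} t \<partial>lborel)\<^sup>2
       \<le> (\<integral>t. (indicator {0..1} t * f' t)\<^sup>2 \<partial>lborel) * (\<integral>t. (indicator {0..1::real} t)\<^sup>2 \<partial>lborel)"
      by (rule L2_Cauchy_Schwarz[OF L1 L2])
    moreover have "(indicator {0..1} t * f' t) * indicator {0..1} t = indicator {0..1} t * f' t" for t
      by (simp add: indicator_def)
    moreover have "(indicator {0..1::real} t)\<^sup>2 = (indicator {0..1} t :: real)" for t by (simp add: indicator_def)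
    ultimately show ?thesis using FTC by (simp add: indicator_mult_square)
  qed
  also have "\<dots> \<le> (\<integral>t. D\<^sup>2 * (indicator {0..1} t * G t) \<partial>lborel)"
  proof (rule integral_mono[OF i_sq])
    show "integrable lborel (\<lambda>t. D\<^sup>2 * (indicator {0..1} t * G t))" using i_G by simp
    fix t
    have G: "G t = (norm (\<chi> i. partial i \<phi> (x + t *\<^sub>R (y - x))))\<^sup>2"
      by (simp add: G_def norm_vec_def L2_set_def sum_nonneg)
    have "f' t = (y - x) \<bullet> (\<chi> i. partial i \<phi> (x + t *\<^sub>R (y - x)))" by (simp add: f'_def inner_vec_def)
    then have "\<bar>f' t\<bar> \<le> norm (y - x) * norm (\<chi> i. partial i \<phi> (x + t *\<^sub>R (y - x)))"
      using Cauchy_Schwarz_ineq2 by simp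
    also have "\<dots> \<le> D * norm (\<chi> i. partial i \<phi> (x + t *\<^sub>R (y - x)))"
      using D by (rule mult_right_mono) simp
    finally have "(f' t)\<^sup>2 \<le> (D * norm (\<chi> i. partial i \<phi> (x + t *\<^sub>R (y - x))))\<^sup>2"
      by (metis abs_ge_zero abs_of_nonneg abs_le_square_iff order_trans)
    then have "(f' t)\<^sup>2 \<le> D\<^sup>2 * G t" by (simp only: G power_mult_distrib)
    then show "indicator {0..1} t * (f' t)\<^sup>2 \<le> D\<^sup>2 * (indicator {0..1} t * G t)"
      by (simp add: indicator_def)
  qed
  finally have "ennreal ((\<phi> y - \<phi> x)\<^sup>2) \<le> ennreal (\<integral>t. D\<^sup>2 * (indicator {0..1} t * G t) \<partial>lborel)"
    by (rule ennreal_leI)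
  also have "\<dots> = (\<integral>\<^sup>+t. ennreal (D\<^sup>2 * (indicator {0..1} t * G t)) \<partial>lborel)"
    by (rule nn_integral_eq_integral[symmetric]) (use i_G in \<open>auto simp: G_def sum_nonneg\<close>)
  also have "\<dots> = (\<integral>\<^sup>+t. indicator {0..1} t * ennreal (D\<^sup>2 * G t) \<partial>lborel)"
    by (rule nn_integral_cong) (simp add: indicator_def)
  finally show ?thesis by (simp add: G_def)
qed

text \<open>Substitute \<open>z = x + t (y - x)\<close>: convexity keeps \<open>z\<close> in
  \<open>Q\<close>, and the Jacobian factor is at most \<open>2 ^ CARD('n)\<close> because
  \<open>t \<ge> 1/2\<close>.\<close>

lemma convex_average_bound:
  fixes G :: "real^'n::finite \<Rightarrow> ennreal"
  assumes [measurable]: "G \<in> borel_measurable borel" and Q [measurable]: "Q \<in> sets borel" and "convex Q"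
    and x: "x \<in> Q" and t: "1/2 \<le> t" "t \<le> 1"
  shows "(\<integral>\<^sup>+y. indicator Q y * G (x + t *\<^sub>R (y - x)) \<partial>lborel) \<le> 2 ^ CARD('n) * (\<integral>\<^sup>+z. indicator Q z * G z \<partial>lborel)"
proof -
  have pt: "(1 - t) *\<^sub>R x + t *\<^sub>R y = x + t *\<^sub>R (y - x)" for y
    by (simp add: algebra_simps)
  have "(\<integral>\<^sup>+y. indicator Q y * G (x + t *\<^sub>R (y - x)) \<partial>lborel)
      \<le> (\<integral>\<^sup>+y. indicator Q ((1 - t) *\<^sub>R x + t *\<^sub>R y) * G ((1 - t) *\<^sub>R x + t *\<^sub>R y) \<partial>lborel)"
  proof (rule nn_integral_mono)
    fix y
    have "(1 - t) *\<^sub>R x + t *\<^sub>R y \<in> Q" if "y \<in> Q"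
      using convexD[OF \<open>convex Q\<close> x that, of "1 - t" t] t by simp
    then show "indicator Q y * G (x + t *\<^sub>R (y - x))
        \<le> indicator Q ((1 - t) *\<^sub>R x + t *\<^sub>R y) * G ((1 - t) *\<^sub>R x + t *\<^sub>R y)"
      unfolding pt by (auto simp: indicator_def)
  qed
  also have "\<dots> \<le> 2 ^ CARD('n) * (ennreal (\<bar>t\<bar> ^ DIM(real^'n)) *
      (\<integral>\<^sup>+y. indicator Q ((1 - t) *\<^sub>R x + t *\<^sub>R y) * G ((1 - t) *\<^sub>R x + t *\<^sub>R y) \<partial>lborel))"
  proof -
    have "1 \<le> (2 * t) ^ CARD('n)" using t by (intro one_le_power) auto
    then have "(1::ennreal) \<le> ennreal ((2 * t) ^ CARD('n))" using ennreal_leI by fastforce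
    also have "\<dots> = 2 ^ CARD('n) * ennreal (\<bar>t\<bar> ^ DIM(real^'n))"
    proof -
      have "ennreal ((2 * t) ^ CARD('n)) = ennreal (2 ^ CARD('n)) * ennreal (t ^ CARD('n))"
        using t by (simp add: power_mult_distrib ennreal_mult)
      then show ?thesis using t by (simp add: ennreal_power[symmetric])
    qed
    finally have 1: "(1::ennreal) \<le> 2 ^ CARD('n) * ennreal (\<bar>t\<bar> ^ DIM(real^'n))" .
    show ?thesis using mult_right_mono[OF 1] by (simp add: mult.assoc)
  qed
  also have "ennreal (\<bar>t\<bar> ^ DIM(real^'n)) *
      (\<integral>\<^sup>+y. indicator Q ((1 - t) *\<^sub>R x + t *\<^sub>R y) * G ((1 - t) *\<^sub>R x + t *\<^sub>R y) \<partial>lborel)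
      = (\<integral>\<^sup>+z. indicator Q z * G z \<partial>lborel)"
    by (rule nn_integral_lborel_affine[symmetric, of "\<lambda>z. indicator Q z * G z"]) (use t in auto)
  finally show ?thesis .
qed

text \<open>For \<open>t < 1/2\<close> the Jacobian bound fails, but the point on the segment is the
  one at parameter \<open>1 - t\<close> seen from \<open>y\<close>; exchanging the order of
  integration reduces to the other half.\<close>

lemma convex_double_average_bound:
  fixes G :: "real^'n::finite \<Rightarrow> ennreal"
  assumes [measurable]: "G \<in> borel_measurable borel" and Q [measurable]: "Q \<in> sets borel" and "convex Q"
    and t: "0 \<le> t" "t \<le> 1"
  shows "(\<integral>\<^sup>+x. indicator Q x * (\<integral>\<^sup>+y. indicator Q y * G (x + t *\<^sub>R (y - x)) \<partial>lborel) \<partial>lborel)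
    \<le> emeasure lborel Q * (2 ^ CARD('n) * (\<integral>\<^sup>+z. indicator Q z * G z \<partial>lborel))"
proof -
  have *: "(\<integral>\<^sup>+x. indicator Q x * (\<integral>\<^sup>+y. indicator Q y * G (x + t *\<^sub>R (y - x)) \<partial>lborel) \<partial>lborel)
    \<le> emeasure lborel Q * (2 ^ CARD('n) * (\<integral>\<^sup>+z. indicator Q z * G z \<partial>lborel))" if t: "1/2 \<le> t" "t \<le> 1" for t
  proof -
    have "(\<integral>\<^sup>+x. indicator Q x * (\<integral>\<^sup>+y. indicator Q y * G (x + t *\<^sub>R (y - x)) \<partial>lborel) \<partial>lborel)
      \<le> (\<integral>\<^sup>+x. (2 ^ CARD('n) * (\<integral>\<^sup>+z. indicator Q z * G z \<partial>lborel)) * indicator Q x \<partial>lborel)"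
      by (rule nn_integral_mono)
        (use convex_average_bound[OF assms(1-3) _ t] in \<open>auto simp: indicator_def\<close>)
    also have "\<dots> = emeasure lborel Q * (2 ^ CARD('n) * (\<integral>\<^sup>+z. indicator Q z * G z \<partial>lborel))"
      by (subst nn_integral_cmult_indicator) (auto simp: mult.commute)
    finally show ?thesis .
  qed
  show ?thesis
  proof (cases "1/2 \<le> t")
    case True
    then show ?thesis using *[OF True t(2)] by simp
  next
    case False
    have "(\<integral>\<^sup>+x. indicator Q x * (\<integral>\<^sup>+y. indicator Q y * G (x + t *\<^sub>R (y - x)) \<partial>lborel) \<partial>lborel)
        = (\<integral>\<^sup>+x. (\<integral>\<^sup>+y. indicator Q x * (indicator Q y * G (x + t *\<^sub>R (y - x))) \<partial>lborel) \<partial>lborel)"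
      by (simp add: nn_integral_cmult)
    also have "\<dots> = (\<integral>\<^sup>+y. (\<integral>\<^sup>+x. indicator Q x * (indicator Q y * G (x + t *\<^sub>R (y - x))) \<partial>lborel) \<partial>lborel)"
      by (rule lborel_pair.Fubini'[symmetric]) measurable
    also have "\<dots> = (\<integral>\<^sup>+y. indicator Q y * (\<integral>\<^sup>+x. indicator Q x * G (y + (1 - t) *\<^sub>R (x - y)) \<partial>lborel) \<partial>lborel)"
    proof (rule nn_integral_cong)
      fix y :: "real^'n"
      have "x + t *\<^sub>R (y - x) = y + (1 - t) *\<^sub>R (x - y)" for x by (simp add: algebra_simps)
      then show "(\<integral>\<^sup>+x. indicator Q x * (indicator Q y * G (x + t *\<^sub>R (y - x))) \<partial>lborel)
         = indicator Q y * (\<integral>\<^sup>+x. indicator Q x * G (y + (1 - t) *\<^sub>R (x - y)) \<partial>lborel)"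
        by (simp add: nn_integral_cmult[symmetric] mult.left_commute)
    qed
    also have "\<dots> \<le> emeasure lborel Q * (2 ^ CARD('n) * (\<integral>\<^sup>+z. indicator Q z * G z \<partial>lborel))"
      by (rule *) (use False t in auto)
    finally show ?thesis .
  qed
qed

text \<open>The segment bound is integrated over \<open>Q\<close> in both endpoints; Tonelli moves
  the parameter \<open>t\<close> outermost, where the previous bound holds for each \<open>t\<close>
  separately.\<close>

lemma Poincare_smooth_nn:
  fixes \<phi> :: "real^'n::finite \<Rightarrow> real"
  assumes \<phi>: "smooth_fun \<phi>" and Q [measurable]: "Q \<in> sets borel" and "convex Q"
    and D: "\<And>x y. x \<in> Q \<Longrightarrow> y \<in> Q \<Longrightarrow> norm (y - x) \<le> D"
  shows "(\<integral>\<^sup>+x. indicator Q x * (\<integral>\<^sup>+y. indicator Q y * ennreal ((\<phi> y - \<phi> x)\<^sup>2) \<partial>lborel) \<partial>lborel)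
    \<le> emeasure lborel Q * (2 ^ CARD('n) * (\<integral>\<^sup>+z. indicator Q z * ennreal (D\<^sup>2 * (\<Sum>i\<in>UNIV. (partial i \<phi> z)\<^sup>2)) \<partial>lborel))"
proof -
  define G where "G z = ennreal (D\<^sup>2 * (\<Sum>i\<in>UNIV. (partial i \<phi> z)\<^sup>2))" for z
  have [measurable]: "partial i \<phi> \<in> borel_measurable borel" for i
    by (rule smooth_borel_measurable[OF smooth_fun_partial[OF \<phi>]])
  have [measurable]: "G \<in> borel_measurable borel" unfolding G_def by measurable
  let ?B = "emeasure lborel Q * (2 ^ CARD('n) * (\<integral>\<^sup>+z. indicator Q z * G z \<partial>lborel))"
  have "(\<integral>\<^sup>+x. indicator Q x * (\<integral>\<^sup>+y. indicator Q y * ennreal ((\<phi> y - \<phi> x)\<^sup>2) \<partial>lborel) \<partial>lborel)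
    \<le> (\<integral>\<^sup>+x. indicator Q x * (\<integral>\<^sup>+y. indicator Q y * (\<integral>\<^sup>+t. indicator {0..1} t * G (x + t *\<^sub>R (y - x)) \<partial>lborel) \<partial>lborel) \<partial>lborel)"
  proof (intro nn_integral_mono)
    fix x
    show "indicator Q x * (\<integral>\<^sup>+y. indicator Q y * ennreal ((\<phi> y - \<phi> x)\<^sup>2) \<partial>lborel)
      \<le> indicator Q x * (\<integral>\<^sup>+y. indicator Q y * (\<integral>\<^sup>+t. indicator {0..1} t * G (x + t *\<^sub>R (y - x)) \<partial>lborel) \<partial>lborel)"
    proof (cases "x \<in> Q")
      case True
      have "(\<integral>\<^sup>+y. indicator Q y * ennreal ((\<phi> y - \<phi> x)\<^sup>2) \<partial>lborel)
        \<le> (\<integral>\<^sup>+y. indicator Q y * (\<integral>\<^sup>+t. indicator {0..1} t * G (x + t *\<^sub>R (y - x)) \<partial>lborel) \<partial>lborel)"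
      proof (rule nn_integral_mono)
        fix y
        show "indicator Q y * ennreal ((\<phi> y - \<phi> x)\<^sup>2)
           \<le> indicator Q y * (\<integral>\<^sup>+t. indicator {0..1} t * G (x + t *\<^sub>R (y - x)) \<partial>lborel)"
        proof (cases "y \<in> Q")
          case y: True
          show ?thesis using segment_square_bound[OF \<phi> D[OF True y]] y by (simp add: G_def)
        qed simp
      qed
      then show ?thesis using True by simp
    qed simp
  qed
  also have "\<dots> = (\<integral>\<^sup>+x. (\<integral>\<^sup>+y. (\<integral>\<^sup>+t. indicator Q x * (indicator Q y * (indicator {0..1} t * G (x + t *\<^sub>R (y - x)))) \<partial>lborel) \<partial>lborel) \<partial>lborel)"
    by (simp add: nn_integral_cmult)
  also have "\<dots> = (\<integral>\<^sup>+x. (\<integral>\<^sup>+t. (\<integral>\<^sup>+y. indicator Q x * (indicator Q y * (indicator {0..1} t * G (x + t *\<^sub>R (y - x)))) \<partial>lborel) \<partial>lborel) \<partial>lborel)"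
    by (rule nn_integral_cong, rule lborel_pair.Fubini'[symmetric]) measurable
  also have "\<dots> = (\<integral>\<^sup>+t. (\<integral>\<^sup>+x. (\<integral>\<^sup>+y. indicator Q x * (indicator Q y * (indicator {0..1} t * G (x + t *\<^sub>R (y - x)))) \<partial>lborel) \<partial>lborel) \<partial>lborel)"
    by (rule lborel_pair.Fubini'[symmetric]) measurable
  also have "\<dots> = (\<integral>\<^sup>+t. indicator {0..1} t * (\<integral>\<^sup>+x. indicator Q x * (\<integral>\<^sup>+y. indicator Q y * G (x + t *\<^sub>R (y - x)) \<partial>lborel) \<partial>lborel) \<partial>lborel)"
    by (simp add: nn_integral_cmult[symmetric] mult.left_commute[of "indicator {0..1} _"])
  also have "\<dots> \<le> (\<integral>\<^sup>+t. ?B * indicator {0..1::real} t \<partial>lborel)"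
    by (rule nn_integral_mono)
      (use convex_double_average_bound[of G Q] \<open>convex Q\<close> in \<open>auto simp: indicator_def\<close>)
  also have "\<dots> = ?B" by (subst nn_integral_cmult_indicator) auto
  finally show ?thesis by (simp add: G_def)
qed

text \<open>The double integral of \<open>(\<phi> y - \<phi> x)\<^sup>2\<close> over
  \<open>Q\<close> equals twice the volume times the integral of \<open>\<phi>\<^sup>2\<close>,
  minus twice the square of the integral of \<open>\<phi>\<close>. The volume is kept as a factor,
  so sets of measure zero cause no division.\<close>

lemma Poincare_test:
  fixes \<phi> :: "real^'n::finite \<Rightarrow> real"
  assumes \<phi>: "test_fun T \<phi>" and Q [measurable]: "Q \<in> sets borel" and "convex Q" "bounded Q"
    and D: "\<And>x y. x \<in> Q \<Longrightarrow> y \<in> Q \<Longrightarrow> norm (y - x) \<le> D"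
  shows "measure lebesgue Q * (\<integral>x. indicator Q x * (\<phi> x)\<^sup>2 \<partial>lebesgue) \<le> (\<integral>x. indicator Q x * \<phi> x \<partial>lebesgue)\<^sup>2
      + 2 ^ CARD('n) * D\<^sup>2 * measure lebesgue Q * (\<Sum>i\<in>UNIV. \<integral>x. indicator Q x * (partial i \<phi> x)\<^sup>2 \<partial>lebesgue)"
proof -
  note sm = test_fun_smooth[OF \<phi>]
  have [measurable]: "\<phi> \<in> borel_measurable borel" "partial i \<phi> \<in> borel_measurable borel" for i
    by (intro smooth_borel_measurable smooth_fun_partial sm)+
  have Qm: "Q \<in> lmeasurable" using Q \<open>bounded Q\<close> by (simp add: bounded_set_imp_lmeasurable)
  define V where "V = measure lebesgue Q"
  have Ve: "emeasure lborel Q = ennreal V"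
  proof -
    have "emeasure lborel Q = emeasure lebesgue Q" using Q by simp
    also have "\<dots> = ennreal V"
      unfolding V_def by (rule emeasure_eq_ennreal_measure) (use fmeasurableD2[OF Qm] in simp)
    finally show ?thesis .
  qed
  have V0: "V \<ge> 0" by (simp add: V_def)
  have ind: "L2 lebesgue (indicator Q :: real^'n \<Rightarrow> real)" by (rule L2_indicator[OF Qm])
  have L: "L2 lebesgue (\<lambda>x. indicator Q x * f x)" if "test_fun T f" for f
    by (rule L2_AE_bounded_mult[OF test_fun_L2[OF that] L2_measurable[OF ind], where B=1])
      (simp add: indicator_def)
  have isq: "integrable lebesgue (\<lambda>x. indicator Q x * (f x)\<^sup>2)" if "test_fun T f" for f
    using L2_integrable_square[OF L[OF that]] by (simp add: indicator_mult_square)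
  have i1: "integrable lebesgue (\<lambda>x. indicator Q x * \<phi> x)"
    using L2_integrable_mult[OF ind test_fun_L2[OF \<phi>]] .
  have i0: "integrable lebesgue (indicator Q :: real^'n \<Rightarrow> real)"
    by (rule lmeasurable_integrable_indicator[OF Qm])
  define I1 where "I1 = (\<integral>x. indicator Q x * \<phi> x \<partial>lebesgue)"
  define I2 where "I2 = (\<integral>x. indicator Q x * (\<phi> x)\<^sup>2 \<partial>lebesgue)"
  \<comment> \<open>The inner integral over \<open>y\<close>, a quadratic polynomial in
    \<open>\<phi> x\<close>.\<close>
  define r where "r x = I2 - 2 * \<phi> x * I1 + V * (\<phi> x)\<^sup>2" for x
  have expand: "indicator Q y * (\<phi> y - \<phi> x)\<^sup>2
      = indicator Q y * (\<phi> y)\<^sup>2 - 2 * \<phi> x * (indicator Q y * \<phi> y) + (\<phi> x)\<^sup>2 * indicator Q y" for x y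
    by (simp add: power2_diff algebra_simps)
  have int_y: "integrable lebesgue (\<lambda>y. indicator Q y * (\<phi> y - \<phi> x)\<^sup>2)" for x
    unfolding expand using isq[OF \<phi>] i1 i0 by simp
  have r_eq: "(\<integral>y. indicator Q y * (\<phi> y - \<phi> x)\<^sup>2 \<partial>lebesgue) = r x" for x
    unfolding expand r_def I1_def I2_def V_def using isq[OF \<phi>] i1 i0 by simp
  have r0: "0 \<le> r x" for x unfolding r_eq[symmetric] by (rule integral_nonneg_AE) simp
  have inner: "(\<integral>\<^sup>+y. indicator Q y * ennreal ((\<phi> y - \<phi> x)\<^sup>2) \<partial>lborel) = ennreal (r x)" for x
  proof -
    have "(\<integral>\<^sup>+y. indicator Q y * ennreal ((\<phi> y - \<phi> x)\<^sup>2) \<partial>lborel)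
       = (\<integral>\<^sup>+y. ennreal (indicator Q y * (\<phi> y - \<phi> x)\<^sup>2) \<partial>lebesgue)"
      unfolding nn_integral_completion by (rule nn_integral_cong) (simp add: indicator_def)
    also have "\<dots> = ennreal (r x)"
      unfolding r_eq[symmetric] by (rule nn_integral_eq_integral[OF int_y]) simp
    finally show ?thesis .
  qed
  have rx: "indicator Q x * r x = I2 * indicator Q x - 2 * I1 * (indicator Q x * \<phi> x) + V * (indicator Q x * (\<phi> x)\<^sup>2)" for x
    by (simp add: r_def algebra_simps)
  have int_r: "integrable lebesgue (\<lambda>x. indicator Q x * r x)"
    unfolding rx using isq[OF \<phi>] i1 i0 by simp
  have val: "(\<integral>x. indicator Q x * r x \<partial>lebesgue) = 2 * (V * I2) - 2 * I1\<^sup>2"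
  proof -
    have "(\<integral>x. indicator Q x * r x \<partial>lebesgue) = I2 * V - 2 * I1 * I1 + V * I2"
      unfolding rx using isq[OF \<phi>] i1 i0 by (simp add: I1_def[symmetric] I2_def[symmetric] V_def[symmetric])
    then show ?thesis by (simp add: power2_eq_square)
  qed
  have lhs: "(\<integral>\<^sup>+x. indicator Q x * (\<integral>\<^sup>+y. indicator Q y * ennreal ((\<phi> y - \<phi> x)\<^sup>2) \<partial>lborel) \<partial>lborel)
      = ennreal (2 * (V * I2) - 2 * I1\<^sup>2)"
  proof -
    have "(\<integral>\<^sup>+x. indicator Q x * ennreal (r x) \<partial>lborel) = (\<integral>\<^sup>+x. ennreal (indicator Q x * r x) \<partial>lebesgue)"
      unfolding nn_integral_completion by (rule nn_integral_cong) (simp add: indicator_def)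
    also have "\<dots> = ennreal (2 * (V * I2) - 2 * I1\<^sup>2)"
      unfolding val[symmetric] by (rule nn_integral_eq_integral[OF int_r]) (simp add: r0)
    finally show ?thesis by (simp add: inner)
  qed
  define J where "J = (\<Sum>i\<in>UNIV. \<integral>x. indicator Q x * (partial i \<phi> x)\<^sup>2 \<partial>lebesgue)"
  have J0: "J \<ge> 0" unfolding J_def by (intro sum_nonneg integral_nonneg_AE) simp
  have Jnn: "(\<integral>\<^sup>+z. indicator Q z * ennreal (D\<^sup>2 * (\<Sum>i\<in>UNIV. (partial i \<phi> z)\<^sup>2)) \<partial>lborel) = ennreal (D\<^sup>2 * J)"
  proof -
    have e: "D\<^sup>2 * (\<Sum>i\<in>UNIV. indicator Q z * (partial i \<phi> z)\<^sup>2) = indicator Q z * (D\<^sup>2 * (\<Sum>i\<in>UNIV. (partial i \<phi> z)\<^sup>2))" for z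
      by (simp add: indicator_def)
    have "(\<integral>\<^sup>+z. indicator Q z * ennreal (D\<^sup>2 * (\<Sum>i\<in>UNIV. (partial i \<phi> z)\<^sup>2)) \<partial>lborel)
      = (\<integral>\<^sup>+z. ennreal (D\<^sup>2 * (\<Sum>i\<in>UNIV. indicator Q z * (partial i \<phi> z)\<^sup>2)) \<partial>lebesgue)"
      unfolding nn_integral_completion e by (rule nn_integral_cong) (simp add: indicator_def)
    also have "\<dots> = ennreal (\<integral>z. D\<^sup>2 * (\<Sum>i\<in>UNIV. indicator Q z * (partial i \<phi> z)\<^sup>2) \<partial>lebesgue)"
    proof (rule nn_integral_eq_integral)
      show "integrable lebesgue (\<lambda>z. D\<^sup>2 * (\<Sum>i\<in>UNIV. indicator Q z * (partial i \<phi> z)\<^sup>2))"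
        by (intro integrable_mult_right Bochner_Integration.integrable_sum isq test_fun_partial \<phi>)
    qed (intro AE_I2 mult_nonneg_nonneg sum_nonneg, auto)
    also have "(\<integral>z. D\<^sup>2 * (\<Sum>i\<in>UNIV. indicator Q z * (partial i \<phi> z)\<^sup>2) \<partial>lebesgue) = D\<^sup>2 * J"
      unfolding J_def integral_mult_right_zero
      by (subst Bochner_Integration.integral_sum) (rule isq[OF test_fun_partial[OF \<phi>]] refl)+
    finally show ?thesis .
  qed
  have "ennreal (2 * (V * I2) - 2 * I1\<^sup>2) \<le> ennreal V * (2 ^ CARD('n) * ennreal (D\<^sup>2 * J))"
    using Poincare_smooth_nn[OF sm Q \<open>convex Q\<close> D] unfolding lhs Jnn Ve .
  also have "\<dots> = ennreal (V * (2 ^ CARD('n) * (D\<^sup>2 * J)))"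
    using V0 J0 by (simp add: ennreal_mult ennreal_power[symmetric])
  finally have "2 * (V * I2) - 2 * I1\<^sup>2 \<le> V * (2 ^ CARD('n) * (D\<^sup>2 * J))"
    using V0 J0 by (simp add: ennreal_le_iff)
  moreover have "0 \<le> V * (2 ^ CARD('n) * (D\<^sup>2 * J))" using V0 J0 by simp
  ultimately have "V * I2 \<le> I1\<^sup>2 + V * (2 ^ CARD('n) * (D\<^sup>2 * J))" by linarith
  then show ?thesis by (simp add: V_def I1_def I2_def J_def mult_ac)
qed

lemma L2_indicator_mult:
  assumes "Q \<in> sets lebesgue" "L2 lebesgue f" shows "L2 lebesgue (\<lambda>x. indicator Q x * f x)"
  by (rule L2_AE_bounded_mult[OF assms(2), where B=1])
    (use assms(1) in \<open>auto intro!: borel_measurable_indicator AE_I2 simp del: indicator_eq_1_iff\<close>)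

lemma L2_tendsto_indicator_mult:
  fixes F :: "nat \<Rightarrow> 'a::euclidean_space \<Rightarrow> real"
  assumes Q: "Q \<in> sets lebesgue" and F: "\<And>k. L2 lebesgue (F k)" and f: "L2 lebesgue f"
    and lim: "(\<lambda>k. L2dist2 lebesgue (F k) f) \<longlonglongrightarrow> 0"
  shows "(\<lambda>k. L2dist2 lebesgue (\<lambda>x. indicator Q x * F k x) (\<lambda>x. indicator Q x * f x)) \<longlonglongrightarrow> 0"
proof (rule tendsto_sandwich[OF _ _ tendsto_const lim])
  show "\<forall>\<^sub>F k in sequentially. 0 \<le> L2dist2 lebesgue (\<lambda>x. indicator Q x * F k x) (\<lambda>x. indicator Q x * f x)"
    by (simp add: L2dist2_nonneg)
  show "\<forall>\<^sub>F k in sequentially. L2dist2 lebesgue (\<lambda>x. indicator Q x * F k x) (\<lambda>x. indicator Q x * f x) \<le> L2dist2 lebesgue (F k) f"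
  proof (rule always_eventually, rule allI)
    fix k
    show "L2dist2 lebesgue (\<lambda>x. indicator Q x * F k x) (\<lambda>x. indicator Q x * f x) \<le> L2dist2 lebesgue (F k) f"
      unfolding L2dist2_def
    proof (rule integral_mono)
      show "integrable lebesgue (\<lambda>x. (indicator Q x * F k x - indicator Q x * f x)\<^sup>2)"
        by (intro L2_integrable_square L2_diff L2_indicator_mult Q F f)
      show "integrable lebesgue (\<lambda>x. (F k x - f x)\<^sup>2)"
        by (intro L2_integrable_square L2_diff F f)
    qed (simp add: indicator_def)
  qed
qed

lemma L2_tendsto_indicator_square:
  fixes F :: "nat \<Rightarrow> 'a::euclidean_space \<Rightarrow> real"
  assumes Q: "Q \<in> sets lebesgue" and F: "\<And>k. L2 lebesgue (F k)" and f: "L2 lebesgue f"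
    and lim: "(\<lambda>k. L2dist2 lebesgue (F k) f) \<longlonglongrightarrow> 0"
  shows "(\<lambda>k. \<integral>x. indicator Q x * (F k x)\<^sup>2 \<partial>lebesgue) \<longlonglongrightarrow> (\<integral>x. indicator Q x * (f x)\<^sup>2 \<partial>lebesgue)"
  using L2_tendsto_square[OF L2_indicator_mult[OF Q F] L2_indicator_mult[OF Q f] L2_tendsto_indicator_mult[OF assms]]
  by (simp add: indicator_mult_square)

lemma partial_eq_0_locally_const:
  assumes "open U" "x \<in> U" "\<And>y. y \<in> U \<Longrightarrow> f y = c" shows "partial i f x = 0"
proof -
  have "(f has_derivative (\<lambda>h. 0)) (at x)"
    by (rule has_derivative_transform_within_open[of "\<lambda>x. c" _ x UNIV U]) (use assms in auto)
  then show ?thesis by (rule has_derivative_imp_partial)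
qed

text \<open>A cutoff equal to 1 on the closed box does not change \<open>u\<close> or its gradient
  there, so the inequality passes to the limit along the smooth approximations of
  \<open>u * \<eta>\<close>.\<close>

lemma Poincare_box_compact:
  fixes S :: "(real^'n::finite) set"
  assumes S: "open S" and u: "L2on S u" and g: "is_weak_grad S u g" and sub: "cbox a b \<subseteq> S"
    and D: "\<And>x y. x \<in> box a b \<Longrightarrow> y \<in> box a b \<Longrightarrow> norm (y - x) \<le> D"
  shows "measure lebesgue (box a b) * (\<integral>x. indicator (box a b) x * (u x)\<^sup>2 \<partial>lebesgue)
     \<le> (\<integral>x. indicator (box a b) x * u x \<partial>lebesgue)\<^sup>2
      + 2 ^ CARD('n) * D\<^sup>2 * measure lebesgue (box a b) * (\<Sum>i\<in>UNIV. \<integral>x. indicator (box a b) x * (g x $ i)\<^sup>2 \<partial>lebesgue)"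
proof -
  let ?Q = "box a b"
  have Qs: "?Q \<in> sets lebesgue" by simp
  obtain \<eta> where \<eta>: "test_fun S \<eta>" "\<forall>x\<in>cbox a b. \<eta> x = 1" using ex_cutoff[OF compact_cbox S sub] by blast
  have \<eta>1: "\<eta> x = 1" if "x \<in> ?Q" for x using \<eta>(2) that box_subset_cbox[of a b] by blast
  have \<eta>0: "partial i \<eta> x = 0" if "x \<in> ?Q" for x i
    by (rule partial_eq_0_locally_const[OF open_box that \<eta>1])
  let ?w = "\<lambda>x. u x * \<eta> x" and ?G = "\<lambda>i x. g x $ i * \<eta> x + u x * partial i \<eta> x"
  obtain W where W: "\<And>k::nat. test_fun S (W k)" "(\<lambda>k. L2dist2 lebesgue (W k) ?w) \<longlonglongrightarrow> 0"
    "\<And>i. (\<lambda>k. L2dist2 lebesgue (partial i (W k)) (?G i)) \<longlonglongrightarrow> 0"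
    using smooth_approximation_cutoff[OF S u g \<eta>(1)] by blast
  have wL: "L2 lebesgue ?w" by (rule L2on_mult_test(1)[OF u \<eta>(1)])
  have GL: "L2 lebesgue (?G i)" for i
    by (intro L2_add L2on_mult_test(1)[OF is_weak_grad_L2on[OF g] \<eta>(1)] L2on_mult_test(1)[OF u test_fun_partial[OF \<eta>(1)]])
  have l1: "(\<lambda>k. \<integral>x. indicator ?Q x * (W k x)\<^sup>2 \<partial>lebesgue) \<longlonglongrightarrow> (\<integral>x. indicator ?Q x * (u x)\<^sup>2 \<partial>lebesgue)"
  proof -
    have eq: "indicator ?Q x * (?w x)\<^sup>2 = indicator ?Q x * (u x)\<^sup>2" for x by (simp add: indicator_def \<eta>1)
    show ?thesis using L2_tendsto_indicator_square[OF Qs test_fun_L2[OF W(1)] wL W(2)] by (simp only: eq)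
  qed
  have l2: "(\<lambda>k. \<integral>x. indicator ?Q x * (partial i (W k) x)\<^sup>2 \<partial>lebesgue) \<longlonglongrightarrow> (\<integral>x. indicator ?Q x * (g x $ i)\<^sup>2 \<partial>lebesgue)" for i
  proof -
    have eq: "indicator ?Q x * (?G i x)\<^sup>2 = indicator ?Q x * (g x $ i)\<^sup>2" for x by (simp add: indicator_def \<eta>1 \<eta>0)
    show ?thesis
      using L2_tendsto_indicator_square[OF Qs test_fun_L2[OF test_fun_partial[OF W(1)]] GL W(3), of i] by (simp only: eq)
  qed
  have l3: "(\<lambda>k. \<integral>x. indicator ?Q x * W k x \<partial>lebesgue) \<longlonglongrightarrow> (\<integral>x. indicator ?Q x * u x \<partial>lebesgue)"
  proof -
    have eq: "?w x * indicator ?Q x = indicator ?Q x * u x" "W k x * indicator ?Q x = indicator ?Q x * W k x" for k x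
      by (simp_all add: indicator_def \<eta>1)
    have "(\<lambda>k. \<integral>x. W k x * indicator ?Q x \<partial>lebesgue) \<longlonglongrightarrow> (\<integral>x. ?w x * indicator ?Q x \<partial>lebesgue)"
      by (rule L2_tendsto_mult[OF test_fun_L2[OF W(1)] wL L2_indicator W(2)]) simp
    then show ?thesis by (simp only: eq)
  qed
  have P: "measure lebesgue ?Q * (\<integral>x. indicator ?Q x * (W k x)\<^sup>2 \<partial>lebesgue) \<le> (\<integral>x. indicator ?Q x * W k x \<partial>lebesgue)\<^sup>2
      + 2 ^ CARD('n) * D\<^sup>2 * measure lebesgue ?Q * (\<Sum>i\<in>UNIV. \<integral>x. indicator ?Q x * (partial i (W k) x)\<^sup>2 \<partial>lebesgue)" for k
    by (rule Poincare_test[OF W(1) _ convex_box(2) bounded_box D]) simp_all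
  show ?thesis
  proof (rule LIMSEQ_le)
    show "(\<lambda>k. measure lebesgue ?Q * (\<integral>x. indicator ?Q x * (W k x)\<^sup>2 \<partial>lebesgue)) \<longlonglongrightarrow>
      measure lebesgue ?Q * (\<integral>x. indicator ?Q x * (u x)\<^sup>2 \<partial>lebesgue)"
      by (intro tendsto_mult tendsto_const l1)
    show "(\<lambda>k. (\<integral>x. indicator ?Q x * W k x \<partial>lebesgue)\<^sup>2
      + 2 ^ CARD('n) * D\<^sup>2 * measure lebesgue ?Q * (\<Sum>i\<in>UNIV. \<integral>x. indicator ?Q x * (partial i (W k) x)\<^sup>2 \<partial>lebesgue))
      \<longlonglongrightarrow> (\<integral>x. indicator ?Q x * u x \<partial>lebesgue)\<^sup>2
      + 2 ^ CARD('n) * D\<^sup>2 * measure lebesgue ?Q * (\<Sum>i\<in>UNIV. \<integral>x. indicator ?Q x * (g x $ i)\<^sup>2 \<partial>lebesgue)"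
      by (intro tendsto_add tendsto_mult tendsto_const tendsto_power tendsto_sum l2 l3)
  qed (use P in blast)
qed

section \<open>Exhausting an open box from inside\<close>

text \<open>The corner \<open>a\<close> moved towards \<open>b\<close>; swapping the arguments moves
  the opposite corner. The fraction is below 1/2, so the two moved corners do not cross.\<close>

definition shrink :: "nat \<Rightarrow> real^'n::finite \<Rightarrow> real^'n \<Rightarrow> real^'n" where
  "shrink k a b = a + (1 / (real k + 3)) *\<^sub>R (b - a)"

lemma shrink_nth: "shrink k a b $ i = a $ i + (b $ i - a $ i) / (real k + 3)"
  by (simp add: shrink_def)

lemma shrink_cbox:
  assumes "box a b \<noteq> {}" shows "cbox (shrink k a b) (shrink k b a) \<subseteq> box a b"
proof
  fix x assume x: "x \<in> cbox (shrink k a b) (shrink k b a)"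
  show "x \<in> box a b"
    unfolding mem_box_cart
  proof
    fix i
    have ab: "a $ i < b $ i" using assms by (simp add: interval_ne_empty_cart)
    then have p: "0 < (b $ i - a $ i) / (real k + 3)" by (intro divide_pos_pos) auto
    have "(a $ i - b $ i) / (real k + 3) = - ((b $ i - a $ i) / (real k + 3))"
      by (simp only: minus_divide_left minus_diff_eq)
    then show "a $ i < x $ i \<and> x $ i < b $ i"
      using x p unfolding mem_box_cart shrink_nth by (smt (verit))
  qed
qed

lemma eventually_in_shrink_box:
  assumes "x \<in> box a b" shows "\<forall>\<^sub>F k in sequentially. x \<in> box (shrink k a b) (shrink k b a)"
proof -
  have t: "(\<lambda>k. shrink k a b $ i) \<longlonglongrightarrow> a $ i" for a b :: "real^'a" and i
  proof -
    have "(\<lambda>k. (b $ i - a $ i) / (real k + 3)) \<longlonglongrightarrow> 0" by real_asymp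
    then have "(\<lambda>k. a $ i + (b $ i - a $ i) / (real k + 3)) \<longlonglongrightarrow> a $ i + 0" by (intro tendsto_intros)
    then show ?thesis by (simp add: shrink_nth)
  qed
  have "\<forall>\<^sub>F k in sequentially. shrink k a b $ i < x $ i \<and> x $ i < shrink k b a $ i" for i
    using assms order_tendstoD[OF t] by (intro eventually_conj) (auto simp: mem_box_cart)
  then show ?thesis
    unfolding mem_box_cart by (intro eventually_all_finite) auto
qed

lemma integral_shrink_tendsto:
  fixes f :: "real^'n::finite \<Rightarrow> real"
  assumes f: "integrable lebesgue (\<lambda>x. indicator (box a b) x * f x)" and ne: "box a b \<noteq> {}"
  shows "(\<lambda>k. \<integral>x. indicator (box (shrink k a b) (shrink k b a)) x * f x \<partial>lebesgue)
    \<longlonglongrightarrow> (\<integral>x. indicator (box a b) x * f x \<partial>lebesgue)"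
proof -
  have sub: "box (shrink k a b) (shrink k b a) \<subseteq> box a b" for k
    using shrink_cbox[OF ne] box_subset_cbox by blast
  have eq: "indicator (box (shrink k a b) (shrink k b a)) x * f x
    = indicator (box (shrink k a b) (shrink k b a)) x * (indicator (box a b) x * f x)" for k x
    using sub[of k] by (auto simp: indicator_def)
  show ?thesis
  proof (rule integral_dominated_convergence[where w="\<lambda>x. \<bar>indicator (box a b) x * f x\<bar>"])
    show "(\<lambda>x. indicator (box a b) x * f x) \<in> borel_measurable lebesgue" using f by simp
    show "(\<lambda>x. indicator (box (shrink k a b) (shrink k b a)) x * f x) \<in> borel_measurable lebesgue" for k
      unfolding eq[of k] by (rule borel_measurable_times[OF borel_measurable_indicator borel_measurable_integrable[OF f]]) simp
    show "integrable lebesgue (\<lambda>x. \<bar>indicator (box a b) x * f x\<bar>)" using f by (rule integrable_abs)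
    show "AE x in lebesgue. (\<lambda>k. indicator (box (shrink k a b) (shrink k b a)) x * f x)
      \<longlonglongrightarrow> indicator (box a b) x * f x"
    proof (rule AE_I2)
      fix x
      have "\<forall>\<^sub>F k in sequentially. indicator (box (shrink k a b) (shrink k b a)) x * f x = indicator (box a b) x * f x"
      proof (cases "x \<in> box a b")
        case True
        show ?thesis using eventually_in_shrink_box[OF True] by eventually_elim (use True in simp)
      next
        case False
        then show ?thesis using sub by (intro always_eventually allI) (auto simp: indicator_def)
      qed
      then show "(\<lambda>k. indicator (box (shrink k a b) (shrink k b a)) x * f x) \<longlonglongrightarrow> indicator (box a b) x * f x"
        by (rule tendsto_eventually)
    qed
    show "AE x in lebesgue. norm (indicator (box (shrink k a b) (shrink k b a)) x * f x) \<le> \<bar>indicator (box a b) x * f x\<bar>" for k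
      using sub[of k] by (intro AE_I2) (auto simp: indicator_def)
  qed
qed

lemma L2on_integrable:
  assumes "L2on S u" "Q \<in> lmeasurable" "Q \<subseteq> S"
  shows "integrable lebesgue (\<lambda>x. indicator Q x * u x)" "integrable lebesgue (\<lambda>x. indicator Q x * (u x)\<^sup>2)"
proof -
  have "L2on Q u" by (rule L2on_subset[OF assms(1,3) fmeasurableD[OF assms(2)]])
  then have L: "L2 lebesgue (\<lambda>x. indicator Q x * u x)" by (simp add: L2on_def)
  have e: "(\<lambda>x. (indicator Q x * u x) * indicator Q x) = (\<lambda>x. indicator Q x * u x)"
    by (auto simp: indicator_def)
  show "integrable lebesgue (\<lambda>x. indicator Q x * u x)"
    using L2_integrable_mult[OF L L2_indicator[OF assms(2)]] unfolding e .
  show "integrable lebesgue (\<lambda>x. indicator Q x * (u x)\<^sup>2)"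
    using L2_integrable_square[OF L] by (simp add: indicator_mult_square)
qed

text \<open>The box may touch the boundary of \<open>S\<close>, where no test function of
  \<open>S\<close> equals 1 on it. It is exhausted by shrunken boxes whose closures lie inside, with
  dominated convergence for every integral. This form applies to \<open>S\<close> itself and to
  boundary cells.\<close>

lemma Poincare_box:
  fixes S :: "(real^'n::finite) set"
  assumes S: "open S" and u: "L2on S u" and g: "is_weak_grad S u g" and sub: "box a b \<subseteq> S"
    and D: "\<And>x y. x \<in> box a b \<Longrightarrow> y \<in> box a b \<Longrightarrow> norm (y - x) \<le> D"
  shows "measure lebesgue (box a b) * (\<integral>x. indicator (box a b) x * (u x)\<^sup>2 \<partial>lebesgue)
     \<le> (\<integral>x. indicator (box a b) x * u x \<partial>lebesgue)\<^sup>2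
      + 2 ^ CARD('n) * D\<^sup>2 * measure lebesgue (box a b) * (\<Sum>i\<in>UNIV. \<integral>x. indicator (box a b) x * (g x $ i)\<^sup>2 \<partial>lebesgue)"
proof (cases "box a b = {}")
  case True
  then show ?thesis by simp
next
  case False
  define Q where "Q k = box (shrink k a b) (shrink k b a)" for k
  have cs: "cbox (shrink k a b) (shrink k b a) \<subseteq> box a b" for k by (rule shrink_cbox[OF False])
  have Qs: "Q k \<subseteq> box a b" for k unfolding Q_def using cs box_subset_cbox by blast
  have P: "measure lebesgue (Q k) * (\<integral>x. indicator (Q k) x * (u x)\<^sup>2 \<partial>lebesgue)
     \<le> (\<integral>x. indicator (Q k) x * u x \<partial>lebesgue)\<^sup>2
      + 2 ^ CARD('n) * D\<^sup>2 * measure lebesgue (Q k) * (\<Sum>i\<in>UNIV. \<integral>x. indicator (Q k) x * (g x $ i)\<^sup>2 \<partial>lebesgue)" for k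
    unfolding Q_def
    by (rule Poincare_box_compact[OF S u g]) (use cs sub Qs D in \<open>auto simp: Q_def subset_iff\<close>)
  note ui = L2on_integrable[OF u lmeasurable_box sub]
  note gi = L2on_integrable(2)[OF is_weak_grad_L2on[OF g] lmeasurable_box sub]
  have V: "(\<lambda>k. measure lebesgue (Q k)) \<longlonglongrightarrow> measure lebesgue (box a b)"
    using integral_shrink_tendsto[of a b "\<lambda>_. 1", OF _ False] lmeasurable_integrable_indicator[OF lmeasurable_box, of a b]
    by (simp add: Q_def)
  show ?thesis
  proof (rule LIMSEQ_le)
    show "(\<lambda>k. measure lebesgue (Q k) * (\<integral>x. indicator (Q k) x * (u x)\<^sup>2 \<partial>lebesgue)) \<longlonglongrightarrow>
      measure lebesgue (box a b) * (\<integral>x. indicator (box a b) x * (u x)\<^sup>2 \<partial>lebesgue)"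
      by (intro tendsto_mult V) (unfold Q_def, rule integral_shrink_tendsto[OF ui(2) False])
    show "(\<lambda>k. (\<integral>x. indicator (Q k) x * u x \<partial>lebesgue)\<^sup>2
      + 2 ^ CARD('n) * D\<^sup>2 * measure lebesgue (Q k) * (\<Sum>i\<in>UNIV. \<integral>x. indicator (Q k) x * (g x $ i)\<^sup>2 \<partial>lebesgue))
      \<longlonglongrightarrow> (\<integral>x. indicator (box a b) x * u x \<partial>lebesgue)\<^sup>2
      + 2 ^ CARD('n) * D\<^sup>2 * measure lebesgue (box a b) * (\<Sum>i\<in>UNIV. \<integral>x. indicator (box a b) x * (g x $ i)\<^sup>2 \<partial>lebesgue)"
      by (intro tendsto_add tendsto_mult tendsto_const tendsto_power tendsto_sum V)
        (unfold Q_def, (rule integral_shrink_tendsto[OF ui(1) False] integral_shrink_tendsto[OF gi False])+)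
  qed (use P in blast)
qed

text \<open>Poincare's inequality on the cells of a fine division: up to finitely many averages, the \<open>L2\<close> norm
  is controlled by a small multiple of the norm of the gradient.\<close>

lemma Rellich_box:
  fixes p q :: "real^'n::finite"
  assumes \<epsilon>: "\<epsilon> > 0"
  shows "\<exists>\<D>. finite \<D> \<and> (\<forall>K\<in>\<D>. K \<in> lmeasurable \<and> K \<subseteq> box p q) \<and>
    (\<forall>u g. L2on (box p q) u \<and> is_weak_grad (box p q) u g \<longrightarrow>
      (\<integral>x. indicator (box p q) x * (u x)\<^sup>2 \<partial>lebesgue)
      \<le> (\<Sum>K\<in>\<D>. (\<integral>x. indicator K x * u x \<partial>lebesgue)\<^sup>2 / measure lebesgue K)
        + \<epsilon> * (\<Sum>i\<in>UNIV. \<integral>x. indicator (box p q) x * (g x $ i)\<^sup>2 \<partial>lebesgue))"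
proof -
  \<comment> \<open>Cells inside a ball of radius \<open>d\<close> have diameter at most
    \<open>2 * d\<close>, and \<open>d\<close> is chosen to make the Poincare constant for that
    diameter equal to \<open>\<epsilon>\<close>.\<close>
  define d where "d = sqrt (\<epsilon> / (4 * 2 ^ CARD('n)))"
  have d: "d > 0" "2 ^ CARD('n) * (2 * d)\<^sup>2 = \<epsilon>"
    using \<epsilon> by (simp_all add: d_def power_mult_distrib)
  obtain P where P: "P tagged_division_of (cbox p q)" "(\<lambda>x. ball x d) fine P"
    using fine_division_exists[OF gauge_ball[OF d(1)]] by blast
  define \<K> where "\<K> = snd ` P"
  have div: "\<K> division_of (cbox p q)" unfolding \<K>_def by (rule division_of_tagged_division[OF P(1)])
  have fin: "finite \<K>" by (rule division_of_finite[OF div])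
  have \<K>: "\<exists>a b. K = cbox a b" "K \<subseteq> cbox p q" if "K \<in> \<K>" for K
    using division_ofD(2,4)[OF div that] by auto
  have disj: "interior K \<inter> interior L = {}" if "K \<in> \<K>" "L \<in> \<K>" "K \<noteq> L" for K L
    using division_ofD(5)[OF div that] .
  have small: "norm (y - x) \<le> 2 * d" if K: "K \<in> \<K>" and xy: "x \<in> K" "y \<in> K" for K x y
  proof -
    obtain z where "(z, K) \<in> P" using K by (auto simp: \<K>_def)
    then have "K \<subseteq> ball z d" using P(2) by (auto simp: fine_def)
    then have "dist z x < d" "dist z y < d" using xy by auto
    then show ?thesis using dist_triangle[of x y z] by (simp add: dist_norm norm_minus_commute)
  qed
  have intbox: "\<exists>a b. interior K = box a b" if "K \<in> \<K>" for K using \<K>(1)[OF that] interior_cbox by metis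
  have intsub: "interior K \<subseteq> box p q" if "K \<in> \<K>" for K
    using interior_mono[OF \<K>(2)[OF that]] by (simp add: interior_cbox)
  have meas: "interior K \<in> lmeasurable" if "K \<in> \<K>" for K using intbox[OF that] lmeasurable_box by metis
  have "negligible (frontier K)" if "K \<in> \<K>" for K
    using \<K>(1)[OF that] negligible_convex_frontier[OF convex_box(1)] by blast
  then have "negligible (\<Union>K\<in>\<K>. frontier K)"
    using fin by (intro negligible_Union finite_imageI) auto
  then have nf: "AE x in lebesgue. x \<notin> (\<Union>K\<in>\<K>. frontier K)"
    unfolding negligible_iff_null_sets by (rule AE_not_in)
  have ind: "AE x in lebesgue. indicator (box p q) x = (\<Sum>K\<in>\<K>. indicator (interior K) x :: real)"
    using nf
  proof eventually_elim
    case (elim x)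
    show ?case
    proof (cases "x \<in> box p q")
      case True
      then have "x \<in> \<Union>\<K>" using division_ofD(6)[OF div] box_subset_cbox by blast
      then obtain K where K: "K \<in> \<K>" "x \<in> K" by blast
      then have xi: "x \<in> interior K" using elim closure_subset by (fastforce simp: frontier_def)
      have "(\<Sum>L\<in>\<K>. indicator (interior L) x :: real) = (\<Sum>L\<in>\<K>. if L = K then 1 else 0)"
        using disj[OF _ K(1)] xi by (intro sum.cong) (auto simp: indicator_def)
      then show ?thesis using True fin K(1) by simp
    next
      case False
      then have "x \<notin> interior K" if "K \<in> \<K>" for K using intsub[OF that] by blast
      then have "(\<Sum>L\<in>\<K>. indicator (interior L) x :: real) = 0" by (intro sum.neutral) auto
      then show ?thesis using False by simp
    qed
  qed
  have split: "(\<integral>x. indicator (box p q) x * f x \<partial>lebesgue) = (\<Sum>K\<in>\<K>. \<integral>x. indicator (interior K) x * f x \<partial>lebesgue)"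
    if f: "integrable lebesgue (\<lambda>x. indicator (box p q) x * f x)" for f :: "real^'n \<Rightarrow> real"
  proof -
    have fK: "integrable lebesgue (\<lambda>x. indicator (interior K) x * f x)" if "K \<in> \<K>" for K
    proof -
      have "integrable lebesgue (\<lambda>x. (indicator (box p q) x * f x) * indicator (interior K) x)"
        using meas[OF that] by (intro integrable_mult_bounded[OF f, where B=1]) (auto simp: indicator_def fmeasurableD intro!: borel_measurable_indicator)
      moreover have "(\<lambda>x. (indicator (box p q) x * f x) * indicator (interior K) x) = (\<lambda>x. indicator (interior K) x * f x)"
        using intsub[OF that] by (auto simp: indicator_def fun_eq_iff)
      ultimately show ?thesis by simp
    qed
    have "(\<integral>x. indicator (box p q) x * f x \<partial>lebesgue) = (\<integral>x. (\<Sum>K\<in>\<K>. indicator (interior K) x * f x) \<partial>lebesgue)"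
    proof (rule integral_cong_AE)
      show "AE x in lebesgue. indicator (box p q) x * f x = (\<Sum>K\<in>\<K>. indicator (interior K) x * f x)"
        using ind by eventually_elim (simp add: sum_distrib_right)
    qed (use f fK in auto)
    then show ?thesis using fK by (simp add: Bochner_Integration.integral_sum)
  qed
  show ?thesis
  \<comment> \<open>Interiors of cells are open boxes inside \<open>box p q\<close>, so the Poincare
    inequality applies also to cells that meet the boundary.\<close>
  proof (intro exI[of _ "interior ` \<K>"] conjI ballI allI impI)
    show "finite (interior ` \<K>)" using fin by simp
    show "K \<in> lmeasurable" "K \<subseteq> box p q" if "K \<in> interior ` \<K>" for K
      using that meas intsub by auto
    fix u g assume ug: "L2on (box p q) u \<and> is_weak_grad (box p q) u g"
    note u = conjunct1[OF ug] and g = conjunct2[OF ug]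
    define J where "J K = (\<Sum>i\<in>UNIV. \<integral>x. indicator K x * (g x $ i)\<^sup>2 \<partial>lebesgue)" for K
    have cell: "(\<integral>x. indicator (interior K) x * (u x)\<^sup>2 \<partial>lebesgue)
      \<le> (\<integral>x. indicator (interior K) x * u x \<partial>lebesgue)\<^sup>2 / measure lebesgue (interior K) + \<epsilon> * J (interior K)"
      if K: "K \<in> \<K>" for K
    proof -
      obtain a b where ab: "interior K = box a b" using intbox[OF K] by blast
      let ?V = "measure lebesgue (box a b)"
      have "?V * (\<integral>x. indicator (box a b) x * (u x)\<^sup>2 \<partial>lebesgue) \<le> (\<integral>x. indicator (box a b) x * u x \<partial>lebesgue)\<^sup>2
         + 2 ^ CARD('n) * (2 * d)\<^sup>2 * ?V * J (box a b)"
        unfolding J_def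
      proof (rule Poincare_box[OF open_box u g])
        show "box a b \<subseteq> box p q" using intsub[OF K] ab by simp
        show "norm (y - x) \<le> 2 * d" if "x \<in> box a b" "y \<in> box a b" for x y
          by (rule small[OF K]) (use that ab interior_subset[of K] in blast)+
      qed
      then have P: "?V * (\<integral>x. indicator (box a b) x * (u x)\<^sup>2 \<partial>lebesgue) \<le> (\<integral>x. indicator (box a b) x * u x \<partial>lebesgue)\<^sup>2
         + \<epsilon> * ?V * J (box a b)" by (simp only: d(2))
      show ?thesis
      proof (cases "?V = 0")
        case True
        have "box a b \<in> null_sets lebesgue"
          using True by (simp add: negligible_iff_null_sets[symmetric] negligible_iff_measure)
        then have ae: "AE x in lebesgue. x \<notin> box a b" by (rule AE_not_in)
        have "(\<integral>x. indicator (box a b) x * f x \<partial>lebesgue) = 0" for f :: "real^'n \<Rightarrow> real"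
          by (rule integral_eq_zero_AE) (use ae in \<open>eventually_elim, simp\<close>)
        then show ?thesis by (simp add: ab J_def)
      next
        case False
        then have "?V > 0" using measure_nonneg[of lebesgue "box a b"] by linarith
        then show ?thesis using P by (simp add: ab field_simps)
      qed
    qed
    \<comment> \<open>Distinct cells have distinct interiors unless these are empty; degenerate
      cells may coincide there, but contribute 0.\<close>
    have inj: "(\<Sum>K\<in>interior ` \<K>. F K) = (\<Sum>K\<in>\<K>. F (interior K))" if "F {} = 0" for F :: "(real^'n) set \<Rightarrow> real"
    proof (rule sum.reindex_nontrivial[OF fin, THEN trans])
      fix K L assume "K \<in> \<K>" "L \<in> \<K>" "K \<noteq> L" "interior K = interior L"
      then have "interior K = {}" using disj[of K L] by simp
      then show "F (interior K) = 0" using that by simp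
    qed simp
    have "(\<integral>x. indicator (box p q) x * (u x)\<^sup>2 \<partial>lebesgue) = (\<Sum>K\<in>\<K>. \<integral>x. indicator (interior K) x * (u x)\<^sup>2 \<partial>lebesgue)"
      by (rule split[OF L2on_integrable(2)[OF u lmeasurable_box order_refl]])
    also have "\<dots> \<le> (\<Sum>K\<in>\<K>. (\<integral>x. indicator (interior K) x * u x \<partial>lebesgue)\<^sup>2 / measure lebesgue (interior K) + \<epsilon> * J (interior K))"
      by (intro sum_mono cell)
    also have "\<dots> = (\<Sum>K\<in>\<K>. (\<integral>x. indicator (interior K) x * u x \<partial>lebesgue)\<^sup>2 / measure lebesgue (interior K)) + \<epsilon> * (\<Sum>K\<in>\<K>. J (interior K))"
      by (simp add: sum.distrib sum_distrib_left)
    also have "(\<Sum>K\<in>\<K>. J (interior K)) = (\<Sum>i\<in>UNIV. \<integral>x. indicator (box p q) x * (g x $ i)\<^sup>2 \<partial>lebesgue)"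
      unfolding J_def by (subst sum.swap)
        (simp add: split[OF L2on_integrable(2)[OF is_weak_grad_L2on[OF g] lmeasurable_box order_refl]])
    also have "(\<Sum>K\<in>\<K>. (\<integral>x. indicator (interior K) x * u x \<partial>lebesgue)\<^sup>2 / measure lebesgue (interior K))
       = (\<Sum>K\<in>interior ` \<K>. (\<integral>x. indicator K x * u x \<partial>lebesgue)\<^sup>2 / measure lebesgue K)"
      by (rule inj[symmetric]) simp
    finally show "(\<integral>x. indicator (box p q) x * (u x)\<^sup>2 \<partial>lebesgue)
      \<le> (\<Sum>K\<in>interior ` \<K>. (\<integral>x. indicator K x * u x \<partial>lebesgue)\<^sup>2 / measure lebesgue K)
        + \<epsilon> * (\<Sum>i\<in>UNIV. \<integral>x. indicator (box p q) x * (g x $ i)\<^sup>2 \<partial>lebesgue)" .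
  qed
qed

section \<open>Two quadratic forms\<close>

text \<open>Semidefinite on purpose: constants have zero energy. A space of functions with a
  degenerate form stands for the quotient with an inner product, and \<open>a u u = 0\<close> for
  vanishing in that quotient.\<close>

locale psd_form =
  fixes H :: "'v::real_vector set" and a :: "'v \<Rightarrow> 'v \<Rightarrow> real"
  assumes subspace: "subspace H"
    and add_left: "\<And>u v w. u \<in> H \<Longrightarrow> v \<in> H \<Longrightarrow> w \<in> H \<Longrightarrow> a (u + v) w = a u w + a v w"
    and scale_left: "\<And>r u w. u \<in> H \<Longrightarrow> w \<in> H \<Longrightarrow> a (r *\<^sub>R u) w = r * a u w"
    and sym: "\<And>u v. u \<in> H \<Longrightarrow> v \<in> H \<Longrightarrow> a u v = a v u"
    and nonneg: "\<And>u. u \<in> H \<Longrightarrow> 0 \<le> a u u"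
begin

lemma closed: "u \<in> H \<Longrightarrow> v \<in> H \<Longrightarrow> u + v \<in> H" "u \<in> H \<Longrightarrow> r *\<^sub>R u \<in> H" "u \<in> H \<Longrightarrow> v \<in> H \<Longrightarrow> u - v \<in> H"
  using subspace subspace_add subspace_scale subspace_diff by blast+

lemma sum_closed: "(\<And>i. i \<in> F \<Longrightarrow> f i \<in> H) \<Longrightarrow> (\<Sum>i\<in>F. c i *\<^sub>R f i) \<in> H"
  by (rule subspace_sum[OF subspace]) (simp add: closed)

lemma add_right: "u \<in> H \<Longrightarrow> v \<in> H \<Longrightarrow> w \<in> H \<Longrightarrow> a w (u + v) = a w u + a w v"
  using add_left[of u v w] by (simp add: sym closed)

lemma scale_right: "u \<in> H \<Longrightarrow> w \<in> H \<Longrightarrow> a w (r *\<^sub>R u) = r * a w u"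
  using scale_left[of u w r] by (simp add: sym closed)

lemma diff_left: "u \<in> H \<Longrightarrow> v \<in> H \<Longrightarrow> w \<in> H \<Longrightarrow> a (u - v) w = a u w - a v w"
  using add_left[of u "(-1) *\<^sub>R v" w] scale_left[of v w "-1"] closed(2)[of v "-1"] by simp

lemma diff_right: "u \<in> H \<Longrightarrow> v \<in> H \<Longrightarrow> w \<in> H \<Longrightarrow> a w (u - v) = a w u - a w v"
  using diff_left[of u v w] by (simp add: sym closed)

lemma zero_left: "w \<in> H \<Longrightarrow> a 0 w = 0"
  using scale_left[of w w 0] by simp

lemma sum_left:
  assumes "\<And>i. i \<in> F \<Longrightarrow> f i \<in> H" "w \<in> H"
  shows "a (\<Sum>i\<in>F. c i *\<^sub>R f i) w = (\<Sum>i\<in>F. c i * a (f i) w)"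
  using assms
proof (induction F rule: infinite_finite_induct)
  case (insert x F)
  then show ?case using sum_closed[of F f c] by (simp add: add_left scale_left closed)
qed (simp_all add: zero_left)

lemma sum_right:
  assumes "\<And>i. i \<in> F \<Longrightarrow> f i \<in> H" "w \<in> H"
  shows "a w (\<Sum>i\<in>F. c i *\<^sub>R f i) = (\<Sum>i\<in>F. c i * a w (f i))"
proof -
  have "a w (\<Sum>i\<in>F. c i *\<^sub>R f i) = a (\<Sum>i\<in>F. c i *\<^sub>R f i) w"
    by (rule sym[OF assms(2) sum_closed[OF assms(1)]])
  also have "\<dots> = (\<Sum>i\<in>F. c i * a (f i) w)" by (rule sum_left[OF assms(1) assms(2)])
  also have "\<dots> = (\<Sum>i\<in>F. c i * a w (f i))"
    by (rule sum.cong[OF refl]) (simp add: sym[OF assms(1) assms(2)])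
  finally show ?thesis .
qed

lemma expand:
  assumes "u \<in> H" "v \<in> H"
  shows "a (u + t *\<^sub>R v) (u + t *\<^sub>R v) = a u u + 2 * t * a u v + t\<^sup>2 * a v v"
proof -
  have tv: "t *\<^sub>R v \<in> H" and utv: "u + t *\<^sub>R v \<in> H" using assms by (simp_all add: closed)
  have "a (u + t *\<^sub>R v) (u + t *\<^sub>R v) = a u (u + t *\<^sub>R v) + t * a v (u + t *\<^sub>R v)"
    using add_left[OF assms(1) tv utv] scale_left[OF assms(2) utv] by simp
  also have "a u (u + t *\<^sub>R v) = a u u + t * a u v"
    using add_right[OF assms(1) tv assms(1)] scale_right[OF assms(2) assms(1)] by simp
  also have "a v (u + t *\<^sub>R v) = a u v + t * a v v"
    using add_right[OF assms(1) tv assms(2)] scale_right[OF assms(2) assms(2)] sym[OF assms] by simp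
  finally show ?thesis by (simp add: power2_eq_square algebra_simps)
qed

lemma expand_plus:
  assumes "u \<in> H" "v \<in> H" shows "a (u + v) (u + v) = a u u + 2 * a u v + a v v"
  using expand[OF assms, of 1] by simp

lemma scale_square: "u \<in> H \<Longrightarrow> a (r *\<^sub>R u) (r *\<^sub>R u) = r\<^sup>2 * a u u"
  by (simp add: scale_left scale_right closed power2_eq_square)

lemma Cauchy_Schwarz:
  assumes "u \<in> H" "v \<in> H" shows "(a u v)\<^sup>2 \<le> a u u * a v v"
proof (rule nonneg_discriminant)
  fix t :: real
  have "0 \<le> a (u + t *\<^sub>R v) (u + t *\<^sub>R v)" by (intro nonneg closed assms)
  also have "\<dots> = a u u + 2 * t * a u v + t\<^sup>2 * a v v"
    by (rule expand[OF assms])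
  finally show "0 \<le> a u u + 2 * t * a u v + t\<^sup>2 * a v v" .
qed

text \<open>Null vectors lie in the radical of the form; this replaces passing to equivalence
  classes.\<close>

lemma null: assumes "u \<in> H" "v \<in> H" "a u u = 0" shows "a u v = 0"
  using Cauchy_Schwarz[OF assms(1,2)] assms(3) by simp

lemma diff_square:
  assumes "u \<in> H" "v \<in> H" shows "a (u - v) (u - v) = a u u - 2 * a u v + a v v"
  using expand[OF assms, of "-1"] by simp

lemma diff_bound:
  assumes "u \<in> H" "v \<in> H" shows "a (u - v) (u - v) \<le> 2 * a u u + 2 * a v v"
proof -
  have "0 \<le> a (u + v) (u + v)" by (intro nonneg closed assms)
  then show ?thesis unfolding diff_square[OF assms] expand_plus[OF assms] by linarith
qed

lemma tendsto_form:
  assumes w: "\<And>k. w k \<in> H" and \<psi>: "\<psi> \<in> H" "\<delta> \<in> H"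
    and lim: "(\<lambda>k. a (w k - \<psi>) (w k - \<psi>)) \<longlonglongrightarrow> 0"
  shows "(\<lambda>k. a (w k) \<delta>) \<longlonglongrightarrow> a \<psi> \<delta>" and "(\<lambda>k. a (w k) (w k)) \<longlonglongrightarrow> a \<psi> \<psi>"
proof -
  have *: "(\<lambda>k. a (w k) \<delta>) \<longlonglongrightarrow> a \<psi> \<delta>" if \<delta>: "\<delta> \<in> H" for \<delta>
  proof -
    have "(\<lambda>k. (a (w k - \<psi>) \<delta>)\<^sup>2) \<longlonglongrightarrow> 0"
    proof (rule tendsto_sandwich[OF _ _ tendsto_const])
      show "(\<lambda>k. a (w k - \<psi>) (w k - \<psi>) * a \<delta> \<delta>) \<longlonglongrightarrow> 0"
        using tendsto_mult_right[OF lim, of "a \<delta> \<delta>"] by simp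
    qed (auto intro!: always_eventually Cauchy_Schwarz closed w \<psi> \<delta>)
    then have "(\<lambda>k. a (w k) \<delta> - a \<psi> \<delta>) \<longlonglongrightarrow> 0"
      by (simp add: power_tendsto_0_iff diff_left w \<psi> \<delta>)
    then show ?thesis by (rule LIM_zero_cancel)
  qed
  show "(\<lambda>k. a (w k) \<delta>) \<longlonglongrightarrow> a \<psi> \<delta>" by (rule *[OF \<psi>(2)])
  have "(\<lambda>k. a (w k - \<psi>) (w k - \<psi>) + 2 * a (w k) \<psi> - a \<psi> \<psi>) \<longlonglongrightarrow> 0 + 2 * a \<psi> \<psi> - a \<psi> \<psi>"
    by (intro tendsto_intros lim * \<psi>)
  then show "(\<lambda>k. a (w k) (w k)) \<longlonglongrightarrow> a \<psi> \<psi>" by (simp add: diff_square w \<psi>)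
qed

text \<open>Gram-Schmidt: \<open>e\<close> is the new vector minus its projection on the earlier
  ones, not null by independence, and the projection of \<open>u\<close> is corrected along
  \<open>e\<close>. Independence is understood modulo null vectors.\<close>

lemma projection_exists:
  fixes f :: "nat \<Rightarrow> 'v" and n :: nat
  assumes f: "\<And>i. i < n \<Longrightarrow> f i \<in> H"
    and indep: "\<And>c. a (\<Sum>i<n. c i *\<^sub>R f i) (\<Sum>i<n. c i *\<^sub>R f i) = 0 \<Longrightarrow> \<forall>i<n. c i = 0"
    and u: "u \<in> H"
  shows "\<exists>c. \<forall>j<n. a (u - (\<Sum>i<n. c i *\<^sub>R f i)) (f j) = 0"
  using assms
proof (induction n arbitrary: u)
  case (Suc n)
  have fH: "f i \<in> H" if "i < n" for i using Suc.prems(1) that by simp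
  have fn: "f n \<in> H" using Suc.prems(1) by simp
  have SH: "(\<Sum>i<n. c i *\<^sub>R f i) \<in> H" for c by (rule sum_closed) (simp add: fH)
  have ind: "\<forall>i<n. c i = 0" if "a (\<Sum>i<n. c i *\<^sub>R f i) (\<Sum>i<n. c i *\<^sub>R f i) = 0" for c
  proof -
    have "\<forall>i<Suc n. (c(n := 0)) i = 0" using Suc.prems(2)[of "c(n := 0)"] that by simp
    then show ?thesis by (metis fun_upd_other less_SucI less_irrefl)
  qed
  have IH: "\<exists>c. \<forall>j<n. a (w - (\<Sum>i<n. c i *\<^sub>R f i)) (f j) = 0" if "w \<in> H" for w
  proof (rule Suc.IH[OF _ _ that])
    show "f i \<in> H" if "i < n" for i by (rule fH[OF that])
    show "\<forall>i<n. c i = 0" if "a (\<Sum>i<n. c i *\<^sub>R f i) (\<Sum>i<n. c i *\<^sub>R f i) = 0" for c by (rule ind[OF that])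
  qed
  obtain d where d: "\<forall>j<n. a (f n - (\<Sum>i<n. d i *\<^sub>R f i)) (f j) = 0" using IH[OF fn] by blast
  define e where "e = f n - (\<Sum>i<n. d i *\<^sub>R f i)"
  have eH: "e \<in> H" unfolding e_def by (intro closed fn SH)
  have e0: "a e (f j) = 0" if "j < n" for j using d that by (simp add: e_def)
  have ee: "a e e \<noteq> 0"
  proof
    assume "a e e = 0"
    \<comment> \<open>Coefficients expressing \<open>e\<close> in the family; the last one is 1, so
      a null \<open>e\<close> would contradict independence.\<close>
    define d' where "d' i = (if i < n then - d i else 1)" for i
    have eq: "e = (\<Sum>i<Suc n. d' i *\<^sub>R f i)"
      by (simp add: e_def d'_def sum_negf)
    have "\<forall>i<Suc n. d' i = 0"
      by (rule Suc.prems(2)) (simp only: eq[symmetric] \<open>a e e = 0\<close>)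
    then have "d' n = 0" by blast
    then show False by (simp add: d'_def)
  qed
  obtain c where c: "\<forall>j<n. a (u - (\<Sum>i<n. c i *\<^sub>R f i)) (f j) = 0" using IH[OF Suc.prems(3)] by blast
  define u' where "u' = u - (\<Sum>i<n. c i *\<^sub>R f i)"
  have u'H: "u' \<in> H" unfolding u'_def by (intro closed Suc.prems SH)
  define s where "s = a u' e / a e e"
  define v where "v = u' - s *\<^sub>R e"
  have vH: "v \<in> H" unfolding v_def by (intro closed u'H eH)
  have v0: "a v (f j) = 0" if "j < n" for j
    using c that e0[OF that] fH[OF that] unfolding v_def
    by (simp add: diff_left scale_left u'H eH closed) (simp add: u'_def)
  have ve: "a v e = 0" unfolding v_def using ee by (simp add: diff_left scale_left u'H eH closed s_def)
  have fn_eq: "f n = e + (\<Sum>i<n. d i *\<^sub>R f i)" by (simp add: e_def)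
  have "a v (\<Sum>i<n. d i *\<^sub>R f i) = (\<Sum>i<n. d i * a v (f i))"
    by (rule sum_right) (simp_all add: fH vH)
  then have "a v (f n) = a v e + (\<Sum>i<n. d i * a v (f i))"
    unfolding fn_eq add_right[OF eH SH vH] by simp
  then have vn: "a v (f n) = 0" using ve v0 by simp
  define c' where "c' i = (if i < n then c i - s * d i else s)" for i
  have eq: "u - (\<Sum>i<Suc n. c' i *\<^sub>R f i) = v"
    by (simp add: v_def u'_def e_def c'_def algebra_simps sum_subtractf scaleR_sum_right)
  have "a (u - (\<Sum>i<Suc n. c' i *\<^sub>R f i)) (f j) = 0" if "j < Suc n" for j
    unfolding eq using v0[of j] vn that by (cases "j = n") auto
  then show ?case by blast
qed simp

end

section \<open>Elimination and extraction of subsequences\<close>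

text \<open>The unknowns are indexed by \<open>I\<close>, the equations by \<open>j < n\<close>. If
  the last equation is not void, the unknown \<open>p\<close> is eliminated with it and the
  induction hypothesis solves the reduced system. This provides an element of a large span
  orthogonal to a small one.\<close>

lemma linear_system_nontrivial:
  fixes M :: "'i \<Rightarrow> nat \<Rightarrow> real"
  assumes "finite I" "card I > n"
  shows "\<exists>c. (\<exists>i\<in>I. c i \<noteq> 0) \<and> (\<forall>j<n. (\<Sum>i\<in>I. c i * M i j) = 0)"
  using assms
proof (induction n arbitrary: I M)
  case 0
  then have "I \<noteq> {}" by auto
  then show ?case by (intro exI[of _ "\<lambda>_. 1"]) auto
next
  case (Suc n)
  show ?case
  proof (cases "\<forall>i\<in>I. M i n = 0")
    case True
    obtain c where "\<exists>i\<in>I. c i \<noteq> 0" "\<forall>j<n. (\<Sum>i\<in>I. c i * M i j) = 0"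
      using Suc.IH[of I M] Suc.prems by auto
    then show ?thesis using True by (intro exI[of _ c]) (auto simp: less_Suc_eq)
  next
    case False
    then obtain p where p: "p \<in> I" "M p n \<noteq> 0" by blast
    define J where "J = I - {p}"
    have J: "finite J" "card J > n" using Suc.prems p(1) by (auto simp: J_def)
    obtain c' where c': "\<exists>i\<in>J. c' i \<noteq> 0" "\<forall>j<n. (\<Sum>i\<in>J. c' i * (M i j - M i n / M p n * M p j)) = 0"
      using Suc.IH[OF J, of "\<lambda>i j. M i j - M i n / M p n * M p j"] by auto
    define c where "c i = (if i = p then - (\<Sum>i\<in>J. c' i * M i n) / M p n else c' i)" for i
    have split: "(\<Sum>i\<in>I. c i * M i j) = c p * M p j + (\<Sum>i\<in>J. c' i * M i j)" for j
    proof -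
      have "(\<Sum>i\<in>I. c i * M i j) = c p * M p j + (\<Sum>i\<in>J. c i * M i j)"
        unfolding J_def by (rule sum.remove[OF Suc.prems(1) p(1)])
      also have "(\<Sum>i\<in>J. c i * M i j) = (\<Sum>i\<in>J. c' i * M i j)"
        by (rule sum.cong) (auto simp: c_def J_def)
      finally show ?thesis .
    qed
    have cp: "c p = - (\<Sum>i\<in>J. c' i * M i n) / M p n" by (simp add: c_def)
    have "(\<Sum>i\<in>I. c i * M i j) = 0" if "j < Suc n" for j
    proof (cases "j = n")
      case True
      then show ?thesis using p(2) by (simp add: split cp)
    next
      case False
      then have "j < n" using that by simp
      then have "(\<Sum>i\<in>J. c' i * M i j - c' i * M i n * (M p j / M p n)) = 0"
        using c'(2) by (simp add: right_diff_distrib mult.commute mult.left_commute)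
      then have "(\<Sum>i\<in>J. c' i * M i j) = (\<Sum>i\<in>J. c' i * M i n) * (M p j / M p n)"
        by (simp only: sum_subtractf sum_distrib_right[symmetric] eq_iff_diff_eq_0[symmetric])
      then show ?thesis by (simp add: split cp)
    qed
    moreover have "\<exists>i\<in>I. c i \<noteq> 0"
    proof -
      obtain i where "i \<in> J" "c' i \<noteq> 0" using c'(1) by blast
      then have "i \<in> I" "c i \<noteq> 0" by (auto simp: J_def c_def)
      then show ?thesis by blast
    qed
    ultimately show ?thesis by blast
  qed
qed

lemma simultaneous_convergent_subsequence:
  fixes f :: "nat \<Rightarrow> nat \<Rightarrow> real"
  assumes "\<And>j k. j < N \<Longrightarrow> \<bar>f j k\<bar> \<le> B"
  shows "\<exists>r. strict_mono r \<and> (\<forall>j<N. convergent (\<lambda>k. f j (r k)))"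
  using assms
proof (induction N)
  case 0
  then show ?case by (intro exI[of _ id]) (auto simp: strict_mono_def)
next
  case (Suc N)
  obtain r where r: "strict_mono r" "\<forall>j<N. convergent (\<lambda>k. f j (r k))"
    using Suc.IH Suc.prems by auto
  have "bounded (range (\<lambda>k. f N (r k)))" using Suc.prems by (auto simp: bounded_iff)
  then obtain l s where s: "strict_mono s" "((\<lambda>k. f N (r k)) \<circ> s) \<longlonglongrightarrow> l"
    using bounded_imp_convergent_subsequence by blast
  have "convergent (\<lambda>k. f j (r (s k)))" if "j < Suc N" for j
  proof (cases "j = N")
    case True
    then show ?thesis using convergentI[OF s(2)] by (simp add: o_def)
  next
    case False
    then have "convergent (\<lambda>k. f j (r k))" using that r(2) by simp
    from convergent_subseq_convergent[OF this s(1)] show ?thesis by (simp add: o_def)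
  qed
  then show ?case
    using strict_mono_o[OF r(1) s(1)] by (intro exI[of _ "r \<circ> s"]) (simp add: o_def)
qed

section \<open>The spectral argument for a form compact relative to another\<close>

text \<open>\<open>compact\<close> is compactness in quantitative form: up to finitely many bounded
  functionals, \<open>b\<close> is an arbitrarily small multiple of \<open>a\<close>. The
  functionals are evaluated at differences of a sequence, hence compatibility with subtraction.
  \<open>exhaustive\<close> says that eigenvectors for a positive value are, up to null vectors,
  combinations of listed ones with that value.\<close>

locale compact_pair = A: psd_form H a + B: psd_form H b
  for H :: "'v::real_vector set" and a b :: "'v \<Rightarrow> 'v \<Rightarrow> real" +
  fixes lam :: "nat \<Rightarrow> real" and \<phi> :: "nat \<Rightarrow> 'v"
  assumes b_le: "\<And>u. u \<in> H \<Longrightarrow> b u u \<le> a u u"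
    and complete: "\<And>u :: nat \<Rightarrow> 'v. (\<And>k. u k \<in> H) \<Longrightarrow>
        (\<And>e. e > 0 \<Longrightarrow> \<exists>N. \<forall>m\<ge>N. \<forall>n\<ge>N. a (u m - u n) (u m - u n) < e) \<Longrightarrow>
        \<exists>v\<in>H. (\<lambda>k. a (u k - v) (u k - v)) \<longlonglongrightarrow> 0"
    and compact: "\<And>\<epsilon>. \<epsilon> > 0 \<Longrightarrow> \<exists>N l C K. 0 \<le> C \<and>
        (\<forall>j<(N::nat). \<forall>u\<in>H. \<forall>v\<in>H. l j (u - v) = (l j u :: real) - l j v) \<and>
        (\<forall>j<N. \<forall>u\<in>H. (l j u)\<^sup>2 \<le> K * a u u) \<and>
        (\<forall>u\<in>H. b u u \<le> \<epsilon> * a u u + C * (\<Sum>j<N. (l j u)\<^sup>2))"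
    and eigen_H: "\<And>i. \<phi> i \<in> H"
    and eigen: "\<And>i \<delta>. \<delta> \<in> H \<Longrightarrow> b (\<phi> i) \<delta> = lam i * a (\<phi> i) \<delta>"
    and decr: "\<And>i. lam (Suc i) \<le> lam i"
    and indep: "\<And>m c. a (\<Sum>j<m. c j *\<^sub>R \<phi> j) (\<Sum>j<m. c j *\<^sub>R \<phi> j) = 0 \<Longrightarrow> \<forall>j<m. c j = 0"
    and exhaustive: "\<And>\<mu> \<psi>. \<mu> > 0 \<Longrightarrow> \<psi> \<in> H \<Longrightarrow> (\<And>\<delta>. \<delta> \<in> H \<Longrightarrow> b \<psi> \<delta> = \<mu> * a \<psi> \<delta>) \<Longrightarrow>
        \<exists>F d. finite F \<and> F \<subseteq> {i. lam i = \<mu>} \<and>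
          a (\<psi> - (\<Sum>i\<in>F. d i *\<^sub>R \<phi> i)) (\<psi> - (\<Sum>i\<in>F. d i *\<^sub>R \<phi> i)) = 0"
begin

lemma comb_H: "(\<Sum>j<m. c j *\<^sub>R \<phi> j) \<in> H"
  by (rule A.sum_closed) (rule eigen_H)

lemma eigen_pos: "0 < a (\<phi> i) (\<phi> i)"
proof -
  have eq: "(\<Sum>j<Suc i. (if j = i then 1 else 0) *\<^sub>R \<phi> j) = \<phi> i"
    by (simp add: if_distrib[of "\<lambda>c. c *\<^sub>R _"] cong: if_cong)
  have "a (\<phi> i) (\<phi> i) \<noteq> 0"
  proof
    assume z: "a (\<phi> i) (\<phi> i) = 0"
    have "\<forall>j<Suc i. (if j = i then 1 else 0 :: real) = 0" by (rule indep) (simp only: eq z)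
    then have "(if i = i then 1 else 0 :: real) = 0" by blast
    then show False by simp
  qed
  then show ?thesis using A.nonneg[OF eigen_H] by (simp add: order_less_le)
qed

lemma lam_nonneg: "0 \<le> lam i"
  using eigen[OF eigen_H, of i i] B.nonneg[OF eigen_H, of i] eigen_pos[of i]
  by (simp add: zero_le_mult_iff)

lemma lam_antimono: "i \<le> j \<Longrightarrow> lam j \<le> lam i"
  by (rule lift_Suc_antimono_le[of lam]) (rule decr)

text \<open>Add one eigenvector at a time. Since the family need not be orthogonal, the cross term
  stays, but the eigenvalue equation turns it and the new square into exactly
  \<open>lam (Suc m)\<close> times their \<open>a\<close>-counterparts; the old part is covered by
  monotonicity of \<open>lam\<close>.\<close>

lemma lower_bound_span: "lam m * a (\<Sum>j<Suc m. c j *\<^sub>R \<phi> j) (\<Sum>j<Suc m. c j *\<^sub>R \<phi> j)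
    \<le> b (\<Sum>j<Suc m. c j *\<^sub>R \<phi> j) (\<Sum>j<Suc m. c j *\<^sub>R \<phi> j)"
proof (induction m)
  case 0
  show ?case using eigen_H[of 0] by (simp add: A.scale_square B.scale_square eigen)
next
  case (Suc m)
  let ?u = "\<Sum>j<Suc m. c j *\<^sub>R \<phi> j" and ?f = "\<phi> (Suc m)" and ?c = "c (Suc m)" and ?l = "lam (Suc m)"
  have uH: "?u \<in> H" by (rule comb_H)
  have fH: "?f \<in> H" by (rule eigen_H)
  have A: "a (?u + ?c *\<^sub>R ?f) (?u + ?c *\<^sub>R ?f) = a ?u ?u + 2 * ?c * a ?f ?u + ?c\<^sup>2 * a ?f ?f"
    unfolding A.expand[OF uH fH] A.sym[OF uH fH] by (rule refl)
  have B: "b (?u + ?c *\<^sub>R ?f) (?u + ?c *\<^sub>R ?f) = b ?u ?u + 2 * ?c * (?l * a ?f ?u) + ?c\<^sup>2 * (?l * a ?f ?f)"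
    unfolding B.expand[OF uH fH] B.sym[OF uH fH] eigen[OF uH] eigen[OF fH] by (rule refl)
  have "?l * a ?u ?u \<le> lam m * a ?u ?u" by (intro mult_right_mono decr A.nonneg uH)
  also have "\<dots> \<le> b ?u ?u" by (rule Suc.IH)
  finally have "?l * (a ?u ?u + 2 * ?c * a ?f ?u + ?c\<^sup>2 * a ?f ?f)
     \<le> b ?u ?u + 2 * ?c * (?l * a ?f ?u) + ?c\<^sup>2 * (?l * a ?f ?f)"
    by (simp add: algebra_simps)
  then have "?l * a (?u + ?c *\<^sub>R ?f) (?u + ?c *\<^sub>R ?f) \<le> b (?u + ?c *\<^sub>R ?f) (?u + ?c *\<^sub>R ?f)"
    unfolding A B .
  then show ?case by (simp only: sum.lessThan_Suc[of _ "Suc m"])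
qed

definition perp :: "nat \<Rightarrow> 'v set" where
  "perp n = {u \<in> H. \<forall>j<n. a u (\<phi> j) = 0}"

lemma perp_subspace: "subspace (perp n)"
  unfolding perp_def subspace_def
  using A.subspace by (auto simp: subspace_def A.add_left A.scale_left A.zero_left eigen_H)

lemma decompose:
  assumes "u \<in> H" shows "\<exists>c. u - (\<Sum>i<n. c i *\<^sub>R \<phi> i) \<in> perp n"
proof -
  have "\<exists>c. \<forall>j<n. a (u - (\<Sum>i<n. c i *\<^sub>R \<phi> i)) (\<phi> j) = 0"
    by (rule A.projection_exists[OF eigen_H indep assms])
  then show ?thesis using A.closed(3)[OF assms comb_H] by (auto simp: perp_def)
qed

text \<open>A maximising sequence for \<open>b / a\<close> on \<open>perp n\<close> is Cauchy along a subsequence: with \<open>\<mu>\<close> the supremum,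
  \<open>\<mu> a - b\<close> is nonnegative and tends to zero along it, while \<open>b\<close> is at most \<open>\<mu>/2 a\<close> up to finitely many
  functionals. The limit is an eigenfunction for \<open>\<mu>\<close>, which is impossible if \<open>\<mu> > lam n\<close>.\<close>

lemma perp_bound:
  assumes v: "v \<in> perp n" shows "b v v \<le> lam n * a v v"
proof (rule ccontr)
  assume "\<not> ?thesis"
  then have bv: "b v v > lam n * a v v" by simp
  have VH: "u \<in> H" if "u \<in> perp n" for u using that by (simp add: perp_def)
  have Vs: "r *\<^sub>R u \<in> perp n" if "u \<in> perp n" for r u using subspace_scale[OF perp_subspace that] .
  define X where "X = {b u u | u. u \<in> perp n \<and> a u u = 1}"
  have bdd: "bdd_above X"
    unfolding X_def bdd_above_def by (intro exI[of _ 1]) (use b_le[OF VH] in force)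
  define \<mu> where "\<mu> = Sup X"
  have scale_b: "b u u \<le> \<mu> * a u u" if u: "u \<in> perp n" for u
  proof (cases "a u u = 0")
    case True
    then show ?thesis using b_le[OF VH[OF u]] by simp
  next
    case False
    then have pos: "a u u > 0" using A.nonneg[OF VH[OF u]] by simp
    define w where "w = (1 / sqrt (a u u)) *\<^sub>R u"
    have "a w w = 1" "b w w = b u u / a u u"
      using pos VH[OF u] by (simp_all add: w_def A.scale_square B.scale_square power_divide)
    then have "b u u / a u u \<in> X" using Vs[OF u] unfolding X_def w_def by force
    then have "b u u / a u u \<le> \<mu>" unfolding \<mu>_def using bdd by (rule cSup_upper)
    then show ?thesis using pos by (simp add: field_simps)
  qed
  have av: "a v v > 0"
    using bv b_le[OF VH[OF v]] A.nonneg[OF VH[OF v]] by (cases "a v v = 0") auto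
  have \<mu>: "\<mu> > lam n"
  proof -
    have "lam n * a v v < \<mu> * a v v" using bv scale_b[OF v] by linarith
    then show ?thesis using av by simp
  qed
  then have \<mu>0: "\<mu> > 0" using lam_nonneg[of n] by linarith
  have Xne: "X \<noteq> {}"
  proof -
    have "a ((1 / sqrt (a v v)) *\<^sub>R v) ((1 / sqrt (a v v)) *\<^sub>R v) = 1"
      using av VH[OF v] by (simp add: A.scale_square power_divide)
    then show ?thesis using Vs[OF v] unfolding X_def by blast
  qed
  have "\<exists>u. u \<in> perp n \<and> a u u = 1 \<and> \<mu> - 1 / Suc k < b u u" for k
  proof -
    have "\<mu> - 1 / Suc k < Sup X" by (simp add: \<mu>_def)
    then obtain x where "x \<in> X" "\<mu> - 1 / Suc k < x" using less_cSup_iff[OF Xne bdd] by blast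
    then show ?thesis unfolding X_def by blast
  qed
  then obtain v' where v': "\<And>k. v' k \<in> perp n" "\<And>k. a (v' k) (v' k) = 1" "\<And>k. \<mu> - 1 / Suc k < b (v' k) (v' k)"
    by metis
  interpret q: psd_form "perp n" "\<lambda>u v. \<mu> * a u v - b u v"
    by unfold_locales
      (use scale_b VH perp_subspace in \<open>auto simp: A.add_left B.add_left A.scale_left B.scale_left A.sym B.sym algebra_simps\<close>)
  obtain N l C K where C: "0 \<le> C"
    and ld: "\<forall>j<(N::nat). \<forall>u\<in>H. \<forall>v\<in>H. l j (u - v) = (l j u :: real) - l j v"
    and lb: "\<forall>j<N. \<forall>u\<in>H. (l j u)\<^sup>2 \<le> K * a u u"
    and be: "\<forall>u\<in>H. b u u \<le> \<mu> / 2 * a u u + C * (\<Sum>j<N. (l j u)\<^sup>2)"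
    using compact[of "\<mu> / 2"] \<mu>0 by auto
  have "\<bar>l j (v' k)\<bar> \<le> sqrt K" if "j < N" for j k
  proof (rule real_le_rsqrt)
    have "(l j (v' k))\<^sup>2 \<le> K * a (v' k) (v' k)" using lb that VH[OF v'(1)] by blast
    then show "\<bar>l j (v' k)\<bar>\<^sup>2 \<le> K" by (simp add: v'(2))
  qed
  then obtain r where r: "strict_mono r" "\<forall>j<N. convergent (\<lambda>k. l j (v' (r k)))"
    using simultaneous_convergent_subsequence[of N "\<lambda>j k. l j (v' k)" "sqrt K"] by blast
  define w where "w k = v' (r k)" for k
  have wV: "w k \<in> perp n" and wH: "w k \<in> H" and w1: "a (w k) (w k) = 1" for k
    using v' VH by (auto simp: w_def)
  have wq: "\<mu> * a (w k) (w k) - b (w k) (w k) \<le> 1 / Suc k" for k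
  proof -
    have "1 / real (Suc (r k)) \<le> 1 / Suc k" using seq_suble[OF r(1), of k] by (simp add: frac_le)
    then show ?thesis using v'(3)[of "r k"] w1[of k] by (simp add: w_def)
  qed
  obtain L where L: "\<And>j. j < N \<Longrightarrow> (\<lambda>k. l j (w k)) \<longlonglongrightarrow> L j"
    using r(2) unfolding convergent_def w_def by metis
  define t where "t m = 2 / Suc m + 2 * C * (\<Sum>j<N. (l j (w m) - L j)\<^sup>2)" for m
  have t0: "t \<longlonglongrightarrow> 0"
  proof -
    have "(\<lambda>m. 2 * inverse (real (Suc m)) + 2 * C * (\<Sum>j<N. (l j (w m) - L j)\<^sup>2)) \<longlonglongrightarrow> 2 * 0 + 2 * C * (\<Sum>j<N. (L j - L j)\<^sup>2)"
      by (intro tendsto_add tendsto_mult tendsto_const tendsto_sum tendsto_power tendsto_diff L LIMSEQ_inverse_real_of_nat) auto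
    then show ?thesis by (simp add: t_def[abs_def] divide_inverse)
  qed
  \<comment> \<open>\<open>q.diff_bound\<close> bounds the form of the difference by
    \<open>2 / Suc m + 2 / Suc k\<close>; inserting compactness at level \<open>\<mu> / 2\<close>
    leaves half of \<open>\<mu> * a\<close> on the left and splits the right side into a part for
    each index.\<close>
  have Cauchy_bound: "\<mu> / 2 * a (w m - w k) (w m - w k) \<le> t m + t k" for m k
  proof -
    let ?d = "w m - w k"
    have dH: "?d \<in> H" by (intro A.closed wH)
    have "\<mu> * a ?d ?d - b ?d ?d \<le> 2 / Suc m + 2 / Suc k"
      using q.diff_bound[OF wV wV, of m k] wq[of m] wq[of k] by simp
    moreover have "b ?d ?d \<le> \<mu> / 2 * a ?d ?d + C * (\<Sum>j<N. (l j ?d)\<^sup>2)" using be dH by blast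
    moreover have "C * (\<Sum>j<N. (l j ?d)\<^sup>2)
      \<le> C * (\<Sum>j<N. 2 * (l j (w m) - L j)\<^sup>2 + 2 * (l j (w k) - L j)\<^sup>2)"
    proof (intro mult_left_mono sum_mono C)
      fix j assume "j \<in> {..<N}"
      then have ldj: "l j ?d = l j (w m) - l j (w k)" using ld wH by simp
      show "(l j ?d)\<^sup>2 \<le> 2 * (l j (w m) - L j)\<^sup>2 + 2 * (l j (w k) - L j)\<^sup>2"
        unfolding ldj
        using zero_le_power2[of "(l j (w m) - L j) + (l j (w k) - L j)"] by (simp add: power2_eq_square algebra_simps)
    qed
    moreover have "C * (\<Sum>j<N. 2 * (l j (w m) - L j)\<^sup>2 + 2 * (l j (w k) - L j)\<^sup>2)
      = 2 * C * (\<Sum>j<N. (l j (w m) - L j)\<^sup>2) + 2 * C * (\<Sum>j<N. (l j (w k) - L j)\<^sup>2)"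
      by (simp add: sum.distrib sum_distrib_left distrib_left mult_ac)
    ultimately show ?thesis unfolding t_def by linarith
  qed
  have "\<exists>M. \<forall>m\<ge>M. \<forall>k\<ge>M. a (w m - w k) (w m - w k) < e" if e: "e > 0" for e
  proof -
    have "\<forall>\<^sub>F m in sequentially. t m < \<mu> / 4 * e" using t0 \<mu>0 e by (intro order_tendstoD) auto
    then obtain M where M: "\<And>m. m \<ge> M \<Longrightarrow> t m < \<mu> / 4 * e" by (auto simp: eventually_sequentially)
    have "a (w m - w k) (w m - w k) < e" if "m \<ge> M" "k \<ge> M" for m k
    proof -
      have "\<mu> / 2 * a (w m - w k) (w m - w k) < \<mu> / 2 * e"
        using Cauchy_bound[of m k] M[OF that(1)] M[OF that(2)] by linarith
      then show ?thesis using \<mu>0 by simp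
    qed
    then show ?thesis by blast
  qed
  then obtain \<psi> where \<psi>H: "\<psi> \<in> H" and \<psi>: "(\<lambda>k. a (w k - \<psi>) (w k - \<psi>)) \<longlonglongrightarrow> 0"
    using complete[of w] wH by blast
  have \<psi>b: "(\<lambda>k. b (w k - \<psi>) (w k - \<psi>)) \<longlonglongrightarrow> 0"
    by (rule tendsto_sandwich[OF _ _ tendsto_const \<psi>])
      (auto intro!: always_eventually B.nonneg b_le A.closed wH \<psi>H)
  have \<psi>1: "a \<psi> \<psi> = 1"
    using A.tendsto_form(2)[OF wH \<psi>H \<psi>H \<psi>] by (simp add: w1 LIMSEQ_const_iff)
  have \<psi>0: "a \<psi> (\<phi> j) = 0" if "j < n" for j
  proof -
    have "a (w k) (\<phi> j) = 0" for k using wV[of k] that by (simp add: perp_def)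
    then show ?thesis using A.tendsto_form(1)[OF wH \<psi>H eigen_H \<psi>, of j] by (simp add: LIMSEQ_const_iff)
  qed
  have \<psi>V: "\<psi> \<in> perp n" using \<psi>H \<psi>0 by (simp add: perp_def)
  have "(\<lambda>k. \<mu> - inverse (real (Suc k))) \<longlonglongrightarrow> \<mu> - 0"
    by (intro tendsto_intros LIMSEQ_inverse_real_of_nat)
  moreover have "\<mu> - inverse (real (Suc k)) \<le> b (w k) (w k)" for k
    using wq[of k] by (simp add: w1 divide_inverse)
  ultimately have "\<mu> - 0 \<le> b \<psi> \<psi>"
    by (intro LIMSEQ_le[OF _ B.tendsto_form(2)[OF wH \<psi>H \<psi>H \<psi>b]]) auto
  then have q0: "\<mu> * a \<psi> \<psi> - b \<psi> \<psi> = 0" using q.nonneg[OF \<psi>V] \<psi>1 by simp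
  \<comment> \<open>As a null vector of \<open>\<mu> a - b\<close>, \<open>\<psi>\<close> satisfies
    the equation against \<open>perp n\<close>. Against the span of the first \<open>n\<close>
    eigenvectors both sides vanish, the \<open>b\<close>-side by the eigenvalue equation of those
    vectors.\<close>
  have eig: "b \<psi> \<delta> = \<mu> * a \<psi> \<delta>" if \<delta>: "\<delta> \<in> H" for \<delta>
  proof -
    obtain c where c: "\<delta> - (\<Sum>i<n. c i *\<^sub>R \<phi> i) \<in> perp n" using decompose[OF \<delta>] by blast
    have "\<mu> * a \<psi> (\<delta> - (\<Sum>i<n. c i *\<^sub>R \<phi> i)) - b \<psi> (\<delta> - (\<Sum>i<n. c i *\<^sub>R \<phi> i)) = 0"
      by (rule q.null[OF \<psi>V c q0])
    moreover have "a \<psi> (\<Sum>i<n. c i *\<^sub>R \<phi> i) = 0"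
      using \<psi>0 by (simp add: A.sum_right eigen_H \<psi>H)
    moreover have "b \<psi> (\<Sum>i<n. c i *\<^sub>R \<phi> i) = 0"
      using \<psi>0 by (simp add: B.sum_right eigen_H \<psi>H B.sym[OF \<psi>H eigen_H] eigen A.sym[OF eigen_H \<psi>H])
    ultimately show ?thesis by (simp add: A.diff_right B.diff_right \<psi>H \<delta> comb_H)
  qed
  obtain F d where F: "finite F" "F \<subseteq> {i. lam i = \<mu>}"
    "a (\<psi> - (\<Sum>i\<in>F. d i *\<^sub>R \<phi> i)) (\<psi> - (\<Sum>i\<in>F. d i *\<^sub>R \<phi> i)) = 0"
    using exhaustive[OF \<mu>0 \<psi>H eig] by blast
  have FH: "(\<Sum>i\<in>F. d i *\<^sub>R \<phi> i) \<in> H" by (rule A.sum_closed) (rule eigen_H)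
  \<comment> \<open>The listed eigenvectors for \<open>\<mu> > lam n\<close> have index below
    \<open>n\<close>, so \<open>\<psi>\<close> is orthogonal to all of them and yet equals a
    combination of them up to a null vector.\<close>
  have "a \<psi> (\<phi> i) = 0" if "i \<in> F" for i
  proof (rule \<psi>0, rule ccontr)
    assume "\<not> i < n"
    then have "lam i \<le> lam n" by (intro lam_antimono) simp
    then show False using F(2) that \<mu> by auto
  qed
  then have "a \<psi> (\<Sum>i\<in>F. d i *\<^sub>R \<phi> i) = 0" by (simp add: A.sum_right eigen_H \<psi>H)
  moreover have "a (\<psi> - (\<Sum>i\<in>F. d i *\<^sub>R \<phi> i)) \<psi> = 0"
    by (rule A.null[OF A.closed(3)[OF \<psi>H FH] \<psi>H F(3)])
  ultimately have "a \<psi> \<psi> = 0" by (simp add: A.diff_left \<psi>H FH A.sym[OF FH \<psi>H])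
  then show False using \<psi>1 by simp
qed

lemma upper_bound:
  assumes u: "u \<in> H"
  shows "\<exists>c. b (u - (\<Sum>i<n. c i *\<^sub>R \<phi> i)) (u - (\<Sum>i<n. c i *\<^sub>R \<phi> i)) \<le> lam n * a u u"
proof -
  obtain c where c: "u - (\<Sum>i<n. c i *\<^sub>R \<phi> i) \<in> perp n" using decompose[OF u] by blast
  let ?v = "u - (\<Sum>i<n. c i *\<^sub>R \<phi> i)" and ?s = "\<Sum>i<n. c i *\<^sub>R \<phi> i"
  have vH: "?v \<in> H" using c by (simp add: perp_def)
  have "a ?v ?s = 0" using c by (simp add: A.sum_right eigen_H vH perp_def)
  moreover have "a (?v + ?s) (?v + ?s) = a ?v ?v + 2 * a ?v ?s + a ?s ?s"
    by (rule A.expand_plus[OF vH comb_H])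
  ultimately have "a ?v ?v \<le> a u u" using A.nonneg[OF comb_H[of c n]] by simp
  then have "lam n * a ?v ?v \<le> lam n * a u u" by (rule mult_left_mono[OF _ lam_nonneg])
  then show ?thesis using perp_bound[OF c] by (intro exI[of _ c]) linarith
qed

end

section \<open>Functions as a real vector space with pointwise operations\<close>

instantiation "fun" :: (type, real_vector) real_vector
begin

definition scaleR_fun_def: "r *\<^sub>R f = (\<lambda>x. r *\<^sub>R f x)"

instance
  by standard (auto simp: scaleR_fun_def fun_eq_iff algebra_simps)

end

lemma scaleR_fun_apply [simp]: "(r *\<^sub>R f) x = r *\<^sub>R f x"
  by (simp add: scaleR_fun_def)

lemma sum_fun_apply [simp]: "(\<Sum>i\<in>I. f i) x = (\<Sum>i\<in>I. f i x)"
  by (induction I rule: infinite_finite_induct) auto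

section \<open>The energy form\<close>

definition L2field :: "(real^'n::finite) set \<Rightarrow> (real^'n \<Rightarrow> real^'n) set" where
  "L2field S = {p. \<forall>i. L2on S (\<lambda>x. p x $ i)}"

definition sqnorm :: "(real^'n::finite) set \<Rightarrow> (real^'n \<Rightarrow> real^'n) \<Rightarrow> real" where
  "sqnorm S p = (\<Sum>i\<in>UNIV. \<integral>x. indicator S x * (p x $ i)\<^sup>2 \<partial>lebesgue)"

lemma L2fieldD: "p \<in> L2field S \<Longrightarrow> L2on S (\<lambda>x. p x $ i)"
  by (simp add: L2field_def)

lemma L2on_zero: "L2on S (\<lambda>x. 0)"
  by (simp add: L2on_def L2_zero)

lemma L2on_sum: "(\<And>i. i \<in> I \<Longrightarrow> L2on S (f i)) \<Longrightarrow> L2on S (\<lambda>x. \<Sum>i\<in>I. f i x)"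
  by (induction I rule: infinite_finite_induct) (auto intro: L2on_add L2on_zero)

lemma L2field_subspace: "subspace (L2field S)"
  unfolding subspace_def L2field_def by (auto intro: L2on_add L2on_cmult L2on_zero)

lemma L2on_integrable_square: "L2on S f \<Longrightarrow> integrable lebesgue (\<lambda>x. indicator S x * (f x)\<^sup>2)"
  using L2_integrable_square[of lebesgue "\<lambda>x. indicator S x * f x"]
  by (simp add: L2on_def indicator_mult_square)

lemma L2on_integrable_mult:
  assumes "L2on S f" "L2on S g" shows "integrable lebesgue (\<lambda>x. indicator S x * (f x * g x))"
proof -
  have "(\<lambda>x. (indicator S x * f x) * (indicator S x * g x)) = (\<lambda>x. indicator S x * (f x * g x) :: real)"
    by (auto simp: indicator_def)
  then show ?thesis using L2_integrable_mult[of lebesgue "\<lambda>x. indicator S x * f x" "\<lambda>x. indicator S x * g x"] assms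
    by (simp add: L2on_def)
qed

lemma sqnorm_nonneg: "0 \<le> sqnorm S p"
  unfolding sqnorm_def by (intro sum_nonneg integral_nonneg_AE) simp

lemma sqnorm_eq:
  assumes "p \<in> L2field S"
  shows "sqnorm S p = (\<integral>x. indicator S x * (norm (p x))\<^sup>2 \<partial>lebesgue)"
    and "integrable lebesgue (\<lambda>x. indicator S x * (norm (p x))\<^sup>2)"
proof -
  have e: "indicator S x * (norm (p x))\<^sup>2 = (\<Sum>i\<in>UNIV. indicator S x * (p x $ i)\<^sup>2)" for x
    by (simp only: norm_vec_def L2_set_def real_norm_def power2_abs sum_distrib_left
        real_sqrt_pow2[OF sum_nonneg[OF zero_le_power2]])
  show "integrable lebesgue (\<lambda>x. indicator S x * (norm (p x))\<^sup>2)"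
    unfolding e by (intro Bochner_Integration.integrable_sum L2on_integrable_square L2fieldD assms)
  show "sqnorm S p = (\<integral>x. indicator S x * (norm (p x))\<^sup>2 \<partial>lebesgue)"
    unfolding e sqnorm_def
    by (rule Bochner_Integration.integral_sum[symmetric]) (intro L2on_integrable_square L2fieldD assms)
qed

lemma grad_fun_nth [simp]: "grad_fun f x $ i = partial i f x"
  by (simp add: grad_fun_def)

lemma L2on_test_fun:
  assumes "test_fun S f" shows "L2on S f"
proof -
  have "(\<lambda>x. indicator S x * f x) = f" using test_fun_indicator[OF assms] by auto
  then show ?thesis using test_fun_L2[OF assms] by (simp add: L2on_def)
qed

lemma grad_fun_L2field: "test_fun S f \<Longrightarrow> grad_fun f \<in> L2field S"
  by (simp add: L2field_def L2on_test_fun test_fun_partial)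

lemma is_weak_grad_L2field: "is_weak_grad S u g \<Longrightarrow> g \<in> L2field S"
  by (simp add: L2field_def is_weak_grad_L2on)

lemma is_weak_grad_lincomb:
  assumes u: "L2on S u" "is_weak_grad S u g" and v: "L2on S v" "is_weak_grad S v h"
  shows "is_weak_grad S (u + r *\<^sub>R v) (g + r *\<^sub>R h)"
proof (rule is_weak_gradI)
  show "L2on S (\<lambda>x. (g + r *\<^sub>R h) x $ i)" for i
    using L2on_add[OF is_weak_grad_L2on[OF u(2)] L2on_cmult[OF is_weak_grad_L2on[OF v(2)]], of i r i] by simp
  fix \<phi> i assume \<phi>: "test_fun S \<phi>"
  note P = test_fun_partial[OF \<phi>, of i]
  have "(\<integral>x. (u + r *\<^sub>R v) x * partial i \<phi> x \<partial>lebesgue)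
      = (\<integral>x. u x * partial i \<phi> x \<partial>lebesgue) + r * (\<integral>x. v x * partial i \<phi> x \<partial>lebesgue)"
    using L2on_mult_test(3)[OF u(1) P] L2on_mult_test(3)[OF v(1) P] by (simp add: distrib_right mult.assoc)
  also have "\<dots> = - ((\<integral>x. g x $ i * \<phi> x \<partial>lebesgue) + r * (\<integral>x. h x $ i * \<phi> x \<partial>lebesgue))"
    using is_weak_grad_integral[OF u(2) \<phi>] is_weak_grad_integral[OF v(2) \<phi>] by simp
  also have "(\<integral>x. g x $ i * \<phi> x \<partial>lebesgue) + r * (\<integral>x. h x $ i * \<phi> x \<partial>lebesgue)
      = (\<integral>x. (g + r *\<^sub>R h) x $ i * \<phi> x \<partial>lebesgue)"
    using L2on_mult_test(3)[OF is_weak_grad_L2on[OF u(2)] \<phi>] L2on_mult_test(3)[OF is_weak_grad_L2on[OF v(2)] \<phi>]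
    by (simp add: distrib_right mult.assoc)
  finally show "(\<integral>x. (u + r *\<^sub>R v) x * partial i \<phi> x \<partial>lebesgue) = - (\<integral>x. (g + r *\<^sub>R h) x $ i * \<phi> x \<partial>lebesgue)" .
qed

lemma is_weak_grad_smooth:
  assumes "smooth_fun f" "grad_fun f \<in> L2field S" shows "is_weak_grad S f (grad_fun f)"
  by (rule is_weak_gradI) (use assms integration_by_parts_smooth in \<open>auto simp: L2field_def\<close>)

lemma is_weak_grad_AE_cong:
  assumes g: "is_weak_grad S u g" and u: "L2on S u" "L2on S v"
    and ae: "AE x in lebesgue. x \<in> S \<longrightarrow> u x = v x"
  shows "is_weak_grad S v g"
proof (rule is_weak_gradI)
  show "L2on S (\<lambda>x. g x $ i)" for i by (rule is_weak_grad_L2on[OF g])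
  fix \<phi> i assume \<phi>: "test_fun S \<phi>"
  note P = test_fun_partial[OF \<phi>, of i]
  have "(\<integral>x. v x * partial i \<phi> x \<partial>lebesgue) = (\<integral>x. u x * partial i \<phi> x \<partial>lebesgue)"
  proof (rule integral_cong_AE)
    show "AE x in lebesgue. v x * partial i \<phi> x = u x * partial i \<phi> x"
      using ae by eventually_elim (use test_fun_outside[OF P] in auto)
  qed (use L2on_mult_test(1)[OF _ P] u in \<open>auto simp: L2_def\<close>)
  then show "(\<integral>x. v x * partial i \<phi> x \<partial>lebesgue) = - (\<integral>x. g x $ i * \<phi> x \<partial>lebesgue)"
    using is_weak_grad_integral[OF g \<phi>] by simp
qed

lemma is_weak_grad_subset:
  assumes g: "is_weak_grad S u g" and T: "T \<subseteq> S" "T \<in> sets lebesgue"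
  shows "is_weak_grad T u g"
proof (rule is_weak_gradI)
  show "L2on T (\<lambda>x. g x $ i)" for i by (rule L2on_subset[OF is_weak_grad_L2on[OF g] T])
  show "(\<integral>x. u x * partial i \<phi> x \<partial>lebesgue) = - (\<integral>x. g x $ i * \<phi> x \<partial>lebesgue)" if "test_fun T \<phi>" for \<phi> i
    by (rule is_weak_grad_integral[OF g test_fun_subset[OF that T(1)]])
qed

lemma H1_iff: "H1 S u \<longleftrightarrow> L2on S u \<and> (\<exists>g. is_weak_grad S u g)"
  by (auto simp: H1_def L2on_iff)

lemma wgrad_is_weak_grad: "H1 S u \<Longrightarrow> is_weak_grad S u (wgrad S u)"
  unfolding H1_def wgrad_def by (metis someI_ex)

section \<open>Energy of vector fields, and A-harmonic functions on a bounded open set\<close>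

locale energy =
  fixes A :: "real^'n::finite \<Rightarrow> real^'n^'n" and S :: "(real^'n) set" and \<alpha> \<beta> :: real
  assumes openS: "open S" and boundedS: "bounded S"
    and A_meas: "\<And>i j. set_borel_measurable lebesgue S (\<lambda>x. A x $ i $ j)"
    and A_Linf: "\<And>i j. \<exists>M. AE x in lebesgue. x \<in> S \<longrightarrow> \<bar>A x $ i $ j\<bar> \<le> M"
    and A_sym: "\<And>x. x \<in> S \<Longrightarrow> transpose (A x) = A x"
    and alpha_pos: "0 < \<alpha>" and beta_pos: "0 < \<beta>"
    and ellip: "AE x in lebesgue. x \<in> S \<longrightarrow>
       (\<forall>v. \<alpha> * (norm v)\<^sup>2 \<le> v \<bullet> (A x *v v) \<and> v \<bullet> (A x *v v) \<le> \<beta> * (norm v)\<^sup>2)"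
begin

lemma lmeasS: "S \<in> lmeasurable"
  using openS boundedS by (simp add: lmeasurable_open)

text \<open>The form acts on square-integrable fields rather than on functions, because
  Caccioppoli's inequality evaluates it at products such as \<open>\<eta> \<nabla>u\<close> and
  \<open>u \<nabla>\<eta>\<close>, which need not be gradients.\<close>

definition E :: "(real^'n \<Rightarrow> real^'n) \<Rightarrow> (real^'n \<Rightarrow> real^'n) \<Rightarrow> real" where
  "E p q = (\<integral>x. indicator S x * ((A x *v p x) \<bullet> q x) \<partial>lebesgue)"

lemma energy_ip_E: "energy_ip A S u v = E (wgrad S u) (wgrad S v)"
  by (simp add: energy_ip_def E_def set_lebesgue_integral_def)

lemma flux_L2:
  assumes "p \<in> L2field S" shows "L2on S (\<lambda>x. (A x *v p x) $ i)"
proof -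
  have "L2on S (\<lambda>x. A x $ i $ j * p x $ j)" for j
  proof -
    obtain M where M: "AE x in lebesgue. x \<in> S \<longrightarrow> \<bar>A x $ i $ j\<bar> \<le> M" using A_Linf by blast
    have "L2 lebesgue (\<lambda>x. (indicator S x * A x $ i $ j) * (indicator S x * p x $ j))"
    proof (rule L2_AE_bounded_mult)
      show "L2 lebesgue (\<lambda>x. indicator S x * p x $ j)" using L2fieldD[OF assms] by (simp add: L2on_def)
      show "(\<lambda>x. indicator S x * A x $ i $ j) \<in> borel_measurable lebesgue"
        using A_meas[of i j] by (simp add: set_borel_measurable_def)
      show "AE x in lebesgue. \<bar>indicator S x * A x $ i $ j\<bar> \<le> max 0 M"
        using M by eventually_elim (auto simp: indicator_def le_max_iff_disj)
    qed
    moreover have "(\<lambda>x. (indicator S x * A x $ i $ j) * (indicator S x * p x $ j)) = (\<lambda>x. indicator S x * (A x $ i $ j * p x $ j))"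
      by (auto simp: indicator_def)
    ultimately show ?thesis by (simp add: L2on_def)
  qed
  then show ?thesis by (simp add: matrix_vector_mult_def L2on_sum)
qed

lemma E_integrable:
  assumes "p \<in> L2field S" "q \<in> L2field S"
  shows "integrable lebesgue (\<lambda>x. indicator S x * ((A x *v p x) \<bullet> q x))"
proof -
  have "indicator S x * ((A x *v p x) \<bullet> q x) = (\<Sum>i\<in>UNIV. indicator S x * ((A x *v p x) $ i * q x $ i))" for x
    by (simp only: inner_vec_def inner_real_def sum_distrib_left)
  then show ?thesis
    by (simp only:) (intro Bochner_Integration.integrable_sum L2on_integrable_mult flux_L2 L2fieldD assms)
qed

lemma E_cong_AE:
  assumes "p \<in> L2field S" "q \<in> L2field S" "p' \<in> L2field S" "q' \<in> L2field S"
    and "AE x in lebesgue. x \<in> S \<longrightarrow> p x = p' x" "AE x in lebesgue. x \<in> S \<longrightarrow> q x = q' x"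
  shows "E p q = E p' q'"
  unfolding E_def
proof (rule integral_cong_AE)
  show "AE x in lebesgue. indicator S x * ((A x *v p x) \<bullet> q x) = indicator S x * ((A x *v p' x) \<bullet> q' x)"
    using assms(5,6) by eventually_elim (simp add: indicator_def)
qed (use E_integrable assms in auto)

lemma E_lower:
  assumes "p \<in> L2field S" shows "\<alpha> * sqnorm S p \<le> E p p"
proof -
  have "\<alpha> * sqnorm S p = (\<integral>x. \<alpha> * (indicator S x * (norm (p x))\<^sup>2) \<partial>lebesgue)"
    by (simp add: sqnorm_eq[OF assms])
  also have "\<dots> \<le> E p p"
    unfolding E_def
  proof (rule integral_mono_AE)
    show "AE x in lebesgue. \<alpha> * (indicator S x * (norm (p x))\<^sup>2) \<le> indicator S x * ((A x *v p x) \<bullet> p x)"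
      using ellip by eventually_elim (auto simp: indicator_def inner_commute)
  qed (use sqnorm_eq(2)[OF assms] E_integrable[OF assms assms] in auto)
  finally show ?thesis .
qed

lemma E_upper:
  assumes "p \<in> L2field S" shows "E p p \<le> \<beta> * sqnorm S p"
proof -
  have "E p p \<le> (\<integral>x. \<beta> * (indicator S x * (norm (p x))\<^sup>2) \<partial>lebesgue)"
    unfolding E_def
  proof (rule integral_mono_AE)
    show "AE x in lebesgue. indicator S x * ((A x *v p x) \<bullet> p x) \<le> \<beta> * (indicator S x * (norm (p x))\<^sup>2)"
      using ellip by eventually_elim (auto simp: indicator_def inner_commute)
  qed (use sqnorm_eq(2)[OF assms] E_integrable[OF assms assms] in auto)
  also have "\<dots> = \<beta> * sqnorm S p" by (simp add: sqnorm_eq[OF assms])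
  finally show ?thesis .
qed

lemma E_add_left:
  assumes "p \<in> L2field S" "q \<in> L2field S" "s \<in> L2field S" shows "E (p + q) s = E p s + E q s"
  using E_integrable[OF assms(1,3)] E_integrable[OF assms(2,3)]
  by (simp add: E_def matrix_vector_right_distrib inner_add_left distrib_left)

lemma E_scale_left: "E (r *\<^sub>R p) s = r * E p s"
proof -
  have "indicator S x * ((A x *v (r *\<^sub>R p) x) \<bullet> s x) = r * (indicator S x * ((A x *v p x) \<bullet> s x))" for x
    by (simp add: matrix_vector_mult_scaleR)
  then show ?thesis by (simp only: E_def integral_mult_right_zero)
qed

lemma E_sym: "E p q = E q p"
  unfolding E_def
proof (rule Bochner_Integration.integral_cong[OF refl])
  fix x
  show "indicator S x * ((A x *v p x) \<bullet> q x) = indicator S x * ((A x *v q x) \<bullet> p x)"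
  proof (cases "x \<in> S")
    case True
    have "(A x *v p x) \<bullet> q x = (p x v* transpose (A x)) \<bullet> q x" by simp
    also have "\<dots> = p x \<bullet> (transpose (A x) *v q x)" by (rule dot_lmul_matrix)
    finally show ?thesis using A_sym[OF True] by (simp add: inner_commute)
  qed simp
qed

sublocale F: psd_form "L2field S" E
proof
  show "subspace (L2field S)" by (rule L2field_subspace)
  show "0 \<le> E p p" if "p \<in> L2field S" for p
    using E_lower[OF that] sqnorm_nonneg[of S p] alpha_pos by (meson mult_nonneg_nonneg less_imp_le order_trans)
qed (use E_add_left E_scale_left E_sym in auto)

lemma E_tendsto:
  assumes p: "p \<in> L2field S" and q: "\<And>k. q k \<in> L2field S" "h \<in> L2field S"
    and lim: "(\<lambda>k. sqnorm S (q k - h)) \<longlonglongrightarrow> 0"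
  shows "(\<lambda>k. E p (q k)) \<longlonglongrightarrow> E p h"
proof -
  have "(\<lambda>k. E (q k - h) (q k - h)) \<longlonglongrightarrow> 0"
  proof (rule tendsto_sandwich[OF _ _ tendsto_const])
    show "(\<lambda>k. \<beta> * sqnorm S (q k - h)) \<longlonglongrightarrow> 0" using tendsto_mult_left[OF lim, of \<beta>] by simp
  qed (auto intro!: always_eventually F.nonneg E_upper F.closed q)
  then have "(\<lambda>k. E (q k) p) \<longlonglongrightarrow> E h p"
    by (rule F.tendsto_form(1)[OF q p])
  then show ?thesis by (simp add: E_sym)
qed

text \<open>By uniqueness almost everywhere, any weak gradient may replace the one picked by
  \<open>wgrad\<close>; sums and restrictions can then use the obvious candidates.\<close>

lemma energy_ip_weak_grad:
  assumes "H1 S u" "H1 S v" "is_weak_grad S u g" "is_weak_grad S v h"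
  shows "energy_ip A S u v = E g h"
  unfolding energy_ip_E
proof (rule E_cong_AE)
  have u: "L2on S u" "L2on S v" using assms by (auto simp: H1_iff)
  note W = wgrad_is_weak_grad[OF assms(1)] wgrad_is_weak_grad[OF assms(2)]
  show "AE x in lebesgue. x \<in> S \<longrightarrow> wgrad S u x = g x"
    by (rule weak_grad_unique[OF openS W(1) assms(3) _ u(1) u(1)]) simp
  show "AE x in lebesgue. x \<in> S \<longrightarrow> wgrad S v x = h x"
    by (rule weak_grad_unique[OF openS W(2) assms(4) _ u(2) u(2)]) simp
qed (rule is_weak_grad_L2field wgrad_is_weak_grad assms)+

lemma A_harmonic_iff:
  "A_harmonic A S u \<longleftrightarrow> L2on S u \<and> (\<exists>g. is_weak_grad S u g \<and> (\<forall>\<phi>. test_fun S \<phi> \<longrightarrow> E g (grad_fun \<phi>) = 0))"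
proof
  assume "A_harmonic A S u"
  then have h: "H1 S u" "\<And>\<phi>. test_fun S \<phi> \<Longrightarrow> E (wgrad S u) (grad_fun \<phi>) = 0"
    by (auto simp: A_harmonic_def E_def set_lebesgue_integral_def)
  then show "L2on S u \<and> (\<exists>g. is_weak_grad S u g \<and> (\<forall>\<phi>. test_fun S \<phi> \<longrightarrow> E g (grad_fun \<phi>) = 0))"
    using wgrad_is_weak_grad[OF h(1)] by (auto simp: H1_iff)
next
  assume "L2on S u \<and> (\<exists>g. is_weak_grad S u g \<and> (\<forall>\<phi>. test_fun S \<phi> \<longrightarrow> E g (grad_fun \<phi>) = 0))"
  then obtain g where u: "L2on S u" and g: "is_weak_grad S u g" and z: "\<And>\<phi>. test_fun S \<phi> \<Longrightarrow> E g (grad_fun \<phi>) = 0"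
    by blast
  have h: "H1 S u" using u g by (auto simp: H1_iff)
  note W = wgrad_is_weak_grad[OF h]
  have "E (wgrad S u) (grad_fun \<phi>) = 0" if \<phi>: "test_fun S \<phi>" for \<phi>
  proof -
    have "E (wgrad S u) (grad_fun \<phi>) = E g (grad_fun \<phi>)"
      by (rule E_cong_AE)
        (use W g \<phi> weak_grad_unique[OF openS W g _ u u] in \<open>auto intro: is_weak_grad_L2field grad_fun_L2field\<close>)
    then show ?thesis using z[OF \<phi>] by simp
  qed
  then show "A_harmonic A S u" using h by (auto simp: A_harmonic_def E_def set_lebesgue_integral_def)
qed

lemma A_harmonic_H1: "A_harmonic A S u \<Longrightarrow> H1 S u"
  by (simp add: A_harmonic_def)

lemma A_harmonic_weak_grad:
  assumes "A_harmonic A S u"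
  obtains g where "L2on S u" "is_weak_grad S u g" "\<And>\<phi>. test_fun S \<phi> \<Longrightarrow> E g (grad_fun \<phi>) = 0"
  using assms A_harmonic_iff by auto

lemma H1_lincomb:
  assumes "H1 S u" "H1 S v" shows "H1 S (u + r *\<^sub>R v)"
  using assms is_weak_grad_lincomb[of S u _ v _ r] L2on_add[of S u "\<lambda>x. r * v x"] L2on_cmult[of S v r]
  unfolding H1_iff plus_fun_def scaleR_fun_def by auto

lemma A_harmonic_lincomb:
  assumes "A_harmonic A S u" "A_harmonic A S v" shows "A_harmonic A S (u + r *\<^sub>R v)"
proof -
  obtain g where g: "L2on S u" "is_weak_grad S u g" "\<And>\<phi>. test_fun S \<phi> \<Longrightarrow> E g (grad_fun \<phi>) = 0"
    using A_harmonic_weak_grad[OF assms(1)] by metis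
  obtain h where h: "L2on S v" "is_weak_grad S v h" "\<And>\<phi>. test_fun S \<phi> \<Longrightarrow> E h (grad_fun \<phi>) = 0"
    using A_harmonic_weak_grad[OF assms(2)] by metis
  have "H1 S (u + r *\<^sub>R v)" by (intro H1_lincomb A_harmonic_H1 assms)
  then have "L2on S (u + r *\<^sub>R v)" by (simp add: H1_iff)
  moreover have "is_weak_grad S (u + r *\<^sub>R v) (g + r *\<^sub>R h)" by (rule is_weak_grad_lincomb[OF g(1,2) h(1,2)])
  moreover have "E (g + r *\<^sub>R h) (grad_fun \<phi>) = 0" if "test_fun S \<phi>" for \<phi>
    using g h that by (simp add: E_add_left E_scale_left F.closed is_weak_grad_L2field grad_fun_L2field)
  ultimately show ?thesis unfolding A_harmonic_iff by blast
qed

lemma L2on_const: "L2on S (\<lambda>x. c)"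
  by (rule L2on_bounded[OF lmeasS, of _ "\<bar>c\<bar>"]) auto

lemma is_weak_grad_const: "is_weak_grad S (\<lambda>x. c) (\<lambda>x. 0)"
proof -
  have "grad_fun (\<lambda>x::real^'n. c) = (\<lambda>x. 0)" by (simp add: fun_eq_iff vec_eq_iff)
  moreover have "(\<lambda>x::real^'n. 0::real^'n) \<in> L2field S" by (simp add: L2field_def L2on_zero)
  ultimately show ?thesis using is_weak_grad_smooth[OF smooth_const, of c S] by simp
qed

lemma A_harmonic_const: "A_harmonic A S (\<lambda>x. c)"
  unfolding A_harmonic_iff
  by (intro conjI L2on_const exI[of _ "\<lambda>x. 0"] is_weak_grad_const) (simp add: E_def)

lemma H1_subspace: "subspace {u. H1 S u}"
proof -
  have 0: "H1 S 0" using is_weak_grad_const[of 0] L2on_const[of 0] by (auto simp: H1_iff zero_fun_def)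
  have "H1 S (u + v)" if "H1 S u" "H1 S v" for u v using H1_lincomb[OF that, of 1] by simp
  moreover have "H1 S (r *\<^sub>R u)" if "H1 S u" for u r using H1_lincomb[OF 0 that, of r] by simp
  ultimately show ?thesis using 0 by (simp add: subspace_def)
qed

lemma A_harmonic_subspace: "subspace {u. A_harmonic A S u}"
proof -
  have 0: "A_harmonic A S 0" using A_harmonic_const[of 0] by (simp add: zero_fun_def)
  have "A_harmonic A S (u + v)" if "A_harmonic A S u" "A_harmonic A S v" for u v
    using A_harmonic_lincomb[OF that, of 1] by simp
  moreover have "A_harmonic A S (r *\<^sub>R u)" if "A_harmonic A S u" for u r
    using A_harmonic_lincomb[OF 0 that, of r] by simp
  ultimately show ?thesis using 0 by (simp add: subspace_def)
qed

lemma energy_psd: "psd_form {u. H1 S u} (energy_ip A S)"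
proof
  show "subspace {u. H1 S u}" by (rule H1_subspace)
  fix u v w assume "u \<in> {u. H1 S u}" "v \<in> {u. H1 S u}" "w \<in> {u. H1 S u}"
  then have h: "H1 S u" "H1 S v" "H1 S w" by auto
  note W = h[THEN wgrad_is_weak_grad] and L = h[THEN H1_iff[THEN iffD1, THEN conjunct1]]
  have "energy_ip A S (u + 1 *\<^sub>R v) w = E (wgrad S u + 1 *\<^sub>R wgrad S v) (wgrad S w)"
    by (rule energy_ip_weak_grad[OF H1_lincomb[OF h(1,2)] h(3) is_weak_grad_lincomb[OF L(1) W(1) L(2) W(2)] W(3)])
  then show "energy_ip A S (u + v) w = energy_ip A S u w + energy_ip A S v w"
    using W by (simp add: E_add_left is_weak_grad_L2field energy_ip_E)
next
  fix r u w assume "u \<in> {u. H1 S u}" "w \<in> {u. H1 S u}"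
  then have h: "H1 S u" "H1 S w" by auto
  note W = h[THEN wgrad_is_weak_grad] and L = h[THEN H1_iff[THEN iffD1, THEN conjunct1]]
  have 0: "H1 S 0" using H1_subspace subspace_0 by blast
  have 00: "L2on S 0" "is_weak_grad S 0 0" using L2on_const[of 0] is_weak_grad_const[of 0] by (auto simp: zero_fun_def)
  have "energy_ip A S (0 + r *\<^sub>R u) w = E (0 + r *\<^sub>R wgrad S u) (wgrad S w)"
    by (rule energy_ip_weak_grad[OF H1_lincomb[OF 0 h(1)] h(2) is_weak_grad_lincomb[OF 00 L(1) W(1)] W(2)])
  then show "energy_ip A S (r *\<^sub>R u) w = r * energy_ip A S u w"
    by (simp add: E_scale_left energy_ip_E)
next
  show "energy_ip A S u v = energy_ip A S v u" for u v by (simp add: energy_ip_E E_sym)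
  show "0 \<le> energy_ip A S u u" if "u \<in> {u. H1 S u}" for u
    using that F.nonneg[OF is_weak_grad_L2field[OF wgrad_is_weak_grad]] by (simp add: energy_ip_E)
qed

end

lemma L2on_integrable_self:
  assumes "L2on S u" "S \<in> lmeasurable" shows "integrable lebesgue (\<lambda>x. indicator S x * u x)"
  by (rule L2on_integrable(1)[OF assms order_refl])

lemma L2dist2_indicator: "L2dist2 lebesgue (\<lambda>x. indicator S x * f x) (\<lambda>x. indicator S x * g x) = (\<integral>x. indicator S x * (f x - g x)\<^sup>2 \<partial>lebesgue)"
  unfolding L2dist2_def by (rule Bochner_Integration.integral_cong) (auto simp: indicator_def)

section \<open>Mean-free representatives and completeness on a box\<close>

locale energy_box = energy A "box p q" \<alpha> \<beta> for A :: "real^'n::finite \<Rightarrow> real^'n^'n" and p q \<alpha> \<beta> +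
  assumes ne: "box p q \<noteq> {}"
begin

abbreviation S :: "(real^'n) set" where "S \<equiv> box p q"
abbreviation vol :: real where "vol \<equiv> measure lebesgue S"

lemma vol_pos: "0 < vol"
proof -
  have "\<not> negligible S" using ne open_not_negligible[OF open_box] by blast
  then have "vol \<noteq> 0" using lmeasurable_box[of p q] by (simp add: negligible_iff_measure)
  then show ?thesis using measure_nonneg[of lebesgue S] by linarith
qed

definition mean :: "(real^'n \<Rightarrow> real) \<Rightarrow> real" where
  "mean u = (\<integral>x. indicator S x * u x \<partial>lebesgue) / vol"

text \<open>The representative with mean zero of a class modulo constants; on it the energy controls
  the L2 norm.\<close>

definition centered :: "(real^'n \<Rightarrow> real) \<Rightarrow> real^'n \<Rightarrow> real" where
  "centered u = u + (- mean u) *\<^sub>R (\<lambda>x. 1)"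

lemma centered_apply: "centered u x = u x - mean u"
  by (simp add: centered_def)

lemma L2on_centered: assumes "L2on S u" shows "L2on S (centered u)"
  using L2on_diff[OF assms L2on_const[of "mean u"]] by (simp add: centered_apply[abs_def])

lemma is_weak_grad_centered:
  assumes "L2on S u" "is_weak_grad S u g" shows "is_weak_grad S (centered u) g"
  using is_weak_grad_lincomb[OF assms L2on_const is_weak_grad_const, of "- mean u" 1]
  by (simp add: centered_def zero_fun_def[symmetric])

lemma integral_centered:
  assumes "L2on S u" shows "(\<integral>x. indicator S x * centered u x \<partial>lebesgue) = 0"
proof -
  have "(\<integral>x. indicator S x * centered u x \<partial>lebesgue) = (\<integral>x. indicator S x * u x - mean u * indicator S x \<partial>lebesgue)"
    by (rule Bochner_Integration.integral_cong) (auto simp: centered_apply algebra_simps)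
  also have "\<dots> = (\<integral>x. indicator S x * u x \<partial>lebesgue) - mean u * vol"
    using L2on_integrable_self[OF assms lmeasS] lmeasurable_integrable_indicator[OF lmeasS] by simp
  also have "\<dots> = 0" using vol_pos by (simp add: mean_def)
  finally show ?thesis .
qed

lemma Poincare_centered:
  "\<exists>C\<ge>0. \<forall>u g. L2on S u \<and> is_weak_grad S u g \<and> (\<integral>x. indicator S x * u x \<partial>lebesgue) = 0 \<longrightarrow>
    (\<integral>x. indicator S x * (u x)\<^sup>2 \<partial>lebesgue) \<le> C * sqnorm S g"
proof -
  obtain B where B: "\<And>x. x \<in> S \<Longrightarrow> norm x \<le> B" using boundedS by (auto simp: bounded_iff)
  have D: "norm (y - x) \<le> 2 * B" if "x \<in> S" "y \<in> S" for x y
    using norm_triangle_ineq4[of y x] B[OF that(1)] B[OF that(2)] by linarith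
  show ?thesis
  proof (intro exI[of _ "2 ^ CARD('n) * (2 * B)\<^sup>2"] conjI allI impI)
    fix u g assume h: "L2on S u \<and> is_weak_grad S u g \<and> (\<integral>x. indicator S x * u x \<partial>lebesgue) = 0"
    have "vol * (\<integral>x. indicator S x * (u x)\<^sup>2 \<partial>lebesgue) \<le> 0\<^sup>2 + 2 ^ CARD('n) * (2 * B)\<^sup>2 * vol * sqnorm S g"
      using Poincare_box[OF openS _ _ order_refl D, of u g] h by (simp add: sqnorm_def)
    then have "vol * (\<integral>x. indicator S x * (u x)\<^sup>2 \<partial>lebesgue) \<le> vol * (2 ^ CARD('n) * (2 * B)\<^sup>2 * sqnorm S g)"
      by (simp add: mult_ac)
    then show "(\<integral>x. indicator S x * (u x)\<^sup>2 \<partial>lebesgue) \<le> 2 ^ CARD('n) * (2 * B)\<^sup>2 * sqnorm S g"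
      using vol_pos by (simp only: mult_le_cancel_left_pos)
  qed simp
qed

text \<open>Poincare's inequality bounds the centered function by a multiple of its gradient norm,
  which is 0 here.\<close>

lemma sqnorm_0_imp_const:
  assumes u: "L2on S u" and g: "is_weak_grad S u g" and 0: "sqnorm S g = 0"
  shows "AE x in lebesgue. x \<in> S \<longrightarrow> u x = mean u"
proof -
  obtain C where C: "\<And>u g. L2on S u \<Longrightarrow> is_weak_grad S u g \<Longrightarrow> (\<integral>x. indicator S x * u x \<partial>lebesgue) = 0 \<Longrightarrow>
    (\<integral>x. indicator S x * (u x)\<^sup>2 \<partial>lebesgue) \<le> C * sqnorm S g"
    using Poincare_centered by blast
  have "(\<integral>x. indicator S x * (centered u x)\<^sup>2 \<partial>lebesgue) \<le> C * sqnorm S g"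
    by (rule C[OF L2on_centered[OF u] is_weak_grad_centered[OF u g] integral_centered[OF u]])
  moreover have "0 \<le> (\<integral>x. indicator S x * (centered u x)\<^sup>2 \<partial>lebesgue)" by (rule integral_nonneg_AE) simp
  ultimately have "(\<integral>x. indicator S x * (centered u x)\<^sup>2 \<partial>lebesgue) = 0" using 0 by simp
  moreover have "(\<integral>x. indicator S x * (centered u x)\<^sup>2 \<partial>lebesgue) = 0 \<longleftrightarrow> (AE x in lebesgue. indicator S x * (centered u x)\<^sup>2 = 0)"
    by (rule integral_nonneg_eq_0_iff_AE[OF L2on_integrable_square[OF L2on_centered[OF u]]]) simp
  ultimately have "AE x in lebesgue. indicator S x * (centered u x)\<^sup>2 = 0" by blast
  then show ?thesis by eventually_elim (auto simp: centered_apply indicator_def)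
qed

text \<open>The dictionary between being zero modulo constants and being a null vector of the
  energy.\<close>

lemma const_on_iff:
  assumes "H1 S u" shows "const_on S u \<longleftrightarrow> energy_ip A S u u = 0"
proof
  have u: "L2on S u" using assms by (simp add: H1_iff)
  note W = wgrad_is_weak_grad[OF assms]
  show "const_on S u" if "energy_ip A S u u = 0"
  proof -
    have "\<alpha> * sqnorm S (wgrad S u) \<le> 0" using E_lower[OF is_weak_grad_L2field[OF W]] that by (simp add: energy_ip_E)
    then have "sqnorm S (wgrad S u) = 0"
      using sqnorm_nonneg[of S "wgrad S u"] alpha_pos by (simp add: mult_le_0_iff)
    then show ?thesis using sqnorm_0_imp_const[OF u W] by (auto simp: const_on_def)
  qed
  show "energy_ip A S u u = 0" if "const_on S u"
  proof -
    obtain c where "AE x in lebesgue. x \<in> S \<longrightarrow> c = u x" using \<open>const_on S u\<close> by (auto simp: const_on_def eq_commute)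
    then have "is_weak_grad S u (\<lambda>x. 0)" by (rule is_weak_grad_AE_cong[OF is_weak_grad_const L2on_const u])
    then have "energy_ip A S u u = E (\<lambda>x. 0) (\<lambda>x. 0)" by (intro energy_ip_weak_grad assms)
    then show ?thesis by (simp add: E_def)
  qed
qed

lemma is_weak_grad_diff:
  assumes "L2on S u" "is_weak_grad S u g" "L2on S v" "is_weak_grad S v h"
  shows "is_weak_grad S (u - v) (g - h)"
  using is_weak_grad_lincomb[OF assms, of "-1"] by simp

lemma L2on_minus: "L2on S u \<Longrightarrow> L2on S v \<Longrightarrow> L2on S (u - v)"
  using L2on_diff[of S u v] by (simp add: fun_diff_def)

lemma L2on_fun_complete:
  assumes F: "\<And>k. L2on S (F k)"
    and Cauchy: "\<And>e. e > 0 \<Longrightarrow> \<exists>N. \<forall>m\<ge>N. \<forall>n\<ge>N. (\<integral>x. indicator S x * (F m x - F n x)\<^sup>2 \<partial>lebesgue) < e"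
  shows "\<exists>f. L2on S f \<and> (\<lambda>k. \<integral>x. indicator S x * (F k x - f x)\<^sup>2 \<partial>lebesgue) \<longlonglongrightarrow> 0"
proof -
  have LF: "L2 lebesgue (\<lambda>x. indicator S x * F k x)" for k using F by (simp add: L2on_def)
  have "\<exists>f. L2 lebesgue f \<and> (\<lambda>k. L2dist2 lebesgue (\<lambda>x. indicator S x * F k x) f) \<longlonglongrightarrow> 0"
    by (rule L2_complete[OF LF]) (unfold L2dist2_indicator, rule Cauchy)
  then obtain f where f: "L2 lebesgue f" "(\<lambda>k. L2dist2 lebesgue (\<lambda>x. indicator S x * F k x) f) \<longlonglongrightarrow> 0"
    by blast
  have "L2 lebesgue (\<lambda>x. indicator S x * f x)" by (rule L2_indicator_mult[OF _ f(1)]) simp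
  moreover have "(\<lambda>k. L2dist2 lebesgue (\<lambda>x. indicator S x * (indicator S x * F k x)) (\<lambda>x. indicator S x * f x)) \<longlonglongrightarrow> 0"
    by (rule L2_tendsto_indicator_mult[OF _ LF f]) simp
  moreover have "(\<lambda>x. indicator S x * (indicator S x * F k x)) = (\<lambda>x. indicator S x * F k x)" for k
    by (auto simp: indicator_def)
  ultimately show ?thesis unfolding L2on_def by (auto simp: L2dist2_indicator)
qed

lemma L2on_tendsto_test:
  assumes F: "\<And>k. L2on S (F k)" and f: "L2on S f"
    and lim: "(\<lambda>k. \<integral>x. indicator S x * (F k x - f x)\<^sup>2 \<partial>lebesgue) \<longlonglongrightarrow> 0" and \<phi>: "test_fun S \<phi>"
  shows "(\<lambda>k. \<integral>x. F k x * \<phi> x \<partial>lebesgue) \<longlonglongrightarrow> (\<integral>x. f x * \<phi> x \<partial>lebesgue)"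
proof -
  have e: "(indicator S x * v x) * \<phi> x = v x * \<phi> x" for v x
    using test_fun_indicator[OF \<phi>, of x] by auto
  have "(\<lambda>k. \<integral>x. (indicator S x * F k x) * \<phi> x \<partial>lebesgue) \<longlonglongrightarrow> (\<integral>x. (indicator S x * f x) * \<phi> x \<partial>lebesgue)"
    by (rule L2_tendsto_mult[OF _ _ test_fun_L2[OF \<phi>]]) (use F f lim in \<open>simp_all add: L2on_def[symmetric] L2dist2_indicator\<close>)
  then show ?thesis by (simp only: e)
qed

text \<open>The gradients control the functions only modulo constants, so it is the centered
  functions that converge in L2; the limit of the gradients is then their limit's weak gradient,
  since both sides of integration by parts are continuous in L2.\<close>

lemma H1_complete:
  assumes u: "\<And>k. L2on S (u k)" and g: "\<And>k. is_weak_grad S (u k) (g k)"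
    and Cauchy: "\<And>e. e > 0 \<Longrightarrow> \<exists>N. \<forall>m\<ge>N. \<forall>n\<ge>N. sqnorm S (g m - g n) < e"
  shows "\<exists>v h. L2on S v \<and> is_weak_grad S v h \<and> (\<lambda>k. sqnorm S (g k - h)) \<longlonglongrightarrow> 0"
proof -
  obtain C where C: "C \<ge> 0" "\<And>u g. L2on S u \<Longrightarrow> is_weak_grad S u g \<Longrightarrow> (\<integral>x. indicator S x * u x \<partial>lebesgue) = 0 \<Longrightarrow>
    (\<integral>x. indicator S x * (u x)\<^sup>2 \<partial>lebesgue) \<le> C * sqnorm S g"
    using Poincare_centered by blast
  define U where "U k = centered (u k)" for k
  have UL: "L2on S (U k)" and Ug: "is_weak_grad S (U k) (g k)" and U0: "(\<integral>x. indicator S x * U k x \<partial>lebesgue) = 0" for k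
    using L2on_centered[OF u] is_weak_grad_centered[OF u g] integral_centered[OF u] by (auto simp: U_def)
  have bound: "(\<integral>x. indicator S x * (U m x - U n x)\<^sup>2 \<partial>lebesgue) \<le> C * sqnorm S (g m - g n)" for m n
  proof -
    have "(\<integral>x. indicator S x * (U m - U n) x \<partial>lebesgue) = 0"
      using L2on_integrable_self[OF UL lmeasS, of m] L2on_integrable_self[OF UL lmeasS, of n] U0[of m] U0[of n]
      by (simp add: right_diff_distrib)
    from C(2)[OF L2on_minus[OF UL UL] is_weak_grad_diff[OF UL Ug UL Ug] this] show ?thesis by simp
  qed
  have "\<exists>f. L2on S f \<and> (\<lambda>k. \<integral>x. indicator S x * (U k x - f x)\<^sup>2 \<partial>lebesgue) \<longlonglongrightarrow> 0"
  proof (rule L2on_fun_complete[OF UL])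
    fix e :: real assume e: "e > 0"
    obtain N where N: "\<forall>m\<ge>N. \<forall>n\<ge>N. sqnorm S (g m - g n) < e / (C + 1)"
      using Cauchy[of "e / (C + 1)"] e C(1) by auto
    have "(\<integral>x. indicator S x * (U m x - U n x)\<^sup>2 \<partial>lebesgue) < e" if "m \<ge> N" "n \<ge> N" for m n
    proof -
      have "C * sqnorm S (g m - g n) \<le> (C + 1) * sqnorm S (g m - g n)" using sqnorm_nonneg by (intro mult_right_mono) auto
      moreover have "(C + 1) * sqnorm S (g m - g n) < e" using N that C(1) by (auto simp: field_simps)
      ultimately show ?thesis using bound[of m n] by linarith
    qed
    then show "\<exists>N. \<forall>m\<ge>N. \<forall>n\<ge>N. (\<integral>x. indicator S x * (U m x - U n x)\<^sup>2 \<partial>lebesgue) < e" by blast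
  qed
  then obtain f where f: "L2on S f" "(\<lambda>k. \<integral>x. indicator S x * (U k x - f x)\<^sup>2 \<partial>lebesgue) \<longlonglongrightarrow> 0" by blast
  have gL: "L2on S (\<lambda>x. g k x $ i)" for k i by (rule is_weak_grad_L2on[OF g])
  have "\<exists>h. L2on S h \<and> (\<lambda>k. \<integral>x. indicator S x * (g k x $ i - h x)\<^sup>2 \<partial>lebesgue) \<longlonglongrightarrow> 0" for i
  proof (rule L2on_fun_complete[OF gL])
    fix e :: real assume e: "e > 0"
    obtain N where N: "\<forall>m\<ge>N. \<forall>n\<ge>N. sqnorm S (g m - g n) < e" using Cauchy[OF e] by blast
    have le: "(\<integral>x. indicator S x * (g m x $ i - g n x $ i)\<^sup>2 \<partial>lebesgue) \<le> sqnorm S (g m - g n)" for m n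
    proof -
      have "(\<integral>x. indicator S x * ((g m - g n) x $ i)\<^sup>2 \<partial>lebesgue) \<le> sqnorm S (g m - g n)"
        unfolding sqnorm_def
        by (rule member_le_sum[where f="\<lambda>i. \<integral>x. indicator S x * ((g m - g n) x $ i)\<^sup>2 \<partial>lebesgue"])
          (auto intro!: integral_nonneg_AE)
      then show ?thesis by simp
    qed
    show "\<exists>N. \<forall>m\<ge>N. \<forall>n\<ge>N. (\<integral>x. indicator S x * (g m x $ i - g n x $ i)\<^sup>2 \<partial>lebesgue) < e"
      using N order_le_less_trans[OF le] by blast
  qed
  then have "\<forall>i. \<exists>h. L2on S h \<and> (\<lambda>k. \<integral>x. indicator S x * (g k x $ i - h x)\<^sup>2 \<partial>lebesgue) \<longlonglongrightarrow> 0" ..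
  from choice[OF this] obtain h where
    hh: "\<forall>i. L2on S (h i) \<and> (\<lambda>k. \<integral>x. indicator S x * (g k x $ i - h i x)\<^sup>2 \<partial>lebesgue) \<longlonglongrightarrow> 0" ..
  have h: "L2on S (h i)" "(\<lambda>k. \<integral>x. indicator S x * (g k x $ i - h i x)\<^sup>2 \<partial>lebesgue) \<longlonglongrightarrow> 0" for i
    using hh[THEN spec, of i] by auto
  define H where "H x = (\<chi> i. h i x)" for x
  have "is_weak_grad S f H"
  proof (rule is_weak_gradI)
    show "L2on S (\<lambda>x. H x $ i)" for i using h(1) by (simp add: H_def)
    fix \<phi> i assume \<phi>: "test_fun S \<phi>"
    have "(\<lambda>k. \<integral>x. U k x * partial i \<phi> x \<partial>lebesgue) \<longlonglongrightarrow> (\<integral>x. f x * partial i \<phi> x \<partial>lebesgue)"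
      by (rule L2on_tendsto_test[OF UL f test_fun_partial[OF \<phi>]])
    moreover have "(\<lambda>k. - (\<integral>x. g k x $ i * \<phi> x \<partial>lebesgue)) \<longlonglongrightarrow> - (\<integral>x. h i x * \<phi> x \<partial>lebesgue)"
      by (intro tendsto_minus L2on_tendsto_test[OF gL h \<phi>])
    moreover have "(\<integral>x. U k x * partial i \<phi> x \<partial>lebesgue) = - (\<integral>x. g k x $ i * \<phi> x \<partial>lebesgue)" for k
      by (rule is_weak_grad_integral[OF Ug \<phi>])
    ultimately show "(\<integral>x. f x * partial i \<phi> x \<partial>lebesgue) = - (\<integral>x. H x $ i * \<phi> x \<partial>lebesgue)"
      by (simp only: H_def vec_lambda_beta) (rule LIMSEQ_unique)
  qed
  moreover have "(\<lambda>k. sqnorm S (g k - H)) \<longlonglongrightarrow> 0"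
  proof -
    have "(\<lambda>k. \<Sum>i\<in>UNIV. \<integral>x. indicator S x * (g k x $ i - h i x)\<^sup>2 \<partial>lebesgue) \<longlonglongrightarrow> (\<Sum>i\<in>(UNIV::'n set). 0)"
      by (intro tendsto_sum h)
    then show ?thesis by (simp add: sqnorm_def H_def)
  qed
  ultimately show ?thesis using f(1) by blast
qed

text \<open>Ellipticity makes the energy equivalent to the gradient norm, and orthogonality to
  gradients of test functions survives the limit.\<close>

lemma A_harmonic_complete:
  assumes u: "\<And>k. A_harmonic A S (u k)"
    and Cauchy: "\<And>e. e > 0 \<Longrightarrow> \<exists>N. \<forall>m\<ge>N. \<forall>n\<ge>N. energy_ip A S (u m - u n) (u m - u n) < e"
  shows "\<exists>v. A_harmonic A S v \<and> (\<lambda>k. energy_ip A S (u k - v) (u k - v)) \<longlonglongrightarrow> 0"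
proof -
  have "\<exists>g. L2on S (u k) \<and> is_weak_grad S (u k) g \<and> (\<forall>\<phi>. test_fun S \<phi> \<longrightarrow> E g (grad_fun \<phi>) = 0)" for k
    using u[of k] unfolding A_harmonic_iff by blast
  then have "\<forall>k. \<exists>g. L2on S (u k) \<and> is_weak_grad S (u k) g \<and> (\<forall>\<phi>. test_fun S \<phi> \<longrightarrow> E g (grad_fun \<phi>) = 0)" ..
  from choice[OF this] obtain g where
    gg: "\<forall>k. L2on S (u k) \<and> is_weak_grad S (u k) (g k) \<and> (\<forall>\<phi>. test_fun S \<phi> \<longrightarrow> E (g k) (grad_fun \<phi>) = 0)" ..
  have g: "L2on S (u k)" "is_weak_grad S (u k) (g k)" "test_fun S \<phi> \<Longrightarrow> E (g k) (grad_fun \<phi>) = 0" for k \<phi>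
    using gg[THEN spec, of k] by auto
  have gF: "g k \<in> L2field S" for k by (rule is_weak_grad_L2field[OF g(2)])
  have ip: "energy_ip A S (v - w) (v - w) = E (h - h') (h - h')"
    if "L2on S v" "is_weak_grad S v h" "L2on S w" "is_weak_grad S w h'" for v w h h'
  proof -
    have "H1 S (v - w)" using is_weak_grad_diff[OF that] L2on_minus that by (auto simp: H1_iff)
    then show ?thesis by (intro energy_ip_weak_grad is_weak_grad_diff that)
  qed
  have "\<exists>v h. L2on S v \<and> is_weak_grad S v h \<and> (\<lambda>k. sqnorm S (g k - h)) \<longlonglongrightarrow> 0"
  proof (rule H1_complete[OF g(1,2)])
    fix e :: real assume e: "e > 0"
    obtain N where N: "\<forall>m\<ge>N. \<forall>n\<ge>N. energy_ip A S (u m - u n) (u m - u n) < \<alpha> * e"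
      using Cauchy[of "\<alpha> * e"] alpha_pos e by auto
    have "sqnorm S (g m - g n) < e" if "m \<ge> N" "n \<ge> N" for m n
    proof -
      have "\<alpha> * sqnorm S (g m - g n) < \<alpha> * e"
        using N that E_lower[OF F.closed(3)[OF gF gF], of m n] ip[OF g(1,2) g(1,2), of m n] by (metis order_le_less_trans)
      then show ?thesis using alpha_pos by simp
    qed
    then show "\<exists>N. \<forall>m\<ge>N. \<forall>n\<ge>N. sqnorm S (g m - g n) < e" by blast
  qed
  then obtain v h where v: "L2on S v" "is_weak_grad S v h" and lim: "(\<lambda>k. sqnorm S (g k - h)) \<longlonglongrightarrow> 0" by blast
  have hF: "h \<in> L2field S" by (rule is_weak_grad_L2field[OF v(2)])
  have "E h (grad_fun \<phi>) = 0" if "test_fun S \<phi>" for \<phi>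
    using E_tendsto[OF grad_fun_L2field[OF that] gF hF lim] g(3)[OF that]
    by (simp add: E_sym[of "grad_fun \<phi>"] LIMSEQ_const_iff)
  then have "A_harmonic A S v" using v unfolding A_harmonic_iff by blast
  moreover have "(\<lambda>k. energy_ip A S (u k - v) (u k - v)) \<longlonglongrightarrow> 0"
    unfolding ip[OF g(1,2) v]
  proof (rule tendsto_sandwich[OF _ _ tendsto_const])
    show "(\<lambda>k. \<beta> * sqnorm S (g k - h)) \<longlonglongrightarrow> 0" using tendsto_mult_left[OF lim, of \<beta>] by simp
  qed (auto intro!: always_eventually F.nonneg E_upper F.closed gF hF)
  ultimately show ?thesis by blast
qed

end

section \<open>An inner box whose closure lies in the outer one\<close>

locale energy_pair = energy_box A p q \<alpha> \<beta>
  for A :: "real^'n::finite \<Rightarrow> real^'n^'n" and p q \<alpha> \<beta> +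
  fixes p' q' :: "real^'n"
  assumes inner_sub: "cbox p' q' \<subseteq> box p q" and inner_ne: "box p' q' \<noteq> {}"
begin

abbreviation \<omega> :: "(real^'n) set" where "\<omega> \<equiv> box p' q'"

lemma \<omega>_sub: "\<omega> \<subseteq> S"
  using inner_sub box_subset_cbox by blast

lemma inner_energy_box: "energy_box A p' q' \<alpha> \<beta>"
proof
  show "set_borel_measurable lebesgue \<omega> (\<lambda>x. A x $ i $ j)" for i j
    using set_borel_measurable_subset[OF A_meas _ \<omega>_sub] by simp
  show "\<exists>M. AE x in lebesgue. x \<in> \<omega> \<longrightarrow> \<bar>A x $ i $ j\<bar> \<le> M" for i j
  proof -
    obtain M where "AE x in lebesgue. x \<in> S \<longrightarrow> \<bar>A x $ i $ j\<bar> \<le> M" using A_Linf by blast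
    then have "AE x in lebesgue. x \<in> \<omega> \<longrightarrow> \<bar>A x $ i $ j\<bar> \<le> M" by eventually_elim (use \<omega>_sub in blast)
    then show ?thesis by blast
  qed
  show "AE x in lebesgue. x \<in> \<omega> \<longrightarrow> (\<forall>v. \<alpha> * (norm v)\<^sup>2 \<le> v \<bullet> (A x *v v) \<and> v \<bullet> (A x *v v) \<le> \<beta> * (norm v)\<^sup>2)"
    using ellip by eventually_elim (use \<omega>_sub in blast)
qed (use \<omega>_sub A_sym alpha_pos beta_pos inner_ne in auto)

sublocale inner: energy_box A p' q' \<alpha> \<beta>
  by (rule inner_energy_box)

lemma H1_inner: "H1 S u \<Longrightarrow> H1 \<omega> u"
  using L2on_subset[of S u \<omega>] is_weak_grad_subset[of S u _ \<omega>] \<omega>_sub unfolding H1_iff by (meson lmeasurable_box fmeasurableD)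

lemma L2field_inner: "g \<in> L2field S \<Longrightarrow> g \<in> L2field \<omega>"
  using L2on_subset[OF _ \<omega>_sub] by (auto simp: L2field_def fmeasurableD)

lemma A_harmonic_inner:
  assumes "A_harmonic A S u" shows "A_harmonic A \<omega> u"
proof -
  obtain g where g: "L2on S u" "is_weak_grad S u g" "\<And>\<phi>. test_fun S \<phi> \<Longrightarrow> E g (grad_fun \<phi>) = 0"
    using assms unfolding A_harmonic_iff by blast
  have "inner.E g (grad_fun \<phi>) = 0" if \<phi>: "test_fun \<omega> \<phi>" for \<phi>
  proof -
    have z: "grad_fun \<phi> x = 0" if "x \<notin> \<omega>" for x
      using test_fun_outside[OF test_fun_partial[OF \<phi>] that] by (simp add: vec_eq_iff)
    have "inner.E g (grad_fun \<phi>) = E g (grad_fun \<phi>)"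
      unfolding inner.E_def E_def
      by (rule Bochner_Integration.integral_cong[OF refl]) (use z \<omega>_sub in \<open>auto simp: indicator_def\<close>)
    then show ?thesis using g(3)[OF test_fun_subset[OF \<phi> \<omega>_sub]] by simp
  qed
  moreover have "L2on \<omega> u" by (rule L2on_subset[OF g(1) \<omega>_sub]) simp
  moreover have "is_weak_grad \<omega> u g" by (rule is_weak_grad_subset[OF g(2) \<omega>_sub]) simp
  ultimately show ?thesis unfolding inner.A_harmonic_iff by blast
qed

lemma inner_energy_ip:
  assumes "L2on S u" "is_weak_grad S u g" shows "energy_ip A \<omega> u u = inner.E g g"
proof -
  have "H1 \<omega> u" using assms H1_inner by (auto simp: H1_iff)
  moreover have "is_weak_grad \<omega> u g" by (rule is_weak_grad_subset[OF assms(2) \<omega>_sub]) simp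
  ultimately show ?thesis by (intro inner.energy_ip_weak_grad)
qed

text \<open>Outside the inner box the integrand for \<open>P\<close> is nonnegative by ellipticity.
  With \<open>P\<close> equal to the gradient this compares the two energies; with a cut-off
  gradient it starts Caccioppoli's inequality.\<close>

lemma inner_E_le:
  assumes "g \<in> L2field S" "P \<in> L2field S" "\<And>x. x \<in> \<omega> \<Longrightarrow> P x = g x" shows "inner.E g g \<le> E P P"
  unfolding inner.E_def E_def
proof (rule integral_mono_AE)
  show "AE x in lebesgue. indicator \<omega> x * ((A x *v g x) \<bullet> g x) \<le> indicator S x * ((A x *v P x) \<bullet> P x)"
    using ellip
  proof eventually_elim
    case (elim x)
    show ?case
    proof (cases "x \<in> \<omega>")
      case True
      then show ?thesis using assms(3)[OF True] \<omega>_sub by auto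
    next
      case False
      have "0 \<le> (A x *v P x) \<bullet> P x" if "x \<in> S"
      proof -
        have "\<alpha> * (norm (P x))\<^sup>2 \<le> P x \<bullet> (A x *v P x)" using elim that by blast
        moreover have "0 \<le> \<alpha> * (norm (P x))\<^sup>2" using alpha_pos by simp
        ultimately show ?thesis by (simp add: inner_commute)
      qed
      then show ?thesis using False by (simp add: indicator_def)
    qed
  qed
qed (use inner.E_integrable L2field_inner E_integrable assms in auto)

lemma energy_inner_le:
  assumes "H1 S u" shows "energy_ip A \<omega> u u \<le> energy_ip A S u u"
proof -
  have u: "L2on S u" using assms by (simp add: H1_iff)
  note W = wgrad_is_weak_grad[OF assms]
  show ?thesis unfolding inner_energy_ip[OF u W] unfolding energy_ip_E
    by (rule inner_E_le) (use W in \<open>auto intro: is_weak_grad_L2field\<close>)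
qed

text \<open>Caccioppoli's inequality, by testing the equation with \<open>\<eta>^2 u\<close>: with \<open>P = \<eta> \<nabla>u\<close> and
  \<open>R = u \<nabla>\<eta>\<close> this gives \<open>E P P + 2 E P R = 0\<close>, hence \<open>E P P \<le> 4 E R R\<close>.\<close>

lemma Caccioppoli:
  "\<exists>K\<ge>0. \<forall>u. A_harmonic A S u \<longrightarrow> energy_ip A \<omega> u u \<le> K * (\<integral>x. indicator S x * (u x)\<^sup>2 \<partial>lebesgue)"
proof -
  obtain \<eta> where \<eta>: "test_fun S \<eta>" "\<forall>x\<in>cbox p' q'. \<eta> x = 1"
    using ex_cutoff[OF compact_cbox openS inner_sub] by blast
  have "\<exists>B. \<forall>x. \<bar>partial i \<eta> x\<bar> \<le> B" for i using test_fun_bounded[OF test_fun_partial[OF \<eta>(1)]] by metis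
  then obtain B where B: "\<And>i x. \<bar>partial i \<eta> x\<bar> \<le> B i" by metis
  define M where "M = (\<Sum>i\<in>UNIV. (B i)\<^sup>2)"
  have M0: "M \<ge> 0" unfolding M_def by (intro sum_nonneg) simp
  have main: "energy_ip A \<omega> u u \<le> 4 * \<beta> * M * (\<integral>x. indicator S x * (u x)\<^sup>2 \<partial>lebesgue)" if u: "A_harmonic A S u" for u
  proof -
    obtain g where g: "L2on S u" "is_weak_grad S u g" "\<And>\<phi>. test_fun S \<phi> \<Longrightarrow> E g (grad_fun \<phi>) = 0"
      using u unfolding A_harmonic_iff by blast
    note gF = is_weak_grad_L2field[OF g(2)]
    have \<eta>2: "test_fun S (\<lambda>x. \<eta> x * \<eta> x)" by (rule test_fun_mult[OF \<eta>(1) test_fun_smooth[OF \<eta>(1)]])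
    have P2: "partial i (\<lambda>x. \<eta> x * \<eta> x) x = 2 * \<eta> x * partial i \<eta> x" for i x
      using partial_mult[OF smooth_fun_differentiable smooth_fun_differentiable, OF test_fun_smooth test_fun_smooth, OF \<eta>(1) \<eta>(1), of i x]
      by simp
    \<comment> \<open>\<open>\<eta>\<^sup>2 u\<close> is not smooth, so it is replaced by test
      functions whose gradients converge to its product-rule gradient \<open>G\<close>.\<close>
    obtain W where W: "\<And>k::nat. test_fun S (W k)"
      "\<And>i. (\<lambda>k. L2dist2 lebesgue (partial i (W k)) (\<lambda>x. g x $ i * (\<eta> x * \<eta> x) + u x * (2 * \<eta> x * partial i \<eta> x))) \<longlonglongrightarrow> 0"
      using smooth_approximation_cutoff[OF openS g(1,2) \<eta>2] unfolding P2 by blast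
    define G where "G x = (\<chi> i. g x $ i * (\<eta> x * \<eta> x) + u x * (2 * \<eta> x * partial i \<eta> x))" for x
    have mt: "L2on S (\<lambda>x. v x * \<phi> x)" if "L2on S v" "test_fun S \<phi>" for v \<phi>
      using L2_indicator_mult[OF _ L2on_mult_test(1)[OF that], of S] by (simp add: L2on_def)
    have GLi: "L2 lebesgue (\<lambda>x. g x $ i * (\<eta> x * \<eta> x) + u x * (2 * \<eta> x * partial i \<eta> x))" for i
      using L2_add[OF L2on_mult_test(1)[OF L2fieldD[OF gF] \<eta>2] L2on_mult_test(1)[OF g(1) test_fun_partial[OF \<eta>2]], of i i]
      by (simp only: P2)
    have GF: "G \<in> L2field S"
      using L2_indicator_mult[OF _ GLi, of S] by (simp add: L2field_def G_def L2on_def)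
    have "(\<lambda>k. sqnorm S (grad_fun (W k) - G)) \<longlonglongrightarrow> 0"
    proof -
      have "(\<lambda>k. \<Sum>i\<in>UNIV. \<integral>x. indicator S x * (partial i (W k) x - (g x $ i * (\<eta> x * \<eta> x) + u x * (2 * \<eta> x * partial i \<eta> x)))\<^sup>2 \<partial>lebesgue)
          \<longlonglongrightarrow> (\<Sum>i\<in>(UNIV::'n set). 0)"
        by (intro tendsto_sum)
          (use L2_tendsto_indicator_mult[OF _ test_fun_L2[OF test_fun_partial[OF W(1)]] GLi W(2), of S] in \<open>simp add: L2dist2_indicator\<close>)
      then show ?thesis by (simp add: sqnorm_def G_def)
    qed
    then have "(\<lambda>k. E g (grad_fun (W k))) \<longlonglongrightarrow> E g G"
      by (rule E_tendsto[OF gF grad_fun_L2field[OF W(1)] GF])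
    then have EG: "E g G = 0" by (simp add: g(3)[OF W(1)] LIMSEQ_const_iff)
    define P where "P x = \<eta> x *\<^sub>R g x" for x
    define R where "R x = u x *\<^sub>R grad_fun \<eta> x" for x
    have PF: "P \<in> L2field S" using mt[OF L2fieldD[OF gF] \<eta>(1)] by (simp add: L2field_def P_def mult.commute)
    have RF: "R \<in> L2field S" using mt[OF g(1) test_fun_partial[OF \<eta>(1)]] by (simp add: L2field_def R_def)
    \<comment> \<open>One factor \<open>\<eta>\<close> of \<open>G\<close> moves to the other side
      of the form.\<close>
    have "E g G = E P (P + 2 *\<^sub>R R)"
      unfolding E_def
    proof (rule Bochner_Integration.integral_cong[OF refl])
      fix x
      have "G x = \<eta> x *\<^sub>R (P + 2 *\<^sub>R R) x"
        by (simp add: G_def P_def R_def vec_eq_iff algebra_simps)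
      moreover have "A x *v P x = \<eta> x *\<^sub>R (A x *v g x)" by (simp add: P_def matrix_vector_mult_scaleR)
      ultimately show "indicator S x * ((A x *v g x) \<bullet> G x) = indicator S x * ((A x *v P x) \<bullet> (P + 2 *\<^sub>R R) x)"
        by simp
    qed
    also have "\<dots> = E P P + 2 * E P R"
      using F.add_right[OF PF F.closed(2)[OF RF] PF] F.scale_right[OF RF PF] by simp
    finally have PR: "E P P = - 2 * E P R" using EG by simp
    have "(E P P)\<^sup>2 = 4 * (E P R)\<^sup>2" unfolding PR by (simp add: power2_eq_square)
    also have "\<dots> \<le> 4 * (E P P * E R R)" using F.Cauchy_Schwarz[OF PF RF] by simp
    finally have sq: "E P P * E P P \<le> E P P * (4 * E R R)" by (simp add: power2_eq_square mult_ac)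
    have "E P P \<le> 4 * E R R"
    proof (cases "E P P = 0")
      case True
      then show ?thesis using F.nonneg[OF RF] by simp
    next
      case False
      then have "E P P > 0" using F.nonneg[OF PF] by simp
      then show ?thesis using sq by (simp only: mult_le_cancel_left_pos)
    qed
    also have "\<dots> \<le> 4 * (\<beta> * sqnorm S R)" using E_upper[OF RF] by simp
    also have "sqnorm S R \<le> M * (\<integral>x. indicator S x * (u x)\<^sup>2 \<partial>lebesgue)"
    proof -
      have "sqnorm S R \<le> (\<Sum>i\<in>UNIV. (B i)\<^sup>2 * (\<integral>x. indicator S x * (u x)\<^sup>2 \<partial>lebesgue))"
        unfolding sqnorm_def
      proof (rule sum_mono)
        fix i
        have "(\<integral>x. indicator S x * (R x $ i)\<^sup>2 \<partial>lebesgue) \<le> (\<integral>x. (B i)\<^sup>2 * (indicator S x * (u x)\<^sup>2) \<partial>lebesgue)"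
        proof (rule integral_mono)
          show "integrable lebesgue (\<lambda>x. indicator S x * (R x $ i)\<^sup>2)" by (rule L2on_integrable_square[OF L2fieldD[OF RF]])
          show "integrable lebesgue (\<lambda>x. (B i)\<^sup>2 * (indicator S x * (u x)\<^sup>2))"
            by (intro integrable_mult_right L2on_integrable_square g)
          fix x
          have "(partial i \<eta> x)\<^sup>2 \<le> (B i)\<^sup>2"
            using B[of i x] by (metis abs_ge_zero abs_le_square_iff abs_of_nonneg order_trans)
          from mult_right_mono[OF this, of "(u x)\<^sup>2"] have "(R x $ i)\<^sup>2 \<le> (B i)\<^sup>2 * (u x)\<^sup>2"
            by (simp add: R_def power_mult_distrib mult.commute)
          then show "indicator S x * (R x $ i)\<^sup>2 \<le> (B i)\<^sup>2 * (indicator S x * (u x)\<^sup>2)" by (simp add: indicator_def)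
        qed
        then show "(\<integral>x. indicator S x * (R x $ i)\<^sup>2 \<partial>lebesgue) \<le> (B i)\<^sup>2 * (\<integral>x. indicator S x * (u x)\<^sup>2 \<partial>lebesgue)" by simp
      qed
      then show ?thesis by (simp add: M_def sum_distrib_right)
    qed
    finally have EP: "E P P \<le> 4 * \<beta> * M * (\<integral>x. indicator S x * (u x)\<^sup>2 \<partial>lebesgue)" using beta_pos by (simp add: mult_left_mono)
    have "energy_ip A \<omega> u u = inner.E g g" by (rule inner_energy_ip[OF g(1,2)])
    also have "\<dots> \<le> E P P"
    proof (rule inner_E_le[OF gF PF])
      show "P x = g x" if "x \<in> \<omega>" for x using that \<eta>(2) box_subset_cbox[of p' q'] by (auto simp: P_def)
    qed
    finally show ?thesis using EP by linarith
  qed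
  show ?thesis using main M0 beta_pos by (intro exI[of _ "4 * \<beta> * M"]) auto
qed

end

section \<open>The Dirichlet problem and the dimension of the space of A-harmonic functions\<close>

context energy_box
begin

lemma A_harmonic_centered:
  assumes "A_harmonic A S u" shows "A_harmonic A S (centered u)"
  unfolding centered_def by (rule A_harmonic_lincomb[OF assms A_harmonic_const])

lemma centered_diff:
  assumes "L2on S u" "L2on S v" shows "centered (u - v) = centered u - centered v"
proof -
  have "mean (u - v) = mean u - mean v"
    using L2on_integrable_self[OF assms(1) lmeasS] L2on_integrable_self[OF assms(2) lmeasS]
    by (simp add: mean_def right_diff_distrib diff_divide_distrib)
  then show ?thesis by (auto simp: fun_eq_iff centered_apply)
qed

text \<open>Cauchy-Schwarz against the indicator of \<open>K\<close>. For \<open>K\<close> of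
  measure zero the quotient is 0 by convention.\<close>

lemma average_bound:
  assumes u: "L2on S u" and K: "K \<in> lmeasurable" "K \<subseteq> S"
  shows "(\<integral>x. indicator K x * u x \<partial>lebesgue)\<^sup>2 / measure lebesgue K \<le> (\<integral>x. indicator S x * (u x)\<^sup>2 \<partial>lebesgue)"
proof -
  have L: "L2 lebesgue (\<lambda>x. indicator K x * u x)"
    using L2on_subset[OF u K(2) fmeasurableD[OF K(1)]] by (simp add: L2on_def)
  have "(\<integral>x. (indicator K x * u x) * indicator K x \<partial>lebesgue)\<^sup>2
      \<le> (\<integral>x. (indicator K x * u x)\<^sup>2 \<partial>lebesgue) * (\<integral>x. (indicator K x)\<^sup>2 \<partial>lebesgue)"
    by (rule L2_Cauchy_Schwarz[OF L L2_indicator[OF K(1)]])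
  moreover have "(indicator K x * u x) * indicator K x = indicator K x * u x" for x by (simp add: indicator_def)
  moreover have "(indicator K x)\<^sup>2 = (indicator K x :: real)" for x by (simp add: indicator_def)
  ultimately have "(\<integral>x. indicator K x * u x \<partial>lebesgue)\<^sup>2 \<le> (\<integral>x. indicator K x * (u x)\<^sup>2 \<partial>lebesgue) * measure lebesgue K"
    using K(1) by (simp add: indicator_mult_square fmeasurableD)
  moreover have "(\<integral>x. indicator K x * (u x)\<^sup>2 \<partial>lebesgue) \<le> (\<integral>x. indicator S x * (u x)\<^sup>2 \<partial>lebesgue)"
    by (rule integral_mono[OF L2on_integrable(2)[OF u K] L2on_integrable_square[OF u]])
      (use K(2) in \<open>auto simp: indicator_def\<close>)
  moreover have "0 \<le> (\<integral>x. indicator S x * (u x)\<^sup>2 \<partial>lebesgue)" by (rule integral_nonneg_AE) simp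
  ultimately show ?thesis
    using measure_nonneg[of lebesgue K] mult_right_mono[of "\<integral>x. indicator K x * (u x)\<^sup>2 \<partial>lebesgue" "\<integral>x. indicator S x * (u x)\<^sup>2 \<partial>lebesgue" "measure lebesgue K"]
    by (cases "measure lebesgue K = 0") (simp_all add: divide_le_eq)
qed

text \<open>Minimise the energy of \<open>u0 - \<psi>\<close> over all test functions \<open>\<psi>\<close>.\<close>

lemma Dirichlet_problem:
  assumes u0: "L2on S u0" "is_weak_grad S u0 g0"
  shows "\<exists>v h \<psi>. A_harmonic A S v \<and> is_weak_grad S v h \<and> (\<forall>k::nat. test_fun S (\<psi> k)) \<and>
    (\<lambda>k. sqnorm S (g0 - grad_fun (\<psi> k) - h)) \<longlonglongrightarrow> 0"
proof -
  have g0F: "g0 \<in> L2field S" by (rule is_weak_grad_L2field[OF u0(2)])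
  define X where "X = {E (g0 - grad_fun \<psi>) (g0 - grad_fun \<psi>) | \<psi>. test_fun S \<psi>}"
  define d where "d = Inf X"
  have Xne: "X \<noteq> {}" unfolding X_def using test_fun_zero by blast
  have bdd: "bdd_below X"
    unfolding X_def bdd_below_def by (intro exI[of _ 0]) (auto intro!: F.nonneg F.closed g0F grad_fun_L2field)
  have dle: "d \<le> E (g0 - grad_fun \<psi>) (g0 - grad_fun \<psi>)" if "test_fun S \<psi>" for \<psi>
    unfolding d_def by (rule cInf_lower[OF _ bdd]) (use that in \<open>auto simp: X_def\<close>)
  have "\<exists>\<psi>. test_fun S \<psi> \<and> E (g0 - grad_fun \<psi>) (g0 - grad_fun \<psi>) < d + inverse (real (Suc k))" for k
  proof -
    have "Inf X < d + inverse (real (Suc k))" by (simp add: d_def)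
    then obtain x where "x \<in> X" "x < d + inverse (real (Suc k))" using cInf_less_iff[OF Xne bdd] by blast
    then show ?thesis unfolding X_def by blast
  qed
  then have "\<forall>k. \<exists>\<psi>. test_fun S \<psi> \<and> E (g0 - grad_fun \<psi>) (g0 - grad_fun \<psi>) < d + inverse (real (Suc k))" ..
  from choice[OF this] obtain \<psi> where
    psi: "\<forall>k. test_fun S (\<psi> k) \<and> E (g0 - grad_fun (\<psi> k)) (g0 - grad_fun (\<psi> k)) < d + inverse (real (Suc k))" ..
  have \<psi>: "test_fun S (\<psi> k)" and \<psi>d: "E (g0 - grad_fun (\<psi> k)) (g0 - grad_fun (\<psi> k)) < d + inverse (real (Suc k))" for k
    using psi[THEN spec, of k] by auto
  define g where "g k = g0 - grad_fun (\<psi> k)" for k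
  have gF: "g k \<in> L2field S" for k unfolding g_def by (intro F.closed g0F grad_fun_L2field \<psi>)
  have grad_lin: "grad_fun (\<lambda>x. f x + r * f' x) = grad_fun f + r *\<^sub>R grad_fun f'" if "test_fun S f" "test_fun S f'" for f f' r
  proof -
    note D = smooth_fun_differentiable[OF test_fun_smooth[OF that(1)]] smooth_fun_differentiable[OF test_fun_smooth[OF that(2)]]
    have "partial i (\<lambda>x. f x + r * f' x) x = partial i f x + r * partial i f' x" for i x
      using D by (subst partial_add) (auto simp: partial_cmult)
    then show ?thesis by (simp add: fun_eq_iff vec_eq_iff)
  qed
  have shift: "d \<le> E (g k + t *\<^sub>R grad_fun f) (g k + t *\<^sub>R grad_fun f)" if f: "test_fun S f" for f k t
  proof -
    have "test_fun S (\<lambda>x. \<psi> k x + (- t) * f x)" by (intro test_fun_add test_fun_cmult \<psi> f)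
    moreover have "g0 - (grad_fun (\<psi> k) + (- t) *\<^sub>R grad_fun f) = g k + t *\<^sub>R grad_fun f"
      by (simp add: g_def algebra_simps)
    ultimately show ?thesis using dle[of "\<lambda>x. \<psi> k x + (- t) * f x"] by (simp only: grad_lin[OF \<psi> f])
  qed
  have Cauchy: "sqnorm S (g m - g n) \<le> (2 * inverse (real (Suc m)) + 2 * inverse (real (Suc n))) / \<alpha>" for m n
  proof -
    \<comment> \<open>The midpoint of two near-minimisers is admissible, so its energy is at least
      \<open>d\<close>; the parallelogram identity then bounds the difference.\<close>
    have half: "test_fun S (\<lambda>x. (1/2) * \<psi> m x + (1/2) * \<psi> n x)" by (intro test_fun_add test_fun_cmult \<psi>)
    have hs: "test_fun S (\<lambda>x. (1/2) * \<psi> m x)" by (intro test_fun_cmult \<psi>)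
    have pc: "partial i (\<lambda>x. (1/2) * \<psi> m x) x = (1/2) * partial i (\<psi> m) x" for i x
      by (rule partial_cmult[OF smooth_fun_differentiable[OF test_fun_smooth[OF \<psi>]]])
    have hg: "grad_fun (\<lambda>x. (1/2) * \<psi> m x) = (1/2) *\<^sub>R grad_fun (\<psi> m)"
      by (simp only: fun_eq_iff vec_eq_iff grad_fun_nth scaleR_fun_apply vector_scaleR_component pc real_scaleR_def simp_thms)
    have "g0 - grad_fun (\<lambda>x. (1/2) * \<psi> m x + (1/2) * \<psi> n x) = (1/2) *\<^sub>R (g m + g n)"
      unfolding grad_lin[OF hs \<psi>] hg by (simp add: g_def fun_eq_iff vec_eq_iff field_simps)
    then have "d \<le> E ((1/2) *\<^sub>R (g m + g n)) ((1/2) *\<^sub>R (g m + g n))" using dle[OF half] by simp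
    also have "\<dots> = (1/4) * E (g m + g n) (g m + g n)"
      using F.scale_square[OF F.closed(1)[OF gF gF], of "1/2"] by (simp add: power2_eq_square)
    finally have "4 * d \<le> E (g m) (g m) + 2 * E (g m) (g n) + E (g n) (g n)"
      unfolding F.expand_plus[OF gF gF] by simp
    moreover have "E (g m) (g m) < d + inverse (real (Suc m))" "E (g n) (g n) < d + inverse (real (Suc n))"
      using \<psi>d by (auto simp: g_def)
    ultimately have "E (g m - g n) (g m - g n) \<le> 2 * inverse (real (Suc m)) + 2 * inverse (real (Suc n))"
      unfolding F.diff_square[OF gF gF] by linarith
    then have "\<alpha> * sqnorm S (g m - g n) \<le> 2 * inverse (real (Suc m)) + 2 * inverse (real (Suc n))"
      using E_lower[OF F.closed(3)[OF gF gF], of m n] by linarith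
    then show ?thesis using alpha_pos by (simp add: pos_le_divide_eq mult.commute)
  qed
  define U where "U k = u0 + (-1) *\<^sub>R \<psi> k" for k
  have UL: "L2on S (U k)" for k
    using L2on_diff[OF u0(1) L2on_test_fun[OF \<psi>]] by (simp add: U_def plus_fun_def fun_diff_def)
  have Ug: "is_weak_grad S (U k) (g k)" for k
  proof -
    have "is_weak_grad S (\<psi> k) (grad_fun (\<psi> k))"
      by (rule is_weak_grad_smooth[OF test_fun_smooth[OF \<psi>] grad_fun_L2field[OF \<psi>]])
    from is_weak_grad_lincomb[OF u0 L2on_test_fun[OF \<psi>] this, of "-1"] show ?thesis
      by (simp add: U_def g_def)
  qed
  have "\<exists>v h. L2on S v \<and> is_weak_grad S v h \<and> (\<lambda>k. sqnorm S (g k - h)) \<longlonglongrightarrow> 0"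
  proof (rule H1_complete[OF UL Ug])
    fix e :: real assume e: "e > 0"
    have "(\<lambda>k. inverse (real (Suc k))) \<longlonglongrightarrow> 0" by (rule LIMSEQ_inverse_real_of_nat)
    then have "\<forall>\<^sub>F k in sequentially. inverse (real (Suc k)) < e * \<alpha> / 4"
      using e alpha_pos by (intro order_tendstoD) auto
    then obtain N where N: "\<And>k. k \<ge> N \<Longrightarrow> inverse (real (Suc k)) < e * \<alpha> / 4" by (auto simp: eventually_sequentially)
    have "sqnorm S (g m - g n) < e" if "m \<ge> N" "n \<ge> N" for m n
    proof -
      have "2 * inverse (real (Suc m)) + 2 * inverse (real (Suc n)) < e * \<alpha>"
        using N[OF that(1)] N[OF that(2)] by linarith
      then have "(2 * inverse (real (Suc m)) + 2 * inverse (real (Suc n))) / \<alpha> < e"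
        using alpha_pos by (simp only: pos_divide_less_eq)
      then show ?thesis using Cauchy[of m n] by linarith
    qed
    then show "\<exists>N. \<forall>m\<ge>N. \<forall>n\<ge>N. sqnorm S (g m - g n) < e" by blast
  qed
  then obtain v h where v: "L2on S v" "is_weak_grad S v h" and lim: "(\<lambda>k. sqnorm S (g k - h)) \<longlonglongrightarrow> 0" by blast
  have hF: "h \<in> L2field S" by (rule is_weak_grad_L2field[OF v(2)])
  have Elim: "(\<lambda>k. E (g k - h) (g k - h)) \<longlonglongrightarrow> 0"
  proof (rule tendsto_sandwich[OF _ _ tendsto_const])
    show "(\<lambda>k. \<beta> * sqnorm S (g k - h)) \<longlonglongrightarrow> 0" using tendsto_mult_left[OF lim, of \<beta>] by simp
  qed (auto intro!: always_eventually F.nonneg E_upper F.closed gF hF)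
  have Eh: "E h h \<le> d + 0"
    by (rule LIMSEQ_le[OF F.tendsto_form(2)[OF gF hF hF Elim] tendsto_add[OF tendsto_const LIMSEQ_inverse_real_of_nat]])
      (use \<psi>d in \<open>auto simp: g_def less_imp_le\<close>)
  have low: "d \<le> E h h + 2 * t * E h (grad_fun f) + t\<^sup>2 * E (grad_fun f) (grad_fun f)" if f: "test_fun S f" for f t
  proof (rule LIMSEQ_le[OF tendsto_const])
    note fF = grad_fun_L2field[OF f]
    show "(\<lambda>k. E (g k) (g k) + 2 * t * E (g k) (grad_fun f) + t\<^sup>2 * E (grad_fun f) (grad_fun f))
      \<longlonglongrightarrow> E h h + 2 * t * E h (grad_fun f) + t\<^sup>2 * E (grad_fun f) (grad_fun f)"
      by (intro tendsto_add tendsto_mult tendsto_const F.tendsto_form(1)[OF gF hF fF Elim] F.tendsto_form(2)[OF gF hF hF Elim])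
    show "\<exists>N. \<forall>k\<ge>N. d \<le> E (g k) (g k) + 2 * t * E (g k) (grad_fun f) + t\<^sup>2 * E (grad_fun f) (grad_fun f)"
      using shift[OF f] unfolding F.expand[OF gF fF] by blast
  qed
  \<comment> \<open>The minimum is attained at \<open>h\<close>, so the variation in direction
    \<open>f\<close> is a nonnegative quadratic in \<open>t\<close> without constant term, which
    forces its linear coefficient to vanish.\<close>
  have pos: "0 \<le> 0 + 2 * t * E h (grad_fun f) + t\<^sup>2 * E (grad_fun f) (grad_fun f)" if "test_fun S f" for f t
    using low[OF that, of t] Eh by linarith
  have "E h (grad_fun f) = 0" if f: "test_fun S f" for f
    using nonneg_discriminant[of 0 "E h (grad_fun f)" "E (grad_fun f) (grad_fun f)", OF pos[OF f]] by simp
  then have "A_harmonic A S v" using v unfolding A_harmonic_iff by blast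
  then show ?thesis using v(2) \<psi> lim unfolding g_def by blast
qed

lemma smooth_L2on:
  assumes "smooth_fun f" shows "L2on S f"
proof -
  have "compact (f ` cbox p q)" by (intro compact_continuous_image smooth_continuous assms compact_cbox)
  then obtain B where "\<And>x. x \<in> cbox p q \<Longrightarrow> \<bar>f x\<bar> \<le> B" by (force simp: bounded_iff dest!: compact_imp_bounded)
  then show ?thesis
    using box_subset_cbox[of p q] by (intro L2on_bounded[OF lmeasS smooth_lebesgue_measurable[OF assms], of B]) blast
qed

lemma partial_coordinate: "partial i (\<lambda>x::real^'n. x $ j) x = (if i = j then 1 else 0)"
proof -
  have "((\<lambda>x::real^'n. x $ j) has_derivative (\<lambda>h. h $ j)) (at x)"
    by (rule bounded_linear_imp_has_derivative) (rule bounded_linear_vec_nth)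
  from has_derivative_imp_partial[OF this] show ?thesis by (simp add: axis_def)
qed

lemma partial_coordinate_power:
  assumes "i \<noteq> j" shows "partial i (\<lambda>x::real^'n. (x $ j) ^ k) x = 0"
proof -
  have "((\<lambda>x::real^'n. x $ j) has_derivative (\<lambda>h. h $ j)) (at x)"
    by (rule bounded_linear_imp_has_derivative) (rule bounded_linear_vec_nth)
  from has_derivative_imp_partial[OF has_derivative_power[OF this]] assms show ?thesis
    by (simp add: axis_def)
qed

text \<open>In dimension at least two, the solutions \<open>v k\<close> of the Dirichlet problem with data \<open>x_i x_j^k\<close> are independent
  modulo constants: for a smooth function \<open>h\<close> of \<open>x_j\<close> alone the functional \<open>p \<mapsto> \<integral> p_i h\<close> vanishes on gradients of test
  functions, so on \<open>\<nabla>(v k)\<close> it takes the value \<open>\<integral> x_j^k h\<close>.\<close>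

lemma ex_independent_A_harmonic:
  assumes ij: "(i::'n) \<noteq> j"
  shows "\<exists>v. (\<forall>k<n. A_harmonic A S (v k)) \<and> indep_mod_const S v n"
proof -
  define f where "f k x = x $ i * (x $ j) ^ k" for k :: nat and x :: "real^'n"
  have fs: "smooth_fun (f k)" for k
    unfolding f_def[abs_def] by (intro smooth_mult smooth_coordinate smooth_power)
  have fi: "partial i (f k) x = (x $ j) ^ k" for k x
    unfolding f_def[abs_def]
    by (subst partial_mult)
      (use ij in \<open>auto simp: partial_coordinate partial_coordinate_power intro!: smooth_fun_differentiable smooth_coordinate smooth_power\<close>)
  have fF: "grad_fun (f k) \<in> L2field S" for k
    by (simp add: L2field_def smooth_L2on smooth_fun_partial fs)
  have fg: "is_weak_grad S (f k) (grad_fun (f k))" for k by (rule is_weak_grad_smooth[OF fs fF])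
  have "\<forall>k. \<exists>vh. A_harmonic A S (fst vh) \<and> is_weak_grad S (fst vh) (snd vh) \<and>
    (\<exists>\<psi>. (\<forall>l::nat. test_fun S (\<psi> l)) \<and> (\<lambda>l. sqnorm S (grad_fun (f k) - grad_fun (\<psi> l) - snd vh)) \<longlonglongrightarrow> 0)"
    using Dirichlet_problem[OF smooth_L2on[OF fs] fg] by fastforce
  from choice[OF this] obtain vh where vh: "\<And>k. A_harmonic A S (fst (vh k))" "\<And>k. is_weak_grad S (fst (vh k)) (snd (vh k))"
    "\<And>k. \<exists>\<psi>. (\<forall>l::nat. test_fun S (\<psi> l)) \<and> (\<lambda>l. sqnorm S (grad_fun (f k) - grad_fun (\<psi> l) - snd (vh k))) \<longlonglongrightarrow> 0"
    by blast
  define v where "v k = fst (vh k)" for k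
  define g where "g k = snd (vh k)" for k
  have vA: "A_harmonic A S (v k)" and vg: "is_weak_grad S (v k) (g k)" for k using vh by (auto simp: v_def g_def)
  have vL: "L2on S (v k)" for k using vA A_harmonic_iff by blast
  have gF: "g k \<in> L2field S" for k by (rule is_weak_grad_L2field[OF vg])
  have "\<forall>k<n. c k = 0" if const: "const_on S (\<lambda>x. \<Sum>k<n. c k * v k x)" for c
  proof -
    \<comment> \<open>The same coefficients as in the supposed relation: pairing the relation with
      \<open>h\<close> then yields the integral of \<open>h\<^sup>2\<close>, so \<open>h\<close>
      vanishes on the box.\<close>
    define h where "h x = (\<Sum>k<n. c k * (x $ j) ^ k)" for x :: "real^'n"
    have hs: "smooth_fun h" unfolding h_def[abs_def] by (intro smooth_sum smooth_cmult smooth_power smooth_coordinate)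
    have h0: "partial i h x = 0" for x
    proof -
      have d: "(\<lambda>x::real^'n. (x $ j) ^ k) differentiable (at x)" for k
        by (intro smooth_fun_differentiable smooth_power smooth_coordinate)
      have cd: "(\<lambda>x::real^'n. c k * (x $ j) ^ k) differentiable (at x)" for k
        by (intro smooth_fun_differentiable smooth_cmult smooth_power smooth_coordinate)
      have "partial i (\<lambda>x. c k * (x $ j) ^ k) x = 0" for k
        using partial_cmult[OF d] partial_coordinate_power[OF ij] by simp
      then show ?thesis unfolding h_def[abs_def] by (subst partial_sum[OF cd]) simp
    qed
    have hL: "L2on S h" by (rule smooth_L2on[OF hs])
    define \<Lambda> where "\<Lambda> P = (\<integral>x. indicator S x * (P x $ i * h x) \<partial>lebesgue)" for P :: "real^'n \<Rightarrow> real^'n"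
    have int: "integrable lebesgue (\<lambda>x. indicator S x * (P x $ i * h x))" if "P \<in> L2field S" for P
      by (rule L2on_integrable_mult[OF L2fieldD[OF that] hL])
    have \<Lambda>_diff: "\<Lambda> (P - Q) = \<Lambda> P - \<Lambda> Q" if "P \<in> L2field S" "Q \<in> L2field S" for P Q
      using int[OF that(1)] int[OF that(2)] by (simp add: \<Lambda>_def left_diff_distrib right_diff_distrib)
    have \<Lambda>_bound: "(\<Lambda> P)\<^sup>2 \<le> sqnorm S P * (\<integral>x. indicator S x * (h x)\<^sup>2 \<partial>lebesgue)" if P: "P \<in> L2field S" for P
    proof -
      have "(\<integral>x. (indicator S x * P x $ i) * (indicator S x * h x) \<partial>lebesgue)\<^sup>2
        \<le> (\<integral>x. (indicator S x * P x $ i)\<^sup>2 \<partial>lebesgue) * (\<integral>x. (indicator S x * h x)\<^sup>2 \<partial>lebesgue)"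
        by (rule L2_Cauchy_Schwarz) (use L2fieldD[OF P] hL in \<open>auto simp: L2on_def\<close>)
      moreover have "(indicator S x * P x $ i) * (indicator S x * h x) = indicator S x * (P x $ i * h x)"
        "(indicator S x * P x $ i)\<^sup>2 = indicator S x * (P x $ i)\<^sup>2" for x
        by (simp_all add: indicator_def)
      ultimately have "(\<Lambda> P)\<^sup>2 \<le> (\<integral>x. indicator S x * (P x $ i)\<^sup>2 \<partial>lebesgue) * (\<integral>x. indicator S x * (h x)\<^sup>2 \<partial>lebesgue)"
        by (simp only: \<Lambda>_def indicator_mult_square)
      also have "\<dots> \<le> sqnorm S P * (\<integral>x. indicator S x * (h x)\<^sup>2 \<partial>lebesgue)"
      proof (rule mult_right_mono)
        show "(\<integral>x. indicator S x * (P x $ i)\<^sup>2 \<partial>lebesgue) \<le> sqnorm S P"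
          unfolding sqnorm_def
          by (rule member_le_sum[where f="\<lambda>i. \<integral>x. indicator S x * (P x $ i)\<^sup>2 \<partial>lebesgue"])
            (auto intro!: integral_nonneg_AE)
      qed (auto intro!: integral_nonneg_AE)
      finally show ?thesis .
    qed
    have \<Lambda>_test: "\<Lambda> (grad_fun \<psi>) = 0" if \<psi>: "test_fun S \<psi>" for \<psi>
    proof -
      have "indicator S x * (grad_fun \<psi> x $ i * h x) = h x * partial i \<psi> x" for x
        using test_fun_indicator[OF test_fun_partial[OF \<psi>], of x i] by auto
      then have "\<Lambda> (grad_fun \<psi>) = (\<integral>x. h x * partial i \<psi> x \<partial>lebesgue)" by (simp only: \<Lambda>_def)
      also have "\<dots> = - (\<integral>x. partial i h x * \<psi> x \<partial>lebesgue)" by (rule integration_by_parts_smooth[OF hs \<psi>])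
      finally show ?thesis by (simp add: h0)
    qed
    have \<Lambda>_g: "\<Lambda> (g k) = (\<integral>x. indicator S x * ((x $ j) ^ k * h x) \<partial>lebesgue)" for k
    proof -
      obtain \<psi> where \<psi>: "\<And>l::nat. test_fun S (\<psi> l)" "(\<lambda>l. sqnorm S (grad_fun (f k) - grad_fun (\<psi> l) - g k)) \<longlonglongrightarrow> 0"
        using vh(3)[of k] unfolding g_def by blast
      have pF: "grad_fun (\<psi> l) \<in> L2field S" for l by (rule grad_fun_L2field[OF \<psi>(1)])
      have eq: "\<Lambda> (grad_fun (f k) - grad_fun (\<psi> l) - g k) = \<Lambda> (grad_fun (f k)) - \<Lambda> (g k)" for l
        using \<Lambda>_diff[OF F.closed(3)[OF fF pF] gF] \<Lambda>_diff[OF fF pF] \<Lambda>_test[OF \<psi>(1)] by simp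
      have "(\<Lambda> (grad_fun (f k)) - \<Lambda> (g k))\<^sup>2
        \<le> sqnorm S (grad_fun (f k) - grad_fun (\<psi> l) - g k) * (\<integral>x. indicator S x * (h x)\<^sup>2 \<partial>lebesgue)" for l
        using \<Lambda>_bound[OF F.closed(3)[OF F.closed(3)[OF fF pF] gF], of k l k] unfolding eq .
      moreover have "(\<lambda>l. sqnorm S (grad_fun (f k) - grad_fun (\<psi> l) - g k) * (\<integral>x. indicator S x * (h x)\<^sup>2 \<partial>lebesgue)) \<longlonglongrightarrow> 0"
        using tendsto_mult_right[OF \<psi>(2)] by simp
      ultimately have "(\<Lambda> (grad_fun (f k)) - \<Lambda> (g k))\<^sup>2 \<le> 0"
        by (intro LIMSEQ_le[OF tendsto_const]) auto
      then show ?thesis by (simp add: \<Lambda>_def fi)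
    qed
    define u where "u = (\<Sum>k<n. c k *\<^sub>R v k)"
    define G where "G = (\<Sum>k<n. c k *\<^sub>R g k)"
    have uG: "L2on S (\<Sum>k<m. c k *\<^sub>R v k) \<and> is_weak_grad S (\<Sum>k<m. c k *\<^sub>R v k) (\<Sum>k<m. c k *\<^sub>R g k)" for m
    proof (induction m)
      case 0
      then show ?case using L2on_const[of 0] is_weak_grad_const[of 0] by (simp add: zero_fun_def)
    next
      case (Suc m)
      have "L2on S ((\<Sum>k<m. c k *\<^sub>R v k) + c m *\<^sub>R v m)"
        using L2on_add[OF conjunct1[OF Suc] L2on_cmult[OF vL, of "c m" m]] by (simp add: plus_fun_def scaleR_fun_def)
      then show ?case using is_weak_grad_lincomb[OF conjunct1[OF Suc] conjunct2[OF Suc] vL vg, of "c m" m]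
        by (simp only: sum.lessThan_Suc simp_thms)
    qed
    have H: "H1 S u" using uG[of n] by (auto simp: H1_iff u_def)
    have "(\<lambda>x. \<Sum>k<n. c k * v k x) = u" by (simp add: u_def fun_eq_iff)
    then have "energy_ip A S u u = 0" using const const_on_iff[OF H] by simp
    then have "E G G = 0" using energy_ip_weak_grad[OF H H, of G G] uG[of n] by (simp add: u_def G_def)
    moreover have GF: "G \<in> L2field S" unfolding G_def by (rule F.sum_closed) (rule gF)
    ultimately have "\<alpha> * sqnorm S G \<le> 0" using E_lower[OF GF] by simp
    then have "sqnorm S G = 0" using sqnorm_nonneg[of S G] alpha_pos by (simp add: mult_le_0_iff)
    then have "\<Lambda> G = 0" using \<Lambda>_bound[OF GF] by simp
    moreover have "\<Lambda> G = (\<Sum>k<n. c k * \<Lambda> (g k))"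
    proof -
      have "indicator S x * (G x $ i * h x) = (\<Sum>k<n. c k * (indicator S x * (g k x $ i * h x)))" for x
        by (simp add: G_def sum_distrib_left sum_distrib_right mult_ac)
      then have "\<Lambda> G = (\<integral>x. (\<Sum>k<n. c k * (indicator S x * (g k x $ i * h x))) \<partial>lebesgue)" by (simp only: \<Lambda>_def)
      also have "\<dots> = (\<Sum>k<n. \<integral>x. c k * (indicator S x * (g k x $ i * h x)) \<partial>lebesgue)"
        by (rule Bochner_Integration.integral_sum) (intro integrable_mult_right int gF)
      finally show ?thesis by (simp only: \<Lambda>_def integral_mult_right_zero)
    qed
    moreover have "(\<Sum>k<n. c k * \<Lambda> (g k)) = (\<integral>x. indicator S x * (h x)\<^sup>2 \<partial>lebesgue)"
    proof -
      have i: "integrable lebesgue (\<lambda>x. indicator S x * ((x $ j) ^ k * h x))" for k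
        by (rule L2on_integrable_mult[OF smooth_L2on hL]) (intro smooth_power smooth_coordinate)
      have "indicator S x * (h x)\<^sup>2 = (\<Sum>k<n. c k * (indicator S x * ((x $ j) ^ k * h x)))" for x
      proof -
        have "(\<Sum>k<n. c k * (indicator S x * ((x $ j) ^ k * h x))) = indicator S x * ((\<Sum>k<n. c k * (x $ j) ^ k) * h x)"
          by (simp only: sum_distrib_left sum_distrib_right mult_ac)
        then show ?thesis by (simp only: h_def[of x, symmetric] power2_eq_square)
      qed
      then have "(\<integral>x. indicator S x * (h x)\<^sup>2 \<partial>lebesgue) = (\<integral>x. (\<Sum>k<n. c k * (indicator S x * ((x $ j) ^ k * h x))) \<partial>lebesgue)"
        by (simp only:)
      also have "\<dots> = (\<Sum>k<n. \<integral>x. c k * (indicator S x * ((x $ j) ^ k * h x)) \<partial>lebesgue)"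
        by (rule Bochner_Integration.integral_sum) (intro integrable_mult_right i)
      finally show ?thesis by (simp only: \<Lambda>_g integral_mult_right_zero)
    qed
    ultimately have "(\<integral>x. indicator S x * (h x)\<^sup>2 \<partial>lebesgue) = 0" by simp
    moreover have "(\<integral>x. indicator S x * (h x)\<^sup>2 \<partial>lebesgue) = 0 \<longleftrightarrow> (AE x in lebesgue. indicator S x * (h x)\<^sup>2 = 0)"
      by (rule integral_nonneg_eq_0_iff_AE[OF L2on_integrable_square[OF hL]]) simp
    ultimately have "AE x in lebesgue. indicator S x * (h x)\<^sup>2 = 0" by blast
    then have ae: "AE x in lebesgue. \<not> (x \<in> S \<and> h x \<noteq> 0)" by eventually_elim (auto simp: indicator_def)
    have op: "open (S \<inter> {x. h x \<noteq> 0})"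
      using open_Collect_neq[OF smooth_continuous[OF hs] continuous_on_const] by (intro open_Int open_box)
    have "S \<inter> {x. h x \<noteq> 0} \<in> null_sets lebesgue"
      using AE_iff_null[of lebesgue "\<lambda>x. \<not> (x \<in> S \<and> h x \<noteq> 0)"] ae op by (simp add: Collect_conj_eq)
    then have "negligible (S \<inter> {x. h x \<noteq> 0})" by (simp add: negligible_iff_null_sets)
    then have "S \<inter> {x. h x \<noteq> 0} = {}" using op open_not_negligible by blast
    then have hz: "h x = 0" if "x \<in> S" for x using that by blast
    obtain x0 where x0: "x0 \<in> S" using ne by blast
    then have pj: "p $ j < q $ j" by (auto simp: mem_box_cart intro: less_trans)
    \<comment> \<open>Vary the \<open>j\<close>-th coordinate of a fixed point of the box: the
      one-variable polynomial with coefficients \<open>c\<close> vanishes on an interval.\<close>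
    have "(\<Sum>k<n. c k * t ^ k) = 0" if t: "t \<in> {p $ j<..<q $ j}" for t
    proof -
      have "(\<chi> l. if l = j then t else x0 $ l) \<in> S" using x0 t by (simp add: mem_box_cart)
      from hz[OF this] show ?thesis by (simp add: h_def)
    qed
    then have sub: "{p $ j<..<q $ j} \<subseteq> {t. (\<Sum>k<n. c k * t ^ k) = 0}" by blast
    show ?thesis
    proof (cases n)
      case (Suc m)
      have eq: "{..<n} = {..m}" using Suc by auto
      have "infinite {t. (\<Sum>k<n. c k * t ^ k) = 0}"
        using finite_subset[OF sub] infinite_Ioo[OF pj] by blast
      then have "infinite {t. (\<Sum>k\<le>m. c k * t ^ k) = 0}" unfolding eq .
      then have "\<forall>k\<le>m. c k = 0" using polyfun_finite_roots[of c m] by auto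
      then show ?thesis using Suc by auto
    qed simp
  qed
  then show ?thesis using vA unfolding indep_mod_const_def by blast
qed

text \<open>In dimension one the flux \<open>A \<nabla>u\<close> is constant, so harmonic functions modulo constants form a line.\<close>

lemma one_dimensional_dependent:
  assumes one: "(UNIV :: 'n set) = {i}" and u: "\<And>k::nat. A_harmonic A S (u k)"
  shows "\<not> indep_mod_const S u 2"
proof
  assume indep: "indep_mod_const S u 2"
  have "\<forall>k. \<exists>g. L2on S (u k) \<and> is_weak_grad S (u k) g \<and> (\<forall>\<phi>. test_fun S \<phi> \<longrightarrow> E g (grad_fun \<phi>) = 0)"
    using u unfolding A_harmonic_iff by blast
  from choice[OF this] obtain g where
    gg: "\<forall>k. L2on S (u k) \<and> is_weak_grad S (u k) (g k) \<and> (\<forall>\<phi>. test_fun S \<phi> \<longrightarrow> E (g k) (grad_fun \<phi>) = 0)" ..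
  have g: "L2on S (u k)" "is_weak_grad S (u k) (g k)" "test_fun S \<phi> \<Longrightarrow> E (g k) (grad_fun \<phi>) = 0" for k \<phi>
    using gg[THEN spec, of k] by auto
  have gF: "g k \<in> L2field S" for k by (rule is_weak_grad_L2field[OF g(2)])
  have inner1: "x \<bullet> y = x $ i * y $ i" for x y :: "real^'n" by (simp add: inner_vec_def one)
  have j1: "j = i" for j :: 'n using one by blast
  define Fl where "Fl k x = (A x *v g k x) $ i" for k x
  have FL: "L2on S (Fl k)" for k unfolding Fl_def by (rule flux_L2[OF gF])
  have "is_weak_grad S (Fl k) (\<lambda>x. 0)" for k
  proof (rule is_weak_gradI)
    show "L2on S (\<lambda>x. (0::real^'n) $ j)" for j by (simp add: L2on_zero)
    fix \<phi> j assume \<phi>: "test_fun S \<phi>"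
    have "indicator S x * ((A x *v g k x) \<bullet> grad_fun \<phi> x) = Fl k x * partial i \<phi> x" for x
      using test_fun_indicator[OF test_fun_partial[OF \<phi>], of x i] by (auto simp: inner1 Fl_def)
    then have "(\<integral>x. Fl k x * partial i \<phi> x \<partial>lebesgue) = E (g k) (grad_fun \<phi>)" by (simp only: E_def)
    then show "(\<integral>x. Fl k x * partial j \<phi> x \<partial>lebesgue) = - (\<integral>x. (0::real^'n) $ j * \<phi> x \<partial>lebesgue)"
      using g(3)[OF \<phi>] j1[of j] by simp
  qed
  then have Fc: "AE x in lebesgue. x \<in> S \<longrightarrow> Fl k x = mean (Fl k)" for k
    by (rule sqnorm_0_imp_const[OF FL]) (simp add: sqnorm_def)
  define m where "m k = mean (Fl k)" for k
  \<comment> \<open>If the constant fluxes cancel, the flux of the combination is zero a.e. and so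
    is its energy.\<close>
  have comb: "const_on S (\<lambda>x. \<Sum>k<2. c k * u k x)" if c: "c 0 * m 0 + c 1 * m 1 = 0" for c :: "nat \<Rightarrow> real"
  proof -
    define G where "G = c 0 *\<^sub>R g 0 + c 1 *\<^sub>R g 1"
    have z: "L2on S 0" "is_weak_grad S 0 0" using L2on_const[of 0] is_weak_grad_const[of 0] by (auto simp: zero_fun_def)
    have "L2on S (0 + c 0 *\<^sub>R u 0)" using L2on_cmult[OF g(1), of "c 0" 0] by (simp add: scaleR_fun_def)
    moreover have "is_weak_grad S (0 + c 0 *\<^sub>R u 0) (0 + c 0 *\<^sub>R g 0)" by (rule is_weak_grad_lincomb[OF z g(1,2)])
    ultimately have W: "is_weak_grad S (c 0 *\<^sub>R u 0 + c 1 *\<^sub>R u 1) G"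
      using is_weak_grad_lincomb[OF _ _ g(1,2), of "c 0 *\<^sub>R u 0" "c 0 *\<^sub>R g 0" "c 1" 1] by (simp add: G_def)
    have "A_harmonic A S (c 0 *\<^sub>R u 0 + c 1 *\<^sub>R u 1)"
      using u A_harmonic_subspace by (auto simp: subspace_def)
    then have H: "H1 S (c 0 *\<^sub>R u 0 + c 1 *\<^sub>R u 1)" by (rule A_harmonic_H1)
    have "E G G = (\<integral>x. 0 \<partial>(lebesgue :: (real^'n) measure))"
      unfolding E_def
    proof (rule integral_cong_AE)
      show "AE x in lebesgue. indicator S x * ((A x *v G x) \<bullet> G x) = 0"
        using Fc[of 0] Fc[of 1]
      proof eventually_elim
        case (elim x)
        have "(A x *v G x) $ i = c 0 * Fl 0 x + c 1 * Fl 1 x"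
          by (simp add: G_def Fl_def matrix_vector_right_distrib matrix_vector_mult_scaleR)
        then show ?case using elim c by (auto simp: inner1 indicator_def m_def)
      qed
    qed (use E_integrable[of G G] is_weak_grad_L2field[OF W] in auto)
    then have "energy_ip A S (c 0 *\<^sub>R u 0 + c 1 *\<^sub>R u 1) (c 0 *\<^sub>R u 0 + c 1 *\<^sub>R u 1) = 0"
      using energy_ip_weak_grad[OF H H W W] by simp
    then have "const_on S (c 0 *\<^sub>R u 0 + c 1 *\<^sub>R u 1)" using const_on_iff[OF H] by simp
    moreover have "c 0 *\<^sub>R u 0 + c 1 *\<^sub>R u 1 = (\<lambda>x. \<Sum>k<2. c k * u k x)" by (simp add: fun_eq_iff numeral_2_eq_2)
    ultimately show ?thesis by simp
  qed
  have z: "c 0 = 0 \<and> c 1 = 0" if "c 0 * m 0 + c 1 * m 1 = 0" for c :: "nat \<Rightarrow> real"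
    using indep comb[OF that] unfolding indep_mod_const_def by force
  \<comment> \<open>The coefficients \<open>m 1\<close> and \<open>- m 0\<close> always cancel the
    fluxes, so independence forces both fluxes to be 0; then the coefficients 1, 1 cancel them too,
    a contradiction.\<close>
  have "m 0 = 0 \<and> m 1 = 0" using z[of "\<lambda>k. if k = 0 then m 1 else - m 0"] by (simp add: mult.commute)
  then show False using z[of "\<lambda>k. 1"] by simp
qed

end

section \<open>Compactness of the inner energy relative to the outer one\<close>

context energy_pair
begin

text \<open>Caccioppoli bounds the inner energy by the L2 norm of the centered function, which
  leaves the inner energy unchanged, and the cell decomposition bounds that norm. Centering is
  essential for the functionals: averages of \<open>u\<close> itself are not bounded by its energy,
  those of the centered function are.\<close>

lemma compactness:
  assumes \<epsilon>: "\<epsilon> > 0"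
  shows "\<exists>N l C K. 0 \<le> C \<and>
        (\<forall>j<(N::nat). \<forall>u\<in>{u. A_harmonic A S u}. \<forall>v\<in>{u. A_harmonic A S u}. l j (u - v) = (l j u :: real) - l j v) \<and>
        (\<forall>j<N. \<forall>u\<in>{u. A_harmonic A S u}. (l j u)\<^sup>2 \<le> K * energy_ip A S u u) \<and>
        (\<forall>u\<in>{u. A_harmonic A S u}. energy_ip A \<omega> u u \<le> \<epsilon> * energy_ip A S u u + C * (\<Sum>j<N. (l j u)\<^sup>2))"
proof -
  obtain K0 where K0: "K0 \<ge> 0"
    "\<And>u. A_harmonic A S u \<Longrightarrow> energy_ip A \<omega> u u \<le> K0 * (\<integral>x. indicator S x * (u x)\<^sup>2 \<partial>lebesgue)"
    using Caccioppoli by blast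
  obtain C0 where C0: "C0 \<ge> 0" "\<And>u g. L2on S u \<Longrightarrow> is_weak_grad S u g \<Longrightarrow> (\<integral>x. indicator S x * u x \<partial>lebesgue) = 0 \<Longrightarrow>
    (\<integral>x. indicator S x * (u x)\<^sup>2 \<partial>lebesgue) \<le> C0 * sqnorm S g"
    using Poincare_centered by blast
  \<comment> \<open>After Caccioppoli (factor at most \<open>K0 + 1\<close>) and ellipticity (factor
    \<open>1 / \<alpha>\<close>) exactly \<open>\<epsilon>\<close> remains; the added 1 avoids
    division by zero.\<close>
  define \<epsilon>' where "\<epsilon>' = \<epsilon> * \<alpha> / (K0 + 1)"
  have \<epsilon>': "\<epsilon>' > 0" using \<epsilon> alpha_pos K0(1) by (simp add: \<epsilon>'_def)
  have "\<exists>\<D>. finite \<D> \<and> (\<forall>K\<in>\<D>. K \<in> lmeasurable \<and> K \<subseteq> S) \<and>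
    (\<forall>u g. L2on S u \<and> is_weak_grad S u g \<longrightarrow> (\<integral>x. indicator S x * (u x)\<^sup>2 \<partial>lebesgue)
      \<le> (\<Sum>K\<in>\<D>. (\<integral>x. indicator K x * u x \<partial>lebesgue)\<^sup>2 / measure lebesgue K) + \<epsilon>' * sqnorm S g)"
    unfolding sqnorm_def by (rule Rellich_box[OF \<epsilon>'])
  then obtain \<D> where DD: "finite \<D> \<and> (\<forall>K\<in>\<D>. K \<in> lmeasurable \<and> K \<subseteq> S) \<and>
    (\<forall>u g. L2on S u \<and> is_weak_grad S u g \<longrightarrow> (\<integral>x. indicator S x * (u x)\<^sup>2 \<partial>lebesgue)
      \<le> (\<Sum>K\<in>\<D>. (\<integral>x. indicator K x * u x \<partial>lebesgue)\<^sup>2 / measure lebesgue K) + \<epsilon>' * sqnorm S g)" ..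
  have D: "finite \<D>" "\<And>K. K \<in> \<D> \<Longrightarrow> K \<in> lmeasurable \<and> K \<subseteq> S"
    "\<And>u g. L2on S u \<Longrightarrow> is_weak_grad S u g \<Longrightarrow> (\<integral>x. indicator S x * (u x)\<^sup>2 \<partial>lebesgue)
      \<le> (\<Sum>K\<in>\<D>. (\<integral>x. indicator K x * u x \<partial>lebesgue)\<^sup>2 / measure lebesgue K) + \<epsilon>' * sqnorm S g"
    by (use DD in simp_all)
  \<comment> \<open>Scaled so that the square is the term of cell \<open>K\<close> in the
    decomposition.\<close>
  define l where "l K u = (\<integral>x. indicator K x * centered u x \<partial>lebesgue) / sqrt (measure lebesgue K)" for K u
  have l2: "(l K u)\<^sup>2 = (\<integral>x. indicator K x * centered u x \<partial>lebesgue)\<^sup>2 / measure lebesgue K" for K u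
    by (simp add: l_def power_divide)
  have data: "\<exists>g. L2on S u \<and> is_weak_grad S u g \<and> sqnorm S g \<le> energy_ip A S u u / \<alpha>" if u: "A_harmonic A S u" for u
  proof -
    note H = A_harmonic_H1[OF u] and W = wgrad_is_weak_grad[OF A_harmonic_H1[OF u]]
    have "\<alpha> * sqnorm S (wgrad S u) \<le> energy_ip A S u u" unfolding energy_ip_E by (rule E_lower[OF is_weak_grad_L2field[OF W]])
    then show ?thesis using H W alpha_pos by (intro exI[of _ "wgrad S u"]) (simp add: H1_iff pos_le_divide_eq mult.commute)
  qed
  have lin: "l K (u - v) = l K u - l K v" if K: "K \<in> \<D>" and u: "A_harmonic A S u" and v: "A_harmonic A S v" for K u v
  proof -
    have L: "L2on S u" "L2on S v" using data[OF u] data[OF v] by auto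
    have i: "integrable lebesgue (\<lambda>x. indicator K x * centered w x)" if "L2on S w" for w
      using L2on_integrable(1)[OF L2on_centered[OF that]] D(2)[OF K] by blast
    show ?thesis
      unfolding l_def centered_diff[OF L] using i[OF L(1)] i[OF L(2)] by (simp add: right_diff_distrib diff_divide_distrib)
  qed
  have bd: "(l K u)\<^sup>2 \<le> C0 / \<alpha> * energy_ip A S u u" if K: "K \<in> \<D>" and u: "A_harmonic A S u" for K u
  proof -
    obtain g where g: "L2on S u" "is_weak_grad S u g" "sqnorm S g \<le> energy_ip A S u u / \<alpha>" using data[OF u] by blast
    have "(l K u)\<^sup>2 \<le> (\<integral>x. indicator S x * (centered u x)\<^sup>2 \<partial>lebesgue)"
      unfolding l2 by (rule average_bound[OF L2on_centered[OF g(1)]]) (use D(2)[OF K] in auto)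
    also have "\<dots> \<le> C0 * sqnorm S g"
      by (rule C0(2)[OF L2on_centered[OF g(1)] is_weak_grad_centered[OF g(1,2)] integral_centered[OF g(1)]])
    also have "\<dots> \<le> C0 * (energy_ip A S u u / \<alpha>)" by (rule mult_left_mono[OF g(3) C0(1)])
    finally show ?thesis by simp
  qed
  have main: "energy_ip A \<omega> u u \<le> \<epsilon> * energy_ip A S u u + K0 * (\<Sum>K\<in>\<D>. (l K u)\<^sup>2)" if u: "A_harmonic A S u" for u
  proof -
    obtain g where g: "L2on S u" "is_weak_grad S u g" "sqnorm S g \<le> energy_ip A S u u / \<alpha>" using data[OF u] by blast
    note c = L2on_centered[OF g(1)] is_weak_grad_centered[OF g(1,2)]
    have "energy_ip A \<omega> u u = energy_ip A \<omega> (centered u) (centered u)"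
      using inner_energy_ip[OF g(1,2)] inner_energy_ip[OF c] by simp
    also have "\<dots> \<le> K0 * (\<integral>x. indicator S x * (centered u x)\<^sup>2 \<partial>lebesgue)" by (rule K0(2)[OF A_harmonic_centered[OF u]])
    also have "\<dots> \<le> K0 * ((\<Sum>K\<in>\<D>. (l K u)\<^sup>2) + \<epsilon>' * sqnorm S g)"
      using D(3)[OF c] unfolding l2 by (rule mult_left_mono[OF _ K0(1)])
    also have "\<dots> \<le> K0 * (\<Sum>K\<in>\<D>. (l K u)\<^sup>2) + (K0 + 1) * (\<epsilon>' * (energy_ip A S u u / \<alpha>))"
    proof -
      have le: "\<epsilon>' * sqnorm S g \<le> \<epsilon>' * (energy_ip A S u u / \<alpha>)" by (rule mult_left_mono[OF g(3)]) (use \<epsilon>' in simp)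
      have "K0 * (\<epsilon>' * sqnorm S g) \<le> (K0 + 1) * (\<epsilon>' * (energy_ip A S u u / \<alpha>))"
        by (rule mult_mono[OF _ le]) (use K0(1) sqnorm_nonneg[of S g] \<epsilon>' in auto)
      then show ?thesis by (simp add: distrib_left)
    qed
    also have "(K0 + 1) * (\<epsilon>' * (energy_ip A S u u / \<alpha>)) = \<epsilon> * energy_ip A S u u"
      using K0(1) alpha_pos by (simp add: \<epsilon>'_def)
    finally show ?thesis by linarith
  qed
  obtain f where f: "bij_betw f {0..<card \<D>} \<D>" using ex_bij_betw_nat_finite[OF D(1)] by blast
  have fD: "f j \<in> \<D>" if "j < card \<D>" for j using bij_betwE[OF f] that by simp
  have sum: "(\<Sum>K\<in>\<D>. (l K u)\<^sup>2) = (\<Sum>j<card \<D>. (l (f j) u)\<^sup>2)" for u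
    using sum.reindex_bij_betw[OF f, of "\<lambda>K. (l K u)\<^sup>2"] by (simp add: atLeast0LessThan)
  show ?thesis
    using K0(1) lin bd main fD unfolding sum
    by (intro exI[of _ "card \<D>"] exI[of _ "\<lambda>j. l (f j)"] exI[of _ K0] exI[of _ "C0 / \<alpha>"]) auto
qed

end

section \<open>The n-width\<close>

lemma psd_form_subset:
  assumes "psd_form K b" "subspace H" "H \<subseteq> K" shows "psd_form H b"
proof -
  interpret psd_form K b by fact
  have K: "u \<in> K" if "u \<in> H" for u using that assms(3) by blast
  show ?thesis
    by unfold_locales (simp_all add: assms(2) add_left scale_left sym[OF K K] nonneg K)
qed

context psd_form
begin

lemma null_sum:
  assumes z: "\<And>i. i \<in> F \<Longrightarrow> z i \<in> H \<and> a (z i) (z i) = 0"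
  shows "a (\<Sum>i\<in>F. x i *\<^sub>R z i) (\<Sum>i\<in>F. x i *\<^sub>R z i) = 0"
proof -
  have S: "(\<Sum>i\<in>F. x i *\<^sub>R z i) \<in> H" by (rule sum_closed) (use z in blast)
  have "a (\<Sum>i\<in>F. x i *\<^sub>R z i) (\<Sum>i\<in>F. x i *\<^sub>R z i) = (\<Sum>i\<in>F. x i * a (z i) (\<Sum>i\<in>F. x i *\<^sub>R z i))"
    by (rule sum_left[OF _ S]) (use z in blast)
  also have "\<dots> = 0" by (rule sum.neutral) (use null[OF _ S] z in simp)
  finally show ?thesis .
qed

definition indep_family :: "(nat \<Rightarrow> 'v) \<Rightarrow> nat \<Rightarrow> bool" where
  "indep_family f n \<longleftrightarrow> (\<forall>c. a (\<Sum>i<n. c i *\<^sub>R f i) (\<Sum>i<n. c i *\<^sub>R f i) = 0 \<longrightarrow> (\<forall>i<n. c i = 0))"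

text \<open>Steinitz exchange modulo null vectors. Subtract from each \<open>e i\<close> its
  projection on the span of \<open>f\<close>. If all residuals were null, then, since
  \<open>m < n\<close>, some nontrivial combination of the \<open>e i\<close> would have all
  projection coefficients 0 and so be null itself. An \<open>e i\<close> with a nonnull residual
  extends \<open>f\<close>.\<close>

lemma indep_family_Suc:
  assumes f: "\<And>i. i < m \<Longrightarrow> f i \<in> H" "indep_family f m"
    and e: "\<And>i. i < n \<Longrightarrow> e i \<in> H" "indep_family e n" and mn: "m < n"
  shows "\<exists>w\<in>H. indep_family (f(m := w)) (Suc m)"
proof -
  have "\<exists>c. \<forall>j<m. a (e i - (\<Sum>j<m. c j *\<^sub>R f j)) (f j) = 0" if "i < n" for i
    by (rule projection_exists[OF f(1) _ e(1)[OF that]]) (use f(2) in \<open>auto simp: indep_family_def\<close>)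
  then have "\<forall>i. \<exists>c. i < n \<longrightarrow> (\<forall>j<m. a (e i - (\<Sum>j<m. c j *\<^sub>R f j)) (f j) = 0)" by blast
  from choice[OF this] obtain d where d: "\<forall>i. i < n \<longrightarrow> (\<forall>j<m. a (e i - (\<Sum>j<m. d i j *\<^sub>R f j)) (f j) = 0)" ..
  have SH: "(\<Sum>j<m. c j *\<^sub>R f j) \<in> H" for c by (rule sum_closed) (use f(1) in simp)
  define r where "r i = e i - (\<Sum>j<m. d i j *\<^sub>R f j)" for i
  have rH: "r i \<in> H" if "i < n" for i unfolding r_def by (intro closed e(1) that SH)
  have rf: "a (r i) (f j) = 0" if "i < n" "j < m" for i j using d that by (simp add: r_def)
  have "\<exists>i<n. a (r i) (r i) \<noteq> 0"
  proof (rule ccontr)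
    assume "\<not> ?thesis"
    then have r0: "a (r i) (r i) = 0" if "i < n" for i using that by blast
    obtain x where x: "\<exists>i\<in>{..<n}. x i \<noteq> 0" "\<forall>j<m. (\<Sum>i\<in>{..<n}. x i * d i j) = 0"
      using linear_system_nontrivial[of "{..<n}" m d] mn by auto
    have "(\<Sum>i<n. x i *\<^sub>R e i) = (\<Sum>i<n. x i *\<^sub>R r i) + (\<Sum>i<n. \<Sum>j<m. (x i * d i j) *\<^sub>R f j)"
      by (simp add: r_def scaleR_diff_right sum_subtractf scaleR_sum_right)
    also have "(\<Sum>i<n. \<Sum>j<m. (x i * d i j) *\<^sub>R f j) = (\<Sum>j<m. (\<Sum>i<n. x i * d i j) *\<^sub>R f j)"
      by (subst sum.swap) (simp add: scaleR_sum_left)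
    also have "\<dots> = 0" using x(2) by simp
    finally have "(\<Sum>i<n. x i *\<^sub>R e i) = (\<Sum>i<n. x i *\<^sub>R r i)" by simp
    moreover have "a (\<Sum>i<n. x i *\<^sub>R r i) (\<Sum>i<n. x i *\<^sub>R r i) = 0"
      by (rule null_sum) (use rH r0 in simp)
    ultimately show False using e(2) x(1) unfolding indep_family_def by (metis lessThan_iff)
  qed
  then obtain i where i: "i < n" "a (r i) (r i) \<noteq> 0" by blast
  have "indep_family (f(m := e i)) (Suc m)"
    unfolding indep_family_def
  proof (intro allI impI)
    fix c k
    assume "a (\<Sum>j<Suc m. c j *\<^sub>R (f(m := e i)) j) (\<Sum>j<Suc m. c j *\<^sub>R (f(m := e i)) j) = 0" and k: "k < Suc m"
    moreover define s where "s = (\<Sum>j<Suc m. c j *\<^sub>R (f(m := e i)) j)"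
    ultimately have s0: "a s s = 0" by simp
    have s: "s = (\<Sum>j<m. c j *\<^sub>R f j) + c m *\<^sub>R e i" by (simp add: s_def)
    have sH: "s \<in> H" unfolding s by (intro closed SH e(1) i)
    have s': "s = c m *\<^sub>R r i + (\<Sum>j<m. (c j + c m * d i j) *\<^sub>R f j)"
      by (simp add: s r_def scaleR_diff_right scaleR_add_left sum.distrib scaleR_sum_right)
    have "a (\<Sum>j<m. (c j + c m * d i j) *\<^sub>R f j) (r i) = (\<Sum>j<m. (c j + c m * d i j) * a (f j) (r i))"
      by (rule sum_left) (use f(1) rH i in auto)
    also have "\<dots> = 0"
      using rf[OF i(1)] sym[OF f(1) rH[OF i(1)]] by (intro sum.neutral) simp
    finally have "a s (r i) = c m * a (r i) (r i)"
      using rH[OF i(1)] SH by (simp add: s' add_left scale_left closed)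
    moreover have "a s (r i) = 0" by (rule null[OF sH rH[OF i(1)] s0])
    ultimately have cm: "c m = 0" using i(2) by simp
    then have "s = (\<Sum>j<m. c j *\<^sub>R f j)" by (simp add: s)
    then have "\<forall>j<m. c j = 0" using f(2) s0 unfolding indep_family_def by metis
    then show "c k = 0" using cm k by (cases "k = m") auto
  qed
  then show ?thesis using e(1)[OF i(1)] by blast
qed

lemma indep_family_extend:
  assumes f: "\<And>i. i < m \<Longrightarrow> f i \<in> H" "indep_family f m"
    and e: "\<And>i. i < n \<Longrightarrow> e i \<in> H" "indep_family e n" and mn: "m \<le> n"
  shows "\<exists>g. (\<forall>i<n. g i \<in> H) \<and> indep_family g n \<and> (\<forall>i<m. g i = f i)"
proof -
  have "\<exists>g. (\<forall>i<m + k. g i \<in> H) \<and> indep_family g (m + k) \<and> (\<forall>i<m. g i = f i)" if "m + k \<le> n" for k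
    using that
  proof (induction k)
    case 0
    then show ?case using f by (intro exI[of _ f]) simp
  next
    case (Suc k)
    then obtain g where g: "\<forall>i<m + k. g i \<in> H" "indep_family g (m + k)" "\<forall>i<m. g i = f i" by auto
    obtain w where w: "w \<in> H" "indep_family (g(m + k := w)) (Suc (m + k))"
      using indep_family_Suc[of "m + k" g n e] g e Suc.prems by auto
    have "\<forall>i<m + Suc k. (g(m + k := w)) i \<in> H" using g(1) w(1) by (auto simp: less_Suc_eq)
    moreover have "indep_family (g(m + k := w)) (m + Suc k)" using w(2) by (simp only: add_Suc_right)
    moreover have "\<forall>i<m. (g(m + k := w)) i = f i" using g(3) by simp
    ultimately show ?case by blast
  qed
  from this[of "n - m"] mn show ?thesis by simp
qed

end

lemma comb_eq: "(\<lambda>x. \<Sum>j<n. c j * \<chi>s j x) = (\<Sum>j<n. c j *\<^sub>R \<chi>s j)" for \<chi>s :: "nat \<Rightarrow> 'a \<Rightarrow> real"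
  by (simp add: fun_eq_iff)

lemma (in energy_box) sum_A_harmonic:
  "(\<And>j. j \<in> F \<Longrightarrow> A_harmonic A S (f j)) \<Longrightarrow> A_harmonic A S (\<Sum>j\<in>F. c j *\<^sub>R f j)"
  using subspace_sum[OF A_harmonic_subspace, of F "\<lambda>j. c j *\<^sub>R f j"] subspace_scale[OF A_harmonic_subspace] by simp

lemma (in energy_box) A_harmonic_psd: "psd_form {u. A_harmonic A S u} (energy_ip A S)"
  by (rule psd_form_subset[OF energy_psd A_harmonic_subspace]) (auto dest: A_harmonic_H1)

lemma (in energy_box) indep_mod_const_iff:
  assumes "\<And>j. j < n \<Longrightarrow> A_harmonic A S (f j)"
  shows "indep_mod_const S f n \<longleftrightarrow> psd_form.indep_family (energy_ip A S) f n"
proof -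
  interpret psd_form "{u. A_harmonic A S u}" "energy_ip A S" by (rule A_harmonic_psd)
  have "H1 S (\<Sum>j<n. c j *\<^sub>R f j)" for c by (rule A_harmonic_H1[OF sum_A_harmonic]) (use assms in simp)
  then show ?thesis unfolding indep_mod_const_def indep_family_def comb_eq by (simp add: const_on_iff)
qed

section \<open>Matching bounds for the n-width\<close>

text \<open>\<open>all_eigen\<close> encodes listing with multiplicity: modulo constants, each
  eigenfunction for a positive value is a finite combination of listed ones carrying that
  value.\<close>

locale spectral_pair = energy_pair A p q \<alpha> \<beta> p' q'
  for A :: "real^'n::finite \<Rightarrow> real^'n^'n" and p q \<alpha> \<beta> p' q' +
  fixes lam :: "nat \<Rightarrow> real" and \<phi> :: "nat \<Rightarrow> real^'n \<Rightarrow> real"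
  assumes harm: "\<And>i. A_harmonic A S (\<phi> i)"
    and eig: "\<And>i \<delta>. A_harmonic A S \<delta> \<Longrightarrow> energy_ip A \<omega> (\<phi> i) \<delta> = lam i * energy_ip A S (\<phi> i) \<delta>"
    and decreasing: "\<And>i. lam (Suc i) \<le> lam i"
    and independent: "\<And>m. indep_mod_const S \<phi> m"
    and all_eigen: "\<And>\<mu> \<psi>. 0 < \<mu> \<Longrightarrow> A_harmonic A S \<psi> \<Longrightarrow>
      (\<And>\<delta>. A_harmonic A S \<delta> \<Longrightarrow> energy_ip A \<omega> \<psi> \<delta> = \<mu> * energy_ip A S \<psi> \<delta>) \<Longrightarrow>
      \<exists>F d. finite F \<and> F \<subseteq> {i. lam i = \<mu>} \<and> const_on S (\<lambda>x. \<psi> x - (\<Sum>i\<in>F. d i * \<phi> i x))"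
begin

abbreviation HS :: "(real^'n \<Rightarrow> real) set" where "HS \<equiv> {u. A_harmonic A S u}"
abbreviation H\<omega> :: "(real^'n \<Rightarrow> real) set" where "H\<omega> \<equiv> {u. A_harmonic A \<omega> u}"
abbreviation a where "a \<equiv> energy_ip A S"
abbreviation b where "b \<equiv> energy_ip A \<omega>"

lemma compact_pair_energy: "compact_pair HS a b lam \<phi>"
proof -
  have psa: "psd_form HS a" by (rule A_harmonic_psd)
  have psb: "psd_form HS b"
    by (rule psd_form_subset[OF inner.A_harmonic_psd A_harmonic_subspace]) (auto intro: A_harmonic_inner)
  show ?thesis
  proof (intro compact_pair.intro psa psb compact_pair_axioms.intro)
    show "b u u \<le> a u u" if "u \<in> HS" for u using that energy_inner_le A_harmonic_H1 by blast
    show "\<exists>v\<in>HS. (\<lambda>k. a (u k - v) (u k - v)) \<longlonglongrightarrow> 0"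
      if "\<And>k. u k \<in> HS" "\<And>e. e > 0 \<Longrightarrow> \<exists>N. \<forall>m\<ge>N. \<forall>n\<ge>N. a (u m - u n) (u m - u n) < e" for u :: "nat \<Rightarrow> _"
      using A_harmonic_complete[of u] that by simp
    show "\<exists>N l C K. 0 \<le> C \<and>
        (\<forall>j<(N::nat). \<forall>u\<in>HS. \<forall>v\<in>HS. l j (u - v) = (l j u :: real) - l j v) \<and>
        (\<forall>j<N. \<forall>u\<in>HS. (l j u)\<^sup>2 \<le> K * a u u) \<and>
        (\<forall>u\<in>HS. b u u \<le> \<epsilon> * a u u + C * (\<Sum>j<N. (l j u)\<^sup>2))" if "\<epsilon> > 0" for \<epsilon>
      by (rule compactness[OF that])
    show "\<phi> i \<in> HS" for i using harm by simp
    show "b (\<phi> i) \<delta> = lam i * a (\<phi> i) \<delta>" if "\<delta> \<in> HS" for i \<delta> using eig that by simp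
    show "lam (Suc i) \<le> lam i" for i by (rule decreasing)
    show "\<forall>j<m. c j = 0" if "a (\<Sum>j<m. c j *\<^sub>R \<phi> j) (\<Sum>j<m. c j *\<^sub>R \<phi> j) = 0" for m c
      using independent[of m] that indep_mod_const_iff[of m \<phi>] harm psd_form.indep_family_def[OF psa] by blast
    show "\<exists>F d. finite F \<and> F \<subseteq> {i. lam i = \<mu>} \<and>
          a (\<psi> - (\<Sum>i\<in>F. d i *\<^sub>R \<phi> i)) (\<psi> - (\<Sum>i\<in>F. d i *\<^sub>R \<phi> i)) = 0"
      if \<mu>: "\<mu> > 0" and \<psi>: "\<psi> \<in> HS" and e: "\<And>\<delta>. \<delta> \<in> HS \<Longrightarrow> b \<psi> \<delta> = \<mu> * a \<psi> \<delta>" for \<mu> \<psi>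
    proof -
      have "\<exists>F d. finite F \<and> F \<subseteq> {i. lam i = \<mu>} \<and> const_on S (\<lambda>x. \<psi> x - (\<Sum>i\<in>F. d i * \<phi> i x))"
        by (rule all_eigen[OF \<mu>]) (use \<psi> e in simp_all)
      then obtain F where "\<exists>d. finite F \<and> F \<subseteq> {i. lam i = \<mu>} \<and> const_on S (\<lambda>x. \<psi> x - (\<Sum>i\<in>F. d i * \<phi> i x))" ..
      then obtain d where "finite F \<and> F \<subseteq> {i. lam i = \<mu>} \<and> const_on S (\<lambda>x. \<psi> x - (\<Sum>i\<in>F. d i * \<phi> i x))" ..
      then have F: "finite F" "F \<subseteq> {i. lam i = \<mu>}" "const_on S (\<lambda>x. \<psi> x - (\<Sum>i\<in>F. d i * \<phi> i x))"
        by simp_all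
      have eq: "(\<lambda>x. \<psi> x - (\<Sum>i\<in>F. d i * \<phi> i x)) = \<psi> - (\<Sum>i\<in>F. d i *\<^sub>R \<phi> i)" by (simp add: fun_eq_iff)
      have "\<psi> - (\<Sum>i\<in>F. d i *\<^sub>R \<phi> i) \<in> HS"
        by (rule subspace_diff[OF A_harmonic_subspace \<psi>]) (simp add: sum_A_harmonic harm)
      then have "a (\<psi> - (\<Sum>i\<in>F. d i *\<^sub>R \<phi> i)) (\<psi> - (\<Sum>i\<in>F. d i *\<^sub>R \<phi> i)) = 0"
        using F(3) const_on_iff[OF A_harmonic_H1] unfolding eq by simp
      with F(1,2) have "finite F \<and> F \<subseteq> {i. lam i = \<mu>} \<and>
          a (\<psi> - (\<Sum>i\<in>F. d i *\<^sub>R \<phi> i)) (\<psi> - (\<Sum>i\<in>F. d i *\<^sub>R \<phi> i)) = 0" by simp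
      then show ?thesis by (intro exI)
    qed
  qed
qed

sublocale C: compact_pair HS a b lam \<phi>
  by (rule compact_pair_energy)

sublocale W: psd_form H\<omega> b
  by (rule inner.A_harmonic_psd)

definition ratio :: "(nat \<Rightarrow> real^'n \<Rightarrow> real) \<Rightarrow> nat \<Rightarrow> (real^'n \<Rightarrow> real) \<Rightarrow> real" where
  "ratio \<chi>s n u = (INF c::nat \<Rightarrow> real. energy_norm A \<omega> (\<lambda>x. u x - (\<Sum>j<n. c j * \<chi>s j x))) / energy_norm A S u"

lemma approx_error_ratio:
  "approx_error A \<omega> S \<chi>s n = Sup {ratio \<chi>s n u | u. A_harmonic A S u \<and> \<not> const_on S u}"
  by (simp add: approx_error_def ratio_def)

lemma residual_norm:
  "energy_norm A \<omega> (\<lambda>x. u x - (\<Sum>j<n. c j * \<chi>s j x)) = sqrt (b (u - (\<Sum>j<n. c j *\<^sub>R \<chi>s j)) (u - (\<Sum>j<n. c j *\<^sub>R \<chi>s j)))"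
proof -
  have "(\<lambda>x. u x - (\<Sum>j<n. c j * \<chi>s j x)) = u - (\<Sum>j<n. c j *\<^sub>R \<chi>s j)" by (simp add: fun_eq_iff)
  then show ?thesis by (simp add: energy_norm_def)
qed

lemma a_pos: "A_harmonic A S u \<Longrightarrow> \<not> const_on S u \<Longrightarrow> 0 < a u u"
  using const_on_iff[OF A_harmonic_H1] C.A.nonneg[of u] by (simp add: order_less_le)

lemma residual_bdd:
  assumes "\<And>j. j < n \<Longrightarrow> \<chi>s j \<in> H\<omega>" "u \<in> H\<omega>"
  shows "bdd_below (range (\<lambda>c. energy_norm A \<omega> (\<lambda>x. u x - (\<Sum>j<n. c j * \<chi>s j x))))"
proof -
  have "u - (\<Sum>j<n. c j *\<^sub>R \<chi>s j) \<in> H\<omega>" for c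
    by (rule W.closed(3)[OF assms(2) W.sum_closed]) (use assms(1) in blast)
  then have "0 \<le> energy_norm A \<omega> (\<lambda>x. u x - (\<Sum>j<n. c j * \<chi>s j x))" for c
    unfolding residual_norm using W.nonneg by simp
  then show ?thesis by (intro bdd_belowI[of _ 0]) auto
qed

lemma HS_inner: "A_harmonic A S u \<Longrightarrow> u \<in> H\<omega>"
  by (simp add: A_harmonic_inner)

lemma ratio_le:
  assumes \<chi>: "\<And>j. j < n \<Longrightarrow> \<chi>s j \<in> H\<omega>" and u: "A_harmonic A S u" "\<not> const_on S u"
    and c: "b (u - (\<Sum>j<n. c j *\<^sub>R \<chi>s j)) (u - (\<Sum>j<n. c j *\<^sub>R \<chi>s j)) \<le> t * a u u"
  shows "ratio \<chi>s n u \<le> sqrt t"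
proof -
  have pos: "0 < a u u" by (rule a_pos[OF u])
  have "(INF c::nat \<Rightarrow> real. energy_norm A \<omega> (\<lambda>x. u x - (\<Sum>j<n. c j * \<chi>s j x)))
     \<le> energy_norm A \<omega> (\<lambda>x. u x - (\<Sum>j<n. c j * \<chi>s j x))"
    by (rule cINF_lower[OF residual_bdd[OF \<chi> HS_inner[OF u(1)]]]) auto
  also have "\<dots> \<le> sqrt t * sqrt (a u u)"
    unfolding residual_norm real_sqrt_mult[symmetric] using c by (rule real_sqrt_le_mono)
  finally show ?thesis using pos by (simp add: ratio_def energy_norm_def pos_divide_le_eq)
qed

text \<open>The zero element of the span is an admissible approximation, and restriction does not
  increase the energy, so every quotient is at most 1. Boundedness is what gives the real-valued
  \<open>Sup\<close> its meaning.\<close>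

lemma ratio_bdd:
  assumes \<chi>: "\<And>j. j < n \<Longrightarrow> \<chi>s j \<in> H\<omega>"
  shows "bdd_above {ratio \<chi>s n u | u. A_harmonic A S u \<and> \<not> const_on S u}"
proof -
  have "ratio \<chi>s n u \<le> sqrt 1" if u: "A_harmonic A S u" "\<not> const_on S u" for u
    by (rule ratio_le[OF \<chi> u, where c="\<lambda>_. 0"]) (use C.b_le[of u] u in auto)
  then show ?thesis by (intro bdd_aboveI[of _ "sqrt 1"]) blast
qed

text \<open>It serves twice: for the competitors in the infimum and, with
  \<open>\<chi>s = \<phi>\<close>, for the span of the eigenfunctions itself.\<close>

lemma approx_error_lower:
  assumes \<chi>: "\<And>j. j < n \<Longrightarrow> \<chi>s j \<in> H\<omega>"
  shows "sqrt (lam n) \<le> approx_error A \<omega> S \<chi>s n"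
proof -
  \<comment> \<open>\<open>Suc n\<close> coefficients against \<open>n\<close> orthogonality
    conditions.\<close>
  obtain c where c: "\<exists>i\<in>{..<Suc n}. c i \<noteq> 0" "\<forall>j<n. (\<Sum>i\<in>{..<Suc n}. c i * b (\<phi> i) (\<chi>s j)) = 0"
    using linear_system_nontrivial[of "{..<Suc n}" n "\<lambda>i j. b (\<phi> i) (\<chi>s j)"] by auto
  define u where "u = (\<Sum>i<Suc n. c i *\<^sub>R \<phi> i)"
  have uS: "A_harmonic A S u" unfolding u_def by (rule sum_A_harmonic) (rule harm)
  have uw: "u \<in> H\<omega>" by (rule HS_inner[OF uS])
  have "a u u \<noteq> 0"
  proof
    assume "a u u = 0"
    then have "\<forall>j<Suc n. c j = 0" unfolding u_def by (rule C.indep)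
    then show False using c(1) by auto
  qed
  then have pos: "0 < a u u" using C.A.nonneg[of u] uS by simp
  have nc: "\<not> const_on S u" using pos const_on_iff[OF A_harmonic_H1[OF uS]] by simp
  have orth: "b u (\<chi>s j) = 0" if "j < n" for j
  proof -
    have "b u (\<chi>s j) = (\<Sum>i<Suc n. c i * b (\<phi> i) (\<chi>s j))"
      unfolding u_def by (rule W.sum_left[OF HS_inner[OF harm] \<chi>[OF that]])
    then show ?thesis using c(2) that by (simp only: simp_thms)
  qed
  have low: "lam n * a u u \<le> b u u" unfolding u_def by (rule C.lower_bound_span)
  \<comment> \<open>By orthogonality to the competitor, subtracting an element of its span can only
    increase the energy of \<open>u\<close>.\<close>
  have res: "lam n * a u u \<le> b (u - (\<Sum>j<n. d j *\<^sub>R \<chi>s j)) (u - (\<Sum>j<n. d j *\<^sub>R \<chi>s j))" for d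
  proof -
    have sH: "(\<Sum>j<n. d j *\<^sub>R \<chi>s j) \<in> H\<omega>" by (rule W.sum_closed) (use \<chi> in blast)
    have "b u (\<Sum>j<n. d j *\<^sub>R \<chi>s j) = (\<Sum>j<n. d j * b u (\<chi>s j))" by (rule W.sum_right[OF _ uw]) (use \<chi> in blast)
    also have "\<dots> = 0" using orth by simp
    finally show ?thesis unfolding W.diff_square[OF uw sH] using low W.nonneg[OF sH] by linarith
  qed
  have "sqrt (lam n) * sqrt (a u u) \<le> (INF c::nat \<Rightarrow> real. energy_norm A \<omega> (\<lambda>x. u x - (\<Sum>j<n. c j * \<chi>s j x)))"
    by (rule cINF_greatest) (auto simp: residual_norm real_sqrt_mult[symmetric] intro: res)
  then have "sqrt (lam n) \<le> ratio \<chi>s n u"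
    using pos by (simp add: ratio_def energy_norm_def pos_le_divide_eq)
  also have "\<dots> \<le> approx_error A \<omega> S \<chi>s n"
    unfolding approx_error_ratio by (rule cSup_upper[OF _ ratio_bdd[OF \<chi>]]) (use uS nc in blast)
  finally show ?thesis .
qed

text \<open>Coefficients for the first \<open>m\<close> eigenfunctions are padded with zeros. The
  case \<open>m = n\<close> treats the eigenfunctions themselves; a smaller \<open>m\<close> treats
  a family that continues differently after the first \<open>m\<close> members.\<close>

lemma approx_error_upper:
  assumes \<chi>: "\<And>j. j < n \<Longrightarrow> \<chi>s j \<in> H\<omega>" and mn: "m \<le> n" and eq: "\<And>j. j < m \<Longrightarrow> \<chi>s j = \<phi> j"
  shows "approx_error A \<omega> S \<chi>s n \<le> sqrt (lam m)"
  unfolding approx_error_ratio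
proof (rule cSup_least)
  have "\<not> const_on S (\<phi> 0)" using const_on_iff[OF A_harmonic_H1[OF harm]] C.eigen_pos[of 0] by simp
  then show "{ratio \<chi>s n u |u. A_harmonic A S u \<and> \<not> const_on S u} \<noteq> {}" using harm by blast
  fix x assume "x \<in> {ratio \<chi>s n u |u. A_harmonic A S u \<and> \<not> const_on S u}"
  then obtain u where u: "x = ratio \<chi>s n u" "A_harmonic A S u" "\<not> const_on S u" by blast
  obtain c where c: "b (u - (\<Sum>i<m. c i *\<^sub>R \<phi> i)) (u - (\<Sum>i<m. c i *\<^sub>R \<phi> i)) \<le> lam m * a u u"
    using C.upper_bound[of u m] u(2) by blast
  define c' where "c' i = (if i < m then c i else 0)" for i
  have "(\<Sum>i<n. c' i *\<^sub>R \<chi>s i) = (\<Sum>i<m. c' i *\<^sub>R \<chi>s i)"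
    by (rule sum.mono_neutral_right) (use mn in \<open>auto simp: c'_def\<close>)
  also have "\<dots> = (\<Sum>i<m. c i *\<^sub>R \<phi> i)" by (rule sum.cong) (auto simp: c'_def eq)
  finally have "(\<Sum>i<n. c' i *\<^sub>R \<chi>s i) = (\<Sum>i<m. c i *\<^sub>R \<phi> i)" .
  then show "x \<le> sqrt (lam m)" unfolding u(1) using c by (intro ratio_le[OF \<chi> u(2,3), where c=c']) auto
qed

text \<open>Guarantees that \<open>n\<close>-dimensional competitors exist, so the infimum is not
  over the empty set. In dimension one the existence is vacuous: two independent eigenfunctions on
  the outer box are already contradictory.\<close>

lemma ex_independent_inner: "\<exists>v. (\<forall>k<n. A_harmonic A \<omega> (v k)) \<and> indep_mod_const \<omega> v n"
proof (cases "\<exists>i j :: 'n. i \<noteq> j")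
  case True
  then show ?thesis using inner.ex_independent_A_harmonic by blast
next
  case False
  then have "(UNIV :: 'n set) = {undefined}" by auto
  from one_dimensional_dependent[OF this, of \<phi>] harm independent[of 2] show ?thesis by simp
qed

text \<open>If some eigenvalue before \<open>n\<close> vanishes, the restrictions of the first \<open>n\<close> eigenfunctions are dependent and
  the competitor attaining the width is an extension of the independent ones.\<close>

lemma ex_optimal_family:
  "\<exists>\<chi>s. (\<forall>j<n. A_harmonic A \<omega> (\<chi>s j)) \<and> indep_mod_const \<omega> \<chi>s n \<and> approx_error A \<omega> S \<chi>s n \<le> sqrt (lam n)"
proof -
  \<comment> \<open>The first vanishing eigenvalue, or \<open>n\<close> if there is none before.
    Since \<open>lam\<close> is nonnegative and decreasing, \<open>lam m = lam n\<close> in either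
    case.\<close>
  define m where "m = (LEAST j. j = n \<or> lam j = 0)"
  have P: "m = n \<or> lam m = 0" unfolding m_def by (rule LeastI[of _ n]) simp
  have mn: "m \<le> n" unfolding m_def by (rule Least_le) simp
  have lm: "lam m = lam n"
    using P C.lam_antimono[OF mn] C.lam_nonneg[of n] by auto
  have lpos: "lam j \<noteq> 0" if "j < m" for j using not_less_Least[OF that[unfolded m_def]] by simp
  have \<phi>w: "\<phi> j \<in> H\<omega>" for j by (rule HS_inner[OF harm])
  have indm: "W.indep_family \<phi> m"
    unfolding W.indep_family_def
  proof (intro allI impI)
    fix c i assume z: "b (\<Sum>j<m. c j *\<^sub>R \<phi> j) (\<Sum>j<m. c j *\<^sub>R \<phi> j) = 0" and i: "i < m"
    \<comment> \<open>By the eigenvalue equation \<open>a w w\<close> equals \<open>b\<close> of the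
      null combination with \<open>w\<close>, hence 0. Independence on the outer box gives
      \<open>c j * lam j = 0\<close>, and the eigenvalues before \<open>m\<close> are
      nonzero.\<close>
    define w where "w = (\<Sum>j<m. (c j * lam j) *\<^sub>R \<phi> j)"
    have wS: "w \<in> HS" unfolding w_def mem_Collect_eq by (rule sum_A_harmonic) (rule harm)
    have "a (\<Sum>j<m. (c j * lam j) *\<^sub>R \<phi> j) w = (\<Sum>j<m. (c j * lam j) * a (\<phi> j) w)"
      by (rule C.A.sum_left[OF C.eigen_H wS])
    then have "a w w = (\<Sum>j<m. (c j * lam j) * a (\<phi> j) w)" by (simp only: w_def)
    also have "\<dots> = (\<Sum>j<m. c j * b (\<phi> j) w)" using eig wS by (simp add: mult.assoc)
    also have "\<dots> = b (\<Sum>j<m. c j *\<^sub>R \<phi> j) w"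
      by (rule W.sum_left[symmetric, OF \<phi>w]) (use HS_inner wS in blast)
    also have "\<dots> = 0"
      by (rule W.null[OF W.sum_closed _ z]) (use \<phi>w HS_inner wS in auto)
    finally have "\<forall>j<m. c j * lam j = 0" unfolding w_def by (rule C.indep)
    then show "c i = 0" using i lpos by auto
  qed
  obtain v where v: "\<forall>k<n. A_harmonic A \<omega> (v k)" "indep_mod_const \<omega> v n" using ex_independent_inner by blast
  have vi: "W.indep_family v n" using v inner.indep_mod_const_iff[of n v] by simp
  obtain \<chi>s where \<chi>s: "\<forall>i<n. \<chi>s i \<in> H\<omega>" "W.indep_family \<chi>s n" "\<forall>i<m. \<chi>s i = \<phi> i"
    using W.indep_family_extend[of m \<phi> n v] \<phi>w indm v(1) vi mn by auto
  have "indep_mod_const \<omega> \<chi>s n" using \<chi>s inner.indep_mod_const_iff[of n \<chi>s] by simp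
  moreover have "approx_error A \<omega> S \<chi>s n \<le> sqrt (lam n)"
    using approx_error_upper[of n \<chi>s m] \<chi>s mn lm by simp
  ultimately show ?thesis using \<chi>s(1) by auto
qed

text \<open>Both sides equal \<open>sqrt (lam n)\<close>. The infimum is a minimum attained by the
  enlarged family, which may differ from the span of the eigenfunctions when their restrictions are
  dependent.\<close>

lemma n_width_optimal: "n_width A \<omega> S n = approx_error A \<omega> S \<phi> n"
proof -
  have \<phi>w: "\<phi> j \<in> H\<omega>" for j by (rule HS_inner[OF harm])
  have eq: "approx_error A \<omega> S \<phi> n = sqrt (lam n)"
    using approx_error_lower[of n \<phi>] approx_error_upper[of n \<phi> n] \<phi>w by (intro antisym) auto
  obtain \<chi>s where \<chi>s: "\<forall>j<n. A_harmonic A \<omega> (\<chi>s j)" "indep_mod_const \<omega> \<chi>s n" "approx_error A \<omega> S \<chi>s n \<le> sqrt (lam n)"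
    using ex_optimal_family by blast
  have attained: "approx_error A \<omega> S \<chi>s n = sqrt (lam n)"
    using approx_error_lower[of n \<chi>s] \<chi>s by (intro antisym) auto
  have "n_width A \<omega> S n = sqrt (lam n)"
    unfolding n_width_def
  proof (intro cInf_eq_minimum)
    show "sqrt (lam n) \<in> {approx_error A \<omega> S \<chi>s n |\<chi>s. (\<forall>j<n. A_harmonic A \<omega> (\<chi>s j)) \<and> indep_mod_const \<omega> \<chi>s n}"
      using \<chi>s(1,2) attained[symmetric] by blast
    show "sqrt (lam n) \<le> x"
      if "x \<in> {approx_error A \<omega> S \<chi>s n |\<chi>s. (\<forall>j<n. A_harmonic A \<omega> (\<chi>s j)) \<and> indep_mod_const \<omega> \<chi>s n}" for x
      using that approx_error_lower by auto
  qed
  then show ?thesis using eq by simp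
qed

end

theorem theorem3p2:
  fixes A :: "real^'n::finite \<Rightarrow> real^'n^'n" and \<Omega> :: "(real^'n) set"
    and c :: "real^'n" and \<sigma> \<rho> \<alpha> \<beta> :: real
    and \<omega> \<omega>s :: "(real^'n) set"
    and lam :: "nat \<Rightarrow> real" and \<phi> :: "nat \<Rightarrow> real^'n \<Rightarrow> real" and n :: nat
  assumes dom: "open \<Omega>" "connected \<Omega>"
    and A_meas: "\<forall>i j. set_borel_measurable lebesgue \<Omega> (\<lambda>x. A x $ i $ j)"
    and A_Linf: "\<forall>i j. \<exists>M. AE x in lebesgue. x \<in> \<Omega> \<longrightarrow> \<bar>A x $ i $ j\<bar> \<le> M"
    and A_sym: "\<forall>x\<in>\<Omega>. transpose (A x) = A x"
    and alpha_pos: "0 < \<alpha>" and alpha_beta: "\<alpha> \<le> \<beta>"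
    and ellip: "AE x in lebesgue. x \<in> \<Omega> \<longrightarrow>
                 (\<forall>v. \<alpha> * (norm v)^2 \<le> v \<bullet> (A x *v v) \<and> v \<bullet> (A x *v v) \<le> \<beta> * (norm v)^2)"
    and sigma_pos: "0 < \<sigma>" and rho_pos: "0 < \<rho>"
    and omega: "\<omega> = box (c - (\<sigma> / 2) *\<^sub>R One) (c + (\<sigma> / 2) *\<^sub>R One)"
    and omegas: "\<omega>s = box (c - ((1 + \<rho>) * \<sigma> / 2) *\<^sub>R One) (c + ((1 + \<rho>) * \<sigma> / 2) *\<^sub>R One)"
    and sub: "\<omega>s \<subseteq> \<Omega>"
    and eig: "\<forall>i. A_harmonic A \<omega>s (\<phi> i) \<and>
               (\<forall>\<delta>. A_harmonic A \<omega>s \<delta> \<longrightarrow> energy_ip A \<omega> (\<phi> i) \<delta> = lam i * energy_ip A \<omega>s (\<phi> i) \<delta>)"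
    and decr: "\<forall>i. lam (Suc i) \<le> lam i"
    and indep: "\<forall>m. indep_mod_const \<omega>s \<phi> m"
    and complete: "\<forall>\<mu> \<psi>. 0 < \<mu> \<and> A_harmonic A \<omega>s \<psi> \<and>
               (\<forall>\<delta>. A_harmonic A \<omega>s \<delta> \<longrightarrow> energy_ip A \<omega> \<psi> \<delta> = \<mu> * energy_ip A \<omega>s \<psi> \<delta>)
             \<longrightarrow> (\<exists>F d. finite F \<and> F \<subseteq> {i. lam i = \<mu>} \<and>
                    const_on \<omega>s (\<lambda>x. \<psi> x - (\<Sum>i\<in>F. d i * \<phi> i x)))"
  shows "n_width A \<omega> \<omega>s n = approx_error A \<omega> \<omega>s \<phi> n"
proof -
  define p q where "p = c - ((1 + \<rho>) * \<sigma> / 2) *\<^sub>R (One :: real^'n)" and "q = c + ((1 + \<rho>) * \<sigma> / 2) *\<^sub>R (One :: real^'n)"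
  define p' q' where "p' = c - (\<sigma> / 2) *\<^sub>R (One :: real^'n)" and "q' = c + (\<sigma> / 2) *\<^sub>R (One :: real^'n)"
  have ws: "\<omega>s = box p q" and w: "\<omega> = box p' q'" by (simp_all add: omega omegas p_def q_def p'_def q'_def)
  have sr: "0 < (1 + \<rho>) * \<sigma>" "\<sigma> < (1 + \<rho>) * \<sigma>" using sigma_pos rho_pos by simp_all
  have ne: "c \<in> box p q" "c \<in> box p' q'"
    using sr sigma_pos by (auto simp: mem_box p_def q_def p'_def q'_def inner_diff_left inner_add_left)
  \<comment> \<open>A gap of width \<open>\<rho> * \<sigma> / 2\<close> separates the cubes on every
    side; it leaves room for the cutoff in Caccioppoli's inequality.\<close>
  have inner: "cbox p' q' \<subseteq> box p q"
  proof
    fix x assume x: "x \<in> cbox p' q'"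
    show "x \<in> box p q"
      unfolding mem_box
    proof
      fix i :: "real^'n" assume i: "i \<in> Basis"
      have "c \<bullet> i - \<sigma> / 2 \<le> x \<bullet> i \<and> x \<bullet> i \<le> c \<bullet> i + \<sigma> / 2"
        using x i by (auto simp: mem_box p'_def q'_def inner_diff_left inner_add_left)
      moreover have "\<sigma> / 2 < (1 + \<rho>) * \<sigma> / 2" using sr(2) by simp
      moreover have "p \<bullet> i = c \<bullet> i - (1 + \<rho>) * \<sigma> / 2" "q \<bullet> i = c \<bullet> i + (1 + \<rho>) * \<sigma> / 2"
        using i by (simp_all add: p_def q_def inner_diff_left inner_add_left)
      ultimately show "p \<bullet> i < x \<bullet> i \<and> x \<bullet> i < q \<bullet> i" by linarith
    qed
  qed
  interpret energy_pair A p q \<alpha> \<beta> p' q'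
  proof
    show "set_borel_measurable lebesgue (box p q) (\<lambda>x. A x $ i $ j)" for i j
      using set_borel_measurable_subset[of lebesgue \<Omega> "\<lambda>x. A x $ i $ j" "box p q"] A_meas sub ws by simp
    show "\<exists>M. AE x in lebesgue. x \<in> box p q \<longrightarrow> \<bar>A x $ i $ j\<bar> \<le> M" for i j
    proof -
      obtain M where "AE x in lebesgue. x \<in> \<Omega> \<longrightarrow> \<bar>A x $ i $ j\<bar> \<le> M" using A_Linf by blast
      then have "AE x in lebesgue. x \<in> box p q \<longrightarrow> \<bar>A x $ i $ j\<bar> \<le> M" by eventually_elim (use sub ws in blast)
      then show ?thesis by blast
    qed
    show "AE x in lebesgue. x \<in> box p q \<longrightarrow>
       (\<forall>v. \<alpha> * (norm v)\<^sup>2 \<le> v \<bullet> (A x *v v) \<and> v \<bullet> (A x *v v) \<le> \<beta> * (norm v)\<^sup>2)"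
      using ellip by eventually_elim (use sub ws in blast)
    show "transpose (A x) = A x" if "x \<in> box p q" for x using A_sym sub ws that by blast
  qed (use alpha_pos alpha_beta inner ne in auto)
  interpret spectral_pair A p q \<alpha> \<beta> p' q' lam \<phi>
    by unfold_locales (use eig decr indep complete in \<open>auto simp: ws w\<close>)
  show ?thesis unfolding ws w by (rule n_width_optimal)
qed

end
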